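(* Let $\Sigma=(A,B,C)$ be a linear system with $A\in\mathbb{C}^{n\times n}$, $B\in\mathbb{C}^{n\times m}$, $C\in\mathbb{C}^{l\times n}$. Let $M_1,\dots,M_u$ be the successive reduced subblocks obtained when $\Sigma$ is reduced to its canonical form by Belitskii's algorithm, $M_k$ having size $m_k\times n_k$, and define $$\sigma_k=\begin{cases} m_kn_k & \text{if } M_k=\emptyset,\\ r(m_k+n_k-r) & \text{if } M_k=\begin{bmatrix}0&I_r\\0&0\end{bmatrix},\\ m_k^2-\sum_{i=1}^{s}\sum_{j=1}^{t_i}(2j-1)q_{ij} & \text{if } M_k=W,\end{cases}$$ where in the third case $m_k=n_k$ and $W$ is a Weyr matrix similar to the Jordan matrix $\bigoplus_{i=1}^s\bigoplus_{j=1}^{t_i}J_{q_{ij}}(\lambda_i)$ with $\lambda_1,\dots,\lambda_s$ distinct and $q_{i1}\ge q_{i2}\ge\cdots\ge q_{it_i}\ge 1$ for each $i$. Then the dimension of the equivalence class of $\Sigma$ is $\sum_{k=1}^u\sigma_k$.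
   Context: **Systems and equivalence.** The group $G=GL_m(\mathbb{C})\times GL_n(\mathbb{C})\times GL_l(\mathbb{C})$ acts on the space $\mathcal S$ of triples $(A,B,C)\in\mathbb{C}^{n\times n}\times\mathbb{C}^{n\times m}\times\mathbb{C}^{l\times n}$ by $(X,Y,Z)\cdot(A,B,C)=(YAY^{-1},YBX^{-1},ZCY^{-1})$. Two systems are equivalent if they lie in the same $G$-orbit. The equivalence class of $\Sigma$ is its orbit $\mathcal O_\Sigma$, and its dimension is its dimension as a (locally closed) complex algebraic subvariety of $\mathcal S$. **Weyr matrices.** Fix a total order on $\mathbb{C}$. For an eigenvalue $\lambda$ and integers $w_1\ge w_2\ge\cdots\ge w_p\ge1$, the Weyr block has diagonal blocks $\lambda I_{w_1},\dots,\lambda I_{w_p}$, blocks $\begin{bmatrix}I_{w_{j+1}}\\0\end{bmatrix}$ in positions $(j,j+1)$, and zeros elsewhere. It is permutation similar to a Jordan matrix with eigenvalue $\lambda$, where $w_j$ is the number of Jordan blocks of size at least $j$. A Weyr matrix is a direct sum of such blocks for distinct eigenvalues, listed in increasing order. Every square complex matrix is similar to exactly one Weyr matrix. The standard partition of a Weyr block divides, for each $j$, the $j$-th strip (of size $w_j$) into consecutive substrips $(j,p),(j,p-1),\dots,(j,j)$, where $(j,q)$ has size equal to the number of Jordan blocks of size exactly $q$ (empty substrips are ignored). Substrips $(1,q),\dots,(q,q)$ belonging to the same eigenvalue and the same $q$ are declared equivalent. With respect to this partition, all matrices commuting with the Weyr matrix are block upper triangular with equal diagonal blocks at equivalent substrips.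 **Belitskii's algorithm.** At each stage the coordinates of $\mathbb{C}^m$, $\mathbb{C}^n$, $\mathbb{C}^l$ are each partitioned into consecutive nonempty strips, and there is an equivalence relation $\sim$ on the set of all strips (equivalent strips have the same size). The columns of $B$ are divided by the strips of $\mathbb{C}^m$; the rows and columns of $A$, the rows of $B$ and the columns of $C$ by the strips of $\mathbb{C}^n$; the rows of $C$ by the strips of $\mathbb{C}^l$. Initially each nonzero space is a single strip and no two distinct strips are equivalent. Blocks are processed in the order: $A$ first, then the blocks of $B$, then the blocks of $C$; within $B$ and within $C$, lower block rows come before upper ones, and within a block row blocks go from left to right (always with respect to the current partition, among blocks not yet reduced). Let $M_1,\dots,M_{k-1}$ be the blocks already reduced and let $\Lambda_{k-1}$ be the algebra of all triples $(X,Y,Z)$ of square matrices of sizes $m,n,l$ that preserve these reduced blocks, i.e. such that the corresponding blocks of $YA=AY$, $YB=BX$, $ZC=CY$ hold. Its unit group is the stabilizer group $G_{k-1}$ of $M_1,\dots,M_{k-1}$ (with $G_0=G$). The triples in $\Lambda_{k-1}$ are block upper triangular with respect to the current strips, have equal diagonal blocks at equivalent strips and otherwise arbitrary diagonal blocks, and have off-diagonal blocks subject only to linear relations with scalar coefficients. Moreover, each reduced block of the current partition is a scalar multiple of an identity matrix, or zero. Let the first unreduced block be in row strip $i$ and column strip $j$ of one of the matrices $A,B,C$ (call this matrix $N$, with blocks $N_{ab}$). Let $R$ and $S$ be the components of $(X,Y,Z)\in\Lambda_{k-1}$ acting on the rows and columns of $N$ respectively, so that the transformation reads $RN=N'S$.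 Put $D=\sum_{a>i}R_{ia}N_{aj}-\sum_{a<j}N_{ia}S_{aj}$, which involves only already reduced blocks of $N$. Then $D$ either takes all values or is identically $0$ as $(X,Y,Z)$ ranges over $\Lambda_{k-1}$. 1. If $D$ is not identically $0$, the block can be made zero by a transformation from $G_{k-1}$. One does so, and writes $M_k=\emptyset$ (a zero block of size $m_k\times n_k$, distinguished from zero blocks arising in case 2). The partition and $\sim$ are unchanged. 2. If $D\equiv0$ and the row strip $i$ and column strip $j$ are not equivalent, the block transforms as $N_{ij}\mapsto PN_{ij}Q^{-1}$ with $P,Q$ arbitrary and independent nonsingular matrices. It is reduced to $M_k=\begin{bmatrix}0&I_r\\0&0\end{bmatrix}$, with $r$ its rank ($r=0$ allowed). Strip $i$ is split into substrips of sizes $r,\ m_k-r$, and strip $j$ into substrips of sizes $n_k-r,\ r$; all strips equivalent to $i$ or to $j$ are split in the same way. Corresponding substrips of equivalent strips remain equivalent, and in addition the first substrip of $i$ and the second substrip of $j$ become equivalent. 3. If $D\equiv0$ and the strips $i$ and $j$ are equal or equivalent, the block is square and transforms as $N_{ij}\mapsto PN_{ij}P^{-1}$ with $P$ an arbitrary nonsingular matrix. It is reduced to the Weyr matrix $M_k=W$ similar to it. All strips in the class of $i$ are split by the standard partition of $W$, with corresponding substrips equivalent and with the equivalences of the standard partition added. The first step reduces $A$ to a Weyr matrix $M_1$ (case 3). The process ends after finitely many steps, when all of $A,B,C$ is reduced; $u$ denotes the number of steps. *)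

theory Defs
  imports
    "Jordan_Normal_Form.Jordan_Normal_Form_Existence"
    "Jordan_Normal_Form.DL_Rank"
    "HOL-Library.Extended_Nat"
    "HOL-Analysis.Abstract_Topology"
begin

section \<open>Systems and the group action\<close>

type_synonym system = "complex mat \<times> complex mat \<times> complex mat"
type_synonym mat_triple = "complex mat \<times> complex mat \<times> complex mat"

text \<open>The spaces of dimension \<open>m\<close>, \<open>n\<close>, \<open>l\<close> are called \<open>Input\<close>, \<open>State\<close>, \<open>Output\<close>.\<close>

datatype space = Input | State | Output

datatype component = Comp_A | Comp_B | Comp_C

fun component_mat :: "component \<Rightarrow> system \<Rightarrow> complex mat" where
  "component_mat Comp_A (A, B, C) = A"
| "component_mat Comp_B (A, B, C) = B"
| "component_mat Comp_C (A, B, C) = C"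

fun row_space :: "component \<Rightarrow> space" where
  "row_space Comp_A = State"
| "row_space Comp_B = State"
| "row_space Comp_C = Output"

fun col_space :: "component \<Rightarrow> space" where
  "col_space Comp_A = State"
| "col_space Comp_B = Input"
| "col_space Comp_C = State"

fun factor :: "space \<Rightarrow> mat_triple \<Rightarrow> complex mat" where
  "factor Input (X, Y, Z) = X"
| "factor State (X, Y, Z) = Y"
| "factor Output (X, Y, Z) = Z"

definition systems :: "nat \<Rightarrow> nat \<Rightarrow> nat \<Rightarrow> system set" where
  "systems m n l = carrier_mat n n \<times> carrier_mat n m \<times> carrier_mat l n"

definition square_triples :: "nat \<Rightarrow> nat \<Rightarrow> nat \<Rightarrow> mat_triple set" where
  "square_triples m n l = carrier_mat m m \<times> carrier_mat n n \<times> carrier_mat l l"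

definition GL_triples :: "nat \<Rightarrow> nat \<Rightarrow> nat \<Rightarrow> mat_triple set" where
  "GL_triples m n l =
     {(X, Y, Z) \<in> square_triples m n l. invertible_mat X \<and> invertible_mat Y \<and> invertible_mat Z}"

abbreviation inv_mat :: "complex mat \<Rightarrow> complex mat" where
  "inv_mat P \<equiv> the (mat_inverse P)"

fun act :: "mat_triple \<Rightarrow> system \<Rightarrow> system" where
  "act (X, Y, Z) (A, B, C) = (Y * A * inv_mat Y, Y * B * inv_mat X, Z * C * inv_mat Y)"

definition equiv_class :: "nat \<Rightarrow> nat \<Rightarrow> nat \<Rightarrow> system \<Rightarrow> system set" where
  "equiv_class m n l S = {act T S | T. T \<in> GL_triples m n l}"


section \<open>Dimension in the Zariski topology\<close>

inductive_set polynomial_functions :: "nat \<Rightarrow> nat \<Rightarrow> nat \<Rightarrow> (system \<Rightarrow> complex) set"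
  for m n l where
  const: "(\<lambda>_. a) \<in> polynomial_functions m n l"
| coord_A: "p < n \<Longrightarrow> q < n \<Longrightarrow> (\<lambda>S. component_mat Comp_A S $$ (p, q)) \<in> polynomial_functions m n l"
| coord_B: "p < n \<Longrightarrow> q < m \<Longrightarrow> (\<lambda>S. component_mat Comp_B S $$ (p, q)) \<in> polynomial_functions m n l"
| coord_C: "p < l \<Longrightarrow> q < n \<Longrightarrow> (\<lambda>S. component_mat Comp_C S $$ (p, q)) \<in> polynomial_functions m n l"
| add: "f \<in> polynomial_functions m n l \<Longrightarrow> g \<in> polynomial_functions m n l \<Longrightarrow>
    (\<lambda>S. f S + g S) \<in> polynomial_functions m n l"
| mult: "f \<in> polynomial_functions m n l \<Longrightarrow> g \<in> polynomial_functions m n l \<Longrightarrow>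
    (\<lambda>S. f S * g S) \<in> polynomial_functions m n l"

definition zariski_topology :: "nat \<Rightarrow> nat \<Rightarrow> nat \<Rightarrow> system topology" where
  "zariski_topology m n l =
     topology_generated_by {{S \<in> systems m n l. f S \<noteq> 0} | f. f \<in> polynomial_functions m n l}"

definition irreducible_space :: "'a topology \<Rightarrow> bool" where
  "irreducible_space X \<longleftrightarrow> topspace X \<noteq> {} \<and>
     (\<forall>C D. closedin X C \<longrightarrow> closedin X D \<longrightarrow> C \<union> D = topspace X \<longrightarrow> C = topspace X \<or> D = topspace X)"

text \<open>The supremum of the lengths \<open>k\<close> of chains \<open>Z\<^sub>0 \<subset> \<dots> \<subset> Z\<^sub>k\<close> of irreducible closed subsets
  (\<open>0\<close> for the empty space).\<close>

definition krull_dim :: "'a topology \<Rightarrow> enat" where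
  "krull_dim X = Sup {enat k | k. \<exists>Z :: nat \<Rightarrow> 'a set.
     (\<forall>i\<le>k. closedin X (Z i) \<and> irreducible_space (subtopology X (Z i))) \<and>
     (\<forall>i<k. Z i \<subset> Z (Suc i))}"


section \<open>Weyr matrices\<close>

text \<open>\<open>weyr_block c ws\<close> is the Weyr block with eigenvalue \<open>c\<close> and \<open>w\<^sub>j = ws ! (j - 1)\<close>; its strip
  number \<open>j\<close> (counted from \<open>0\<close>) starts at position \<open>sum_list (take j ws)\<close>.\<close>

definition weyr_block :: "complex \<Rightarrow> nat list \<Rightarrow> complex mat" where
  "weyr_block c ws = mat (sum_list ws) (sum_list ws) (\<lambda>(p, q).
     if p = q then c
     else if \<exists>j t. Suc j < length ws \<and> t < ws ! Suc j \<and>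
                p = sum_list (take j ws) + t \<and> q = sum_list (take (Suc j) ws) + t then 1
     else 0)"

definition weyr_data :: "(complex \<times> complex) set \<Rightarrow> (complex \<times> nat list) list \<Rightarrow> bool" where
  "weyr_data ordC cws \<longleftrightarrow>
     sorted_wrt (\<lambda>c d. (c, d) \<in> ordC \<and> c \<noteq> d) (map fst cws) \<and>
     (\<forall>(c, ws) \<in> set cws. ws \<noteq> [] \<and> sorted_wrt (\<ge>) ws \<and> (\<forall>w \<in> set ws. 1 \<le> w))"

definition weyr_matrix :: "(complex \<times> nat list) list \<Rightarrow> complex mat" where
  "weyr_matrix cws = diag_block_mat (map (\<lambda>(c, ws). weyr_block c ws) cws)"

text \<open>The number \<open>w\<^sub>q - w\<^sub>q\<^sub>+\<^sub>1\<close> of Jordan blocks of size exactly \<open>q\<close>, where \<open>w\<^sub>j\<close> counts those of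
  size at least \<open>j\<close>.\<close>

definition jordan_count :: "nat list \<Rightarrow> nat \<Rightarrow> nat" where
  "jordan_count ws q = ws ! (q - 1) - (if q < length ws then ws ! q else 0)"

text \<open>The substrips \<open>(j, q)\<close> of the standard partition, in order, as pairs of a tag and a size.
  The tag \<open>(c, q)\<close> does not depend on \<open>j\<close>: substrips are equivalent iff their tags agree.
  Sizes may be \<open>0\<close> here.\<close>

definition standard_partition :: "(complex \<times> nat list) list \<Rightarrow> ((complex \<times> nat) \<times> nat) list" where
  "standard_partition cws = concat (map (\<lambda>(c, ws).
     concat (map (\<lambda>j. map (\<lambda>q. ((c, q), jordan_count ws q)) (rev [j..<Suc (length ws)]))
       [1..<Suc (length ws)])) cws)"

text \<open>A list of pairs \<open>(\<lambda>\<^sub>i, [q\<^sub>i\<^sub>1, q\<^sub>i\<^sub>2, \<dots>])\<close> with distinct \<open>\<lambda>\<^sub>i\<close>.\<close>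

definition jordan_data :: "(complex \<times> nat list) list \<Rightarrow> bool" where
  "jordan_data cqs \<longleftrightarrow> distinct (map fst cqs) \<and>
     (\<forall>(c, qs) \<in> set cqs. qs \<noteq> [] \<and> sorted_wrt (\<ge>) qs \<and> (\<forall>q \<in> set qs. 1 \<le> q))"

definition jordan_of_data :: "(complex \<times> nat list) list \<Rightarrow> complex mat" where
  "jordan_of_data cqs = jordan_matrix (concat (map (\<lambda>(c, qs). map (\<lambda>q. (q, c)) qs) cqs))"


section \<open>Belitskii's algorithm\<close>

text \<open>A strip is a pair of a label and a size. The partition of a space is the list of its
  consecutive strips, and two strips (of the same space or not) are equivalent iff they have the
  same label.\<close>

type_synonym strip = "nat \<times> nat"
type_synonym strips = "space \<Rightarrow> strip list"

text \<open>A position \<open>(N, p, q)\<close> is the entry in row \<open>p\<close> and column \<open>q\<close> of the matrix \<open>N\<close>. As partitions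
  only get finer, the blocks reduced so far are recorded by the set of their positions.\<close>

type_synonym position = "component \<times> nat \<times> nat"

definition offset :: "strip list \<Rightarrow> nat \<Rightarrow> nat" where
  "offset ss i = (\<Sum>k<i. snd (ss ! k))"

definition block :: "strip list \<Rightarrow> strip list \<Rightarrow> complex mat \<Rightarrow> nat \<Rightarrow> nat \<Rightarrow> complex mat" where
  "block rs cs N i j =
     mat (snd (rs ! i)) (snd (cs ! j)) (\<lambda>(p, q). N $$ (offset rs i + p, offset cs j + q))"

definition comp_block :: "strips \<Rightarrow> system \<Rightarrow> component \<Rightarrow> nat \<Rightarrow> nat \<Rightarrow> complex mat" where
  "comp_block P S N i j = block (P (row_space N)) (P (col_space N)) (component_mat N S) i j"

definition block_positions :: "strips \<Rightarrow> component \<Rightarrow> nat \<Rightarrow> nat \<Rightarrow> position set" where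
  "block_positions P N i j =
     {(N, p, q) | p q.
        p \<in> {offset (P (row_space N)) i ..< offset (P (row_space N)) (Suc i)} \<and>
        q \<in> {offset (P (col_space N)) j ..< offset (P (col_space N)) (Suc j)}}"

definition is_block :: "strips \<Rightarrow> component \<Rightarrow> nat \<Rightarrow> nat \<Rightarrow> bool" where
  "is_block P N i j \<longleftrightarrow> i < length (P (row_space N)) \<and> j < length (P (col_space N))"

fun comp_index :: "component \<Rightarrow> nat" where
  "comp_index Comp_A = 0"
| "comp_index Comp_B = 1"
| "comp_index Comp_C = 2"

fun precedes :: "component \<times> nat \<times> nat \<Rightarrow> component \<times> nat \<times> nat \<Rightarrow> bool" where
  "precedes (N, i, j) (N', i', j') \<longleftrightarrow>
     comp_index N < comp_index N' \<or> (N = N' \<and> (i > i' \<or> (i = i' \<and> j < j')))"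

definition unreduced :: "strips \<Rightarrow> position set \<Rightarrow> component \<Rightarrow> nat \<Rightarrow> nat \<Rightarrow> bool" where
  "unreduced P R N i j \<longleftrightarrow> is_block P N i j \<and> \<not> block_positions P N i j \<subseteq> R"

definition first_unreduced :: "strips \<Rightarrow> position set \<Rightarrow> component \<Rightarrow> nat \<Rightarrow> nat \<Rightarrow> bool" where
  "first_unreduced P R N i j \<longleftrightarrow> unreduced P R N i j \<and>
     (\<forall>N' i' j'. unreduced P R N' i' j' \<longrightarrow> \<not> precedes (N', i', j') (N, i, j))"

text \<open>The algebra \<open>\<Lambda>\<close> of the triples preserving the reduced entries \<open>R\<close> of \<open>S\<close>, and its unit group
  (a matrix inverse of an element of \<open>\<Lambda>\<close> is a polynomial in it, hence lies in \<open>\<Lambda>\<close>).\<close>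

definition preserving_algebra ::
    "nat \<Rightarrow> nat \<Rightarrow> nat \<Rightarrow> system \<Rightarrow> position set \<Rightarrow> mat_triple set" where
  "preserving_algebra m n l S R = {T \<in> square_triples m n l. \<forall>(N, p, q) \<in> R.
     (factor (row_space N) T * component_mat N S) $$ (p, q) = (component_mat N S * factor (col_space N) T) $$ (p, q)}"

definition preserving_group ::
    "nat \<Rightarrow> nat \<Rightarrow> nat \<Rightarrow> system \<Rightarrow> position set \<Rightarrow> mat_triple set" where
  "preserving_group m n l S R = preserving_algebra m n l S R \<inter> GL_triples m n l"

text \<open>\<open>D = \<Sum>\<^sub>a\<^sub>>\<^sub>i R\<^sub>i\<^sub>a N\<^sub>a\<^sub>j - \<Sum>\<^sub>a\<^sub><\<^sub>j N\<^sub>i\<^sub>a S\<^sub>a\<^sub>j\<close>, where \<open>R\<close>, \<open>S\<close> are the components of the triple \<open>T\<close>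
  acting on the rows and columns of \<open>N\<close>.\<close>

definition residual :: "strips \<Rightarrow> system \<Rightarrow> mat_triple \<Rightarrow> component \<Rightarrow> nat \<Rightarrow> nat \<Rightarrow> complex mat" where
  "residual P S T N i j =
    (let rs = P (row_space N); cs = P (col_space N);
         RR = factor (row_space N) T; SS = factor (col_space N) T; M = component_mat N S
     in mat (snd (rs ! i)) (snd (cs ! j)) (\<lambda>pq.
          (\<Sum>a\<in>{i<..<length rs}. (block rs rs RR i a * block rs cs M a j) $$ pq) -
          (\<Sum>a<j. (block rs cs M i a * block cs cs SS a j) $$ pq)))"

definition residual_vanishes ::
    "nat \<Rightarrow> nat \<Rightarrow> nat \<Rightarrow> system \<Rightarrow> strips \<Rightarrow> position set \<Rightarrow> component \<Rightarrow> nat \<Rightarrow> nat \<Rightarrow> bool" where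
  "residual_vanishes m n l S P R N i j \<longleftrightarrow>
     (\<forall>T \<in> preserving_algebra m n l S R.
        residual P S T N i j = 0\<^sub>m (snd (P (row_space N) ! i)) (snd (P (col_space N) ! j)))"

definition rank_normal_form :: "nat \<Rightarrow> nat \<Rightarrow> nat \<Rightarrow> complex mat" where
  "rank_normal_form mk nk r =
     four_block_mat (0\<^sub>m r (nk - r)) (1\<^sub>m r) (0\<^sub>m (mk - r) (nk - r)) (0\<^sub>m (mk - r) r)"

definition labels :: "strips \<Rightarrow> nat set" where
  "labels P = (\<Union>sp. fst ` set (P sp))"

definition split_strips :: "(strip \<Rightarrow> strip list) \<Rightarrow> strips \<Rightarrow> strips" where
  "split_strips f P = (\<lambda>sp. filter (\<lambda>s. snd s > 0) (concat (map f (P sp))))"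

text \<open>The reduced blocks \<open>M\<^sub>k\<close>: \<open>Empty_Block m\<^sub>k n\<^sub>k\<close> is the block \<open>\<emptyset>\<close>, \<open>Rank_Block m\<^sub>k n\<^sub>k r\<close> is
  \<open>rank_normal_form m\<^sub>k n\<^sub>k r\<close>, and \<open>Weyr_Block W cqs\<close> is the Weyr matrix \<open>W\<close> together with the
  sizes and eigenvalues of the blocks of a Jordan matrix similar to \<open>W\<close>.\<close>

datatype reduced_block =
    Empty_Block nat nat
  | Rank_Block nat nat nat
  | Weyr_Block "complex mat" "(complex \<times> nat list) list"

text \<open>The label of the rest of a split strip in \<open>rank_reduction\<close> is the old label; the fresh
  label \<open>e\<close> makes the first substrips of \<open>i\<close> and the second substrips of \<open>j\<close> equivalent.\<close>

inductive belitskii_step ::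
    "(complex \<times> complex) set \<Rightarrow> nat \<Rightarrow> nat \<Rightarrow> nat \<Rightarrow> system \<times> strips \<times> position set \<Rightarrow> reduced_block \<Rightarrow>
     system \<times> strips \<times> position set \<Rightarrow> bool"
  for ordC m n l where
  zero_reduction:
    "first_unreduced P R N i j \<Longrightarrow>
     P (row_space N) ! i = (a, mk) \<Longrightarrow> P (col_space N) ! j = (b, nk) \<Longrightarrow>
     \<not> residual_vanishes m n l S P R N i j \<Longrightarrow>
     T \<in> preserving_group m n l S R \<Longrightarrow>
     comp_block P (act T S) N i j = 0\<^sub>m mk nk \<Longrightarrow>
     belitskii_step ordC m n l (S, P, R) (Empty_Block mk nk)
       (act T S, P, R \<union> block_positions P N i j)"
| rank_reduction:
    "first_unreduced P R N i j \<Longrightarrow>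
     P (row_space N) ! i = (a, mk) \<Longrightarrow> P (col_space N) ! j = (b, nk) \<Longrightarrow>
     residual_vanishes m n l S P R N i j \<Longrightarrow>
     a \<noteq> b \<Longrightarrow>
     r = vec_space.rank mk (comp_block P S N i j) \<Longrightarrow>
     T \<in> preserving_group m n l S R \<Longrightarrow>
     comp_block P (act T S) N i j = rank_normal_form mk nk r \<Longrightarrow>
     e \<notin> labels P \<Longrightarrow>
     f = (\<lambda>(d, s). if d = a then [(e, r), (a, mk - r)]
                   else if d = b then [(b, nk - r), (e, r)]
                   else [(d, s)]) \<Longrightarrow>
     belitskii_step ordC m n l (S, P, R) (Rank_Block mk nk r)
       (act T S, split_strips f P, R \<union> block_positions P N i j)"
| weyr_reduction:
    "first_unreduced P R N i j \<Longrightarrow>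
     P (row_space N) ! i = (a, mk) \<Longrightarrow> P (col_space N) ! j = (a, mk) \<Longrightarrow>
     residual_vanishes m n l S P R N i j \<Longrightarrow>
     weyr_data ordC cws \<Longrightarrow> W = weyr_matrix cws \<Longrightarrow>
     similar_mat (comp_block P S N i j) W \<Longrightarrow>
     T \<in> preserving_group m n l S R \<Longrightarrow>
     comp_block P (act T S) N i j = W \<Longrightarrow>
     jordan_data cqs \<Longrightarrow> similar_mat W (jordan_of_data cqs) \<Longrightarrow>
     inj_on g (fst ` set (standard_partition cws)) \<Longrightarrow>
     g ` fst ` set (standard_partition cws) \<inter> labels P = {} \<Longrightarrow>
     f = (\<lambda>(d, s). if d = a then map (\<lambda>(tag, t). (g tag, t)) (standard_partition cws)
                   else [(d, s)]) \<Longrightarrow>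
     belitskii_step ordC m n l (S, P, R) (Weyr_Block W cqs)
       (act T S, split_strips f P, R \<union> block_positions P N i j)"

inductive belitskii_run ::
    "(complex \<times> complex) set \<Rightarrow> nat \<Rightarrow> nat \<Rightarrow> nat \<Rightarrow> system \<times> strips \<times> position set \<Rightarrow>
     reduced_block list \<Rightarrow> bool"
  for ordC m n l where
  finished: "\<forall>N i j. \<not> unreduced P R N i j \<Longrightarrow> belitskii_run ordC m n l (S, P, R) []"
| step: "belitskii_step ordC m n l st M st' \<Longrightarrow> belitskii_run ordC m n l st' Ms \<Longrightarrow>
    belitskii_run ordC m n l st (M # Ms)"

fun initial_strips :: "nat \<Rightarrow> nat \<Rightarrow> nat \<Rightarrow> strips" where
  "initial_strips m n l Input = (if m = 0 then [] else [(0, m)])"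
| "initial_strips m n l State = (if n = 0 then [] else [(1, n)])"
| "initial_strips m n l Output = (if l = 0 then [] else [(2, l)])"

text \<open>\<open>belitskii ordC m n l S Ms\<close>: with \<open>ordC\<close> as the order of \<open>\<complex>\<close>, the algorithm reduces \<open>S\<close> to its
  canonical form, and \<open>Ms = [M\<^sub>1, \<dots>, M\<^sub>u]\<close> are its successive reduced subblocks.\<close>

definition belitskii ::
    "(complex \<times> complex) set \<Rightarrow> nat \<Rightarrow> nat \<Rightarrow> nat \<Rightarrow> system \<Rightarrow> reduced_block list \<Rightarrow> bool" where
  "belitskii ordC m n l S Ms \<longleftrightarrow> belitskii_run ordC m n l (S, initial_strips m n l, {}) Ms"

text \<open>The subtraction in the last case is not truncated: the \<open>q\<^sub>i\<^sub>j\<close> sum up to \<open>dim_row W\<close>, and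
  \<open>\<Sum>\<^sub>j (2j - 1) q\<^sub>j \<le> (\<Sum>\<^sub>j q\<^sub>j)\<^sup>2\<close> for positive integers \<open>q\<^sub>j\<close>.\<close>

fun sigma :: "reduced_block \<Rightarrow> nat" where
  "sigma (Empty_Block mk nk) = mk * nk"
| "sigma (Rank_Block mk nk r) = r * (mk + nk - r)"
| "sigma (Weyr_Block W cqs) = (dim_row W)\<^sup>2 -
     (\<Sum>i<length cqs. \<Sum>j=1..length (snd (cqs ! i)). (2 * j - 1) * snd (cqs ! i) ! (j - 1))"

end

theory Submission
  imports Defs
begin

text \<open>Let \<open>\<Lambda>\<^sub>k\<close> be the algebra of the triples preserving the first \<open>k\<close> reduced blocks: \<open>\<Lambda>\<^sub>0\<close> is the space of
  all triples, and \<open>\<Lambda>\<^sub>u\<close> is the stabilizer algebra of the canonical system. Passing from \<open>\<Lambda>\<^sub>k\<^sub>-\<^sub>1\<close> to \<open>\<Lambda>\<^sub>k\<close>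
  adds exactly \<open>\<sigma>\<^sub>k\<close> independent linear conditions. If \<open>D\<close> is not identically \<open>0\<close>, then it takes all values, and
  every entry of the block contributes one condition. Otherwise the conditions are \<open>P M\<^sub>k = M\<^sub>k Q\<close> for
  diagonal blocks \<open>P\<close>, \<open>Q\<close>, which are independent in case 2 and equal in case 3, where the codimension
  is that of the centralizer of \<open>W\<close>. Hence the stabilizer algebra has codimension \<open>d = \<sigma>\<^sub>1 + \<dots> + \<sigma>\<^sub>u\<close>.

  The orbit then has Krull dimension \<open>d\<close>. Let \<open>w\<^sub>1, \<dots>, w\<^sub>d\<close> span a complement of the stabilizer algebra.
  Acting by \<open>1 + x\<^sub>1 w\<^sub>1 + \<dots> + x\<^sub>d w\<^sub>d\<close> gives a rational map from the affine \<open>d\<close>-space with dense image in the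
  orbit, so the polynomials of degree at most \<open>t\<close> span a space of dimension \<open>O(t\<^sup>d)\<close> on the orbit, whereas
  a chain of irreducible closed sets of length \<open>k\<close> forces growth at least \<open>t\<^sup>k / k!\<close>. Conversely, the closures of the
  images of the coordinate subspaces form a strict chain of length \<open>d\<close>.\<close>

section \<open>Matrices as functions\<close>

text \<open>A step of the algorithm may use any \<open>T\<close> of the current group, and the
  system changes with it. What survives is the orbit and, as a set, the algebra \<open>Lam\<close>:
  its elements are block triangular and the reduced positions form a staircase, so reduced entries
  and the conditions they impose are untouched. Only when all positions are reduced does
  \<open>Lam\<close> become a stabilizer. The action is not linear in the triple, but
  \<open>v S = S' v\<close> is. Cosets of the stabilizer are handled through this equation, with
  inverses replaced by adjugates, so that everything is polynomial along lines. Density of the slice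
  is Cramer's rule: on a line of triples \<open>g\<close> through 1, the coset
  \<open>g * Stab\<close> meets \<open>1 + span w\<close> in an invertible triple except where a
  polynomial that is nonzero at \<open>g = 1\<close> vanishes. Counting parameters does not show
  that the chain of closures is strict. For this a polynomial is required that vanishes on one
  closure but not on the next; it is a Gram determinant with the conjugates frozen at one point.
  Triples are total functions and hence form a vector space without a carrier set. Entries out of
  range lie in every algebra and do not affect codimensions.\<close>

type_synonym fmat = "nat \<Rightarrow> nat \<Rightarrow> complex"
type_synonym tri = "space \<Rightarrow> fmat"

definition mm :: "nat \<Rightarrow> fmat \<Rightarrow> fmat \<Rightarrow> fmat" where
  "mm k X Y = (\<lambda>p q. \<Sum>a<k. X p a * Y a q)"

definition idm :: fmat where "idm p q = (if p = q then 1 else 0)"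

lemma mm_assoc: "mm k (mm k' X Y) Z = mm k' X (mm k Y Z)"
proof (intro ext)
  fix p q
  have "mm k (mm k' X Y) Z p q = (\<Sum>a<k. \<Sum>b<k'. X p b * Y b a * Z a q)"
    by (simp add: mm_def sum_distrib_right)
  also have "\<dots> = (\<Sum>b<k'. \<Sum>a<k. X p b * Y b a * Z a q)"
    by (rule sum.swap)
  also have "\<dots> = mm k' X (mm k Y Z) p q"
    by (simp add: mm_def sum_distrib_left mult.assoc)
  finally show "mm k (mm k' X Y) Z p q = mm k' X (mm k Y Z) p q" .
qed

lemma mm_idm_left: "p < k \<Longrightarrow> mm k idm Y p q = Y p q"
  by (simp add: mm_def idm_def if_distrib[of "\<lambda>x. x * _"] sum.delta cong: if_cong)

lemma mm_idm_right: "q < k \<Longrightarrow> mm k X idm p q = X p q"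
  by (simp add: mm_def idm_def if_distrib[of "\<lambda>x. _ * x"] sum.delta' cong: if_cong)

lemma mm_cong:
  assumes "\<And>a. a < k \<Longrightarrow> X p a = X' p a" and "\<And>a. a < k \<Longrightarrow> Y a q = Y' a q"
  shows "mm k X Y p q = mm k X' Y' p q"
  using assms by (simp add: mm_def)

definition lin :: "(tri \<Rightarrow> complex) \<Rightarrow> bool" where
  "lin F \<longleftrightarrow> (\<forall>a b u v. F (\<lambda>s p q. a * u s p q + b * v s p q) = a * F u + b * F v)"

lemma linD: "lin F \<Longrightarrow> F (\<lambda>s p q. a * u s p q + b * v s p q) = a * F u + b * F v"
  by (simp add: lin_def)

lemma lin_zero:
  assumes "lin F"
  shows "F (\<lambda>s p q. 0) = 0"
  using linD[OF assms, of 0 "\<lambda>s p q. 0" 0 "\<lambda>s p q. 0"] by simp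

lemma lin_sum:
  assumes "lin F" "finite I"
  shows "F (\<lambda>s p q. \<Sum>i\<in>I. c i * u i s p q) = (\<Sum>i\<in>I. c i * F (u i))"
  using assms(2)
proof (induction rule: finite_induct)
  case empty
  show ?case using lin_zero[OF assms(1)] by simp
next
  case (insert x I)
  then show ?case
    using linD[OF assms(1), of "c x" "u x" 1 "\<lambda>s p q. \<Sum>i\<in>I. c i * u i s p q"] by simp
qed

text \<open>The ambient space is infinite-dimensional, so the codimension is witnessed by
  functionals instead of dimensions. The dual vectors \<open>w\<close> express independence of the
  functionals and later span the complement in which the slice lives.\<close>

definition codim :: "tri set \<Rightarrow> nat \<Rightarrow> bool" where
  "codim V d \<longleftrightarrow> (\<exists>F. (\<forall>k<d. lin (F k)) \<and> (\<forall>v. v \<in> V \<longleftrightarrow> (\<forall>k<d. F k v = 0)) \<and>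
     (\<forall>k<d. \<exists>w. \<forall>j<d. F j w = (if j = k then 1 else 0)))"

lemma codim_UNIV: "codim UNIV 0"
  by (auto simp: codim_def)

text \<open>The new functionals only have to be jointly onto on \<open>V\<close>. New dual vectors
  are then found inside \<open>V\<close>, where the old functionals vanish; an old dual vector is
  corrected by a \<open>v\<close> in \<open>V\<close> with the same new values, which leaves its old
  values alone.\<close>

lemma codim_step:
  fixes G :: "'k \<Rightarrow> tri \<Rightarrow> complex"
  assumes V: "codim V d" and K: "finite K" and linG: "\<And>x. x \<in> K \<Longrightarrow> lin (G x)"
    and surj: "\<And>a :: 'k \<Rightarrow> complex. \<exists>v\<in>V. \<forall>x\<in>K. G x v = a x"
    and V': "V' = {v \<in> V. \<forall>x\<in>K. G x v = 0}"
  shows "codim V' (d + card K)"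
proof -
  obtain F where linF: "\<And>k. k < d \<Longrightarrow> lin (F k)" and VF: "\<And>v. v \<in> V \<longleftrightarrow> (\<forall>k<d. F k v = 0)"
    and dual: "\<And>k. k < d \<Longrightarrow> \<exists>w. \<forall>j<d. F j w = (if j = k then 1 else 0)"
    using V unfolding codim_def by blast
  obtain h where h: "bij_betw h {..<card K} K"
    using K ex_bij_betw_nat_finite[of K] by (metis atLeast0LessThan)
  define F' where "F' k = (if k < d then F k else G (h (k - d)))" for k
  have hK: "h (k - d) \<in> K" if "k < d + card K" "\<not> k < d" for k
    using that h by (auto simp: bij_betw_def)
  have 1: "\<forall>k<d + card K. lin (F' k)"
    using linF linG hK by (auto simp: F'_def)
  have 2: "v \<in> V' \<longleftrightarrow> (\<forall>k<d + card K. F' k v = 0)" for v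
  proof
    assume "v \<in> V'"
    then show "\<forall>k<d + card K. F' k v = 0" using VF hK by (auto simp: F'_def V')
  next
    assume *: "\<forall>k<d + card K. F' k v = 0"
    have "F k v = 0" if "k < d" for k using *[rule_format, of k] that by (auto simp: F'_def)
    then have "v \<in> V" using VF by simp
    moreover have "G x v = 0" if "x \<in> K" for x
    proof -
      obtain k where "k < card K" "h k = x" using h \<open>x \<in> K\<close> unfolding bij_betw_def by (metis imageE lessThan_iff)
      then show ?thesis using *[rule_format, of "d + k"] by (auto simp: F'_def)
    qed
    ultimately show "v \<in> V'" by (simp add: V')
  qed
  have 3: "\<exists>w. \<forall>j<d + card K. F' j w = (if j = k then 1 else 0)" if k: "k < d + card K" for k
  proof (cases "k < d")
    case True
    obtain w where w: "\<And>j. j < d \<Longrightarrow> F j w = (if j = k then 1 else 0)" using dual[OF True] by blast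
    obtain v where v: "v \<in> V" "\<And>x. x \<in> K \<Longrightarrow> G x v = G x w" using surj[of "\<lambda>x. G x w"] by blast
    have "F' j (\<lambda>s p q. 1 * w s p q + (-1) * v s p q) = (if j = k then 1 else 0)" if "j < d + card K" for j
    proof (cases "j < d")
      case jd: True
      then show ?thesis using linD[OF linF[OF jd], of 1 w "-1" v] w[OF jd] v(1) VF by (simp add: F'_def)
    next
      case False
      then show ?thesis using linD[OF linG[OF hK[OF that False]], of 1 w "-1" v] v(2)[OF hK[OF that False]] True
        by (simp add: F'_def)
    qed
    then show ?thesis by blast
  next
    case False
    obtain v where v: "v \<in> V" "\<And>x. x \<in> K \<Longrightarrow> G x v = (if x = h (k - d) then 1 else 0)"
      using surj[of "\<lambda>x. if x = h (k - d) then 1 else 0"] by blast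
    have "F' j v = (if j = k then 1 else 0)" if "j < d + card K" for j
    proof (cases "j < d")
      case jd: True
      then show ?thesis using v(1) VF False by (auto simp: F'_def)
    next
      case jd: False
      have "h (j - d) = h (k - d) \<longleftrightarrow> j - d = k - d"
        using h that k jd False unfolding bij_betw_def inj_on_def
        by (metis add_diff_inverse_nat lessThan_iff nat_add_left_cancel_less)
      then show ?thesis using v(2)[OF hK[OF that jd]] jd False
        by (auto simp: F'_def)
    qed
    then show ?thesis by blast
  qed
  show ?thesis unfolding codim_def using 1 2 3 by blast
qed

section \<open>Zariski closed sets\<close>

text \<open>The generating sets are already a base: the product of two polynomials yields the
  intersection of their nonvanishing loci.\<close>

lemma zariski_openin_basic:
  assumes "openin (zariski_topology m n l) U" "x \<in> U"
  shows "\<exists>f\<in>polynomial_functions m n l. f x \<noteq> 0 \<and> {S \<in> systems m n l. f S \<noteq> 0} \<subseteq> U"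
proof -
  have "generate_topology_on {{S \<in> systems m n l. f S \<noteq> 0} | f. f \<in> polynomial_functions m n l} U"
    using assms(1) by (simp add: zariski_topology_def openin_topology_generated_by_iff)
  then have "\<forall>x\<in>U. \<exists>f\<in>polynomial_functions m n l. f x \<noteq> 0 \<and> {S \<in> systems m n l. f S \<noteq> 0} \<subseteq> U"
  proof (induction rule: generate_topology_on.induct)
    case (Int a b)
    show ?case
    proof
      fix x assume x: "x \<in> a \<inter> b"
      from Int.IH(1)[THEN bspec, OF IntD1[OF x]]
      obtain f where f: "f \<in> polynomial_functions m n l" "f x \<noteq> 0" "{S \<in> systems m n l. f S \<noteq> 0} \<subseteq> a"
        by (elim bexE conjE) (rule that)
      from Int.IH(2)[THEN bspec, OF IntD2[OF x]]
      obtain g where g: "g \<in> polynomial_functions m n l" "g x \<noteq> 0" "{S \<in> systems m n l. g S \<noteq> 0} \<subseteq> b"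
        by (elim bexE conjE) (rule that)
      have "f x * g x \<noteq> 0" "{S \<in> systems m n l. f S * g S \<noteq> 0} \<subseteq> a \<inter> b"
        using f g by auto
      then show "\<exists>f\<in>polynomial_functions m n l. f x \<noteq> 0 \<and> {S \<in> systems m n l. f S \<noteq> 0} \<subseteq> a \<inter> b"
        using polynomial_functions.mult[OF f(1) g(1)] by (rule_tac bexI[of _ "\<lambda>S. f S * g S"]) (rule conjI)
    qed
  next
    case (UN K)
    show ?case
    proof
      fix x assume "x \<in> \<Union>K"
      then obtain k where k: "k \<in> K" "x \<in> k" by blast
      from UN.IH[OF k(1), THEN bspec, OF k(2)]
      obtain f where f: "f \<in> polynomial_functions m n l" "f x \<noteq> 0" "{S \<in> systems m n l. f S \<noteq> 0} \<subseteq> k"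
        by (elim bexE conjE) (rule that)
      have "{S \<in> systems m n l. f S \<noteq> 0} \<subseteq> \<Union>K" using f(3) k(1) by auto
      then show "\<exists>f\<in>polynomial_functions m n l. f x \<noteq> 0 \<and> {S \<in> systems m n l. f S \<noteq> 0} \<subseteq> \<Union>K"
        using f(1,2) by (rule_tac bexI[of _ f]) (rule conjI)
    qed
  next
    case (Basis s)
    then obtain f where f: "s = {S \<in> systems m n l. f S \<noteq> 0}" "f \<in> polynomial_functions m n l" by auto
    show ?case unfolding f(1) using f(2) by (intro ballI bexI[of _ f]) auto
  qed auto
  then show ?thesis using assms(2) by blast
qed

lemma zariski_openin_basicI:
  "f \<in> polynomial_functions m n l \<Longrightarrow> openin (zariski_topology m n l) {S \<in> systems m n l. f S \<noteq> 0}"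
  unfolding zariski_topology_def openin_topology_generated_by_iff
  by (rule generate_topology_on.Basis) auto

lemma topspace_zariski: "topspace (zariski_topology m n l) = systems m n l"
proof -
  have "openin (zariski_topology m n l) (systems m n l)"
    using zariski_openin_basicI[OF polynomial_functions.const[of 1 m n l]] by simp
  moreover have "topspace (zariski_topology m n l) \<subseteq> systems m n l"
    unfolding zariski_topology_def topology_generated_by_topspace by auto
  ultimately show ?thesis using openin_subset by blast
qed

text \<open>Translates closedness into separation by polynomials, the form in which all later
  arguments use it. For the converse direction the open set is the union of all nonvanishing loci of
  polynomials that vanish on \<open>C\<close>.\<close>

lemma closedin_zariski_subtopology:
  assumes "E \<subseteq> systems m n l"
  shows "closedin (subtopology (zariski_topology m n l) E) C \<longleftrightarrow>
    C \<subseteq> E \<and> (\<forall>x\<in>E - C. \<exists>f\<in>polynomial_functions m n l. (\<forall>y\<in>C. f y = 0) \<and> f x \<noteq> 0)"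
proof
  assume C: "closedin (subtopology (zariski_topology m n l) E) C"
  then have CE: "C \<subseteq> E" using closedin_subset by fastforce
  have "openin (subtopology (zariski_topology m n l) E) (E - C)"
    using C assms by (auto simp: closedin_def topspace_zariski Int_absorb1)
  then obtain U where U: "openin (zariski_topology m n l) U" "E - C = U \<inter> E"
    by (auto simp: openin_subtopology)
  have "\<exists>f\<in>polynomial_functions m n l. (\<forall>y\<in>C. f y = 0) \<and> f x \<noteq> 0" if "x \<in> E - C" for x
  proof -
    have "x \<in> U" using U(2) that by blast
    from zariski_openin_basic[OF U(1) this]
    obtain f where f: "f \<in> polynomial_functions m n l" "f x \<noteq> 0" "{S \<in> systems m n l. f S \<noteq> 0} \<subseteq> U"
      by (elim bexE conjE) (rule that)
    have "\<forall>y\<in>C. f y = 0"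
    proof
      fix y assume "y \<in> C"
      then have "y \<notin> U" "y \<in> systems m n l" using U(2) CE assms by auto
      then show "f y = 0" using f(3) by auto
    qed
    then show ?thesis using f(1,2) by (intro bexI[of _ f] conjI)
  qed
  then show "C \<subseteq> E \<and> (\<forall>x\<in>E - C. \<exists>f\<in>polynomial_functions m n l. (\<forall>y\<in>C. f y = 0) \<and> f x \<noteq> 0)"
    using CE by simp
next
  assume *: "C \<subseteq> E \<and> (\<forall>x\<in>E - C. \<exists>f\<in>polynomial_functions m n l. (\<forall>y\<in>C. f y = 0) \<and> f x \<noteq> 0)"
  define U where "U = \<Union>{{S \<in> systems m n l. f S \<noteq> 0} | f. f \<in> polynomial_functions m n l \<and> (\<forall>y\<in>C. f y = 0)}"
  have "openin (zariski_topology m n l) U"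
    unfolding U_def
  proof (rule openin_Union)
    fix W assume "W \<in> {{S \<in> systems m n l. f S \<noteq> 0} | f. f \<in> polynomial_functions m n l \<and> (\<forall>y\<in>C. f y = 0)}"
    then obtain f where "W = {S \<in> systems m n l. f S \<noteq> 0}" "f \<in> polynomial_functions m n l" by auto
    then show "openin (zariski_topology m n l) W" using zariski_openin_basicI by simp
  qed
  moreover have "E - C = U \<inter> E"
  proof
    show "E - C \<subseteq> U \<inter> E"
    proof
      fix x assume x: "x \<in> E - C"
      from *[THEN conjunct2, THEN bspec, OF x]
      obtain f where f: "f \<in> polynomial_functions m n l" "\<forall>y\<in>C. f y = 0" "f x \<noteq> 0"
        by (elim bexE conjE) (rule that)
      then have "{S \<in> systems m n l. f S \<noteq> 0} \<subseteq> U"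
        unfolding U_def by (intro Union_upper CollectI exI[of _ f]) simp
      then show "x \<in> U \<inter> E" using x f(3) assms by auto
    qed
    show "U \<inter> E \<subseteq> E - C" unfolding U_def by auto
  qed
  ultimately have "openin (subtopology (zariski_topology m n l) E) (E - C)"
    by (auto simp: openin_subtopology)
  then show "closedin (subtopology (zariski_topology m n l) E) C"
    using * assms by (auto simp: closedin_def topspace_zariski Int_absorb1)
qed

lemma zariski_separate:
  assumes "E \<subseteq> systems m n l" "closedin (subtopology (zariski_topology m n l) E) C" "x \<in> E - C"
  obtains f where "f \<in> polynomial_functions m n l" "\<forall>y\<in>C. f y = 0" "f x \<noteq> 0"
  using iffD1[OF closedin_zariski_subtopology[OF assms(1)] assms(2), THEN conjunct2, THEN bspec, OF assms(3)]
  by (elim bexE conjE) (rule that)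

text \<open>Primality of the vanishing ideal. Zero loci of \<open>f\<close> and \<open>g\<close> are
  closed; conversely, two proper closed sets covering \<open>Z\<close> have separating polynomials
  whose product vanishes on \<open>Z\<close>.\<close>

lemma irreducible_zariski_iff:
  assumes "Z \<subseteq> systems m n l"
  shows "irreducible_space (subtopology (zariski_topology m n l) Z) \<longleftrightarrow> Z \<noteq> {} \<and>
    (\<forall>f\<in>polynomial_functions m n l. \<forall>g\<in>polynomial_functions m n l.
       (\<forall>x\<in>Z. f x * g x = 0) \<longrightarrow> (\<forall>x\<in>Z. f x = 0) \<or> (\<forall>x\<in>Z. g x = 0))"
    (is "?L \<longleftrightarrow> _ \<and> ?R")
proof -
  have ts: "topspace (subtopology (zariski_topology m n l) Z) = Z"
    using assms by (auto simp: topspace_zariski)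
  have "?L \<Longrightarrow> ?R"
  proof (intro ballI impI)
    fix f g assume L: ?L and f: "f \<in> polynomial_functions m n l" and g: "g \<in> polynomial_functions m n l"
      and fg: "\<forall>x\<in>Z. f x * g x = 0"
    let ?C = "{x\<in>Z. f x = 0}" and ?D = "{x\<in>Z. g x = 0}"
    have "closedin (subtopology (zariski_topology m n l) Z) ?C"
      "closedin (subtopology (zariski_topology m n l) Z) ?D"
      using f g by (auto simp: closedin_zariski_subtopology[OF assms])
    moreover have "?C \<union> ?D = Z" using fg by auto
    ultimately have "?C = Z \<or> ?D = Z" using L unfolding irreducible_space_def ts by blast
    then show "(\<forall>x\<in>Z. f x = 0) \<or> (\<forall>x\<in>Z. g x = 0)" by blast
  qed
  moreover have "?L" if "Z \<noteq> {}" and R: ?R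
    unfolding irreducible_space_def ts
  proof (intro conjI allI impI)
    show "Z \<noteq> {}" by fact
    fix C D
    assume C: "closedin (subtopology (zariski_topology m n l) Z) C"
      and D: "closedin (subtopology (zariski_topology m n l) Z) D" and CD: "C \<union> D = Z"
    show "C = Z \<or> D = Z"
    proof (rule ccontr)
      assume "\<not> (C = Z \<or> D = Z)"
      then obtain x y where xy: "x \<in> Z - C" "y \<in> Z - D" using CD by blast
      obtain f where f: "f \<in> polynomial_functions m n l" "\<forall>y\<in>C. f y = 0" "f x \<noteq> 0"
        using zariski_separate[OF assms C xy(1)] .
      obtain g where g: "g \<in> polynomial_functions m n l" "\<forall>y\<in>D. g y = 0" "g y \<noteq> 0"
        using zariski_separate[OF assms D xy(2)] .
      have "\<forall>x\<in>Z. f x * g x = 0" using CD f(2) g(2) by auto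
      then have "(\<forall>x\<in>Z. f x = 0) \<or> (\<forall>x\<in>Z. g x = 0)" using R f(1) g(1) by simp
      then show False using xy f(3) g(3) by auto
    qed
  qed
  moreover have "?L \<Longrightarrow> Z \<noteq> {}" unfolding irreducible_space_def ts by blast
  ultimately show ?thesis by blast
qed

section \<open>Growth of polynomial functions along a chain\<close>

text \<open>The index bounds the degree of some expression for the function from above, so leading
  terms and uniqueness of representation never come up.\<close>

inductive poly_deg :: "nat \<Rightarrow> nat \<Rightarrow> nat \<Rightarrow> nat \<Rightarrow> (system \<Rightarrow> complex) \<Rightarrow> bool"
  for m n l where
  const: "poly_deg m n l 0 (\<lambda>_. a)"
| coord_A: "p < n \<Longrightarrow> q < n \<Longrightarrow> poly_deg m n l 1 (\<lambda>S. component_mat Comp_A S $$ (p, q))"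
| coord_B: "p < n \<Longrightarrow> q < m \<Longrightarrow> poly_deg m n l 1 (\<lambda>S. component_mat Comp_B S $$ (p, q))"
| coord_C: "p < l \<Longrightarrow> q < n \<Longrightarrow> poly_deg m n l 1 (\<lambda>S. component_mat Comp_C S $$ (p, q))"
| add: "poly_deg m n l t f \<Longrightarrow> poly_deg m n l t g \<Longrightarrow> poly_deg m n l t (\<lambda>S. f S + g S)"
| mult: "poly_deg m n l s f \<Longrightarrow> poly_deg m n l t g \<Longrightarrow> poly_deg m n l (s + t) (\<lambda>S. f S * g S)"
| mono: "poly_deg m n l s f \<Longrightarrow> s \<le> t \<Longrightarrow> poly_deg m n l t f"

lemma poly_deg_polynomial: "poly_deg m n l t f \<Longrightarrow> f \<in> polynomial_functions m n l"
proof (induction rule: poly_deg.induct)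
  case (add t f g)
  show ?case by (rule polynomial_functions.add[OF add.IH])
next
  case (mult s f t g)
  show ?case by (rule polynomial_functions.mult[OF mult.IH])
qed (simp_all only: polynomial_functions.const polynomial_functions.coord_A
    polynomial_functions.coord_B polynomial_functions.coord_C)

lemma polynomial_poly_deg: "f \<in> polynomial_functions m n l \<Longrightarrow> \<exists>t. poly_deg m n l t f"
proof (induction rule: polynomial_functions.induct)
  case (const a)
  show ?case by (rule exI, rule poly_deg.const)
next
  case (coord_A p q)
  then show ?case by (intro exI, rule poly_deg.coord_A)
next
  case (coord_B p q)
  then show ?case by (intro exI, rule poly_deg.coord_B)
next
  case (coord_C p q)
  then show ?case by (intro exI, rule poly_deg.coord_C)
next
  case (add f g)
  then obtain s t where st: "poly_deg m n l s f" "poly_deg m n l t g" by (elim exE)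
  show ?case
    by (rule exI, rule poly_deg.add[OF poly_deg.mono[OF st(1)] poly_deg.mono[OF st(2)], of "max s t"]) auto
next
  case (mult f g)
  then obtain s t where st: "poly_deg m n l s f" "poly_deg m n l t g" by (elim exE)
  show ?case by (rule exI, rule poly_deg.mult[OF st])
qed

lemma poly_deg_sum:
  fixes N :: nat
  assumes "\<And>i. i < N \<Longrightarrow> poly_deg m n l t (F i)"
  shows "poly_deg m n l t (\<lambda>S. \<Sum>i<N. c i * F i S)"
  using assms
proof (induction N)
  case 0
  show ?case unfolding lessThan_0 sum.empty by (rule poly_deg.mono[OF poly_deg.const]) simp
next
  case (Suc N)
  have "poly_deg m n l t (\<lambda>S. c N * F N S)"
    using poly_deg.mult[OF poly_deg.const Suc.prems[of N], of "c N"] by simp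
  moreover have "poly_deg m n l t (\<lambda>S. \<Sum>i<N. c i * F i S)"
    by (rule Suc.IH, rule Suc.prems) simp
  ultimately show ?case unfolding sum.lessThan_Suc by (rule poly_deg.add[rotated])
qed

lemma sum_lessThan_add:
  fixes g :: "nat \<Rightarrow> 'a::comm_monoid_add"
  shows "(\<Sum>i<M + N. g i) = (\<Sum>i<M. g i) + (\<Sum>i<N. g (M + i))"
  by (induction N) (simp_all add: add.assoc)

text \<open>Linear independence modulo the functions vanishing on \<open>Z\<close>. With degrees
  bounded, the size of such a family is a lower bound for the Hilbert function of
  \<open>Z\<close>.\<close>

definition indep_on :: "'x set \<Rightarrow> nat \<Rightarrow> (nat \<Rightarrow> 'x \<Rightarrow> complex) \<Rightarrow> bool" where
  "indep_on Z N F \<longleftrightarrow> (\<forall>c. (\<forall>x\<in>Z. (\<Sum>i<N. c i * F i x) = 0) \<longrightarrow> (\<forall>i<N. c i = 0))"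

lemma indep_on_one: "Z \<noteq> {} \<Longrightarrow> indep_on Z 1 (\<lambda>i S. 1)"
  by (auto simp: indep_on_def)

text \<open>Multiplication by a function vanishing on \<open>Y\<close> but not on \<open>Z\<close> is injective on the functions on
  the irreducible set \<open>Z\<close>, and the products are independent of lifts of functions from \<open>Y\<close>.\<close>

lemma indep_on_append:
  assumes Z: "Z \<subseteq> systems m n l" "irreducible_space (subtopology (zariski_topology m n l) Z)"
    and YZ: "Y \<subseteq> Z" and f: "poly_deg m n l e f" "\<forall>x\<in>Y. f x = 0" "z \<in> Z" "f z \<noteq> 0"
    and F: "indep_on Y M F" "\<And>i. i < M \<Longrightarrow> poly_deg m n l t (F i)"
    and G: "indep_on Z N G" "\<And>i. i < N \<Longrightarrow> poly_deg m n l t' (G i)" and t: "t' + e \<le> t"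
  shows "\<exists>H. indep_on Z (M + N) H \<and> (\<forall>i<M + N. poly_deg m n l t (H i))"
proof (intro exI conjI)
  define H where "H i = (if i < M then F i else (\<lambda>S. G (i - M) S * f S))" for i
  show "\<forall>i<M + N. poly_deg m n l t (H i)"
  proof (intro allI impI)
    fix i assume "i < M + N"
    show "poly_deg m n l t (H i)"
    proof (cases "i < M")
      case False
      then have "i - M < N" using \<open>i < M + N\<close> by simp
      then have "poly_deg m n l (t' + e) (H i)"
        using poly_deg.mult[OF G(2) f(1), of "i - M"] False by (simp add: H_def)
      then show ?thesis using t by (rule poly_deg.mono)
    qed (simp add: H_def F)
  qed
  show "indep_on Z (M + N) H"
    unfolding indep_on_def
  proof (intro allI impI)
    fix c i assume c: "\<forall>x\<in>Z. (\<Sum>i<M + N. c i * H i x) = 0" and i: "i < M + N"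
    have split: "(\<Sum>i<M + N. c i * H i x) = (\<Sum>i<M. c i * F i x) + (\<Sum>i<N. c (M + i) * G i x) * f x" for x
    proof -
      have "(\<Sum>i<M + N. c i * H i x) = (\<Sum>i<M. c i * H i x) + (\<Sum>i<N. c (M + i) * H (M + i) x)"
        by (rule sum_lessThan_add)
      also have "\<dots> = (\<Sum>i<M. c i * F i x) + (\<Sum>i<N. c (M + i) * G i x) * f x"
        by (simp add: H_def sum_distrib_right mult.assoc)
      finally show ?thesis .
    qed
    have "\<forall>x\<in>Y. (\<Sum>i<M. c i * F i x) = 0"
    proof
      fix x assume "x \<in> Y"
      then have "x \<in> Z" "f x = 0" using YZ f(2) by auto
      then show "(\<Sum>i<M. c i * F i x) = 0" using c unfolding split by fastforce
    qed
    then have cF: "\<forall>i<M. c i = 0" using F(1)[unfolded indep_on_def, THEN spec[of _ c]] by blast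
    then have "\<forall>x\<in>Z. (\<Sum>i<N. c (M + i) * G i x) * f x = 0"
      using c unfolding split by auto
    moreover have "(\<lambda>x. \<Sum>i<N. c (M + i) * G i x) \<in> polynomial_functions m n l"
      by (rule poly_deg_polynomial[OF poly_deg_sum[OF G(2)]])
    ultimately have "(\<forall>x\<in>Z. (\<Sum>i<N. c (M + i) * G i x) = 0) \<or> (\<forall>x\<in>Z. f x = 0)"
      using iffD1[OF irreducible_zariski_iff[OF Z(1)] Z(2), THEN conjunct2, rule_format,
          OF _ poly_deg_polynomial[OF f(1)], of "\<lambda>x. \<Sum>i<N. c (M + i) * G i x"] by simp
    then have "\<forall>x\<in>Z. (\<Sum>i<N. c (M + i) * G i x) = 0"
      using f(3,4) by auto
    then have cG: "\<forall>i<N. c (M + i) = 0" using G(1)[unfolded indep_on_def, THEN spec[of _ "\<lambda>i. c (M + i)"]] by simp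
    show "c i = 0"
    proof (cases "i < M")
      case False
      then show ?thesis using cG[rule_format, of "i - M"] i by simp
    qed (use cF in simp)
  qed
qed

text \<open>The binomial coefficients come from Pascal's rule. On \<open>Z (Suc i)\<close> in degree
  \<open>e * Suc s\<close>, one takes the family found on \<open>Z i\<close> in that degree, and the
  family on \<open>Z (Suc i)\<close> in degree \<open>e * s\<close> multiplied by a polynomial of
  degree at most \<open>e\<close> that vanishes on \<open>Z i\<close> but not on
  \<open>Z (Suc i)\<close>.\<close>

lemma chain_growth:
  assumes E: "E \<subseteq> systems m n l"
    and Z: "\<And>i. i \<le> k \<Longrightarrow> closedin (subtopology (zariski_topology m n l) E) (Z i)"
    and irr: "\<And>i. i \<le> k \<Longrightarrow> irreducible_space (subtopology (zariski_topology m n l) (Z i))"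
    and strict: "\<And>i. i < k \<Longrightarrow> Z i \<subset> Z (Suc i)"
  shows "\<exists>e. \<forall>s. \<exists>F. indep_on E ((s + k) choose k) F \<and> (\<forall>i<(s + k) choose k. poly_deg m n l (e * s) (F i))"
proof -
  have ZE: "Z i \<subseteq> E" if "i \<le> k" for i
    using Z[OF that] by (auto simp: closedin_zariski_subtopology[OF E])
  have Zs: "Z i \<subseteq> systems m n l" if "i \<le> k" for i using ZE[OF that] E by blast
  have "\<exists>t f. poly_deg m n l t f \<and> (\<forall>x\<in>Z i. f x = 0) \<and> (\<exists>z\<in>Z (Suc i). f z \<noteq> 0)" if i: "i < k" for i
  proof -
    obtain z where z: "z \<in> Z (Suc i)" "z \<notin> Z i" using strict[OF i] by blast
    then have "z \<in> E - Z i" using ZE[of "Suc i"] i by auto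
    moreover have "closedin (subtopology (zariski_topology m n l) E) (Z i)" using Z[of i] i by simp
    ultimately obtain f where f: "f \<in> polynomial_functions m n l" "\<forall>x\<in>Z i. f x = 0" "f z \<noteq> 0"
      using zariski_separate[OF E] by metis
    obtain t where "poly_deg m n l t f" using polynomial_poly_deg[OF f(1)] by blast
    then show ?thesis using z(1) f(2,3) by (intro exI[of _ t] exI[of _ f]) auto
  qed
  then have "\<forall>i. \<exists>t. i < k \<longrightarrow> (\<exists>f. poly_deg m n l t f \<and> (\<forall>x\<in>Z i. f x = 0) \<and> (\<exists>z\<in>Z (Suc i). f z \<noteq> 0))"
    by simp
  from choice[OF this] obtain t where t: "\<forall>i. i < k \<longrightarrow> (\<exists>f. poly_deg m n l (t i) f \<and> (\<forall>x\<in>Z i. f x = 0) \<and> (\<exists>z\<in>Z (Suc i). f z \<noteq> 0))"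
    by (elim exE)
  \<comment> \<open>One degree bound for the separating polynomials of all \<open>k\<close>
    inclusions at once.\<close>
  define e where "e = (\<Sum>i<k. t i)"
  have f: "\<exists>f z. poly_deg m n l e f \<and> (\<forall>x\<in>Z i. f x = 0) \<and> z\<in>Z (Suc i) \<and> f z \<noteq> 0" if i: "i < k" for i
  proof -
    have "t i \<le> e" using i member_le_sum[of i "{..<k}" t] by (simp add: e_def)
    obtain f where f: "poly_deg m n l (t i) f" "\<forall>x\<in>Z i. f x = 0" "\<exists>z\<in>Z (Suc i). f z \<noteq> 0"
      using t[rule_format, OF i] by (elim exE conjE) (rule that)
    show ?thesis using f(2,3) poly_deg.mono[OF f(1) \<open>t i \<le> e\<close>] by (intro exI[of _ f]) auto
  qed
  have nonempty: "Z i \<noteq> {}" if "i \<le> k" for i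
    using irr[OF that] irreducible_zariski_iff[OF Zs[OF that]] by blast
  have one: "\<exists>F. indep_on (Z i) 1 F \<and> (\<forall>j<1. poly_deg m n l t (F j))" if "i \<le> k" for i t
    using indep_on_one[OF nonempty[OF that]] poly_deg.mono[OF poly_deg.const[of m n l 1] le0[of t]]
    by (intro exI[of _ "\<lambda>i S. 1"]) simp
  \<comment> \<open>Double induction: on the place in the chain, and inside it on the degree, as
    Pascal's rule requires.\<close>
  have "i \<le> k \<Longrightarrow> \<exists>F. indep_on (Z i) ((s + i) choose i) F \<and> (\<forall>j<(s + i) choose i. poly_deg m n l (e * s) (F j))" for i s
  proof (induction i arbitrary: s)
    case 0
    then show ?case using one[of 0 "e * s"] by simp
  next
    case outer: (Suc i)
    show ?case
    proof (induction s)
      case 0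
      show ?case using one[OF outer(2), of "e * 0"] by (simp only: add_0 binomial_n_n)
    next
      case (Suc s)
      from outer(1)[OF Suc_leD[OF outer(2)], of "Suc s"]
      obtain F where F: "indep_on (Z i) ((Suc s + i) choose i) F"
        "\<forall>j<(Suc s + i) choose i. poly_deg m n l (e * Suc s) (F j)"
        by (elim exE conjE) (rule that)
      from Suc.IH
      obtain G where G: "indep_on (Z (Suc i)) ((s + Suc i) choose Suc i) G"
        "\<forall>j<(s + Suc i) choose Suc i. poly_deg m n l (e * s) (G j)"
        by (elim exE conjE) (rule that)
      have ik: "i < k" using outer(2) by simp
      obtain f z where f: "poly_deg m n l e f" "\<forall>x\<in>Z i. f x = 0" "z \<in> Z (Suc i)" "f z \<noteq> 0"
        using f[OF ik] by (elim exE conjE) (rule that)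
      have Zi: "Z i \<subseteq> Z (Suc i)" using strict[OF ik] by blast
      have eq: "(Suc s + i choose i) + (s + Suc i choose Suc i) = Suc s + Suc i choose Suc i" by simp
      have "e * s + e \<le> e * Suc s" by simp
      from indep_on_append[OF Zs[OF outer(2)] irr[OF outer(2)] Zi f F(1) F(2)[rule_format] G(1) G(2)[rule_format] this]
      show ?case unfolding eq .
    qed
  qed
  then have ex: "\<exists>F. indep_on (Z k) ((s + k) choose k) F \<and> (\<forall>j<(s + k) choose k. poly_deg m n l (e * s) (F j))" for s
    by blast
  have mono: "indep_on E N F" if "indep_on (Z k) N F" for N F
    unfolding indep_on_def
  proof (intro allI impI)
    fix c :: "nat \<Rightarrow> complex" and i
    assume "\<forall>x\<in>E. (\<Sum>i<N. c i * F i x) = 0" "i < N"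
    then show "c i = 0"
      using ZE[of k] that[unfolded indep_on_def, THEN spec[of _ c]] by blast
  qed
  show ?thesis
  proof (intro exI[of _ e] allI)
    fix s
    from ex[of s] obtain F where "indep_on (Z k) ((s + k) choose k) F"
      "\<forall>j<(s + k) choose k. poly_deg m n l (e * s) (F j)"
      by (elim exE conjE) (rule that)
    then show "\<exists>F. indep_on E ((s + k) choose k) F \<and> (\<forall>i<(s + k) choose k. poly_deg m n l (e * s) (F i))"
      using mono by (intro exI[of _ F] conjI)
  qed
qed

section \<open>Filtered algebras of functions\<close>

text \<open>Determinants and adjugates have to be followed through several kinds of dependence. The
  instances are polynomials in \<open>d\<close> variables with a degree bound, and, with the trivial
  filtration, polynomials in one variable and polynomial functions of a system.\<close>

locale filtered_functions =
  fixes A :: "nat \<Rightarrow> ('x \<Rightarrow> complex) \<Rightarrow> bool"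
  assumes const: "A t (\<lambda>_. c)"
    and mono: "A s f \<Longrightarrow> s \<le> t \<Longrightarrow> A t f"
    and add: "A t f \<Longrightarrow> A t g \<Longrightarrow> A t (\<lambda>x. f x + g x)"
    and mult: "A s f \<Longrightarrow> A t g \<Longrightarrow> A (s + t) (\<lambda>x. f x * g x)"
begin

lemma scale: "A t f \<Longrightarrow> A t (\<lambda>x. c * f x)"
  using mult[OF const[of 0 c]] by simp

lemma sum:
  assumes "\<And>i. i \<in> I \<Longrightarrow> A t (F i)"
  shows "A t (\<lambda>x. \<Sum>i\<in>I. F i x)"
proof (cases "finite I")
  case True
  then show ?thesis using assms
  proof (induction rule: finite_induct)
    case empty
    show ?case unfolding sum.empty by (rule const)
  next
    case (insert i I)
    have 1: "A t (F i)" by (rule insert.prems) simp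
    have 2: "A t (\<lambda>x. \<Sum>i\<in>I. F i x)" by (rule insert.IH, rule insert.prems) simp
    show ?case unfolding sum.insert[OF insert.hyps] by (rule add[OF 1 2])
  qed
next
  case False
  show ?thesis unfolding sum.infinite[OF False] by (rule const)
qed

lemma prod:
  assumes "finite I" "\<And>i. i \<in> I \<Longrightarrow> A 1 (F i)"
  shows "A (card I) (\<lambda>x. \<Prod>i\<in>I. F i x)"
  using assms
proof (induction rule: finite_induct)
  case empty
  show ?case unfolding prod.empty by (rule const)
next
  case (insert i I)
  have 1: "A 1 (F i)" by (rule insert.prems) simp
  have 2: "A (card I) (\<lambda>x. \<Prod>i\<in>I. F i x)" by (rule insert.IH, rule insert.prems) simp
  show ?case using mult[OF 1 2] unfolding prod.insert[OF insert.hyps] card_insert_disjoint[OF insert.hyps]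
    by simp
qed

lemma det:
  assumes "\<And>x. M x \<in> carrier_mat k k" "\<And>p q. p < k \<Longrightarrow> q < k \<Longrightarrow> A 1 (\<lambda>x. M x $$ (p, q))"
  shows "A k (\<lambda>x. Determinant.det (M x))"
  unfolding det_def'[OF assms(1)]
proof (rule sum, rule scale)
  fix \<pi> assume "\<pi> \<in> {\<pi>. \<pi> permutes {0..<k}}"
  then have "\<pi> i < k" if "i < k" for i using that permutes_in_image[of \<pi> "{0..<k}" i] by simp
  then have "A (card {0..<k}) (\<lambda>x. \<Prod>i = 0..<k. M x $$ (i, \<pi> i))"
    by (intro prod assms(2)) auto
  then show "A k (\<lambda>x. \<Prod>i = 0..<k. M x $$ (i, \<pi> i))" by simp
qed

text \<open>Cofactors are determinants of size \<open>k - 1\<close>; the bound is rounded up to that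
  of the full determinant.\<close>

lemma adj:
  assumes M: "\<And>x. M x \<in> carrier_mat k k" and M1: "\<And>p q. p < k \<Longrightarrow> q < k \<Longrightarrow> A 1 (\<lambda>x. M x $$ (p, q))"
    and pq: "p < k" "q < k"
  shows "A k (\<lambda>x. adj_mat (M x) $$ (p, q))"
proof -
  have d: "dim_row (M x) = k" "dim_col (M x) = k" for x using M[of x] by auto
  have eq: "adj_mat (M x) $$ (p, q) = (-1)^(q + p) * Determinant.det (mat_delete (M x) q p)" for x
    using pq by (simp add: adj_mat_def d cofactor_def)
  have "A (k - 1) (\<lambda>x. Determinant.det (mat_delete (M x) q p))"
  proof (rule det)
    show "mat_delete (M x) q p \<in> carrier_mat (k - 1) (k - 1)" for x
      using mat_delete_carrier[OF M] .
    fix i j assume ij: "i < k - 1" "j < k - 1"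
    have "mat_delete (M x) q p $$ (i, j) = M x $$ (if i < q then i else Suc i, if j < p then j else Suc j)" for x
      using ij by (simp add: mat_delete_def d)
    moreover have "A 1 (\<lambda>x. M x $$ (if i < q then i else Suc i, if j < p then j else Suc j))"
      by (rule M1) (use ij in auto)
    ultimately show "A 1 (\<lambda>x. mat_delete (M x) q p $$ (i, j))" by (simp only:)
  qed
  then have "A k (\<lambda>x. Determinant.det (mat_delete (M x) q p))" by (rule mono) simp
  then show ?thesis unfolding eq by (rule scale)
qed

end

text \<open>\<open>mat_inverse\<close> is defined by elimination. Uniqueness of inverses identifies
  its value with the adjugate over the determinant, whose dependence on the entries is visibly
  rational.\<close>

lemma inv_mat_eq:
  fixes Q :: "complex mat"
  assumes Q: "Q \<in> carrier_mat k k" and det: "det Q \<noteq> 0"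
  shows "inv_mat Q = (1 / det Q) \<cdot>\<^sub>m adj_mat Q" "Q * inv_mat Q = 1\<^sub>m k" "inv_mat Q * Q = 1\<^sub>m k"
    "inv_mat Q \<in> carrier_mat k k"
proof -
  let ?B = "(1 / det Q) \<cdot>\<^sub>m adj_mat Q"
  have B: "?B \<in> carrier_mat k k" using adj_mat(1)[OF Q] by simp
  have QB: "Q * ?B = 1\<^sub>m k" "?B * Q = 1\<^sub>m k"
    unfolding mult_smult_distrib[OF Q adj_mat(1)[OF Q]] mult_smult_assoc_mat[OF adj_mat(1)[OF Q] Q] adj_mat(2,3)[OF Q]
    using det by (auto intro!: eq_matI)
  have "Q \<in> Units (ring_mat TYPE(complex) k ())"
    by (rule det_non_zero_imp_unit[OF Q det])
  then obtain C where C: "mat_inverse Q = Some C" using mat_inverse(1)[OF Q, of "()"] by (cases "mat_inverse Q") auto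
  note C' = mat_inverse(2)[OF Q C]
  have Cc: "C \<in> carrier_mat k k" and CQ: "C * Q = 1\<^sub>m k" using C' by auto
  have "C = C * (Q * ?B)" unfolding QB(1) right_mult_one_mat[OF Cc] ..
  also have "\<dots> = (C * Q) * ?B" by (rule assoc_mult_mat[OF Cc Q B, symmetric])
  also have "\<dots> = ?B" unfolding CQ by (rule left_mult_one_mat[OF B])
  finally have "inv_mat Q = ?B" using C by simp
  with QB B show "inv_mat Q = (1 / det Q) \<cdot>\<^sub>m adj_mat Q" "Q * inv_mat Q = 1\<^sub>m k" "inv_mat Q * Q = 1\<^sub>m k"
    "inv_mat Q \<in> carrier_mat k k" by simp_all
qed

lemma invertible_mat_iff_det:
  fixes Q :: "complex mat"
  assumes Q: "Q \<in> carrier_mat k k"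
  shows "invertible_mat Q \<longleftrightarrow> det Q \<noteq> 0"
proof
  assume "invertible_mat Q"
  then obtain B where B: "Q * B = 1\<^sub>m (dim_row Q)" "B * Q = 1\<^sub>m (dim_row B)"
    unfolding invertible_mat_def inverts_mat_def by blast
  have "dim_col B = k" using arg_cong[OF B(1), of dim_col] Q by simp
  moreover have "dim_row B = k" using arg_cong[OF B(2), of dim_col] Q by simp
  ultimately have "B \<in> carrier_mat k k" by auto
  then have "det Q * det B = 1" using B(1) Q by (metis carrier_matD(1) det_mult det_one)
  then show "det Q \<noteq> 0" by auto
next
  assume "det Q \<noteq> 0"
  note inv_mat_eq[OF Q this]
  then show "invertible_mat Q" using Q unfolding invertible_mat_def inverts_mat_def
    by (intro conjI exI[of _ "inv_mat Q"]) auto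
qed

lemma conj_entry:
  fixes P N Q :: "complex mat"
  assumes "P \<in> carrier_mat k k" "N \<in> carrier_mat k k'" "Q \<in> carrier_mat k' k'" "det Q \<noteq> 0" "p < k" "q < k'"
  shows "(P * N * inv_mat Q) $$ (p, q) * det Q = (\<Sum>b<k'. \<Sum>a<k. P $$ (p, a) * N $$ (a, b) * adj_mat Q $$ (b, q))"
proof -
  note i = inv_mat_eq[OF assms(3,4)]
  have "(P * N * inv_mat Q) $$ (p, q) = (\<Sum>b<k'. \<Sum>a<k. P $$ (p, a) * N $$ (a, b) * adj_mat Q $$ (b, q)) / det Q"
    using assms adj_mat(1)[OF assms(3)] unfolding i(1)
    by (simp add: scalar_prod_def sum_distrib_right sum_divide_distrib atLeast0LessThan)
  then show ?thesis using assms(4) by simp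
qed

section \<open>The action of triples in coordinates, cleared of denominators\<close>

definition dim_of :: "nat \<Rightarrow> nat \<Rightarrow> nat \<Rightarrow> space \<Rightarrow> nat" where
  "dim_of m n l sp = (case sp of Input \<Rightarrow> m | State \<Rightarrow> n | Output \<Rightarrow> l)"

lemma dim_of_simps [simp]: "dim_of m n l Input = m" "dim_of m n l State = n" "dim_of m n l Output = l"
  by (simp_all add: dim_of_def)

definition sq :: "nat \<Rightarrow> fmat \<Rightarrow> complex mat" where
  "sq k X = mat k k (\<lambda>(p, q). X p q)"

lemma sq_simps [simp]: "sq k X \<in> carrier_mat k k" "p < k \<Longrightarrow> q < k \<Longrightarrow> sq k X $$ (p, q) = X p q"
  "dim_row (sq k X) = k" "dim_col (sq k X) = k"
  by (simp_all add: sq_def)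

definition triple :: "nat \<Rightarrow> nat \<Rightarrow> nat \<Rightarrow> tri \<Rightarrow> mat_triple" where
  "triple m n l v = (sq m (v Input), sq n (v State), sq l (v Output))"

text \<open>One polynomial that is nonzero exactly at the invertible triples; it serves as the
  common denominator of the action.\<close>

definition disc :: "nat \<Rightarrow> nat \<Rightarrow> nat \<Rightarrow> tri \<Rightarrow> complex" where
  "disc m n l v = det (sq m (v Input)) * det (sq n (v State)) * det (sq l (v Output))"

lemma triple_GL_iff: "triple m n l v \<in> GL_triples m n l \<longleftrightarrow> disc m n l v \<noteq> 0"
  by (simp add: triple_def GL_triples_def square_triples_def disc_def invertible_mat_iff_det[OF sq_simps(1)])

context filtered_functions
begin

text \<open>The degree \<open>Suc (m + n + l)\<close> is made up of 1 for the left factor, the size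
  of the right factor for its adjugate, and the two other determinants, which complete the
  denominator to \<open>disc\<close>.\<close>

lemma act_coord:
  assumes T: "\<And>sp p q. p < dim_of m n l sp \<Longrightarrow> q < dim_of m n l sp \<Longrightarrow> A 1 (\<lambda>x. T x sp p q)"
    and S: "S \<in> systems m n l"
    and pq: "p < dim_of m n l (row_space N)" "q < dim_of m n l (col_space N)"
  shows "\<exists>g. A (Suc (m + n + l)) g \<and> (\<forall>x. disc m n l (T x) \<noteq> 0 \<longrightarrow>
     component_mat N (act (triple m n l (T x)) S) $$ (p, q) * disc m n l (T x) = g x)"
proof -
  obtain SA SB SC where S': "S = (SA, SB, SC)" by (cases S)
  have SA: "SA \<in> carrier_mat n n" and SB: "SB \<in> carrier_mat n m" and SC: "SC \<in> carrier_mat l n"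
    using S by (auto simp: S' systems_def)
  have T1: "A 1 (\<lambda>x. sq (dim_of m n l sp) (T x sp) $$ (p, q))" if "p < dim_of m n l sp" "q < dim_of m n l sp" for sp p q
    using T[OF that] that by simp
  have dA: "A (dim_of m n l sp) (\<lambda>x. Determinant.det (sq (dim_of m n l sp) (T x sp)))" for sp
    by (rule det[OF sq_simps(1) T1])
  have aA: "A (dim_of m n l sp) (\<lambda>x. adj_mat (sq (dim_of m n l sp) (T x sp)) $$ (p, q))"
    if "p < dim_of m n l sp" "q < dim_of m n l sp" for sp p q
    by (rule adj[OF sq_simps(1) T1 that])
  have *: "A (1 + dim_of m n l sp') (\<lambda>x. \<Sum>b<dim_of m n l sp'. \<Sum>a<dim_of m n l sp.
      sq (dim_of m n l sp) (T x sp) $$ (p, a) * N $$ (a, b) * adj_mat (sq (dim_of m n l sp') (T x sp')) $$ (b, q))"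
    if "p < dim_of m n l sp" "q < dim_of m n l sp'" for sp sp' p q and N :: "complex mat"
  proof (intro sum mult)
    fix a b assume "b \<in> {..<dim_of m n l sp'}" "a \<in> {..<dim_of m n l sp}"
    then show "A 1 (\<lambda>x. sq (dim_of m n l sp) (T x sp) $$ (p, a) * N $$ (a, b))"
      "A (dim_of m n l sp') (\<lambda>x. adj_mat (sq (dim_of m n l sp') (T x sp')) $$ (b, q))"
      using mult[OF T1[OF that(1), of a] const[of 0]] aA that(2) by auto
  qed
  show ?thesis
  proof (cases N)
    case Comp_A
    let ?g = "\<lambda>x. (\<Sum>b<n. \<Sum>a<n. sq n (T x State) $$ (p, a) * SA $$ (a, b) * adj_mat (sq n (T x State)) $$ (b, q))
      * (Determinant.det (sq m (T x Input)) * Determinant.det (sq l (T x Output)))"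
    have "A (Suc (m + n + l)) ?g"
      by (rule mono[OF mult[OF *[of p State q State] mult[OF dA[of Input] dA[of Output]], unfolded dim_of_simps]])
         (use pq in \<open>simp_all add: Comp_A\<close>)
    moreover have "component_mat N (act (triple m n l (T x)) S) $$ (p, q) * disc m n l (T x) = ?g x"
      if "disc m n l (T x) \<noteq> 0" for x
      using conj_entry[of "sq n (T x State)" n SA n "sq n (T x State)" p q] pq SA that
      by (simp add: Comp_A S' triple_def disc_def mult_ac del: sq_simps(2))
    ultimately show ?thesis by (intro exI[of _ ?g]) simp
  next
    case Comp_B
    let ?g = "\<lambda>x. (\<Sum>b<m. \<Sum>a<n. sq n (T x State) $$ (p, a) * SB $$ (a, b) * adj_mat (sq m (T x Input)) $$ (b, q))
      * (Determinant.det (sq n (T x State)) * Determinant.det (sq l (T x Output)))"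
    have "A (Suc (m + n + l)) ?g"
      by (rule mono[OF mult[OF *[of p State q Input] mult[OF dA[of State] dA[of Output]], unfolded dim_of_simps]])
         (use pq in \<open>simp_all add: Comp_B\<close>)
    moreover have "component_mat N (act (triple m n l (T x)) S) $$ (p, q) * disc m n l (T x) = ?g x"
      if "disc m n l (T x) \<noteq> 0" for x
      using conj_entry[of "sq n (T x State)" n SB m "sq m (T x Input)" p q] pq SB that
      by (simp add: Comp_B S' triple_def disc_def mult_ac del: sq_simps(2))
    ultimately show ?thesis by (intro exI[of _ ?g]) simp
  next
    case Comp_C
    let ?g = "\<lambda>x. (\<Sum>b<n. \<Sum>a<l. sq l (T x Output) $$ (p, a) * SC $$ (a, b) * adj_mat (sq n (T x State)) $$ (b, q))
      * (Determinant.det (sq m (T x Input)) * Determinant.det (sq l (T x Output)))"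
    have "A (Suc (m + n + l)) ?g"
      by (rule mono[OF mult[OF *[of p Output q State] mult[OF dA[of Input] dA[of Output]], unfolded dim_of_simps]])
         (use pq in \<open>simp_all add: Comp_C\<close>)
    moreover have "component_mat N (act (triple m n l (T x)) S) $$ (p, q) * disc m n l (T x) = ?g x"
      if "disc m n l (T x) \<noteq> 0" for x
      using conj_entry[of "sq l (T x Output)" l SC n "sq n (T x State)" p q] pq SC that
      by (simp add: Comp_C S' triple_def disc_def mult_ac del: sq_simps(2))
    ultimately show ?thesis by (intro exI[of _ ?g]) simp
  qed
qed

lemma disc_filtered:
  assumes T: "\<And>sp p q. p < dim_of m n l sp \<Longrightarrow> q < dim_of m n l sp \<Longrightarrow> A 1 (\<lambda>x. T x sp p q)"
  shows "A (m + n + l) (\<lambda>x. disc m n l (T x))"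
proof -
  have "A (dim_of m n l sp) (\<lambda>x. Determinant.det (sq (dim_of m n l sp) (T x sp)))" for sp
  proof (rule det[OF sq_simps(1)])
    fix p q assume "p < dim_of m n l sp" "q < dim_of m n l sp"
    then show "A 1 (\<lambda>x. sq (dim_of m n l sp) (T x sp) $$ (p, q))" using T[of p sp q] by simp
  qed
  from mult[OF mult[OF this[of Input] this[of State]] this[of Output]]
  show ?thesis by (simp add: disc_def)
qed

text \<open>A polynomial on systems pulls back along a family of triples to a rational function with
  a power of \<open>disc\<close> as denominator. Raising a degree bound from \<open>s\<close> to
  \<open>t\<close> costs the factor \<open>disc ^ (t - s)\<close>, of degree
  \<open>(m + n + l) * (t - s)\<close>, which the claimed bound leaves room for.\<close>

lemma act_polynomial:
  assumes T: "\<And>sp p q. p < dim_of m n l sp \<Longrightarrow> q < dim_of m n l sp \<Longrightarrow> A 1 (\<lambda>x. T x sp p q)"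
    and S: "S \<in> systems m n l"
    and f: "poly_deg m n l t f"
  shows "\<exists>g. A (Suc (m + n + l) * t) g \<and> (\<forall>x. disc m n l (T x) \<noteq> 0 \<longrightarrow>
     f (act (triple m n l (T x)) S) * disc m n l (T x) ^ t = g x)"
  using f
proof (induction rule: poly_deg.induct)
  case (const a)
  show ?case
    by (intro exI[of _ "\<lambda>_. a"] conjI filtered_functions.const[OF filtered_functions_axioms] allI impI) simp
next
  case (coord_A p q)
  show ?case unfolding mult_1_right power_one_right
    by (rule act_coord[where T = T, OF T S]; (assumption | simp add: coord_A))
next
  case (coord_B p q)
  show ?case unfolding mult_1_right power_one_right
    by (rule act_coord[where T = T, OF T S]; (assumption | simp add: coord_B))
next
  case (coord_C p q)
  show ?case unfolding mult_1_right power_one_right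
    by (rule act_coord[where T = T, OF T S]; (assumption | simp add: coord_C))
next
  case (add t f g)
  from add.IH(1) obtain f' where f': "A (Suc (m + n + l) * t) f'" "\<forall>x. disc m n l (T x) \<noteq> 0 \<longrightarrow>
     f (act (triple m n l (T x)) S) * disc m n l (T x) ^ t = f' x" by (elim exE conjE) (rule that)
  from add.IH(2) obtain g' where g': "A (Suc (m + n + l) * t) g'" "\<forall>x. disc m n l (T x) \<noteq> 0 \<longrightarrow>
     g (act (triple m n l (T x)) S) * disc m n l (T x) ^ t = g' x" by (elim exE conjE) (rule that)
  have "\<forall>x. disc m n l (T x) \<noteq> 0 \<longrightarrow> (f (act (triple m n l (T x)) S) + g (act (triple m n l (T x)) S)) *
      disc m n l (T x) ^ t = f' x + g' x"
  proof (intro allI impI)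
    fix x assume x: "disc m n l (T x) \<noteq> 0"
    show "(f (act (triple m n l (T x)) S) + g (act (triple m n l (T x)) S)) *
      disc m n l (T x) ^ t = f' x + g' x"
      unfolding f'(2)[rule_format, OF x, symmetric] g'(2)[rule_format, OF x, symmetric]
      by (rule distrib_right)
  qed
  moreover have "A (Suc (m + n + l) * t) (\<lambda>x. f' x + g' x)"
    using f'(1) g'(1) by (rule filtered_functions.add[OF filtered_functions_axioms])
  ultimately have "A (Suc (m + n + l) * t) (\<lambda>x. f' x + g' x) \<and> (\<forall>x. disc m n l (T x) \<noteq> 0 \<longrightarrow>
      (f (act (triple m n l (T x)) S) + g (act (triple m n l (T x)) S)) *
      disc m n l (T x) ^ t = f' x + g' x)" by (rule conjI[rotated])
  then show ?case by (rule exI[where x = "\<lambda>x. f' x + g' x"])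
next
  case (mult s f t g)
  from mult.IH(1) obtain f' where f': "A (Suc (m + n + l) * s) f'" "\<forall>x. disc m n l (T x) \<noteq> 0 \<longrightarrow>
     f (act (triple m n l (T x)) S) * disc m n l (T x) ^ s = f' x" by (elim exE conjE) (rule that)
  from mult.IH(2) obtain g' where g': "A (Suc (m + n + l) * t) g'" "\<forall>x. disc m n l (T x) \<noteq> 0 \<longrightarrow>
     g (act (triple m n l (T x)) S) * disc m n l (T x) ^ t = g' x" by (elim exE conjE) (rule that)
  have "\<forall>x. disc m n l (T x) \<noteq> 0 \<longrightarrow> f (act (triple m n l (T x)) S) * g (act (triple m n l (T x)) S) *
      disc m n l (T x) ^ (s + t) = f' x * g' x"
  proof (intro allI impI)
    fix x assume x: "disc m n l (T x) \<noteq> 0"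
    show "f (act (triple m n l (T x)) S) * g (act (triple m n l (T x)) S) *
      disc m n l (T x) ^ (s + t) = f' x * g' x"
      unfolding f'(2)[rule_format, OF x, symmetric] g'(2)[rule_format, OF x, symmetric]
      by (simp add: power_add mult_ac)
  qed
  moreover have "A (Suc (m + n + l) * (s + t)) (\<lambda>x. f' x * g' x)"
    unfolding distrib_left using f'(1) g'(1) by (rule filtered_functions.mult[OF filtered_functions_axioms])
  ultimately have "A (Suc (m + n + l) * (s + t)) (\<lambda>x. f' x * g' x) \<and> (\<forall>x. disc m n l (T x) \<noteq> 0 \<longrightarrow>
      f (act (triple m n l (T x)) S) * g (act (triple m n l (T x)) S) *
      disc m n l (T x) ^ (s + t) = f' x * g' x)" by (rule conjI[rotated])
  then show ?case by (rule exI[where x = "\<lambda>x. f' x * g' x"])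
next
  case (mono s f t)
  from mono.IH obtain f' where f': "A (Suc (m + n + l) * s) f'" "\<forall>x. disc m n l (T x) \<noteq> 0 \<longrightarrow>
     f (act (triple m n l (T x)) S) * disc m n l (T x) ^ s = f' x" by (elim exE conjE) (rule that)
  have pow: "A ((m + n + l) * k) (\<lambda>x. disc m n l (T x) ^ k)" for k
  proof (induction k)
    case 0
    show ?case unfolding power_0 by (rule filtered_functions.const[OF filtered_functions_axioms])
  next
    case (Suc k)
    have "A (m + n + l) (\<lambda>x. disc m n l (T x))"
      by (rule disc_filtered[where T = T], rule T)
    then show ?case unfolding mult_Suc_right power_Suc
      using Suc.IH by (rule filtered_functions.mult[OF filtered_functions_axioms])
  qed
  have "A (Suc (m + n + l) * s + (m + n + l) * (t - s)) (\<lambda>x. f' x * disc m n l (T x) ^ (t - s))"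
    using f'(1) pow[of "t - s"] by (rule filtered_functions.mult[OF filtered_functions_axioms])
  moreover have "Suc (m + n + l) * s + (m + n + l) * (t - s) \<le> Suc (m + n + l) * t"
  proof -
    obtain k where "t = s + k" using mono.hyps(2) le_Suc_ex by blast
    then show ?thesis by (simp add: algebra_simps)
  qed
  ultimately have "A (Suc (m + n + l) * t) (\<lambda>x. f' x * disc m n l (T x) ^ (t - s))"
    by (rule filtered_functions.mono[OF filtered_functions_axioms])
  moreover have "\<forall>x. disc m n l (T x) \<noteq> 0 \<longrightarrow> f (act (triple m n l (T x)) S) * disc m n l (T x) ^ t =
      f' x * disc m n l (T x) ^ (t - s)"
  proof (intro allI impI)
    fix x assume x: "disc m n l (T x) \<noteq> 0"
    have "disc m n l (T x) ^ t = disc m n l (T x) ^ s * disc m n l (T x) ^ (t - s)"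
      using mono.hyps(2) by (simp flip: power_add)
    then show "f (act (triple m n l (T x)) S) * disc m n l (T x) ^ t = f' x * disc m n l (T x) ^ (t - s)"
      unfolding f'(2)[rule_format, OF x, symmetric] by (simp only: mult.assoc)
  qed
  ultimately have "A (Suc (m + n + l) * t) (\<lambda>x. f' x * disc m n l (T x) ^ (t - s)) \<and>
      (\<forall>x. disc m n l (T x) \<noteq> 0 \<longrightarrow> f (act (triple m n l (T x)) S) * disc m n l (T x) ^ t =
      f' x * disc m n l (T x) ^ (t - s))" by (rule conjI)
  then show ?case by (rule exI[where x = "\<lambda>x. f' x * disc m n l (T x) ^ (t - s)"])
qed

end

section \<open>Polynomial functions of one variable\<close>

definition upoly :: "nat \<Rightarrow> (complex \<Rightarrow> complex) \<Rightarrow> bool" where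
  "upoly t f \<longleftrightarrow> (\<exists>p. \<forall>x. f x = poly p x)"

lemma upolyI: "(\<And>x. f x = poly p x) \<Longrightarrow> upoly t f"
  unfolding upoly_def by (rule exI[of _ p]) simp

lemma upolyE:
  assumes "upoly t f"
  obtains p where "\<forall>x. f x = poly p x"
  using assms unfolding upoly_def by (elim exE) (rule that)

lemma upoly_filtered: "filtered_functions upoly"
proof
  fix s t :: nat and f g :: "complex \<Rightarrow> complex" and c
  show "upoly t (\<lambda>_. c)" by (rule upolyI[of _ "[:c:]"]) simp
  show "upoly t f" if "upoly s f" using that by (simp add: upoly_def)
  show "upoly t (\<lambda>x. f x + g x)" if f: "upoly t f" and g: "upoly t g"
  proof -
    obtain p where p: "\<forall>x. f x = poly p x" using upolyE[OF f] .
    obtain q where q: "\<forall>x. g x = poly q x" using upolyE[OF g] .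
    show ?thesis by (rule upolyI[of _ "p + q"]) (simp add: p q)
  qed
  show "upoly (s + t) (\<lambda>x. f x * g x)" if f: "upoly s f" and g: "upoly t g"
  proof -
    obtain p where p: "\<forall>x. f x = poly p x" using upolyE[OF f] .
    obtain q where q: "\<forall>x. g x = poly q x" using upolyE[OF g] .
    show ?thesis by (rule upolyI[of _ "p * q"]) (simp add: p q)
  qed
qed

lemma upoly_id: "upoly t (\<lambda>x. x)"
  by (rule upolyI[of _ "[:0, 1:]"]) simp

text \<open>The product of the two polynomials vanishes at all points, hence is the zero polynomial,
  and the second factor is not.\<close>

lemma upoly_eq_0:
  assumes f: "upoly t f" and g: "upoly s g" and g0: "g a \<noteq> 0"
    and eq: "\<And>x. g x \<noteq> 0 \<Longrightarrow> f x = 0"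
  shows "f x = 0"
proof -
  obtain p where p: "\<forall>x. f x = poly p x" using upolyE[OF f] .
  obtain q where q: "\<forall>x. g x = poly q x" using upolyE[OF g] .
  have "poly (p * q) x = 0" for x using eq[of x] by (auto simp: p q)
  then have "p * q = 0" using poly_all_0_iff_0 by blast
  moreover have "q \<noteq> 0" using g0 q by auto
  ultimately show ?thesis using p by simp
qed

lemma upoly_nonzero_point:
  assumes g: "upoly s g" and g0: "g a \<noteq> 0"
  obtains x where "x \<noteq> b" "g x \<noteq> 0"
proof -
  obtain q where q: "\<forall>x. g x = poly q x" using upolyE[OF g] .
  have "q \<noteq> 0" using g0 q by auto
  then have "finite ({x. poly q x = 0} \<union> {b})" using poly_roots_finite by simp
  then have "{x. poly q x = 0} \<union> {b} \<noteq> UNIV" using infinite_UNIV_char_0 by metis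
  then obtain x where "x \<notin> {x. poly q x = 0} \<union> {b}" by blast
  then show ?thesis using that[of x] q by auto
qed

section \<open>Polynomial functions of several variables and the number of monomials\<close>

definition expo :: "nat \<Rightarrow> nat \<Rightarrow> (nat \<Rightarrow> nat) set" where
  "expo d t = PiE {..<d} (\<lambda>_. {..t})"

definition monom_at :: "nat \<Rightarrow> (nat \<Rightarrow> nat) \<Rightarrow> (nat \<Rightarrow> complex) \<Rightarrow> complex" where
  "monom_at d e x = (\<Prod>i<d. x i ^ e i)"

text \<open>The bound is on each exponent separately. The number of monomials is then simply
  \<open>(t + 1) ^ d\<close>, the bounds still add under multiplication, and the order of growth in
  \<open>t\<close> is the same as for the total degree.\<close>

definition mpoly_fun :: "nat \<Rightarrow> nat \<Rightarrow> ((nat \<Rightarrow> complex) \<Rightarrow> complex) \<Rightarrow> bool" where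
  "mpoly_fun d t f \<longleftrightarrow> (\<exists>c. \<forall>x. f x = (\<Sum>e\<in>expo d t. c e * monom_at d e x))"

lemma finite_expo: "finite (expo d t)"
  unfolding expo_def by (rule finite_PiE) auto

lemma card_expo: "card (expo d t) = (t + 1) ^ d"
  unfolding expo_def by (subst card_PiE) simp_all

lemma mpoly_funI: "(\<And>x. f x = (\<Sum>e\<in>expo d t. c e * monom_at d e x)) \<Longrightarrow> mpoly_fun d t f"
  unfolding mpoly_fun_def by (rule exI[of _ c]) simp

lemma mpoly_funE:
  assumes "mpoly_fun d t f"
  obtains c where "\<forall>x. f x = (\<Sum>e\<in>expo d t. c e * monom_at d e x)"
  using assms unfolding mpoly_fun_def by (elim exE) (rule that)

lemma mpoly_fun_monom:
  assumes "e \<in> expo d t"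
  shows "mpoly_fun d t (\<lambda>x. a * monom_at d e x)"
proof (rule mpoly_funI[where c = "\<lambda>e'. if e' = e then a else 0"])
  fix x
  have "(\<Sum>e'\<in>expo d t. (if e' = e then a else 0) * monom_at d e' x)
      = (\<Sum>e'\<in>expo d t. if e' = e then a * monom_at d e' x else 0)"
    by (rule sum.cong) auto
  then show "a * monom_at d e x = (\<Sum>e'\<in>expo d t. (if e' = e then a else 0) * monom_at d e' x)"
    using assms finite_expo[of d t] by simp
qed

lemma mpoly_fun_add:
  assumes f: "mpoly_fun d t f" and g: "mpoly_fun d t g"
  shows "mpoly_fun d t (\<lambda>x. f x + g x)"
proof -
  obtain c where c: "\<forall>x. f x = (\<Sum>e\<in>expo d t. c e * monom_at d e x)" using mpoly_funE[OF f] .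
  obtain c' where c': "\<forall>x. g x = (\<Sum>e\<in>expo d t. c' e * monom_at d e x)" using mpoly_funE[OF g] .
  show ?thesis
    by (rule mpoly_funI[where c = "\<lambda>e. c e + c' e"]) (simp add: c c' sum.distrib distrib_right)
qed

lemma mpoly_fun_const: "mpoly_fun d t (\<lambda>_. c)"
proof -
  have "mpoly_fun d t (\<lambda>x. c * monom_at d (\<lambda>i\<in>{..<d}. 0) x)"
    by (rule mpoly_fun_monom) (simp add: expo_def)
  then show ?thesis by (simp add: monom_at_def)
qed

lemma mpoly_fun_sum:
  assumes "finite I" "\<And>i. i \<in> I \<Longrightarrow> mpoly_fun d t (F i)"
  shows "mpoly_fun d t (\<lambda>x. \<Sum>i\<in>I. F i x)"
  using assms
proof (induction rule: finite_induct)
  case empty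
  show ?case unfolding sum.empty by (rule mpoly_fun_const)
next
  case (insert i I)
  have 1: "mpoly_fun d t (F i)" by (rule insert.prems) simp
  have 2: "mpoly_fun d t (\<lambda>x. \<Sum>i\<in>I. F i x)" by (rule insert.IH, rule insert.prems) simp
  show ?case unfolding sum.insert[OF insert.hyps] by (rule mpoly_fun_add[OF 1 2])
qed

lemma mpoly_fun_mono:
  assumes f: "mpoly_fun d s f" and "s \<le> t"
  shows "mpoly_fun d t f"
proof -
  obtain c where c: "\<forall>x. f x = (\<Sum>e\<in>expo d s. c e * monom_at d e x)" using mpoly_funE[OF f] .
  have sub: "expo d s \<subseteq> expo d t" unfolding expo_def by (rule PiE_mono) (use \<open>s \<le> t\<close> in auto)
  have "mpoly_fun d t (\<lambda>x. \<Sum>e\<in>expo d s. c e * monom_at d e x)"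
    by (rule mpoly_fun_sum[OF finite_expo], rule mpoly_fun_monom) (use sub in blast)
  moreover have "f = (\<lambda>x. \<Sum>e\<in>expo d s. c e * monom_at d e x)" using c by (intro ext) simp
  ultimately show ?thesis by simp
qed

lemma mpoly_fun_mult:
  assumes f: "mpoly_fun d s f" and g: "mpoly_fun d t g"
  shows "mpoly_fun d (s + t) (\<lambda>x. f x * g x)"
proof -
  obtain c where c: "\<forall>x. f x = (\<Sum>e\<in>expo d s. c e * monom_at d e x)" using mpoly_funE[OF f] .
  obtain c' where c': "\<forall>x. g x = (\<Sum>e\<in>expo d t. c' e * monom_at d e x)" using mpoly_funE[OF g] .
  \<comment> \<open>Addition of exponents, cut off outside \<open>{..<d}\<close> so that the sum is
    again extensional and belongs to a set \<open>expo\<close>.\<close>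
  define pl where "pl e e' = (\<lambda>i\<in>{..<d}. e i + e' i)" for e e' :: "nat \<Rightarrow> nat"
  have pl: "monom_at d (pl e e') x = monom_at d e x * monom_at d e' x" for e e' x
    by (simp add: monom_at_def pl_def power_add prod.distrib)
  have "mpoly_fun d (s + t) (\<lambda>x. \<Sum>e\<in>expo d s. \<Sum>e'\<in>expo d t. (c e * c' e') * monom_at d (pl e e') x)"
  proof (intro mpoly_fun_sum finite_expo mpoly_fun_monom)
    fix e e' assume e: "e \<in> expo d s" and e': "e' \<in> expo d t"
    have "e i + e' i \<le> s + t" if "i < d" for i
      using that PiE_mem[OF e[unfolded expo_def], of i] PiE_mem[OF e'[unfolded expo_def], of i] by simp
    then show "pl e e' \<in> expo d (s + t)" unfolding expo_def pl_def by (intro restrict_PiE_iff[THEN iffD2]) auto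
  qed
  moreover have "f x * g x = (\<Sum>e\<in>expo d s. \<Sum>e'\<in>expo d t. (c e * c' e') * monom_at d (pl e e') x)" for x
    unfolding c[rule_format] c'[rule_format] sum_product by (intro sum.cong refl) (simp add: pl mult_ac)
  ultimately show ?thesis by simp
qed

lemma mpoly_filtered: "filtered_functions (mpoly_fun d)"
proof
  show "mpoly_fun d t (\<lambda>_. c)" for t c by (rule mpoly_fun_const)
  show "mpoly_fun d t f" if "mpoly_fun d s f" "s \<le> t" for s t f using that by (rule mpoly_fun_mono)
  show "mpoly_fun d t (\<lambda>x. f x + g x)" if "mpoly_fun d t f" "mpoly_fun d t g" for t f g
    using that by (rule mpoly_fun_add)
  show "mpoly_fun d (s + t) (\<lambda>x. f x * g x)" if "mpoly_fun d s f" "mpoly_fun d t g" for s t f g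
    using that by (rule mpoly_fun_mult)
qed

lemma mpoly_fun_coord:
  assumes "k < d"
  shows "mpoly_fun d 1 (\<lambda>x. x k)"
proof -
  let ?e = "\<lambda>i\<in>{..<d}. if i = k then 1 else (0::nat)"
  have "mpoly_fun d 1 (\<lambda>x. 1 * monom_at d ?e x)"
    by (rule mpoly_fun_monom) (auto simp: expo_def)
  moreover have "monom_at d ?e x = x k" for x
  proof -
    have "monom_at d ?e x = (\<Prod>i<d. if i = k then x i else 1)"
      unfolding monom_at_def by (rule prod.cong) auto
    then show ?thesis using assms by simp
  qed
  ultimately show ?thesis by simp
qed

text \<open>The equations are padded with zero rows to a square matrix. Its last row is zero, so a
  unit vector is killed by the transpose, the determinant vanishes, and the matrix has a kernel
  vector.\<close>

lemma homogeneous_solution: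
  fixes a :: "nat \<Rightarrow> 'e \<Rightarrow> complex"
  assumes "finite E" "card E < N"
  obtains c where "\<exists>i<N. c i \<noteq> 0" "\<forall>e\<in>E. (\<Sum>i<N. c i * a i e) = 0"
proof -
  obtain h where h: "bij_betw h {..<card E} E"
    using assms(1) ex_bij_betw_nat_finite[of E] by (metis atLeast0LessThan)
  define M where "M = mat N N (\<lambda>(r, i). if r < card E then a i (h r) else 0)"
  have M: "M \<in> carrier_mat N N" by (simp add: M_def)
  have "transpose_mat M *\<^sub>v unit_vec N (N - 1) = 0\<^sub>v N"
  proof (rule eq_vecI)
    fix i assume "i < dim_vec (0\<^sub>v N)"
    then have "i < N" by simp
    moreover have "M $$ (N - 1, i) = 0" using assms(2) \<open>i < N\<close> by (simp add: M_def)
    ultimately show "(transpose_mat M *\<^sub>v unit_vec N (N - 1)) $ i = 0\<^sub>v N $ i"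
      using M assms(2) by simp
  qed (use M in simp)
  moreover have "unit_vec N (N - 1) \<noteq> (0\<^sub>v N :: complex vec)" using assms(2)
    by (metis diff_less index_unit_vec(1) index_zero_vec(1) less_nat_zero_code linorder_neqE_nat zero_less_one zero_neq_one gr_zeroI)
  moreover have Mt: "transpose_mat M \<in> carrier_mat N N" using M by simp
  ultimately have "det (transpose_mat M) = 0"
    unfolding det_0_iff_vec_prod_zero_field[OF Mt]
    by (intro exI[where x = "unit_vec N (N - 1)"] conjI unit_vec_carrier)
  then have "det M = 0" using det_transpose[OF M] by simp
  then obtain v where v: "v \<in> carrier_vec N" "v \<noteq> 0\<^sub>v N" "M *\<^sub>v v = 0\<^sub>v N"
    using det_0_iff_vec_prod_zero_field[OF M] by blast
  have "\<forall>e\<in>E. (\<Sum>i<N. v $ i * a i e) = 0"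
  proof
    fix e assume "e \<in> E"
    obtain r where r: "r < card E" "h r = e"
      using h \<open>e \<in> E\<close> unfolding bij_betw_def by (metis imageE lessThan_iff)
    have "(M *\<^sub>v v) $ r = 0" using v(3) r(1) assms(2) by simp
    moreover have "(M *\<^sub>v v) $ r = (\<Sum>i<N. v $ i * a i e)"
      using r assms(2) v(1) by (simp add: M_def scalar_prod_def atLeast0LessThan mult.commute)
    ultimately show "(\<Sum>i<N. v $ i * a i e) = 0" by simp
  qed
  moreover have "\<exists>i<N. v $ i \<noteq> 0"
  proof (rule ccontr)
    assume "\<not> (\<exists>i<N. v $ i \<noteq> 0)"
    then have "v = 0\<^sub>v N" using v(1) by (intro eq_vecI) auto
    then show False using v(2) by simp
  qed
  ultimately show ?thesis by (rule_tac that[of "\<lambda>i. v $ i"])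
qed

lemma mpoly_fun_dependent:
  assumes g: "\<And>i. i < N \<Longrightarrow> mpoly_fun d t (g i)" and N: "(t + 1) ^ d < N"
  obtains c where "\<exists>i<N. c i \<noteq> 0" "\<forall>x. (\<Sum>i<N. c i * g i x) = 0"
proof -
  have "\<forall>i. \<exists>c. i < N \<longrightarrow> (\<forall>x. g i x = (\<Sum>e\<in>expo d t. c e * monom_at d e x))"
    using g unfolding mpoly_fun_def by simp
  from choice[OF this] obtain a
    where a: "\<forall>i. i < N \<longrightarrow> (\<forall>x. g i x = (\<Sum>e\<in>expo d t. a i e * monom_at d e x))" by (elim exE)
  have "card (expo d t) < N" using N by (simp add: card_expo)
  from homogeneous_solution[OF finite_expo this, of a]
  obtain c where c: "\<exists>i<N. c i \<noteq> 0" "\<forall>e\<in>expo d t. (\<Sum>i<N. c i * a i e) = 0" .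
  have "(\<Sum>i<N. c i * g i x) = 0" for x
  proof -
    have "(\<Sum>i<N. c i * g i x) = (\<Sum>i<N. \<Sum>e\<in>expo d t. (c i * a i e) * monom_at d e x)"
      by (rule sum.cong) (simp_all add: a sum_distrib_left mult.assoc)
    also have "\<dots> = (\<Sum>e\<in>expo d t. (\<Sum>i<N. c i * a i e) * monom_at d e x)"
      by (subst sum.swap) (simp add: sum_distrib_right)
    also have "\<dots> = 0" using c(2) by simp
    finally show ?thesis .
  qed
  then have "\<forall>x. (\<Sum>i<N. c i * g i x) = 0" by simp
  with c(1) show ?thesis by (rule that)
qed

text \<open>The left side grows like \<open>s ^ d\<close>, the right side like \<open>s ^ k\<close>,
  up to constant factors.\<close>

lemma choose_exceeds_power:
  assumes "d < k"
  shows "\<exists>s. (C * s + 1) ^ d < (s + k) choose k"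
proof -
  \<comment> \<open>The witness is \<open>s = k * r\<close>. The binomial coefficient is then at
    least \<open>((k * r + k) / k) ^ k = (r + 1) ^ k\<close>, and the power is at most
    \<open>((C * k + 1) * (r + 1)) ^ d\<close>. The constant \<open>(C * k + 1) ^ d\<close> is
    \<open>r\<close> itself, so one more factor \<open>r + 1\<close> absorbs it.\<close>
  define r where "r = (C * k + 1) ^ d"
  have "real (Suc r) ^ k \<le> real ((k * r + k) choose k)"
  proof -
    have "real (k * r + k) / real k = real (Suc r)"
      using assms by (simp add: field_simps)
    then show ?thesis
      using binomial_ge_n_over_k_pow_k[of k "k * r + k", where 'a = real] by simp
  qed
  then have "Suc r ^ k \<le> (k * r + k) choose k"
    by (metis of_nat_le_iff of_nat_power)
  moreover have "(C * (k * r) + 1) ^ d < Suc r ^ k"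
  proof -
    have "C * (k * r) + 1 \<le> (C * k + 1) * Suc r" by (simp add: algebra_simps)
    then have "(C * (k * r) + 1) ^ d \<le> ((C * k + 1) * Suc r) ^ d" by (rule power_mono) simp
    also have "\<dots> = r * Suc r ^ d" by (simp only: power_mult_distrib r_def)
    also have "\<dots> < Suc r * Suc r ^ d" by simp
    also have "\<dots> = Suc r ^ Suc d" by simp
    also have "\<dots> \<le> Suc r ^ k" using assms by (intro power_increasing) auto
    finally show ?thesis .
  qed
  ultimately have "(C * (k * r) + 1) ^ d < (k * r + k) choose k" by linarith
  then show ?thesis by blast
qed

section \<open>Intertwiners\<close>

definition ent :: "system \<Rightarrow> component \<Rightarrow> fmat" where
  "ent S N p q = component_mat N S $$ (p, q)"

text \<open>The equation \<open>act v S = S'\<close> with the inverses multiplied out. In this form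
  it is linear in \<open>v\<close> and meaningful for singular \<open>v\<close>.\<close>

definition intw :: "nat \<Rightarrow> nat \<Rightarrow> nat \<Rightarrow> system \<Rightarrow> system \<Rightarrow> tri \<Rightarrow> bool" where
  "intw m n l S S' v \<longleftrightarrow> (\<forall>N. \<forall>p<dim_of m n l (row_space N). \<forall>q<dim_of m n l (col_space N).
     mm (dim_of m n l (row_space N)) (v (row_space N)) (ent S N) p q =
     mm (dim_of m n l (col_space N)) (ent S' N) (v (col_space N)) p q)"

definition tcomp :: "nat \<Rightarrow> nat \<Rightarrow> nat \<Rightarrow> tri \<Rightarrow> tri \<Rightarrow> tri" where
  "tcomp m n l u v sp p q =
     (if p < dim_of m n l sp \<and> q < dim_of m n l sp then mm (dim_of m n l sp) (u sp) (v sp) p q else 0)"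

definition detsp :: "nat \<Rightarrow> nat \<Rightarrow> nat \<Rightarrow> tri \<Rightarrow> space \<Rightarrow> complex" where
  "detsp m n l v sp = det (sq (dim_of m n l sp) (v sp))"

definition codet :: "nat \<Rightarrow> nat \<Rightarrow> nat \<Rightarrow> tri \<Rightarrow> space \<Rightarrow> complex" where
  "codet m n l v sp = (case sp of
     Input \<Rightarrow> detsp m n l v State * detsp m n l v Output
   | State \<Rightarrow> detsp m n l v Input * detsp m n l v Output
   | Output \<Rightarrow> detsp m n l v Input * detsp m n l v State)"

lemma disc_codet: "disc m n l v = codet m n l v sp * detsp m n l v sp"
  by (cases sp) (simp_all add: disc_def codet_def detsp_def mult_ac)

text \<open>Multiplying the inverse by \<open>disc m n l v\<close> makes its entries polynomials in \<open>v\<close>.\<close>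

definition cof :: "nat \<Rightarrow> nat \<Rightarrow> nat \<Rightarrow> tri \<Rightarrow> tri" where
  "cof m n l v sp p q = (if p < dim_of m n l sp \<and> q < dim_of m n l sp
     then codet m n l v sp * adj_mat (sq (dim_of m n l sp) (v sp)) $$ (p, q) else 0)"

lemma mm_cof:
  assumes "p < dim_of m n l sp" "q < dim_of m n l sp"
  shows "mm (dim_of m n l sp) (cof m n l v sp) (v sp) p q = disc m n l v * idm p q"
    and "mm (dim_of m n l sp) (v sp) (cof m n l v sp) p q = disc m n l v * idm p q"
proof -
  let ?k = "dim_of m n l sp"
  let ?Q = "sq ?k (v sp)"
  note a = adj_mat[OF sq_simps(1)[of ?k "v sp"]]
  have "(adj_mat ?Q * ?Q) $$ (p, q) = det ?Q * idm p q"
    unfolding a(3) using assms by (simp add: idm_def)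
  moreover have "(adj_mat ?Q * ?Q) $$ (p, q) = (\<Sum>b<?k. adj_mat ?Q $$ (p, b) * v sp b q)"
    using assms a(1) by (simp add: scalar_prod_def atLeast0LessThan)
  ultimately have "(\<Sum>b<?k. adj_mat ?Q $$ (p, b) * v sp b q) = det ?Q * idm p q" by simp
  moreover have "mm ?k (cof m n l v sp) (v sp) p q = codet m n l v sp * (\<Sum>b<?k. adj_mat ?Q $$ (p, b) * v sp b q)"
    unfolding mm_def sum_distrib_left by (rule sum.cong) (simp_all add: cof_def assms)
  ultimately show "mm ?k (cof m n l v sp) (v sp) p q = disc m n l v * idm p q"
    by (simp add: disc_codet[of m n l v sp] detsp_def)
  have "(?Q * adj_mat ?Q) $$ (p, q) = det ?Q * idm p q"
    unfolding a(2) using assms by (simp add: idm_def)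
  moreover have "(?Q * adj_mat ?Q) $$ (p, q) = (\<Sum>b<?k. v sp p b * adj_mat ?Q $$ (b, q))"
    using assms a(1) by (simp add: scalar_prod_def atLeast0LessThan)
  ultimately have "(\<Sum>b<?k. v sp p b * adj_mat ?Q $$ (b, q)) = det ?Q * idm p q" by simp
  moreover have "mm ?k (v sp) (cof m n l v sp) p q = codet m n l v sp * (\<Sum>b<?k. v sp p b * adj_mat ?Q $$ (b, q))"
    unfolding mm_def sum_distrib_left by (rule sum.cong) (simp_all add: cof_def assms)
  ultimately show "mm ?k (v sp) (cof m n l v sp) p q = disc m n l v * idm p q"
    by (simp add: disc_codet[of m n l v sp] detsp_def)
qed

lemma intwD:
  "intw m n l S S' v \<Longrightarrow> p < dim_of m n l (row_space N) \<Longrightarrow> q < dim_of m n l (col_space N) \<Longrightarrow>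
     mm (dim_of m n l (row_space N)) (v (row_space N)) (ent S N) p q =
     mm (dim_of m n l (col_space N)) (ent S' N) (v (col_space N)) p q"
  by (simp add: intw_def)

lemma intw_comp:
  assumes v: "intw m n l S S' v" and u: "intw m n l S' S'' u"
  shows "intw m n l S S'' (tcomp m n l u v)"
  unfolding intw_def
proof (intro allI impI)
  fix N p q
  let ?r = "dim_of m n l (row_space N)" and ?c = "dim_of m n l (col_space N)"
  assume p: "p < ?r" and q: "q < ?c"
  have "mm ?r (tcomp m n l u v (row_space N)) (ent S N) p q = mm ?r (mm ?r (u (row_space N)) (v (row_space N))) (ent S N) p q"
    by (rule mm_cong) (simp_all add: tcomp_def p)
  also have "\<dots> = mm ?r (u (row_space N)) (mm ?r (v (row_space N)) (ent S N)) p q"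
    by (simp add: mm_assoc)
  also have "\<dots> = mm ?r (u (row_space N)) (mm ?c (ent S' N) (v (col_space N))) p q"
    by (rule mm_cong) (simp_all add: intwD[OF v _ q])
  also have "\<dots> = mm ?c (mm ?r (u (row_space N)) (ent S' N)) (v (col_space N)) p q"
    by (simp add: mm_assoc)
  also have "\<dots> = mm ?c (mm ?c (ent S'' N) (u (col_space N))) (v (col_space N)) p q"
    by (rule mm_cong) (simp_all add: intwD[OF u p])
  also have "\<dots> = mm ?c (ent S'' N) (mm ?c (u (col_space N)) (v (col_space N))) p q"
    by (simp add: mm_assoc)
  also have "\<dots> = mm ?c (ent S'' N) (tcomp m n l u v (col_space N)) p q"
    by (rule mm_cong) (simp_all add: tcomp_def q)
  finally show "mm ?r (tcomp m n l u v (row_space N)) (ent S N) p q = mm ?c (ent S'' N) (tcomp m n l u v (col_space N)) p q" .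
qed

lemma intw_cong:
  assumes "\<And>sp p q. p < dim_of m n l sp \<Longrightarrow> q < dim_of m n l sp \<Longrightarrow> u sp p q = v sp p q"
    and v: "intw m n l S S' v"
  shows "intw m n l S S' u"
  unfolding intw_def
proof (intro allI impI)
  fix N p q
  let ?r = "dim_of m n l (row_space N)" and ?c = "dim_of m n l (col_space N)"
  assume p: "p < ?r" and q: "q < ?c"
  have "mm ?r (u (row_space N)) (ent S N) p q = mm ?r (v (row_space N)) (ent S N) p q"
    by (rule mm_cong) (simp_all add: assms(1) p)
  also have "\<dots> = mm ?c (ent S' N) (v (col_space N)) p q" by (rule intwD[OF v p q])
  also have "\<dots> = mm ?c (ent S' N) (u (col_space N)) p q"
    by (rule mm_cong) (simp_all add: assms(1) q)
  finally show "mm ?r (u (row_space N)) (ent S N) p q = mm ?c (ent S' N) (u (col_space N)) p q" .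
qed

lemma mm_lin_left: "mm k (\<lambda>p q. a * u p q + b * v p q) X p q = a * mm k u X p q + b * mm k v X p q"
  by (simp add: mm_def sum_distrib_left sum.distrib distrib_right mult.assoc)

lemma mm_lin_right: "mm k X (\<lambda>p q. a * u p q + b * v p q) p q = a * mm k X u p q + b * mm k X v p q"
  by (simp add: mm_def sum_distrib_left sum.distrib distrib_left mult_ac)

lemma intw_lin:
  assumes "intw m n l S S' u" "intw m n l S S' v"
  shows "intw m n l S S' (\<lambda>sp p q. a * u sp p q + b * v sp p q)"
  unfolding intw_def
  by (intro allI impI) (simp only: mm_lin_left mm_lin_right intwD[OF assms(1)] intwD[OF assms(2)])

lemma intw_zero:
  assumes "\<And>sp p q. p < dim_of m n l sp \<Longrightarrow> q < dim_of m n l sp \<Longrightarrow> u sp p q = 0"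
  shows "intw m n l S S' u"
  using assms unfolding intw_def mm_def by simp

lemma intw_idm: "intw m n l S S (\<lambda>sp. idm)"
  unfolding intw_def by (simp add: mm_idm_left mm_idm_right)

text \<open>Multiplying \<open>v S = S' v\<close> by the scaled inverse on both sides produces the
  scalar \<open>disc\<close> on both sides, which cancels.\<close>

lemma intw_cof:
  assumes v: "intw m n l S S' v" and d: "disc m n l v \<noteq> 0"
  shows "intw m n l S' S (cof m n l v)"
  unfolding intw_def
proof (intro allI impI)
  fix N p q
  let ?r = "dim_of m n l (row_space N)" and ?c = "dim_of m n l (col_space N)"
  let ?cr = "cof m n l v (row_space N)" and ?cc = "cof m n l v (col_space N)"
  let ?vr = "v (row_space N)" and ?vc = "v (col_space N)"
  let ?X = "ent S N" and ?X' = "ent S' N" and ?d = "disc m n l v"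
  assume p: "p < ?r" and q: "q < ?c"
  have scale: "mm k (\<lambda>a b. ?d * idm a b) Y p' q' = ?d * mm k idm Y p' q'"
    "mm k Y (\<lambda>a b. ?d * idm a b) p' q' = ?d * mm k Y idm p' q'" for k Y p' q'
    by (simp_all add: mm_def sum_distrib_left mult_ac)
  have "?d * mm ?r ?cr ?X' p q = mm ?c (mm ?r ?cr ?X') (\<lambda>a b. ?d * idm a b) p q"
    by (simp add: scale mm_idm_right q)
  also have "\<dots> = mm ?c (mm ?r ?cr ?X') (mm ?c ?vc ?cc) p q"
    by (rule mm_cong) (simp_all add: mm_cof q)
  also have "\<dots> = mm ?c (mm ?r ?cr (mm ?c ?X' ?vc)) ?cc p q"
    by (simp add: mm_assoc)
  also have "\<dots> = mm ?c (mm ?r ?cr (mm ?r ?vr ?X)) ?cc p q"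
    by (intro mm_cong) (simp_all add: intwD[OF v])
  also have "\<dots> = mm ?c (mm ?r (mm ?r ?cr ?vr) ?X) ?cc p q"
    by (simp add: mm_assoc)
  also have "\<dots> = mm ?c (mm ?r (\<lambda>a b. ?d * idm a b) ?X) ?cc p q"
    by (intro mm_cong) (simp_all add: mm_cof p)
  also have "\<dots> = mm ?r (\<lambda>a b. ?d * idm a b) (mm ?c ?X ?cc) p q"
    by (simp add: mm_assoc)
  also have "\<dots> = ?d * mm ?c ?X ?cc p q" by (simp add: scale mm_idm_left p)
  finally show "mm ?r ?cr ?X' p q = mm ?c ?X ?cc p q" using d by simp
qed

lemma component_mat_carrier:
  "S \<in> systems m n l \<Longrightarrow> component_mat N S \<in> carrier_mat (dim_of m n l (row_space N)) (dim_of m n l (col_space N))"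
  by (cases S; cases N) (auto simp: systems_def)

lemma system_eqI:
  assumes "\<And>N. component_mat N S = component_mat N S'"
  shows "S = S'"
  using assms[of Comp_A] assms[of Comp_B] assms[of Comp_C] by (cases S; cases S') simp

lemma component_mat_act:
  "component_mat N (act T S) = factor (row_space N) T * component_mat N S * inv_mat (factor (col_space N) T)"
  by (cases T; cases S; cases N) simp_all

lemma factor_triple: "factor sp (triple m n l v) = sq (dim_of m n l sp) (v sp)"
  by (cases sp) (simp_all add: triple_def)

lemma detsp_nonzero: "disc m n l v \<noteq> 0 \<Longrightarrow> det (sq (dim_of m n l sp) (v sp)) \<noteq> 0"
  by (cases sp) (auto simp: disc_def)

lemma act_systems:
  assumes S: "S \<in> systems m n l" and d: "disc m n l v \<noteq> 0"
  shows "act (triple m n l v) S \<in> systems m n l"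
proof -
  have i: "inv_mat (sq (dim_of m n l sp) (v sp)) \<in> carrier_mat (dim_of m n l sp) (dim_of m n l sp)" for sp
    by (rule inv_mat_eq(4)[OF sq_simps(1) detsp_nonzero[OF d]])
  have "component_mat N (act (triple m n l v) S) \<in> carrier_mat (dim_of m n l (row_space N)) (dim_of m n l (col_space N))" for N
    unfolding component_mat_act factor_triple
    by (intro mult_carrier_mat[OF mult_carrier_mat[OF sq_simps(1) component_mat_carrier[OF S]] i])
  from this[of Comp_A] this[of Comp_B] this[of Comp_C] show ?thesis
    by (cases "act (triple m n l v) S") (simp add: systems_def)
qed

text \<open>From here on, statements about orbits and stabilizers become linear conditions on
  triples.\<close>

lemma act_iff_intw:
  assumes S: "S \<in> systems m n l" and S': "S' \<in> systems m n l" and d: "disc m n l v \<noteq> 0"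
  shows "act (triple m n l v) S = S' \<longleftrightarrow> intw m n l S S' v"
proof -
  have *: "component_mat N (act (triple m n l v) S) = component_mat N S' \<longleftrightarrow>
    (\<forall>p<dim_of m n l (row_space N). \<forall>q<dim_of m n l (col_space N).
     mm (dim_of m n l (row_space N)) (v (row_space N)) (ent S N) p q =
     mm (dim_of m n l (col_space N)) (ent S' N) (v (col_space N)) p q)" for N
  proof -
    let ?r = "dim_of m n l (row_space N)" and ?c = "dim_of m n l (col_space N)"
    let ?P = "sq ?r (v (row_space N))" and ?Q = "sq ?c (v (col_space N))"
    let ?N = "component_mat N S" and ?N' = "component_mat N S'"
    note N = component_mat_carrier[OF S, of N] and N' = component_mat_carrier[OF S', of N]
    note iQ = inv_mat_eq(2-4)[OF sq_simps(1) detsp_nonzero[OF d], of "col_space N"]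
    have PN: "?P * ?N \<in> carrier_mat ?r ?c" by (rule mult_carrier_mat[OF sq_simps(1) N])
    have NQ: "?N' * ?Q \<in> carrier_mat ?r ?c" by (rule mult_carrier_mat[OF N' sq_simps(1)])
    have "component_mat N (act (triple m n l v) S) = ?N' \<longleftrightarrow> ?P * ?N * inv_mat ?Q = ?N'"
      by (simp add: component_mat_act factor_triple)
    also have "\<dots> \<longleftrightarrow> ?P * ?N = ?N' * ?Q"
    proof
      assume e: "?P * ?N * inv_mat ?Q = ?N'"
      have "?N' * ?Q = ?P * ?N * (inv_mat ?Q * ?Q)" unfolding e[symmetric]
        by (rule assoc_mult_mat[OF PN iQ(3) sq_simps(1)])
      also have "\<dots> = ?P * ?N" unfolding iQ(2) by (rule right_mult_one_mat[OF PN])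
      finally show "?P * ?N = ?N' * ?Q" ..
    next
      assume e: "?P * ?N = ?N' * ?Q"
      have "?N' * ?Q * inv_mat ?Q = ?N' * (?Q * inv_mat ?Q)"
        by (rule assoc_mult_mat[OF N' sq_simps(1) iQ(3)])
      also have "\<dots> = ?N'" unfolding iQ(1) by (rule right_mult_one_mat[OF N'])
      finally show "?P * ?N * inv_mat ?Q = ?N'" unfolding e .
    qed
    also have "\<dots> \<longleftrightarrow> (\<forall>p<?r. \<forall>q<?c. (?P * ?N) $$ (p, q) = (?N' * ?Q) $$ (p, q))"
      using PN NQ by (auto intro!: eq_matI)
    also have "\<dots> \<longleftrightarrow> (\<forall>p<?r. \<forall>q<?c. mm ?r (v (row_space N)) (ent S N) p q = mm ?c (ent S' N) (v (col_space N)) p q)"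
    proof -
      have "(?P * ?N) $$ (p, q) = mm ?r (v (row_space N)) (ent S N) p q" if "p < ?r" "q < ?c" for p q
        using that N by (simp add: scalar_prod_def atLeast0LessThan mm_def ent_def)
      moreover have "(?N' * ?Q) $$ (p, q) = mm ?c (ent S' N) (v (col_space N)) p q" if "p < ?r" "q < ?c" for p q
        using that N' by (simp add: scalar_prod_def atLeast0LessThan mm_def ent_def)
      ultimately show ?thesis by simp
    qed
    finally show ?thesis .
  qed
  show ?thesis
  proof
    assume "act (triple m n l v) S = S'"
    then show "intw m n l S S' v" using * unfolding intw_def by simp
  next
    assume "intw m n l S S' v"
    then have "component_mat N (act (triple m n l v) S) = component_mat N S'" for N
      unfolding * intw_def by simp
    then show "act (triple m n l v) S = S'" by (rule system_eqI)
  qed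
qed

lemma intw_act:
  "S \<in> systems m n l \<Longrightarrow> disc m n l v \<noteq> 0 \<Longrightarrow> intw m n l S (act (triple m n l v) S) v"
  using act_iff_intw[OF _ act_systems] by blast

lemma disc_idm: "disc m n l (\<lambda>sp. idm) = 1"
proof -
  have "sq k idm = 1\<^sub>m k" for k by (rule eq_matI) (auto simp: sq_def idm_def)
  then show ?thesis by (simp add: disc_def)
qed

lemma disc_cong:
  assumes "\<And>sp p q. p < dim_of m n l sp \<Longrightarrow> q < dim_of m n l sp \<Longrightarrow> u sp p q = v sp p q"
  shows "disc m n l u = disc m n l v"
proof -
  have "sq (dim_of m n l sp) (u sp) = sq (dim_of m n l sp) (v sp)" for sp
    using assms by (intro eq_matI) auto
  from this[of Input] this[of State] this[of Output] show ?thesis by (simp add: disc_def)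
qed

lemma disc_scale:
  "disc m n l (\<lambda>sp p q. c * v sp p q) = c ^ (m + n + l) * disc m n l v"
proof -
  have "sq k (\<lambda>p q. c * X p q) = c \<cdot>\<^sub>m sq k X" for k X by (rule eq_matI) (auto simp: sq_def)
  then show ?thesis by (simp add: disc_def power_add)
qed

lemma disc_comp: "disc m n l (tcomp m n l u v) = disc m n l u * disc m n l v"
proof -
  have "sq (dim_of m n l sp) (tcomp m n l u v sp) = sq (dim_of m n l sp) (u sp) * sq (dim_of m n l sp) (v sp)" for sp
    by (rule eq_matI) (auto simp: scalar_prod_def tcomp_def mm_def atLeast0LessThan)
  from this[of Input] this[of State] this[of Output] show ?thesis
    by (simp add: disc_def det_mult[OF sq_simps(1) sq_simps(1)])
qed

lemma triple_surj:
  assumes "T \<in> square_triples m n l"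
  shows "triple m n l (\<lambda>sp p q. factor sp T $$ (p, q)) = T"
  using assms by (cases T) (auto simp: square_triples_def triple_def intro!: eq_matI)

lemma equiv_class_eq: "equiv_class m n l S = {act (triple m n l v) S | v. disc m n l v \<noteq> 0}"
proof -
  have ex: "T \<in> GL_triples m n l \<longleftrightarrow> (\<exists>v. T = triple m n l v \<and> disc m n l v \<noteq> 0)" for T
  proof
    assume T: "T \<in> GL_triples m n l"
    then have "T \<in> square_triples m n l" by (auto simp: GL_triples_def)
    note e = triple_surj[OF this]
    show "\<exists>v. T = triple m n l v \<and> disc m n l v \<noteq> 0"
      using T triple_GL_iff[of m n l "\<lambda>sp p q. factor sp T $$ (p, q)"] unfolding e
      by (intro exI[where x = "\<lambda>sp p q. factor sp T $$ (p, q)"] conjI e[symmetric]) simp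
  next
    assume "\<exists>v. T = triple m n l v \<and> disc m n l v \<noteq> 0"
    then show "T \<in> GL_triples m n l" by (elim exE conjE) (simp add: triple_GL_iff)
  qed
  have GL: "GL_triples m n l = triple m n l ` {v. disc m n l v \<noteq> 0}"
  proof
    show "GL_triples m n l \<subseteq> triple m n l ` {v. disc m n l v \<noteq> 0}"
    proof
      fix T assume "T \<in> GL_triples m n l"
      then obtain v where "T = triple m n l v" "disc m n l v \<noteq> 0" unfolding ex by (elim exE conjE)
      then show "T \<in> triple m n l ` {v. disc m n l v \<noteq> 0}" by (intro image_eqI[of _ _ v]) simp_all
    qed
    show "triple m n l ` {v. disc m n l v \<noteq> 0} \<subseteq> GL_triples m n l"
      using triple_GL_iff by auto
  qed
  show ?thesis unfolding equiv_class_def GL by blast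
qed

lemma equiv_class_act:
  assumes S: "S \<in> systems m n l" and d: "disc m n l v \<noteq> 0"
  shows "equiv_class m n l (act (triple m n l v) S) = equiv_class m n l S"
proof -
  have sub: "equiv_class m n l (act (triple m n l v) S) \<subseteq> equiv_class m n l S"
    if S: "S \<in> systems m n l" and d: "disc m n l v \<noteq> 0" for S v
  proof
    fix S'' assume "S'' \<in> equiv_class m n l (act (triple m n l v) S)"
    then obtain u where u: "S'' = act (triple m n l u) (act (triple m n l v) S)" "disc m n l u \<noteq> 0"
      unfolding equiv_class_eq by blast
    note S1 = act_systems[OF S d]
    have "intw m n l S S'' (tcomp m n l u v)" unfolding u(1)
      by (rule intw_comp[OF intw_act[OF S d] intw_act[OF S1 u(2)]])
    moreover have dc: "disc m n l (tcomp m n l u v) \<noteq> 0" using d u(2) by (simp add: disc_comp)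
    moreover have "S'' \<in> systems m n l" unfolding u(1) by (rule act_systems[OF S1 u(2)])
    ultimately have "act (triple m n l (tcomp m n l u v)) S = S''" using act_iff_intw[OF S] by blast
    then show "S'' \<in> equiv_class m n l S" unfolding equiv_class_eq using dc by blast
  qed
  note S1 = act_systems[OF S d]
  \<comment> \<open>Determinants are compared in \<open>cof v * v = disc v * 1\<close>; the right
    side contributes the power \<open>disc v ^ (m + n + l)\<close>.\<close>
  have dc: "disc m n l (cof m n l v) \<noteq> 0"
  proof -
    have "disc m n l (tcomp m n l (cof m n l v) v) = disc m n l (\<lambda>sp p q. disc m n l v * idm p q)"
      by (rule disc_cong) (simp add: tcomp_def mm_cof)
    then have "disc m n l (cof m n l v) * disc m n l v = disc m n l v ^ (m + n + l)"
      by (simp add: disc_comp disc_scale disc_idm)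
    then show ?thesis using d by (metis mult_zero_left power_not_zero)
  qed
  have "act (triple m n l (cof m n l v)) (act (triple m n l v) S) = S"
    using act_iff_intw[OF S1 S dc] intw_cof[OF intw_act[OF S d] d] by blast
  then have "equiv_class m n l S \<subseteq> equiv_class m n l (act (triple m n l v) S)"
    using sub[OF S1 dc] by simp
  with sub[OF S d] show ?thesis by blast
qed

lemma upoly_any: "upoly s f \<Longrightarrow> upoly t f"
  by (simp add: upoly_def)

lemma upoly_mult: "upoly t f \<Longrightarrow> upoly t g \<Longrightarrow> upoly t (\<lambda>x. f x * g x)"
  using filtered_functions.mult[OF upoly_filtered, of t f t g] by (simp add: upoly_def)

lemmas upoly_add = filtered_functions.add[OF upoly_filtered]
lemmas upoly_const = filtered_functions.const[OF upoly_filtered]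
lemmas upoly_sum = filtered_functions.sum[OF upoly_filtered]
lemmas upoly_scale = filtered_functions.scale[OF upoly_filtered]

lemma disc_upoly:
  assumes "\<And>sp p q. p < dim_of m n l sp \<Longrightarrow> q < dim_of m n l sp \<Longrightarrow> upoly 1 (\<lambda>t. g t sp p q)"
  shows "upoly 1 (\<lambda>t. disc m n l (g t))"
  by (rule upoly_any[OF filtered_functions.disc_filtered[where T = g, OF upoly_filtered]], rule assms)

lemma sq_upoly:
  assumes "\<And>sp p q. p < dim_of m n l sp \<Longrightarrow> q < dim_of m n l sp \<Longrightarrow> upoly 1 (\<lambda>t. g t sp p q)"
    and "p < dim_of m n l sp" "q < dim_of m n l sp"
  shows "upoly 1 (\<lambda>t. sq (dim_of m n l sp) (g t sp) $$ (p, q))"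
  using assms(1)[OF assms(2,3)] assms(2,3) by simp

lemma detsp_upoly:
  assumes "\<And>sp p q. p < dim_of m n l sp \<Longrightarrow> q < dim_of m n l sp \<Longrightarrow> upoly 1 (\<lambda>t. g t sp p q)"
  shows "upoly 1 (\<lambda>t. detsp m n l (g t) sp)"
  unfolding detsp_def
  by (rule upoly_any[OF filtered_functions.det[OF upoly_filtered]], rule sq_simps(1), rule sq_upoly, rule assms)

lemma cof_upoly:
  assumes "\<And>sp p q. p < dim_of m n l sp \<Longrightarrow> q < dim_of m n l sp \<Longrightarrow> upoly 1 (\<lambda>t. g t sp p q)"
    and pq: "p < dim_of m n l sp" "q < dim_of m n l sp"
  shows "upoly 1 (\<lambda>t. cof m n l (g t) sp p q)"
proof -
  have d: "upoly 1 (\<lambda>t. detsp m n l (g t) sp)" for sp by (rule detsp_upoly, rule assms(1))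
  have "upoly 1 (\<lambda>t. codet m n l (g t) sp)"
    by (cases sp) (simp_all only: codet_def space.case, (rule upoly_mult[OF d d])+)
  moreover have "upoly 1 (\<lambda>t. adj_mat (sq (dim_of m n l sp) (g t sp)) $$ (p, q))"
    by (rule upoly_any[OF filtered_functions.adj[OF upoly_filtered _ _ pq]], rule sq_simps(1), rule sq_upoly, rule assms(1))
  ultimately have "upoly 1 (\<lambda>t. codet m n l (g t) sp * adj_mat (sq (dim_of m n l sp) (g t sp)) $$ (p, q))"
    by (rule upoly_mult)
  then show ?thesis using pq by (simp add: cof_def)
qed

lemma UNIV_space: "(UNIV :: space set) = {Input, State, Output}"
  using space.exhaust by auto

lemma UNIV_component: "(UNIV :: component set) = {Comp_A, Comp_B, Comp_C}"
  using component.exhaust by auto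

definition unit_tri :: "space \<times> nat \<times> nat \<Rightarrow> tri" where
  "unit_tri x = (\<lambda>sp p q. if (sp, p, q) = x then 1 else 0)"

definition tri_idx :: "nat \<Rightarrow> nat \<Rightarrow> nat \<Rightarrow> (space \<times> nat \<times> nat) set" where
  "tri_idx m n l = {(sp, p, q). p < dim_of m n l sp \<and> q < dim_of m n l sp}"

lemma finite_tri_idx: "finite (tri_idx m n l)"
proof (rule finite_subset)
  show "tri_idx m n l \<subseteq> UNIV \<times> {..<m + n + l} \<times> {..<m + n + l}"
    by (auto simp: tri_idx_def dim_of_def split: space.splits)
  show "finite ((UNIV :: space set) \<times> {..<m + n + l} \<times> {..<m + n + l})"
    by (simp add: UNIV_space)
qed

section \<open>The slice through the identity along a complement of the stabilizer algebra\<close>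

locale orbit_slice =
  fixes m n l :: nat and S :: system and d :: nat and F :: "nat \<Rightarrow> tri \<Rightarrow> complex" and w :: "nat \<Rightarrow> tri"
  assumes S: "S \<in> systems m n l"
    and linF: "\<And>k. k < d \<Longrightarrow> lin (F k)"
    and stab: "\<And>v. intw m n l S S v \<longleftrightarrow> (\<forall>k<d. F k v = 0)"
    and dual: "\<And>j k. j < d \<Longrightarrow> k < d \<Longrightarrow> F j (w k) = (if j = k then 1 else 0)"
begin

text \<open>A triple that vanishes at all indices in range intertwines \<open>S\<close> with itself,
  so every \<open>F k\<close> kills it: the functionals see only genuine matrix entries.\<close>

lemma F_cong:
  assumes "\<And>sp p q. p < dim_of m n l sp \<Longrightarrow> q < dim_of m n l sp \<Longrightarrow> u sp p q = v sp p q" and k: "k < d"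
  shows "F k u = F k v"
proof -
  have "intw m n l S S (\<lambda>sp p q. 1 * u sp p q + (-1) * v sp p q)"
    by (rule intw_zero) (simp add: assms(1))
  then have "F k (\<lambda>sp p q. 1 * u sp p q + (-1) * v sp p q) = 0" using stab k by blast
  then show ?thesis using linD[OF linF[OF k], of 1 u "-1" v] by simp
qed

text \<open>The \<open>F k\<close> are abstract functionals. This finite expansion is what makes
  them polynomial along polynomial curves of triples.\<close>

lemma F_expand:
  assumes k: "k < d"
  shows "F k v = (\<Sum>x\<in>tri_idx m n l. (case x of (sp, p, q) \<Rightarrow> v sp p q) * F k (unit_tri x))"
proof -
  let ?v = "\<lambda>sp p q. \<Sum>x\<in>tri_idx m n l. (case x of (sp, p, q) \<Rightarrow> v sp p q) * unit_tri x sp p q"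
  have "F k v = F k ?v"
  proof (rule F_cong[OF _ k])
    fix sp p q assume pq: "p < dim_of m n l sp" "q < dim_of m n l sp"
    have "?v sp p q = (\<Sum>x\<in>tri_idx m n l. if x = (sp, p, q) then v sp p q else 0)"
      by (rule sum.cong) (auto simp: unit_tri_def)
    then show "v sp p q = ?v sp p q" using pq finite_tri_idx by (simp add: tri_idx_def)
  qed
  also have "\<dots> = (\<Sum>x\<in>tri_idx m n l. (case x of (sp, p, q) \<Rightarrow> v sp p q) * F k (unit_tri x))"
    by (rule lin_sum[OF linF[OF k] finite_tri_idx])
  finally show ?thesis .
qed

lemma F_upoly:
  assumes "\<And>sp p q. p < dim_of m n l sp \<Longrightarrow> q < dim_of m n l sp \<Longrightarrow> upoly 1 (\<lambda>t. v t sp p q)" and k: "k < d"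
  shows "upoly 1 (\<lambda>t. F k (v t))"
  unfolding F_expand[OF k, of "v _"]
proof (rule upoly_sum)
  fix x assume x: "x \<in> tri_idx m n l"
  obtain sp p q where x': "x = (sp, p, q)" by (cases x)
  have "upoly 1 (\<lambda>t. v t sp p q)" using x by (intro assms(1)) (auto simp: x' tri_idx_def)
  then show "upoly 1 (\<lambda>t. (case x of (sp, p, q) \<Rightarrow> v t sp p q) * F k (unit_tri x))"
    unfolding x' prod.case by (rule upoly_mult[OF _ upoly_const])
qed

definition slice :: "(nat \<Rightarrow> complex) \<Rightarrow> tri" where
  "slice x = (\<lambda>sp p q. idm p q + (\<Sum>k<d. x k * w k sp p q))"

text \<open>For invertible \<open>g\<close>, a triple \<open>v\<close> lies in
  \<open>g * Stab\<close> iff all functionals vanish on \<open>cof g * v\<close>. This is the matrix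
  of that condition on the span of the \<open>w k\<close>; it is nonsingular iff the span meets
  \<open>g * Stab\<close> only in 0.\<close>

definition Kmat :: "tri \<Rightarrow> complex mat" where
  "Kmat g = mat d d (\<lambda>(j, k). F j (tcomp m n l (cof m n l g) (w k)))"

lemma Kmat_carrier: "Kmat g \<in> carrier_mat d d"
  by (simp add: Kmat_def)

lemma comp_cof_upoly:
  assumes "\<And>sp p q. p < dim_of m n l sp \<Longrightarrow> q < dim_of m n l sp \<Longrightarrow> upoly 1 (\<lambda>t. g t sp p q)"
    and pq: "p < dim_of m n l sp" "q < dim_of m n l sp"
  shows "upoly 1 (\<lambda>t. tcomp m n l (cof m n l (g t)) v sp p q)"
proof -
  have "upoly 1 (\<lambda>t. \<Sum>a<dim_of m n l sp. cof m n l (g t) sp p a * v sp a q)"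
  proof (rule upoly_sum, rule upoly_mult[OF _ upoly_const])
    fix a assume "a \<in> {..<dim_of m n l sp}"
    then show "upoly 1 (\<lambda>t. cof m n l (g t) sp p a)"
      by (intro cof_upoly[where g = g] assms(1) pq(1)) auto
  qed
  then show ?thesis using pq by (simp add: tcomp_def mm_def)
qed

lemma Kmat_entry_upoly:
  assumes "\<And>sp p q. p < dim_of m n l sp \<Longrightarrow> q < dim_of m n l sp \<Longrightarrow> upoly 1 (\<lambda>t. g t sp p q)"
    and jk: "j < d" "k < d"
  shows "upoly 1 (\<lambda>t. Kmat (g t) $$ (j, k))"
proof -
  have "upoly 1 (\<lambda>t. F j (tcomp m n l (cof m n l (g t)) (w k)))"
    by (rule F_upoly[OF _ jk(1)], rule comp_cof_upoly[where g = g], rule assms(1))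
  then show ?thesis using jk by (simp add: Kmat_def)
qed

lemma Kmat_det_upoly:
  assumes "\<And>sp p q. p < dim_of m n l sp \<Longrightarrow> q < dim_of m n l sp \<Longrightarrow> upoly 1 (\<lambda>t. g t sp p q)"
  shows "upoly 1 (\<lambda>t. det (Kmat (g t)))"
  by (rule upoly_any[OF filtered_functions.det[OF upoly_filtered]], rule Kmat_carrier, rule Kmat_entry_upoly[where g = g], rule assms)

lemma cof_one:
  assumes "\<And>sp p q. p < dim_of m n l sp \<Longrightarrow> q < dim_of m n l sp \<Longrightarrow> g sp p q = idm p q"
    and pq: "p < dim_of m n l sp" "q < dim_of m n l sp"
  shows "cof m n l g sp p q = idm p q"
proof -
  have "disc m n l g = 1" using disc_cong[of m n l g "\<lambda>sp. idm"] assms(1) disc_idm by simp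
  then have "mm (dim_of m n l sp) (cof m n l g sp) (g sp) p q = idm p q" using mm_cof(1)[OF pq] by simp
  moreover have "mm (dim_of m n l sp) (cof m n l g sp) (g sp) p q = mm (dim_of m n l sp) (cof m n l g sp) idm p q"
    by (rule mm_cong) (simp_all add: assms(1) pq)
  ultimately show ?thesis using mm_idm_right[OF pq(2)] by simp
qed

lemma comp_cof_one:
  assumes "\<And>sp p q. p < dim_of m n l sp \<Longrightarrow> q < dim_of m n l sp \<Longrightarrow> g sp p q = idm p q" and k: "k < d"
  shows "F k (tcomp m n l (cof m n l g) v) = F k v"
proof (rule F_cong[OF _ k])
  fix sp p q assume pq: "p < dim_of m n l sp" "q < dim_of m n l sp"
  have "mm (dim_of m n l sp) (cof m n l g sp) (v sp) p q = mm (dim_of m n l sp) idm (v sp) p q"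
    by (rule mm_cong) (simp_all add: cof_one[of g, OF assms(1)] pq)
  then show "tcomp m n l (cof m n l g) v sp p q = v sp p q" using pq by (simp add: tcomp_def mm_idm_left)
qed

lemma Kmat_one:
  assumes "\<And>sp p q. p < dim_of m n l sp \<Longrightarrow> q < dim_of m n l sp \<Longrightarrow> g sp p q = idm p q"
  shows "Kmat g = 1\<^sub>m d"
  by (rule eq_matI) (simp_all add: Kmat_def comp_cof_one[of g, OF assms] dual)

lemma F_comp_combo:
  assumes j: "j < d"
  shows "F j (tcomp m n l U (\<lambda>sp p q. c * u sp p q + (\<Sum>k<d. y k * w k sp p q))) =
    c * F j (tcomp m n l U u) + (\<Sum>k<d. y k * F j (tcomp m n l U (w k)))"
proof -
  let ?z = "\<lambda>sp p q. \<Sum>k<d. y k * tcomp m n l U (w k) sp p q"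
  have "tcomp m n l U (\<lambda>sp p q. c * u sp p q + (\<Sum>k<d. y k * w k sp p q)) =
    (\<lambda>sp p q. c * tcomp m n l U u sp p q + 1 * ?z sp p q)"
  proof (intro ext)
    fix sp p q
    have swap: "(\<Sum>a<D. U sp p a * (\<Sum>k<d. y k * w k sp a q)) = (\<Sum>k<d. y k * (\<Sum>a<D. U sp p a * w k sp a q))" for D
      unfolding sum_distrib_left by (subst sum.swap) (simp add: mult_ac)
    show "tcomp m n l U (\<lambda>sp p q. c * u sp p q + (\<Sum>k<d. y k * w k sp p q)) sp p q =
      c * tcomp m n l U u sp p q + 1 * ?z sp p q"
    proof (cases "p < dim_of m n l sp \<and> q < dim_of m n l sp")
      case True
      have "(\<Sum>a<D. U sp p a * (c * u sp a q + (\<Sum>k<d. y k * w k sp a q))) =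
          c * (\<Sum>a<D. U sp p a * u sp a q) + (\<Sum>k<d. y k * (\<Sum>a<D. U sp p a * w k sp a q))" for D
        unfolding swap[symmetric] sum_distrib_left[of c] distrib_left sum.distrib by (simp add: mult_ac)
      then show ?thesis using True by (simp add: tcomp_def mm_def)
    next
      case False
      then show ?thesis unfolding tcomp_def if_not_P[OF False] by simp
    qed
  qed
  then show ?thesis
    using linD[OF linF[OF j], of c "tcomp m n l U u" 1 ?z]
      lin_sum[OF linF[OF j], of "{..<d}" y "\<lambda>k. tcomp m n l U (w k)"] by simp
qed

end

context orbit_slice
begin

text \<open>A scalar multiple of an intertwiner is again one, so dividing by \<open>c\<close> moves
  \<tau> into the slice without changing the image of \<open>S\<close>.\<close>

lemma slice_act:
  assumes t: "intw m n l S S' \<tau>" and d: "disc m n l \<tau> \<noteq> 0" and S': "S' \<in> systems m n l"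
    and \<tau>: "\<And>sp p q. p < dim_of m n l sp \<Longrightarrow> q < dim_of m n l sp \<Longrightarrow> \<tau> sp p q = c * idm p q + (\<Sum>k<d. y k * w k sp p q)"
    and c: "c \<noteq> 0"
  shows "disc m n l (slice (\<lambda>k. y k / c)) \<noteq> 0" "act (triple m n l (slice (\<lambda>k. y k / c))) S = S'"
proof -
  let ?s = "slice (\<lambda>k. y k / c)"
  have eq: "c * ?s sp p q = \<tau> sp p q" if "p < dim_of m n l sp" "q < dim_of m n l sp" for sp p q
    using c by (simp add: slice_def \<tau>[OF that] distrib_left sum_distrib_left)
  have "disc m n l (\<lambda>sp p q. c * ?s sp p q) = disc m n l \<tau>" by (rule disc_cong) (simp add: eq)
  then show ds: "disc m n l ?s \<noteq> 0" using d by (auto simp: disc_scale)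
  have "?s sp p q = (1 / c) * \<tau> sp p q + 0 * \<tau> sp p q" if "p < dim_of m n l sp" "q < dim_of m n l sp" for sp p q
    using eq[OF that] c by (simp add: field_simps)
  then have "intw m n l S S' ?s" by (rule intw_cong[OF _ intw_lin[OF t t]])
  then show "act (triple m n l ?s) S = S'" using act_iff_intw[OF S S' ds] by blast
qed

text \<open>The coset \<open>h * Stab\<close> need not meet the slice. Along the line from 1 to
  \<open>h\<close> the cosets do meet it for all but finitely many parameters, so the pulled back
  polynomial vanishes identically on the line, and in particular at its end
  \<open>h\<close>.\<close>

lemma slice_dense:
  assumes h: "disc m n l h \<noteq> 0" and f: "poly_deg m n l e f"
    and van: "\<And>x. disc m n l (slice x) \<noteq> 0 \<Longrightarrow> f (act (triple m n l (slice x)) S) = 0"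
  shows "f (act (triple m n l h) S) = 0"
proof -
  define g :: "complex \<Rightarrow> tri" where "g t = (\<lambda>sp p q. idm p q + t * (h sp p q - idm p q))" for t
  have gu: "upoly 1 (\<lambda>t. g t sp p q)" for sp p q
    unfolding g_def by (rule upoly_add[OF upoly_const upoly_mult[OF upoly_id upoly_const]])
  have g0: "g 0 sp p q = idm p q" for sp p q by (simp add: g_def)
  have g1: "g 1 = h" by (intro ext) (simp add: g_def)
  \<comment> \<open>Sought is an element \<open>\<delta> * 1 + \<Sum>k. y k * w k\<close> of
    \<open>g t * Stab\<close>. Applying \<open>cof (g t)\<close> and then the functionals gives a
    linear system for \<open>y\<close> with matrix \<open>Kmat (g t)\<close> and right side
    \<open>\<delta> * b\<close>. With the determinant as \<delta>, Cramer's rule solves it by a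
    \<open>y\<close> that is polynomial in \<open>t\<close>.\<close>
  define b where "b t j = - F j (tcomp m n l (cof m n l (g t)) (\<lambda>sp. idm))" for t j
  define \<delta> where "\<delta> t = det (Kmat (g t))" for t
  define y where "y t k = (\<Sum>j<d. adj_mat (Kmat (g t)) $$ (k, j) * b t j)" for t k
  define \<tau> :: "complex \<Rightarrow> tri" where "\<tau> t = (\<lambda>sp p q. \<delta> t * idm p q + (\<Sum>k<d. y t k * w k sp p q))" for t
  have bu: "upoly 1 (\<lambda>t. b t j)" if "j < d" for j
  proof -
    have "upoly 1 (\<lambda>t. F j (tcomp m n l (cof m n l (g t)) (\<lambda>sp. idm)))"
      by (rule F_upoly[OF _ that], rule comp_cof_upoly[where g = g], rule gu)
    from upoly_scale[OF this, of "-1"] show ?thesis by (simp add: b_def)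
  qed
  have \<delta>u: "upoly 1 \<delta>" unfolding \<delta>_def by (rule Kmat_det_upoly[where g = g], rule gu)
  have yu: "upoly 1 (\<lambda>t. y t k)" if k: "k < d" for k
    unfolding y_def
  proof (rule upoly_sum)
    fix j assume "j \<in> {..<d}"
    then have j: "j < d" by simp
    have "upoly 1 (\<lambda>t. adj_mat (Kmat (g t)) $$ (k, j))"
      by (rule upoly_any[OF filtered_functions.adj[OF upoly_filtered _ _ k j]], rule Kmat_carrier,
          rule Kmat_entry_upoly[where g = g], rule gu)
    then show "upoly 1 (\<lambda>t. adj_mat (Kmat (g t)) $$ (k, j) * b t j)" by (rule upoly_mult[OF _ bu[OF j]])
  qed
  have \<tau>u: "upoly 1 (\<lambda>t. \<tau> t sp p q)" for sp p q
    unfolding \<tau>_def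
  proof (rule upoly_add[OF upoly_mult[OF \<delta>u upoly_const]], rule upoly_sum)
    fix k assume "k \<in> {..<d}"
    then show "upoly 1 (\<lambda>t. y t k * w k sp p q)" by (intro upoly_mult[OF yu upoly_const]) simp
  qed
  \<comment> \<open>Wherever \<open>P\<close> is nonzero, the coset meets the slice in an invertible
    triple. At \<open>t = 0\<close> all three factors are 1, because \<open>b\<close> vanishes there
    and \<open>\<tau> 0\<close> is the identity.\<close>
  define P where "P t = disc m n l (g t) * \<delta> t * disc m n l (\<tau> t)" for t
  have dgu: "upoly 1 (\<lambda>t. disc m n l (g t))" by (rule disc_upoly[where g = g], rule gu)
  have d\<tau>u: "upoly 1 (\<lambda>t. disc m n l (\<tau> t))" by (rule disc_upoly[where g = \<tau>], rule \<tau>u)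
  have Pu: "upoly 1 P" unfolding P_def by (rule upoly_mult[OF upoly_mult[OF dgu \<delta>u] d\<tau>u])
  have P0: "P 0 \<noteq> 0"
  proof -
    have dg: "disc m n l (g 0) = 1" using disc_cong[of m n l "g 0" "\<lambda>sp. idm"] g0 disc_idm by simp
    have d0: "\<delta> 0 = 1" unfolding \<delta>_def using Kmat_one[of "g 0"] g0 by simp
    have "b 0 j = 0" if "j < d" for j
    proof -
      have "F j (tcomp m n l (cof m n l (g 0)) (\<lambda>sp. idm)) = F j (\<lambda>sp. idm)"
        by (rule comp_cof_one[OF g0 that])
      also have "\<dots> = 0" using stab intw_idm that by blast
      finally show ?thesis by (simp add: b_def)
    qed
    then have "y 0 k = 0" for k by (simp add: y_def)
    then have "\<tau> 0 = (\<lambda>sp. idm)" by (intro ext) (simp add: \<tau>_def d0)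
    then show ?thesis using dg d0 disc_idm by (simp add: P_def)
  qed
  have "\<exists>r. upoly (Suc (m + n + l) * e) r \<and> (\<forall>t. disc m n l (g t) \<noteq> 0 \<longrightarrow>
     f (act (triple m n l (g t)) S) * disc m n l (g t) ^ e = r t)"
    by (rule filtered_functions.act_polynomial[where T = g, OF upoly_filtered _ S f], rule gu)
  then obtain r where r: "upoly (Suc (m + n + l) * e) r" "\<forall>t. disc m n l (g t) \<noteq> 0 \<longrightarrow>
     f (act (triple m n l (g t)) S) * disc m n l (g t) ^ e = r t" by (elim exE conjE) (rule that)
  have "r t = 0" if Pt: "P t \<noteq> 0" for t
  proof -
    let ?U = "cof m n l (g t)" and ?S' = "act (triple m n l (g t)) S"
    have nz: "disc m n l (g t) \<noteq> 0" "\<delta> t \<noteq> 0" "disc m n l (\<tau> t) \<noteq> 0" using Pt by (auto simp: P_def)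
    note S' = act_systems[OF S nz(1)]
    have "F j (tcomp m n l ?U (\<tau> t)) = 0" if j: "j < d" for j
    proof -
      have "(\<Sum>k<d. y t k * F j (tcomp m n l ?U (w k))) = (\<Sum>k<d. \<Sum>i<d. Kmat (g t) $$ (j, k) * adj_mat (Kmat (g t)) $$ (k, i) * b t i)"
        using j by (intro sum.cong) (simp_all add: y_def sum_distrib_left sum_distrib_right Kmat_def mult_ac)
      also have "\<dots> = (\<Sum>i<d. (\<Sum>k<d. Kmat (g t) $$ (j, k) * adj_mat (Kmat (g t)) $$ (k, i)) * b t i)"
        unfolding sum_distrib_right by (rule sum.swap)
      also have "\<dots> = (\<Sum>i<d. (Kmat (g t) * adj_mat (Kmat (g t))) $$ (j, i) * b t i)"
        using j Kmat_carrier[of "g t"] adj_mat(1)[OF Kmat_carrier[of "g t"]]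
        by (intro sum.cong) (simp_all add: scalar_prod_def atLeast0LessThan)
      also have "\<dots> = (\<Sum>i<d. if i = j then \<delta> t * b t i else 0)"
        unfolding adj_mat(2)[OF Kmat_carrier[of "g t"]] using j
        by (intro sum.cong) (auto simp: \<delta>_def)
      also have "\<dots> = \<delta> t * b t j" using j by simp
      finally show ?thesis unfolding \<tau>_def F_comp_combo[OF j] by (simp add: b_def)
    qed
    then have "intw m n l S S (tcomp m n l ?U (\<tau> t))" using stab by blast
    from intw_comp[OF this intw_act[OF S nz(1)]]
    have 1: "intw m n l S ?S' (tcomp m n l (g t) (tcomp m n l ?U (\<tau> t)))" .
    \<comment> \<open>Multiplication by \<open>g t\<close> undoes the scaled inverse: up to the
      scalar \<open>disc (g t)\<close>, the composite is \<tau> itself, which therefore carries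
      \<open>S\<close> to the same point as \<open>g t\<close>.\<close>
    have 2: "tcomp m n l (g t) (tcomp m n l ?U (\<tau> t)) sp p q = disc m n l (g t) * \<tau> t sp p q"
      if pq: "p < dim_of m n l sp" "q < dim_of m n l sp" for sp p q
    proof -
      let ?k = "dim_of m n l sp"
      have "tcomp m n l (g t) (tcomp m n l ?U (\<tau> t)) sp p q = mm ?k (g t sp) (tcomp m n l ?U (\<tau> t) sp) p q"
        using pq by (simp add: tcomp_def)
      also have "\<dots> = mm ?k (g t sp) (mm ?k (?U sp) (\<tau> t sp)) p q"
        by (rule mm_cong) (simp_all add: tcomp_def pq)
      also have "\<dots> = mm ?k (mm ?k (g t sp) (?U sp)) (\<tau> t sp) p q" by (simp only: mm_assoc)
      also have "\<dots> = mm ?k (\<lambda>a b. disc m n l (g t) * idm a b) (\<tau> t sp) p q"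
        by (rule mm_cong) (simp_all add: mm_cof pq)
      also have "\<dots> = disc m n l (g t) * mm ?k idm (\<tau> t sp) p q"
        by (simp add: mm_def sum_distrib_left mult_ac)
      finally show ?thesis by (simp add: mm_idm_left pq)
    qed
    have "intw m n l S ?S' (\<tau> t)"
    proof (rule intw_cong[OF _ intw_lin[OF 1 1, of "1 / disc m n l (g t)" 0]])
      fix sp p q assume "p < dim_of m n l sp" "q < dim_of m n l sp"
      from 2[OF this] show "\<tau> t sp p q = 1 / disc m n l (g t) * tcomp m n l (g t) (tcomp m n l ?U (\<tau> t)) sp p q +
          0 * tcomp m n l (g t) (tcomp m n l ?U (\<tau> t)) sp p q" using nz(1) by simp
    qed
    from slice_act[OF this nz(3) S' _ nz(2), of "y t"]
    have "disc m n l (slice (\<lambda>k. y t k / \<delta> t)) \<noteq> 0" "act (triple m n l (slice (\<lambda>k. y t k / \<delta> t))) S = ?S'"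
      by (simp_all add: \<tau>_def)
    then have "f ?S' = 0" using van[of "\<lambda>k. y t k / \<delta> t"] by simp
    then show ?thesis using r(2)[rule_format, OF nz(1)] by simp
  qed
  from upoly_eq_0[OF r(1) Pu P0 this] have "r 1 = 0" .
  then show ?thesis using r(2)[rule_format, of 1] h by (simp add: g1)
qed

lemma slice_mpoly:
  "mpoly_fun d 1 (\<lambda>x. slice x sp p q)"
  unfolding slice_def
proof (rule mpoly_fun_add[OF mpoly_fun_const], rule mpoly_fun_sum)
  fix k assume "k \<in> {..<d}"
  then have "mpoly_fun d 1 (\<lambda>x. x k)" by (intro mpoly_fun_coord) simp
  from filtered_functions.scale[OF mpoly_filtered, OF this, of "w k sp p q"]
  show "mpoly_fun d 1 (\<lambda>x. x k * w k sp p q)" by (simp add: mult.commute)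
qed simp

lemma orbit_systems: "equiv_class m n l S \<subseteq> systems m n l"
  unfolding equiv_class_eq using act_systems[OF S] by blast

text \<open>A longer chain would provide more independent functions on the orbit than there are
  monomials for their pullbacks to the slice. A linear relation between the pullbacks holds at the
  slice points, and by density on the whole orbit, against independence.\<close>

lemma chain_length_le:
  assumes Z: "\<And>i. i \<le> k \<Longrightarrow> closedin (subtopology (zariski_topology m n l) (equiv_class m n l S)) (Z i)"
    and irr: "\<And>i. i \<le> k \<Longrightarrow> irreducible_space (subtopology (zariski_topology m n l) (Z i))"
    and strict: "\<And>i. i < k \<Longrightarrow> Z i \<subset> Z (Suc i)"
  shows "k \<le> d"
proof (rule ccontr)
  assume "\<not> k \<le> d"
  then have dk: "d < k" by simp
  have "\<exists>e. \<forall>s. \<exists>F. indep_on (equiv_class m n l S) ((s + k) choose k) F \<and>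
    (\<forall>i<(s + k) choose k. poly_deg m n l (e * s) (F i))"
    by (rule chain_growth[where Z = Z and k = k, OF orbit_systems Z irr strict])
  then obtain e where e: "\<forall>s. \<exists>F. indep_on (equiv_class m n l S) ((s + k) choose k) F \<and>
    (\<forall>i<(s + k) choose k. poly_deg m n l (e * s) (F i))" by (elim exE)
  from choose_exceeds_power[OF dk, of "Suc (m + n + l) * e"]
  obtain s where s: "(Suc (m + n + l) * e * s + 1) ^ d < (s + k) choose k" by (elim exE)
  let ?N = "(s + k) choose k" and ?O = "equiv_class m n l S"
  from e[rule_format, of s] obtain f where f: "indep_on ?O ?N f" "\<forall>i<?N. poly_deg m n l (e * s) (f i)"
    by (elim exE conjE) (rule that)
  have "\<forall>i. \<exists>g. i < ?N \<longrightarrow> mpoly_fun d (Suc (m + n + l) * (e * s)) g \<and> (\<forall>x. disc m n l (slice x) \<noteq> 0 \<longrightarrow>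
     f i (act (triple m n l (slice x)) S) * disc m n l (slice x) ^ (e * s) = g x)"
  proof
    fix i
    show "\<exists>g. i < ?N \<longrightarrow> mpoly_fun d (Suc (m + n + l) * (e * s)) g \<and> (\<forall>x. disc m n l (slice x) \<noteq> 0 \<longrightarrow>
     f i (act (triple m n l (slice x)) S) * disc m n l (slice x) ^ (e * s) = g x)"
    proof (cases "i < ?N")
      case True
      have "\<exists>g. mpoly_fun d (Suc (m + n + l) * (e * s)) g \<and> (\<forall>x. disc m n l (slice x) \<noteq> 0 \<longrightarrow>
         f i (act (triple m n l (slice x)) S) * disc m n l (slice x) ^ (e * s) = g x)"
        by (rule filtered_functions.act_polynomial[where T = slice, OF mpoly_filtered _ S f(2)[rule_format, OF True]],
            rule slice_mpoly)
      then show ?thesis by simp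
    qed simp
  qed
  from choice[OF this] obtain g where g: "\<forall>i. i < ?N \<longrightarrow> mpoly_fun d (Suc (m + n + l) * (e * s)) (g i) \<and>
     (\<forall>x. disc m n l (slice x) \<noteq> 0 \<longrightarrow>
     f i (act (triple m n l (slice x)) S) * disc m n l (slice x) ^ (e * s) = g i x)" by (elim exE)
  have N: "(Suc (m + n + l) * (e * s) + 1) ^ d < ?N" using s by (simp only: mult.assoc)
  have gm: "mpoly_fun d (Suc (m + n + l) * (e * s)) (g i)" if "i < ?N" for i
    using g[rule_format, OF that] by (rule conjunct1)
  obtain c where c: "\<exists>i<?N. c i \<noteq> 0" "\<forall>x. (\<Sum>i<?N. c i * g i x) = 0"
    by (rule mpoly_fun_dependent[OF gm N])
  let ?f = "\<lambda>S'. \<Sum>i<?N. c i * f i S'"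
  have fdeg: "poly_deg m n l (e * s) ?f" by (rule poly_deg_sum) (simp add: f(2))
  have "?f (act (triple m n l (slice x)) S) = 0" if x: "disc m n l (slice x) \<noteq> 0" for x
  proof -
    have "?f (act (triple m n l (slice x)) S) * disc m n l (slice x) ^ (e * s) = (\<Sum>i<?N. c i * g i x)"
      unfolding sum_distrib_right
    proof (rule sum.cong[OF refl])
      fix i assume "i \<in> {..<?N}"
      then have "f i (act (triple m n l (slice x)) S) * disc m n l (slice x) ^ (e * s) = g i x"
        using g x by simp
      then show "c i * f i (act (triple m n l (slice x)) S) * disc m n l (slice x) ^ (e * s) = c i * g i x"
        by (simp only: mult.assoc)
    qed
    then show ?thesis using c(2) x by simp
  qed
  from slice_dense[OF _ fdeg this]
  have "\<forall>x\<in>?O. ?f x = 0" unfolding equiv_class_eq by auto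
  then have "\<forall>i<?N. c i = 0" using f(1)[unfolded indep_on_def, THEN spec[of _ c]] by simp
  then show False using c(1) by blast
qed

lemma slice_0: "slice (\<lambda>k. 0) = (\<lambda>sp. idm)"
  by (intro ext) (simp add: slice_def)

lemma slice_point_orbit:
  "disc m n l (slice x) \<noteq> 0 \<Longrightarrow> act (triple m n l (slice x)) S \<in> equiv_class m n l S"
  unfolding equiv_class_eq by blast

lemma act_one: "act (triple m n l (\<lambda>sp. idm)) S = S"
  using act_iff_intw[OF S S] disc_idm intw_idm by (metis zero_neq_one)

text \<open>The closure, relative to the orbit, of the image of those slice points whose coordinates
  from \<open>i\<close> on are zero, written as the common zero set of the polynomials vanishing on
  that image.\<close>

definition chain_set :: "nat \<Rightarrow> system set" where
  "chain_set i = {S' \<in> equiv_class m n l S. \<forall>f\<in>polynomial_functions m n l.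
     (\<forall>x. (\<forall>k. i \<le> k \<longrightarrow> x k = 0) \<and> disc m n l (slice x) \<noteq> 0 \<longrightarrow> f (act (triple m n l (slice x)) S) = 0) \<longrightarrow> f S' = 0}"

lemma chain_set_slice:
  assumes "\<forall>k. i \<le> k \<longrightarrow> x k = 0" "disc m n l (slice x) \<noteq> 0"
  shows "act (triple m n l (slice x)) S \<in> chain_set i"
  unfolding chain_set_def using slice_point_orbit[OF assms(2)] assms by simp

lemma chain_set_closed:
  "closedin (subtopology (zariski_topology m n l) (equiv_class m n l S)) (chain_set i)"
  unfolding closedin_zariski_subtopology[OF orbit_systems]
proof (intro conjI ballI)
  show "chain_set i \<subseteq> equiv_class m n l S" by (auto simp: chain_set_def)
  fix S' assume S': "S' \<in> equiv_class m n l S - chain_set i"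
  then have "\<not> (\<forall>f\<in>polynomial_functions m n l.
     (\<forall>x. (\<forall>k. i \<le> k \<longrightarrow> x k = 0) \<and> disc m n l (slice x) \<noteq> 0 \<longrightarrow> f (act (triple m n l (slice x)) S) = 0) \<longrightarrow> f S' = 0)"
    by (simp add: chain_set_def)
  then obtain f where f: "f \<in> polynomial_functions m n l"
    "\<forall>x. (\<forall>k. i \<le> k \<longrightarrow> x k = 0) \<and> disc m n l (slice x) \<noteq> 0 \<longrightarrow> f (act (triple m n l (slice x)) S) = 0" "f S' \<noteq> 0"
    unfolding Set.bex_simps(8)[symmetric] Set.ball_simps not_imp by (elim bexE conjE) (rule that)
  have "\<forall>y\<in>chain_set i. f y = 0"
  proof
    fix y assume "y \<in> chain_set i"
    then have "\<forall>f\<in>polynomial_functions m n l.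
     (\<forall>x. (\<forall>k. i \<le> k \<longrightarrow> x k = 0) \<and> disc m n l (slice x) \<noteq> 0 \<longrightarrow> f (act (triple m n l (slice x)) S) = 0) \<longrightarrow> f y = 0"
      by (simp add: chain_set_def)
    from this[THEN bspec, OF f(1), THEN mp, OF f(2)] show "f y = 0" .
  qed
  then show "\<exists>f\<in>polynomial_functions m n l. (\<forall>y\<in>chain_set i. f y = 0) \<and> f S' \<noteq> 0"
    using f(1,3) by (intro bexI[of _ f] conjI)
qed

lemma slice_line_upoly: "upoly 1 (\<lambda>t. slice (\<lambda>k. a k + t * b k) sp p q)"
  unfolding slice_def
proof (rule upoly_add[OF upoly_const], rule upoly_sum, rule upoly_mult[OF _ upoly_const])
  fix k
  show "upoly 1 (\<lambda>t. a k + t * b k)"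
    by (rule upoly_add[OF upoly_const upoly_mult[OF upoly_id upoly_const]])
qed

text \<open>If neither polynomial vanishes on the image, pick a parameter at which each is nonzero.
  On the line joining the two parameters both become nonzero polynomials in one variable, up to
  powers of \<open>disc\<close>, and their product cannot vanish.\<close>

lemma chain_set_irreducible:
  "irreducible_space (subtopology (zariski_topology m n l) (chain_set i))"
proof -
  have sub: "chain_set i \<subseteq> systems m n l" using orbit_systems by (auto simp: chain_set_def)
  show ?thesis unfolding irreducible_zariski_iff[OF sub]
  proof (intro conjI ballI impI)
    have "S \<in> chain_set i" using chain_set_slice[of i "\<lambda>k. 0"] by (simp add: slice_0 disc_idm act_one)
    then show "chain_set i \<noteq> {}" by blast
    fix f g assume f: "f \<in> polynomial_functions m n l" and g: "g \<in> polynomial_functions m n l"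
      and fg: "\<forall>x\<in>chain_set i. f x * g x = 0"
    let ?ok = "\<lambda>x. (\<forall>k. i \<le> k \<longrightarrow> x k = 0) \<and> disc m n l (slice x) \<noteq> 0"
    let ?\<phi> = "\<lambda>x. act (triple m n l (slice x)) S"
    have zero: "(\<forall>y\<in>chain_set i. h y = 0)" if h: "h \<in> polynomial_functions m n l" and "\<forall>x. ?ok x \<longrightarrow> h (?\<phi> x) = 0" for h
    proof
      fix y assume "y \<in> chain_set i"
      then have "\<forall>f\<in>polynomial_functions m n l. (\<forall>x. ?ok x \<longrightarrow> f (?\<phi> x) = 0) \<longrightarrow> f y = 0"
        by (simp add: chain_set_def)
      from this[THEN bspec, OF that(1), THEN mp, OF that(2)] show "h y = 0" .
    qed
    show "(\<forall>x\<in>chain_set i. f x = 0) \<or> (\<forall>x\<in>chain_set i. g x = 0)"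
    proof (rule ccontr)
      assume *: "\<not> ((\<forall>x\<in>chain_set i. f x = 0) \<or> (\<forall>x\<in>chain_set i. g x = 0))"
      obtain x where x: "?ok x" "f (?\<phi> x) \<noteq> 0" using * zero[OF f] by metis
      obtain y where y: "?ok y" "g (?\<phi> y) \<noteq> 0" using * zero[OF g] by metis
      define L where "L t = (\<lambda>k. x k + t * (y k - x k))" for t
      have L0: "L 0 = x" and L1: "L 1 = y" by (auto simp: L_def)
      have Lu: "upoly 1 (\<lambda>t. slice (L t) sp p q)" for sp p q unfolding L_def by (rule slice_line_upoly)
      have Ls: "\<forall>k. i \<le> k \<longrightarrow> L t k = 0" for t using x(1) y(1) by (simp add: L_def)
      have du: "upoly 1 (\<lambda>t. disc m n l (slice (L t)))"
        by (rule disc_upoly[where g = "\<lambda>t. slice (L t)"], rule Lu)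
      have ex: "\<exists>e r. upoly 1 r \<and> (\<forall>t. disc m n l (slice (L t)) \<noteq> 0 \<longrightarrow>
        h (?\<phi> (L t)) * disc m n l (slice (L t)) ^ e = r t)" if "h \<in> polynomial_functions m n l" for h
      proof -
        from polynomial_poly_deg[OF that] obtain e where e: "poly_deg m n l e h" by (elim exE)
        have "\<exists>r. upoly (Suc (m + n + l) * e) r \<and> (\<forall>t. disc m n l (slice (L t)) \<noteq> 0 \<longrightarrow>
          h (?\<phi> (L t)) * disc m n l (slice (L t)) ^ e = r t)"
          by (rule filtered_functions.act_polynomial[where T = "\<lambda>t. slice (L t)", OF upoly_filtered _ S e], rule Lu)
        then show ?thesis by (elim exE conjE) (rule exI, rule exI, rule conjI, rule upoly_any)
      qed
      from ex[OF f] obtain e r where r: "upoly 1 r" "\<forall>t. disc m n l (slice (L t)) \<noteq> 0 \<longrightarrow>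
        f (?\<phi> (L t)) * disc m n l (slice (L t)) ^ e = r t" by (elim exE conjE) (rule that)
      from ex[OF g] obtain e' r' where r': "upoly 1 r'" "\<forall>t. disc m n l (slice (L t)) \<noteq> 0 \<longrightarrow>
        g (?\<phi> (L t)) * disc m n l (slice (L t)) ^ e' = r' t" by (elim exE conjE) (rule that)
      have r0: "r 0 \<noteq> 0" using r(2)[rule_format, of 0] x by (auto simp: L0)
      have r1: "r' 1 \<noteq> 0" using r'(2)[rule_format, of 1] y by (auto simp: L1)
      have "r t * r' t = 0" if t: "disc m n l (slice (L t)) \<noteq> 0" for t
      proof -
        have "f (?\<phi> (L t)) * g (?\<phi> (L t)) = 0"
          using fg chain_set_slice[OF Ls t] by blast
        then show ?thesis using r(2)[rule_format, OF t] r'(2)[rule_format, OF t] by auto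
      qed
      then have rr: "r t * r' t = 0" for t
        using upoly_eq_0[OF upoly_mult[OF r(1) r'(1)] du, of 0] x by (simp add: L0)
      have "r' t = 0" if "r t \<noteq> 0" for t using rr[of t] that by simp
      from upoly_eq_0[OF r'(1) r(1) r0 this] have "r' 1 = 0" .
      then show False using r1 by simp
    qed
  qed
qed

lemma chain_set_mono: "chain_set i \<subseteq> chain_set (Suc i)"
proof
  fix y assume y: "y \<in> chain_set i"
  then have y': "\<forall>f\<in>polynomial_functions m n l. (\<forall>x. (\<forall>k. i \<le> k \<longrightarrow> x k = 0) \<and> disc m n l (slice x) \<noteq> 0 \<longrightarrow>
      f (act (triple m n l (slice x)) S) = 0) \<longrightarrow> f y = 0" by (simp add: chain_set_def)
  have "f y = 0" if f: "f \<in> polynomial_functions m n l"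
    and van: "\<forall>x. (\<forall>k. Suc i \<le> k \<longrightarrow> x k = 0) \<and> disc m n l (slice x) \<noteq> 0 \<longrightarrow> f (act (triple m n l (slice x)) S) = 0" for f
  proof (rule y'[THEN bspec, OF f, THEN mp], intro allI impI)
    fix x assume "(\<forall>k. i \<le> k \<longrightarrow> x k = 0) \<and> disc m n l (slice x) \<noteq> 0"
    then show "f (act (triple m n l (slice x)) S) = 0" using van[rule_format, of x] by simp
  qed
  then show "y \<in> chain_set (Suc i)" using y by (simp add: chain_set_def)
qed

end

section \<open>Gram determinants as polynomial tests for the existence of an intertwiner\<close>

lemma polynomial_functions_filtered: "filtered_functions (\<lambda>_ f. f \<in> polynomial_functions m n l)"
proof
  show "(\<lambda>_. c) \<in> polynomial_functions m n l" for c by (rule polynomial_functions.const)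
  show "(\<lambda>x. f x + g x) \<in> polynomial_functions m n l"
    if "f \<in> polynomial_functions m n l" "g \<in> polynomial_functions m n l" for f g
    using that by (rule polynomial_functions.add)
  show "(\<lambda>x. f x * g x) \<in> polynomial_functions m n l"
    if "f \<in> polynomial_functions m n l" "g \<in> polynomial_functions m n l" for f g
    using that by (rule polynomial_functions.mult)
qed

lemma ent_polynomial:
  assumes "p < dim_of m n l (row_space N)" "q < dim_of m n l (col_space N)"
  shows "(\<lambda>S. ent S N p q) \<in> polynomial_functions m n l"
proof (cases N)
  case Comp_A
  then show ?thesis unfolding ent_def using assms by (simp add: polynomial_functions.coord_A)
next
  case Comp_B
  then show ?thesis unfolding ent_def using assms by (simp add: polynomial_functions.coord_B)
next
  case Comp_C
  then show ?thesis unfolding ent_def using assms by (simp add: polynomial_functions.coord_C)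
qed

definition sys_idx :: "nat \<Rightarrow> nat \<Rightarrow> nat \<Rightarrow> (component \<times> nat \<times> nat) set" where
  "sys_idx m n l = {(N, p, q). p < dim_of m n l (row_space N) \<and> q < dim_of m n l (col_space N)}"

lemma finite_sys_idx: "finite (sys_idx m n l)"
proof (rule finite_subset)
  show "sys_idx m n l \<subseteq> UNIV \<times> {..<m + n + l} \<times> {..<m + n + l}"
    by (auto simp: sys_idx_def dim_of_def split: space.splits)
  show "finite ((UNIV :: component set) \<times> {..<m + n + l} \<times> {..<m + n + l})"
    by (simp add: UNIV_component)
qed

text \<open>The failure of \<open>intw\<close> at a single position: linear in \<open>u\<close>, and
  polynomial in \<open>S'\<close> for fixed \<open>u\<close>. With \<open>S' = S\<close> it is also
  the linear condition that a reduced entry imposes on a triple.\<close>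

definition defect :: "nat \<Rightarrow> nat \<Rightarrow> nat \<Rightarrow> system \<Rightarrow> system \<Rightarrow> tri \<Rightarrow> component \<times> nat \<times> nat \<Rightarrow> complex" where
  "defect m n l S S' u x = (case x of (N, p, q) \<Rightarrow>
     mm (dim_of m n l (row_space N)) (u (row_space N)) (ent S N) p q -
     mm (dim_of m n l (col_space N)) (ent S' N) (u (col_space N)) p q)"

lemma intw_defect: "intw m n l S S' u \<longleftrightarrow> (\<forall>x\<in>sys_idx m n l. defect m n l S S' u x = 0)"
  unfolding intw_def sys_idx_def defect_def by auto

lemma defect_sum:
  "defect m n l S S' (\<lambda>sp p q. \<Sum>b<r. y b * u b sp p q) x = (\<Sum>b<r. y b * defect m n l S S' (u b) x)"
proof -
  obtain N p q where x: "x = (N, p, q)" by (cases x)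
  have 1: "mm k (\<lambda>p q. \<Sum>b<r. y b * u b sp p q) X p q = (\<Sum>b<r. y b * mm k (u b sp) X p q)" for k sp X
    unfolding mm_def sum_distrib_left sum_distrib_right by (subst sum.swap) (simp add: mult_ac)
  have 2: "mm k X (\<lambda>p q. \<Sum>b<r. y b * u b sp p q) p q = (\<Sum>b<r. y b * mm k X (u b sp) p q)" for k sp X
    unfolding mm_def sum_distrib_left by (subst sum.swap) (simp add: mult_ac)
  show ?thesis unfolding x defect_def prod.case 1 2 by (simp add: sum_subtractf right_diff_distrib)
qed

lemma defect_polynomial:
  assumes "x \<in> sys_idx m n l"
  shows "(\<lambda>S'. defect m n l S S' u x) \<in> polynomial_functions m n l"
proof -
  obtain N p q where x: "x = (N, p, q)" by (cases x)
  have pq: "p < dim_of m n l (row_space N)" "q < dim_of m n l (col_space N)"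
    using assms by (auto simp: x sys_idx_def)
  have "(\<lambda>S'. \<Sum>b<dim_of m n l (col_space N). ent S' N p b * (- u (col_space N) b q)) \<in> polynomial_functions m n l"
  proof (rule filtered_functions.sum[OF polynomial_functions_filtered])
    fix b assume "b \<in> {..<dim_of m n l (col_space N)}"
    then have "(\<lambda>S'. ent S' N p b) \<in> polynomial_functions m n l" by (intro ent_polynomial pq) simp
    then show "(\<lambda>S'. ent S' N p b * (- u (col_space N) b q)) \<in> polynomial_functions m n l"
      by (rule polynomial_functions.mult[OF _ polynomial_functions.const])
  qed
  then have "(\<lambda>S'. mm (dim_of m n l (row_space N)) (u (row_space N)) (ent S N) p q +
    (\<Sum>b<dim_of m n l (col_space N). ent S' N p b * (- u (col_space N) b q))) \<in> polynomial_functions m n l"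
    by (rule polynomial_functions.add[OF polynomial_functions.const])
  then show ?thesis
    by (simp add: x defect_def mm_def sum_negf)
qed

text \<open>The Gram determinant of the \<open>u\<^sub>b\<close> under \<open>u \<mapsto> u S - S' u\<close>, with the complex conjugates taken at
  a fixed point \<open>S\<^sub>0\<close>: polynomial in \<open>S'\<close>, and zero iff the map is not injective if \<open>S' = S\<^sub>0\<close>.\<close>

definition gram :: "nat \<Rightarrow> nat \<Rightarrow> nat \<Rightarrow> system \<Rightarrow> system \<Rightarrow> nat \<Rightarrow> (nat \<Rightarrow> tri) \<Rightarrow> system \<Rightarrow> complex mat" where
  "gram m n l S S0 r u S' = mat r r (\<lambda>(a, b).
     \<Sum>x\<in>sys_idx m n l. cnj (defect m n l S S0 (u a) x) * defect m n l S S' (u b) x)"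

lemma gram_polynomial:
  "(\<lambda>S'. det (gram m n l S S0 r u S')) \<in> polynomial_functions m n l"
proof (rule filtered_functions.det[OF polynomial_functions_filtered])
  show "gram m n l S S0 r u S' \<in> carrier_mat r r" for S' by (simp add: gram_def)
  fix a b assume ab: "a < r" "b < r"
  have "(\<lambda>S'. \<Sum>x\<in>sys_idx m n l. cnj (defect m n l S S0 (u a) x) * defect m n l S S' (u b) x) \<in> polynomial_functions m n l"
    by (rule filtered_functions.sum[OF polynomial_functions_filtered],
        rule polynomial_functions.mult[OF polynomial_functions.const], rule defect_polynomial)
  then show "(\<lambda>S'. gram m n l S S0 r u S' $$ (a, b)) \<in> polynomial_functions m n l"
    using ab by (simp add: gram_def)
qed

lemma gram_mult:
  assumes v: "v \<in> carrier_vec r" and a: "a < r"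
  shows "(gram m n l S S0 r u S' *\<^sub>v v) $ a = (\<Sum>x\<in>sys_idx m n l. cnj (defect m n l S S0 (u a) x) *
     defect m n l S S' (\<lambda>sp p q. \<Sum>b<r. v $ b * u b sp p q) x)"
proof -
  have "(gram m n l S S0 r u S' *\<^sub>v v) $ a = (\<Sum>b<r. (\<Sum>x\<in>sys_idx m n l. cnj (defect m n l S S0 (u a) x) *
     defect m n l S S' (u b) x) * v $ b)"
    using v a by (simp add: gram_def scalar_prod_def atLeast0LessThan)
  also have "\<dots> = (\<Sum>x\<in>sys_idx m n l. \<Sum>b<r. cnj (defect m n l S S0 (u a) x) * (v $ b * defect m n l S S' (u b) x))"
    unfolding sum_distrib_right by (subst sum.swap) (simp add: mult_ac)
  finally show ?thesis unfolding defect_sum sum_distrib_left .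
qed

text \<open>A nontrivial combination without defect is a kernel vector of the matrix, since its
  columns are linear in the defects at \<open>S'\<close>.\<close>

lemma gram_zero:
  assumes "y j \<noteq> 0" "j < r" and "intw m n l S S' (\<lambda>sp p q. \<Sum>b<r. y b * u b sp p q)"
  shows "det (gram m n l S S0 r u S') = 0"
proof -
  let ?v = "vec r y"
  have "(\<lambda>sp p q. \<Sum>b<r. ?v $ b * u b sp p q) = (\<lambda>sp p q. \<Sum>b<r. y b * u b sp p q)" by simp
  then have "defect m n l S S' (\<lambda>sp p q. \<Sum>b<r. ?v $ b * u b sp p q) x = 0" if "x \<in> sys_idx m n l" for x
    using assms(3) that unfolding intw_defect by simp
  then have "gram m n l S S0 r u S' *\<^sub>v ?v = 0\<^sub>v r"
    by (intro eq_vecI) (simp_all add: gram_mult, simp add: gram_def)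
  moreover have "?v \<noteq> 0\<^sub>v r" using assms(1,2) by (metis index_vec index_zero_vec(1))
  moreover have "gram m n l S S0 r u S' \<in> carrier_mat r r" by (simp add: gram_def)
  ultimately show ?thesis using det_0_iff_vec_prod_zero_field[of "gram m n l S S0 r u S'" r] vec_carrier by blast
qed

text \<open>At \<open>S' = S0\<close> the conjugates match. For a kernel vector \<open>v\<close> the
  hermitian form at \<open>v\<close> is the sum of the squared moduli of the defects of the
  corresponding combination, which is therefore an intertwiner.\<close>

lemma gram_nonzero:
  assumes "\<And>y. intw m n l S S0 (\<lambda>sp p q. \<Sum>b<r. y b * u b sp p q) \<Longrightarrow> \<forall>b<r. y b = 0"
  shows "det (gram m n l S S0 r u S0) \<noteq> 0"
proof
  assume "det (gram m n l S S0 r u S0) = 0"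
  moreover have "gram m n l S S0 r u S0 \<in> carrier_mat r r" by (simp add: gram_def)
  ultimately obtain v where v: "v \<in> carrier_vec r" "v \<noteq> 0\<^sub>v r" "gram m n l S S0 r u S0 *\<^sub>v v = 0\<^sub>v r"
    using det_0_iff_vec_prod_zero_field by blast
  let ?y = "\<lambda>sp p q. \<Sum>b<r. v $ b * u b sp p q"
  let ?D = "defect m n l S S0"
  have "0 = (\<Sum>a<r. cnj (v $ a) * (gram m n l S S0 r u S0 *\<^sub>v v) $ a)" using v(3) by simp
  also have "\<dots> = (\<Sum>a<r. \<Sum>x\<in>sys_idx m n l. cnj (v $ a) * cnj (?D (u a) x) * ?D ?y x)"
    by (intro sum.cong) (simp_all add: gram_mult[OF v(1)] sum_distrib_left mult.assoc)
  also have "\<dots> = (\<Sum>x\<in>sys_idx m n l. cnj (?D ?y x) * ?D ?y x)"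
    unfolding defect_sum cnj_sum complex_cnj_mult sum_distrib_right by (rule sum.swap)
  also have "\<dots> = complex_of_real (\<Sum>x\<in>sys_idx m n l. (cmod (?D ?y x))\<^sup>2)"
    by (simp add: complex_norm_square mult.commute del: of_real_power)
  finally have "complex_of_real (\<Sum>x\<in>sys_idx m n l. (cmod (?D ?y x))\<^sup>2) = 0" by (rule sym)
  then have "(\<Sum>x\<in>sys_idx m n l. (cmod (?D ?y x))\<^sup>2) = 0" by (simp only: of_real_eq_0_iff)
  then have "\<forall>x\<in>sys_idx m n l. ?D ?y x = 0"
    by (subst (asm) sum_nonneg_eq_0_iff[OF finite_sys_idx]) auto
  then have "intw m n l S S0 ?y" unfolding intw_defect .
  then have "\<forall>b<r. v $ b = 0" by (rule assms)
  then have "v = 0\<^sub>v r" using v(1) by (intro eq_vecI) auto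
  then show False using v(2) by simp
qed

context orbit_slice
begin

text \<open>The separating point is the image of \<open>1 + t * w i\<close> for a suitable
  \<open>t\<close>. Points from the smaller parameter space are reached by an intertwiner in the
  span of \<open>1, w 0, ..., w (i - 1)\<close>, whereas no nonzero element of this span carries
  \<open>S\<close> to the separating point. The Gram determinant of the span detects the
  difference.\<close>

lemma chain_set_strict:
  assumes i: "i < d"
  shows "chain_set i \<noteq> chain_set (Suc i)"
proof -
  define g :: "complex \<Rightarrow> tri" where "g t = (\<lambda>sp p q. idm p q + t * w i sp p q)" for t
  have gu: "upoly 1 (\<lambda>t. g t sp p q)" for sp p q
    unfolding g_def by (rule upoly_add[OF upoly_const upoly_mult[OF upoly_id upoly_const]])
  have g0: "g 0 = (\<lambda>sp. idm)" by (intro ext) (simp add: g_def)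
  have dgu: "upoly 1 (\<lambda>t. disc m n l (g t))" by (rule disc_upoly[where g = g], rule gu)
  have Ku: "upoly 1 (\<lambda>t. det (Kmat (g t)))" by (rule Kmat_det_upoly[where g = g], rule gu)
  \<comment> \<open>The determinant conditions hold at \<open>t = 0\<close>, but this parameter
    gives \<open>S\<close> itself; since only finitely many parameters violate them, some nonzero
    \<open>t\<close> satisfies them as well.\<close>
  have "disc m n l (g 0) * det (Kmat (g 0)) \<noteq> 0"
    using Kmat_one[of "\<lambda>sp. idm"] by (simp add: g0 disc_idm)
  then obtain t where t: "t \<noteq> 0" "disc m n l (g t) * det (Kmat (g t)) \<noteq> 0"
    by (rule upoly_nonzero_point[OF upoly_mult[OF dgu Ku], where b = 0])
  then have dt: "disc m n l (g t) \<noteq> 0" and Kt: "det (Kmat (g t)) \<noteq> 0" by auto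
  let ?S0 = "act (triple m n l (g t)) S"
  let ?x = "\<lambda>k. if k = i then t else 0"
  have gs: "g t = slice ?x"
    using i by (intro ext) (simp add: g_def slice_def if_distrib[of "\<lambda>x. x * _"] cong: if_cong)
  have in_Suc: "?S0 \<in> chain_set (Suc i)"
    using chain_set_slice[of "Suc i" ?x] dt unfolding gs by simp
  define u where "u b = (if b = 0 then (\<lambda>sp. idm) else w (b - 1))" for b :: nat
  have usum: "(\<Sum>b<Suc i. y b * u b sp p q) = y 0 * idm p q + (\<Sum>k<i. y (Suc k) * w k sp p q)" for y sp p q
    by (simp only: sum.lessThan_Suc_shift) (simp add: u_def)
  let ?f = "\<lambda>S'. det (gram m n l S ?S0 (Suc i) u S')"
  have van: "?f (act (triple m n l (slice x)) S) = 0"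
    if x: "(\<forall>k. i \<le> k \<longrightarrow> x k = 0) \<and> disc m n l (slice x) \<noteq> 0" for x
  proof -
    let ?y = "\<lambda>b. if b = 0 then 1 else x (b - 1)"
    have "(\<lambda>sp p q. \<Sum>b<Suc i. ?y b * u b sp p q) = slice x"
    proof (intro ext)
      fix sp p q
      have "(\<Sum>k<d. x k * w k sp p q) = (\<Sum>k<i. x k * w k sp p q)"
        using i x by (intro sum.mono_neutral_right) auto
      then show "(\<Sum>b<Suc i. ?y b * u b sp p q) = slice x sp p q" unfolding usum slice_def by simp
    qed
    then have "intw m n l S (act (triple m n l (slice x)) S) (\<lambda>sp p q. \<Sum>b<Suc i. ?y b * u b sp p q)"
      using intw_act[OF S, of "slice x"] x by (simp only: simp_thms)
    from gram_zero[of ?y 0 "Suc i", OF _ _ this] show ?thesis by simp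
  qed
  have nz: "?f ?S0 \<noteq> 0"
  proof (rule gram_nonzero[where u = u and r = "Suc i"])
    fix y assume y: "intw m n l S ?S0 (\<lambda>sp p q. \<Sum>b<Suc i. y b * u b sp p q)"
    let ?U = "cof m n l (g t)"
    \<comment> \<open>Subtracting \<open>y 0\<close> times the known intertwiner
      \<open>1 + t * w i\<close> cancels the identity. What remains is a combination of the
      \<open>w k\<close> with coefficient \<open>- (y 0 * t)\<close> at \<open>w i\<close>; it lies
      in \<open>g t * Stab\<close>, so nonsingularity of \<open>Kmat (g t)\<close> makes all its
      coefficients 0, and \<open>t\<close> nonzero gives \<open>y 0 = 0\<close>.\<close>
    define z where "z k = (if k < i then y (Suc k) else if k = i then - (y 0 * t) else 0)" for k
    have split: "{..<d} = insert i ({..<i} \<union> {Suc i..<d})" using i by auto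
    have zsum: "(\<Sum>k<d. z k * h k) = (\<Sum>k<i. y (Suc k) * h k) - y 0 * t * h i" for h :: "nat \<Rightarrow> complex"
    proof -
      have "(\<Sum>k<d. z k * h k) = z i * h i + ((\<Sum>k<i. z k * h k) + (\<Sum>k=Suc i..<d. z k * h k))"
        unfolding split by (subst sum.insert, simp, simp, subst sum.union_disjoint) auto
      then show ?thesis by (simp add: z_def)
    qed
    have "intw m n l S ?S0 (\<lambda>sp p q. 1 * (\<Sum>b<Suc i. y b * u b sp p q) + (- y 0) * g t sp p q)"
      by (rule intw_lin[OF y intw_act[OF S dt]])
    moreover have "(\<lambda>sp p q. 1 * (\<Sum>b<Suc i. y b * u b sp p q) + (- y 0) * g t sp p q) =
        (\<lambda>sp p q. 0 * idm p q + (\<Sum>k<d. z k * w k sp p q))"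
    proof (intro ext)
      fix sp p q
      show "1 * (\<Sum>b<Suc i. y b * u b sp p q) + (- y 0) * g t sp p q = 0 * idm p q + (\<Sum>k<d. z k * w k sp p q)"
        unfolding usum zsum[of "\<lambda>k. w k sp p q"] g_def by (simp add: algebra_simps)
    qed
    ultimately have "intw m n l S ?S0 (\<lambda>sp p q. 0 * idm p q + (\<Sum>k<d. z k * w k sp p q))" by (simp only:)
    from intw_comp[OF this intw_cof[OF intw_act[OF S dt] dt]]
    have Fz: "F j (tcomp m n l ?U (\<lambda>sp p q. 0 * idm p q + (\<Sum>k<d. z k * w k sp p q))) = 0" if "j < d" for j
      using stab that by blast
    have "(\<Sum>k<d. z k * F j (tcomp m n l ?U (w k))) = 0" if "j < d" for j
      using F_comp_combo[OF that, of ?U 0 "\<lambda>sp. idm" z] Fz[OF that] by (simp only: mult_zero_left add_0)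
    then have "Kmat (g t) *\<^sub>v vec d z = 0\<^sub>v d"
      by (intro eq_vecI) (simp_all add: Kmat_def scalar_prod_def atLeast0LessThan mult.commute)
    then have "vec d z = 0\<^sub>v d"
      using Kt det_0_iff_vec_prod_zero_field[OF Kmat_carrier[of "g t"]] vec_carrier by blast
    then have z0: "z k = 0" if "k < d" for k using that by (metis index_vec index_zero_vec(1))
    have "y 0 = 0" using z0[OF i] t(1) by (simp add: z_def)
    moreover have "y (Suc k) = 0" if "k < i" for k using z0[of k] that i by (simp add: z_def)
    ultimately show "\<forall>b<Suc i. y b = 0" by (metis less_Suc_eq_0_disj)
  qed
  have "?S0 \<notin> chain_set i"
  proof
    assume "?S0 \<in> chain_set i"
    then have "\<forall>f\<in>polynomial_functions m n l. (\<forall>x. (\<forall>k. i \<le> k \<longrightarrow> x k = 0) \<and> disc m n l (slice x) \<noteq> 0 \<longrightarrow>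
      f (act (triple m n l (slice x)) S) = 0) \<longrightarrow> f ?S0 = 0" by (simp add: chain_set_def)
    note imp = this[THEN bspec, OF gram_polynomial[of m n l S ?S0 "Suc i" u], THEN mp]
    have "?f ?S0 = 0"
    proof (rule imp, intro allI impI)
      fix x assume "(\<forall>k. i \<le> k \<longrightarrow> x k = 0) \<and> disc m n l (slice x) \<noteq> 0"
      then show "?f (act (triple m n l (slice x)) S) = 0" by (rule van)
    qed
    with nz show False by (rule notE)
  qed
  then show ?thesis using in_Suc by auto
qed

theorem krull_dim_orbit:
  "krull_dim (subtopology (zariski_topology m n l) (equiv_class m n l S)) = enat d"
proof (rule antisym)
  let ?X = "subtopology (zariski_topology m n l) (equiv_class m n l S)"
  have sub: "subtopology ?X Z = subtopology (zariski_topology m n l) Z" if "Z \<subseteq> equiv_class m n l S" for Z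
    using that by (simp add: subtopology_subtopology Int_absorb1)
  have closed_sub: "Z \<subseteq> equiv_class m n l S" if "closedin ?X Z" for Z
    using that by (simp add: closedin_zariski_subtopology[OF orbit_systems])
  show "krull_dim ?X \<le> enat d"
    unfolding krull_dim_def
  proof (rule Sup_least)
    fix e assume "e \<in> {enat k | k. \<exists>Z. (\<forall>i\<le>k. closedin ?X (Z i) \<and> irreducible_space (subtopology ?X (Z i))) \<and>
      (\<forall>i<k. Z i \<subset> Z (Suc i))}"
    then obtain k Z where e: "e = enat k"
      and Z: "\<forall>i\<le>k. closedin ?X (Z i) \<and> irreducible_space (subtopology ?X (Z i))"
        "\<forall>i<k. Z i \<subset> Z (Suc i)" by (elim CollectE exE conjE) (rule that)
    have 1: "closedin ?X (Z i)" if "i \<le> k" for i using Z(1) that by simp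
    have 2: "irreducible_space (subtopology (zariski_topology m n l) (Z i))" if "i \<le> k" for i
    proof -
      have "irreducible_space (subtopology ?X (Z i))" using Z(1) that by blast
      then show ?thesis unfolding sub[OF closed_sub[OF 1[OF that]]] .
    qed
    have 3: "Z i \<subset> Z (Suc i)" if "i < k" for i using Z(2) that by simp
    have "k \<le> d" by (rule chain_length_le[where Z = Z, OF 1 2 3])
    then show "e \<le> enat d" by (simp add: e)
  qed
  show "enat d \<le> krull_dim ?X"
    unfolding krull_dim_def
  proof (rule Sup_upper, intro CollectI exI[of _ d] exI[of _ chain_set] conjI refl allI impI)
    fix i
    show "closedin ?X (chain_set i)" by (rule chain_set_closed)
    show "irreducible_space (subtopology ?X (chain_set i))"
      unfolding sub[OF closed_sub[OF chain_set_closed]] by (rule chain_set_irreducible)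
    show "chain_set i \<subset> chain_set (Suc i)" if "i < d"
      using chain_set_mono[of i] chain_set_strict[OF that] by (rule psubsetI)
  qed
qed

end

lemma krull_dim_orbit_codim:
  assumes S: "S \<in> systems m n l" and codim: "codim {v. intw m n l S S v} d"
  shows "krull_dim (subtopology (zariski_topology m n l) (equiv_class m n l S)) = enat d"
proof -
  from codim obtain F where F: "\<forall>k<d. lin (F k)" "\<forall>v. v \<in> {v. intw m n l S S v} \<longleftrightarrow> (\<forall>k<d. F k v = 0)"
    "\<forall>k<d. \<exists>w. \<forall>j<d. F j w = (if j = k then 1 else 0)"
    unfolding codim_def by (elim exE conjE) (rule that)
  have "\<forall>k. \<exists>w. k < d \<longrightarrow> (\<forall>j<d. F j w = (if j = k then 1 else 0))" using F(3) by simp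
  from choice[OF this] obtain w where w: "\<forall>k. k < d \<longrightarrow> (\<forall>j<d. F j (w k) = (if j = k then 1 else 0))" by (elim exE)
  interpret orbit_slice m n l S d F w
    by unfold_locales (use S F(1,2) w in simp_all)
  show ?thesis by (rule krull_dim_orbit)
qed

section \<open>Coordinates of a partition into strips\<close>

text \<open>Returns strip number, label and position within the strip. The label type is arbitrary
  because the same coordinates describe strips of a partition, Jordan blocks and Weyr strips. Past
  the last strip the values are junk.\<close>

fun locate :: "('b \<times> nat) list \<Rightarrow> nat \<Rightarrow> nat \<times> 'b \<times> nat" where
  "locate [] p = (0, undefined, p)"
| "locate (a # ss) p = (if p < snd a then (0, fst a, p)
     else (case locate ss (p - snd a) of (i, e, t) \<Rightarrow> (Suc i, e, t)))"

definition sidx :: "('b \<times> nat) list \<Rightarrow> nat \<Rightarrow> nat" where "sidx ss p = fst (locate ss p)"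
definition slab :: "('b \<times> nat) list \<Rightarrow> nat \<Rightarrow> 'b" where "slab ss p = fst (snd (locate ss p))"
definition sloc :: "('b \<times> nat) list \<Rightarrow> nat \<Rightarrow> nat" where "sloc ss p = snd (snd (locate ss p))"
definition total_size :: "('b \<times> nat) list \<Rightarrow> nat" where "total_size ss = sum_list (map snd ss)"

lemma total_simps [simp]: "total_size [] = 0" "total_size (a # ss) = snd a + total_size ss" "total_size (xs @ ys) = total_size xs + total_size ys"
  by (simp_all add: total_size_def)

lemma coord_Cons:
  "sidx (a # ss) p = (if p < snd a then 0 else Suc (sidx ss (p - snd a)))"
  "slab (a # ss) p = (if p < snd a then fst a else slab ss (p - snd a))"
  "sloc (a # ss) p = (if p < snd a then p else sloc ss (p - snd a))"
  by (simp_all add: sidx_def slab_def sloc_def split: prod.split)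

definition start :: "('b \<times> nat) list \<Rightarrow> nat \<Rightarrow> nat" where "start ss i = (\<Sum>k<i. snd (ss ! k))"

lemma start_Cons: "start (a # ss) 0 = 0" "start (a # ss) (Suc i) = snd a + start ss i"
  unfolding start_def sum.lessThan_Suc_shift by simp_all

lemma offset_start: "offset = start"
  by (intro ext) (simp add: offset_def start_def)

lemma coord_props:
  assumes "p < total_size ss"
  shows "sidx ss p < length ss" "slab ss p = fst (ss ! sidx ss p)" "sloc ss p < snd (ss ! sidx ss p)"
    "p = start ss (sidx ss p) + sloc ss p"
proof -
  have "sidx ss p < length ss \<and> slab ss p = fst (ss ! sidx ss p) \<and> sloc ss p < snd (ss ! sidx ss p) \<and>
    p = start ss (sidx ss p) + sloc ss p"
    using assms
  proof (induction ss arbitrary: p)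
    case (Cons a ss)
    show ?case
    proof (cases "p < snd a")
      case False
      then have "p - snd a < total_size ss" using Cons.prems by auto
      note IH = Cons.IH[OF this]
      have "p = snd a + (p - snd a)" using False by simp
      also have "\<dots> = snd a + (start ss (sidx ss (p - snd a)) + sloc ss (p - snd a))" using IH by simp
      finally have "p = snd a + (start ss (sidx ss (p - snd a)) + sloc ss (p - snd a))" .
      with IH False show ?thesis by (simp add: coord_Cons start_Cons add.assoc)
    qed (simp add: coord_Cons start_Cons)
  qed simp
  then show "sidx ss p < length ss" "slab ss p = fst (ss ! sidx ss p)" "sloc ss p < snd (ss ! sidx ss p)"
    "p = start ss (sidx ss p) + sloc ss p" by blast+
qed

lemma coord_start:
  assumes "i < length ss" "t < snd (ss ! i)"
  shows "start ss i + t < total_size ss" "sidx ss (start ss i + t) = i" "slab ss (start ss i + t) = fst (ss ! i)"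
    "sloc ss (start ss i + t) = t"
proof -
  have "start ss i + t < total_size ss \<and> sidx ss (start ss i + t) = i \<and> slab ss (start ss i + t) = fst (ss ! i) \<and>
    sloc ss (start ss i + t) = t"
    using assms
  proof (induction ss arbitrary: i)
    case (Cons a ss)
    then show ?case by (cases i) (auto simp: coord_Cons start_Cons)
  qed simp
  then show "start ss i + t < total_size ss" "sidx ss (start ss i + t) = i" "slab ss (start ss i + t) = fst (ss ! i)"
    "sloc ss (start ss i + t) = t" by auto
qed

lemma coord_inj:
  assumes "p < total_size ss" "q < total_size ss" "sidx ss p = sidx ss q" "sloc ss p = sloc ss q"
  shows "p = q"
  using coord_props(4)[OF assms(1)] coord_props(4)[OF assms(2)] assms(3,4) by simp

lemma coord_append:
  "p < total_size xs \<Longrightarrow> sidx (xs @ ys) p = sidx xs p"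
  "p < total_size xs \<Longrightarrow> slab (xs @ ys) p = slab xs p"
  "p < total_size xs \<Longrightarrow> sloc (xs @ ys) p = sloc xs p"
  "\<not> p < total_size xs \<Longrightarrow> sidx (xs @ ys) p = length xs + sidx ys (p - total_size xs)"
  "\<not> p < total_size xs \<Longrightarrow> slab (xs @ ys) p = slab ys (p - total_size xs)"
  "\<not> p < total_size xs \<Longrightarrow> sloc (xs @ ys) p = sloc ys (p - total_size xs)"
  by (induction xs arbitrary: p) (auto simp: coord_Cons)

lemma total_concat_map:
  "(\<And>a. a \<in> set ss \<Longrightarrow> total_size (f a) = snd a) \<Longrightarrow> total_size (concat (map f ss)) = total_size ss"
  by (induction ss) auto

lemma split_coord:
  assumes f: "\<And>a. a \<in> set ss \<Longrightarrow> total_size (f a) = snd a" and p: "p < total_size ss"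
  shows "slab (concat (map f ss)) p = slab (f (ss ! sidx ss p)) (sloc ss p)"
    and "sloc (concat (map f ss)) p = sloc (f (ss ! sidx ss p)) (sloc ss p)"
proof -
  have "slab (concat (map f ss)) p = slab (f (ss ! sidx ss p)) (sloc ss p) \<and>
    sloc (concat (map f ss)) p = sloc (f (ss ! sidx ss p)) (sloc ss p)"
    using f p
  proof (induction ss arbitrary: p)
    case (Cons a ss)
    have a: "total_size (f a) = snd a" using Cons.prems(1) by simp
    show ?case
    proof (cases "p < snd a")
      case True
      then show ?thesis using a by (simp add: coord_append coord_Cons)
    next
      case False
      then have "p - snd a < total_size ss" using Cons.prems(2) by auto
      with Cons.IH[of "p - snd a"] Cons.prems(1) False a show ?thesis by (simp add: coord_append coord_Cons)
    qed
  qed simp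
  then show "slab (concat (map f ss)) p = slab (f (ss ! sidx ss p)) (sloc ss p)"
    "sloc (concat (map f ss)) p = sloc (f (ss ! sidx ss p)) (sloc ss p)" by auto
qed

text \<open>The refined strips are ordered lexicographically. Throughout, strip numbers are compared
  rather than computed, because the later removal of empty strips changes the numbers but not their
  order.\<close>

lemma split_order:
  assumes f: "\<And>a. a \<in> set ss \<Longrightarrow> total_size (f a) = snd a" and "p < total_size ss" "q < total_size ss"
  shows "sidx (concat (map f ss)) p < sidx (concat (map f ss)) q \<longleftrightarrow>
    sidx ss p < sidx ss q \<or> sidx ss p = sidx ss q \<and>
      sidx (f (ss ! sidx ss p)) (sloc ss p) < sidx (f (ss ! sidx ss p)) (sloc ss q)"
  using assms
proof (induction ss arbitrary: p q)
  case (Cons a ss)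
  have a: "total_size (f a) = snd a" using Cons.prems(1) by simp
  have lt: "sidx (f a) x < length (f a)" if "x < snd a" for x using coord_props(1)[of x "f a"] that a by simp
  show ?case
  proof (cases "p < snd a"; cases "q < snd a")
    assume "\<not> p < snd a" "\<not> q < snd a"
    moreover from this have "p - snd a < total_size ss" "q - snd a < total_size ss" using Cons.prems(2,3) by auto
    ultimately show ?thesis using Cons.IH[of "p - snd a" "q - snd a"] Cons.prems(1) a
      by (simp add: coord_append coord_Cons)
  next
    assume "p < snd a" "q < snd a"
    then show ?thesis using a by (simp add: coord_append coord_Cons)
  next
    assume "p < snd a" "\<not> q < snd a"
    then show ?thesis using a lt[of p] by (simp add: coord_append coord_Cons)
  next
    assume "\<not> p < snd a" "q < snd a"
    then show ?thesis using a lt[of q] by (simp add: coord_append coord_Cons)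
  qed
qed simp

lemma filter_coord:
  assumes "p < total_size ss"
  shows "slab (filter (\<lambda>s. snd s > 0) ss) p = slab ss p" "sloc (filter (\<lambda>s. snd s > 0) ss) p = sloc ss p"
proof -
  have "slab (filter (\<lambda>s. snd s > 0) ss) p = slab ss p \<and> sloc (filter (\<lambda>s. snd s > 0) ss) p = sloc ss p"
    using assms by (induction ss arbitrary: p) (auto simp: coord_Cons)
  then show "slab (filter (\<lambda>s. snd s > 0) ss) p = slab ss p" "sloc (filter (\<lambda>s. snd s > 0) ss) p = sloc ss p"
    by auto
qed

lemma filter_total: "total_size (filter (\<lambda>s. snd s > 0) ss) = total_size ss"
  by (induction ss) auto

lemma filter_order:
  assumes "p < total_size ss" "q < total_size ss"
  shows "sidx (filter (\<lambda>s. snd s > 0) ss) p < sidx (filter (\<lambda>s. snd s > 0) ss) q \<longleftrightarrow> sidx ss p < sidx ss q"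
  using assms
proof (induction ss arbitrary: p q)
  case (Cons a ss)
  show ?case
  proof (cases "snd a > 0")
    case True
    show ?thesis using Cons.IH[of "p - snd a" "q - snd a"] Cons.prems True
      by (cases "p < snd a"; cases "q < snd a") (auto simp: coord_Cons)
  next
    case False
    then show ?thesis using Cons.IH[of p q] Cons.prems by (simp add: coord_Cons)
  qed
qed simp

lemma coord_map:
  assumes "p < total_size ss"
  shows "sidx (map (\<lambda>(a, s). (g a, s)) ss) p = sidx ss p" "slab (map (\<lambda>(a, s). (g a, s)) ss) p = g (slab ss p)"
    "sloc (map (\<lambda>(a, s). (g a, s)) ss) p = sloc ss p"
proof -
  have "sidx (map (\<lambda>(a, s). (g a, s)) ss) p = sidx ss p \<and> slab (map (\<lambda>(a, s). (g a, s)) ss) p = g (slab ss p) \<and>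
    sloc (map (\<lambda>(a, s). (g a, s)) ss) p = sloc ss p"
    using assms by (induction ss arbitrary: p) (auto simp: coord_Cons)
  then show "sidx (map (\<lambda>(a, s). (g a, s)) ss) p = sidx ss p" "slab (map (\<lambda>(a, s). (g a, s)) ss) p = g (slab ss p)"
    "sloc (map (\<lambda>(a, s). (g a, s)) ss) p = sloc ss p" by auto
qed

lemma total_map: "total_size (map (\<lambda>(a, s). (g a, s)) ss) = total_size ss"
  by (induction ss) auto

lemma sum_total: "(\<Sum>p<total_size ss. h p) = (\<Sum>i<length ss. \<Sum>t<snd (ss ! i). h (start ss i + t))"
proof (induction ss arbitrary: h)
  case (Cons a ss)
  have "(\<Sum>p<total_size (a # ss). h p) = (\<Sum>t<snd a. h t) + (\<Sum>p<total_size ss. h (snd a + p))"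
    by (simp add: sum_lessThan_add)
  also have "\<dots> = (\<Sum>i<length (a # ss). \<Sum>t<snd ((a # ss) ! i). h (start (a # ss) i + t))"
    unfolding Cons.IH length_Cons sum.lessThan_Suc_shift
    by (simp add: start_Cons add.assoc)
  finally show ?case .
qed simp

lemma sum_strip:
  assumes "i < length ss"
  shows "(\<Sum>p\<in>{p. p < total_size ss \<and> sidx ss p = i}. h p) = (\<Sum>t<snd (ss ! i). h (start ss i + t))"
proof (rule sum.reindex_bij_witness[where j = "sloc ss" and i = "\<lambda>t. start ss i + t"])
  fix p assume "p \<in> {p. p < total_size ss \<and> sidx ss p = i}"
  then show "start ss i + sloc ss p = p" "sloc ss p \<in> {..<snd (ss ! i)}" "h (start ss i + sloc ss p) = h p"
    using coord_props[of p ss] by auto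
qed (use coord_start[OF assms] in auto)

text \<open>Every strip is labelled with its own diagonal block, so that \<open>slab\<close> returns
  the block in which a position lies.\<close>

lemma diag_block_mat_coord:
  assumes "\<And>M. M \<in> set Ms \<Longrightarrow> square_mat M"
    and "p < total_size (map (\<lambda>M. (M, dim_row M)) Ms)" "q < total_size (map (\<lambda>M. (M, dim_row M)) Ms)"
  shows "diag_block_mat Ms $$ (p, q) = (let ss = map (\<lambda>M. (M, dim_row M)) Ms in
    if sidx ss p = sidx ss q then slab ss p $$ (sloc ss p, sloc ss q) else 0)"
  using assms
proof (induction Ms arbitrary: p q)
  case (Cons M Ms)
  let ?D = "diag_block_mat Ms"
  have sq: "dim_col M = dim_row M" using Cons.prems(1)[of M] by simp
  have d: "dim_row ?D = total_size (map (\<lambda>M. (M, dim_row M)) Ms)" "dim_col ?D = total_size (map (\<lambda>M. (M, dim_row M)) Ms)"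
    unfolding dim_diag_block_mat total_size_def using Cons.prems(1)
    by (simp_all add: o_def cong: map_cong)
  have IH: "?D $$ (p - dim_row M, q - dim_row M) = (let ss = map (\<lambda>M. (M, dim_row M)) Ms in
    if sidx ss (p - dim_row M) = sidx ss (q - dim_row M)
    then slab ss (p - dim_row M) $$ (sloc ss (p - dim_row M), sloc ss (q - dim_row M)) else 0)"
    if "\<not> p < dim_row M" "\<not> q < dim_row M"
    using that Cons.prems by (intro Cons.IH) auto
  have "diag_block_mat (M # Ms) $$ (p, q) = (if p < dim_row M then if q < dim_row M then M $$ (p, q) else 0
      else if q < dim_row M then 0 else ?D $$ (p - dim_row M, q - dim_row M))"
    using Cons.prems(2,3) d sq by (auto simp: Let_def)
  then show ?case using IH by (auto simp: Let_def coord_Cons)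
qed simp

section \<open>Matrices commuting with a Jordan matrix\<close>

text \<open>The basis vectors are arranged in Jordan chains: \<open>p\<close> is vector number \<open>pos p\<close> of the chain
  \<open>cid p\<close>, which has length \<open>len (cid p)\<close> and eigenvalue \<open>ev (cid p)\<close>.\<close>

locale chains =
  fixes n :: nat and cid :: "nat \<Rightarrow> 'c" and pos :: "nat \<Rightarrow> nat" and len :: "'c \<Rightarrow> nat" and ev :: "'c \<Rightarrow> complex"
  assumes pos_less: "p < n \<Longrightarrow> pos p < len (cid p)"
    and pos_inj: "p < n \<Longrightarrow> q < n \<Longrightarrow> cid p = cid q \<Longrightarrow> pos p = pos q \<Longrightarrow> p = q"
    and pos_surj: "p < n \<Longrightarrow> i < len (cid p) \<Longrightarrow> \<exists>q<n. cid q = cid p \<and> pos q = i"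
begin

text \<open>Nothing is assumed about how the chains are arranged among the indices, so
  \<open>jm\<close> covers a Jordan matrix and, in another arrangement, a Weyr matrix.\<close>

definition jm :: fmat where
  "jm p q = (if p = q then ev (cid p) else if cid p = cid q \<and> pos q = Suc (pos p) then 1 else 0)"

definition commutes :: "fmat \<Rightarrow> bool" where
  "commutes X \<longleftrightarrow> (\<forall>p<n. \<forall>q<n. mm n X jm p q = mm n jm X p q)"

definition nx :: "nat \<Rightarrow> nat" where "nx p = (SOME q. q < n \<and> cid q = cid p \<and> pos q = Suc (pos p))"
definition pv :: "nat \<Rightarrow> nat" where "pv p = (SOME q. q < n \<and> cid q = cid p \<and> Suc (pos q) = pos p)"

lemma nx: "p < n \<Longrightarrow> Suc (pos p) < len (cid p) \<Longrightarrow> nx p < n \<and> cid (nx p) = cid p \<and> pos (nx p) = Suc (pos p)"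
  unfolding nx_def by (rule someI_ex) (rule pos_surj)

lemma pv:
  assumes "p < n" "pos p > 0"
  shows "pv p < n \<and> cid (pv p) = cid p \<and> Suc (pos (pv p)) = pos p"
  unfolding pv_def
proof (rule someI_ex)
  have "pos p - 1 < len (cid p)" using pos_less[OF assms(1)] by simp
  from pos_surj[OF assms(1) this] obtain q where "q < n" "cid q = cid p" "pos q = pos p - 1" by blast
  then show "\<exists>q<n. cid q = cid p \<and> Suc (pos q) = pos p" using assms(2) by auto
qed

lemma jm_left:
  assumes p: "p < n"
  shows "mm n jm X p q = ev (cid p) * X p q + (if Suc (pos p) < len (cid p) then X (nx p) q else 0)"
proof -
  have "mm n jm X p q = (\<Sum>r<n. (if r = p then ev (cid p) * X p q else 0) +
      (if cid p = cid r \<and> pos r = Suc (pos p) then X r q else 0))"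
    unfolding mm_def by (rule sum.cong) (auto simp: jm_def)
  also have "\<dots> = ev (cid p) * X p q + (\<Sum>r<n. if cid p = cid r \<and> pos r = Suc (pos p) then X r q else 0)"
    using p by (simp add: sum.distrib)
  also have "(\<Sum>r<n. if cid p = cid r \<and> pos r = Suc (pos p) then X r q else 0) =
      (if Suc (pos p) < len (cid p) then X (nx p) q else 0)"
  proof (cases "Suc (pos p) < len (cid p)")
    case True
    note N = nx[OF p True]
    have "(\<Sum>r<n. if cid p = cid r \<and> pos r = Suc (pos p) then X r q else 0) = (\<Sum>r<n. if r = nx p then X r q else 0)"
    proof (rule sum.cong[OF refl])
      fix r assume "r \<in> {..<n}"
      then have "cid p = cid r \<and> pos r = Suc (pos p) \<longleftrightarrow> r = nx p"
        using N pos_inj[of r "nx p"] by auto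
      then show "(if cid p = cid r \<and> pos r = Suc (pos p) then X r q else 0) = (if r = nx p then X r q else 0)" by simp
    qed
    then show ?thesis using N True by simp
  next
    case False
    have "(\<Sum>r<n. if cid p = cid r \<and> pos r = Suc (pos p) then X r q else 0) = 0"
    proof (rule sum.neutral, rule ballI)
      fix r assume "r \<in> {..<n}"
      then have "pos r < len (cid r)" by (simp add: pos_less)
      then have "\<not> (cid p = cid r \<and> pos r = Suc (pos p))" using False by auto
      then show "(if cid p = cid r \<and> pos r = Suc (pos p) then X r q else 0) = 0" by (rule if_not_P)
    qed
    then show ?thesis using False by simp
  qed
  finally show ?thesis .
qed

lemma jm_right:
  assumes q: "q < n"
  shows "mm n X jm p q = ev (cid q) * X p q + (if pos q > 0 then X p (pv q) else 0)"
proof -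
  have "mm n X jm p q = (\<Sum>r<n. (if r = q then ev (cid q) * X p q else 0) +
      (if cid r = cid q \<and> pos q = Suc (pos r) then X p r else 0))"
    unfolding mm_def by (rule sum.cong) (auto simp: jm_def)
  also have "\<dots> = ev (cid q) * X p q + (\<Sum>r<n. if cid r = cid q \<and> pos q = Suc (pos r) then X p r else 0)"
    using q by (simp add: sum.distrib)
  also have "(\<Sum>r<n. if cid r = cid q \<and> pos q = Suc (pos r) then X p r else 0) = (if pos q > 0 then X p (pv q) else 0)"
  proof (cases "pos q > 0")
    case True
    note N = pv[OF q True]
    have "(\<Sum>r<n. if cid r = cid q \<and> pos q = Suc (pos r) then X p r else 0) = (\<Sum>r<n. if r = pv q then X p r else 0)"
    proof (rule sum.cong[OF refl])
      fix r assume "r \<in> {..<n}"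
      then have "cid r = cid q \<and> pos q = Suc (pos r) \<longleftrightarrow> r = pv q"
        using N pos_inj[of r "pv q"] by auto
      then show "(if cid r = cid q \<and> pos q = Suc (pos r) then X p r else 0) = (if r = pv q then X p r else 0)" by simp
    qed
    then show ?thesis using N True by simp
  qed simp
  finally show ?thesis .
qed

text \<open>The classical description: between chains of equal eigenvalue, a triangular Toeplitz
  block pushed into the upper right corner. The last two conditions are the boundary cases of the
  shift rule, where the column has no predecessor or the row no successor.\<close>

definition shift_inv :: "fmat \<Rightarrow> bool" where
  "shift_inv X \<longleftrightarrow>
    (\<forall>p<n. \<forall>q<n. ev (cid p) \<noteq> ev (cid q) \<longrightarrow> X p q = 0) \<and>
    (\<forall>p<n. \<forall>q<n. \<forall>p'<n. \<forall>q'<n. ev (cid p) = ev (cid q) \<longrightarrow> cid p' = cid p \<longrightarrow> cid q' = cid q \<longrightarrow>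
       pos p' = Suc (pos p) \<longrightarrow> pos q' = Suc (pos q) \<longrightarrow> X p' q' = X p q) \<and>
    (\<forall>p<n. \<forall>q<n. ev (cid p) = ev (cid q) \<longrightarrow> 0 < pos p \<longrightarrow> pos q = 0 \<longrightarrow> X p q = 0) \<and>
    (\<forall>p<n. \<forall>q<n. ev (cid p) = ev (cid q) \<longrightarrow> Suc (pos p) = len (cid p) \<longrightarrow> Suc (pos q) < len (cid q) \<longrightarrow> X p q = 0)"

lemma shift_invD1: "shift_inv X \<Longrightarrow> p < n \<Longrightarrow> q < n \<Longrightarrow> ev (cid p) \<noteq> ev (cid q) \<Longrightarrow> X p q = 0"
  unfolding shift_inv_def by (drule conjunct1) blast

lemma shift_invD2:
  "shift_inv X \<Longrightarrow> p < n \<Longrightarrow> q < n \<Longrightarrow> p' < n \<Longrightarrow> q' < n \<Longrightarrow> ev (cid p) = ev (cid q) \<Longrightarrow>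
    cid p' = cid p \<Longrightarrow> cid q' = cid q \<Longrightarrow> pos p' = Suc (pos p) \<Longrightarrow> pos q' = Suc (pos q) \<Longrightarrow> X p' q' = X p q"
  unfolding shift_inv_def by (drule conjunct2, drule conjunct1) simp

lemma shift_invD3:
  "shift_inv X \<Longrightarrow> p < n \<Longrightarrow> q < n \<Longrightarrow> ev (cid p) = ev (cid q) \<Longrightarrow> 0 < pos p \<Longrightarrow> pos q = 0 \<Longrightarrow> X p q = 0"
  unfolding shift_inv_def by (drule conjunct2, drule conjunct2, drule conjunct1) simp

lemma shift_invD4:
  "shift_inv X \<Longrightarrow> p < n \<Longrightarrow> q < n \<Longrightarrow> ev (cid p) = ev (cid q) \<Longrightarrow> Suc (pos p) = len (cid p) \<Longrightarrow>
    Suc (pos q) < len (cid q) \<Longrightarrow> X p q = 0"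
  unfolding shift_inv_def by (drule conjunct2, drule conjunct2, drule conjunct2) simp

lemma commutes_eq:
  "commutes X \<longleftrightarrow> (\<forall>p<n. \<forall>q<n. (ev (cid q) - ev (cid p)) * X p q =
     (if Suc (pos p) < len (cid p) then X (nx p) q else 0) - (if pos q > 0 then X p (pv q) else 0))"
proof -
  have "mm n X jm p q = mm n jm X p q \<longleftrightarrow> (ev (cid q) - ev (cid p)) * X p q =
     (if Suc (pos p) < len (cid p) then X (nx p) q else 0) - (if pos q > 0 then X p (pv q) else 0)"
    if "p < n" "q < n" for p q
    unfolding jm_left[OF that(1)] jm_right[OF that(2)] by (auto simp: algebra_simps)
  then show ?thesis unfolding commutes_def by auto
qed

lemma commutes_imp_shift_inv:
  assumes "commutes X"
  shows "shift_inv X"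
proof -
  have c: "(ev (cid q) - ev (cid p)) * X p q =
     (if Suc (pos p) < len (cid p) then X (nx p) q else 0) - (if pos q > 0 then X p (pv q) else 0)"
    if "p < n" "q < n" for p q using assms that unfolding commutes_eq by blast
  \<comment> \<open>With different eigenvalues the equation determines an entry from its lower and
    its left neighbour. The measure decreases towards the lower left corner of the block, where both
    neighbours are missing.\<close>
  have D: "X p q = 0" if "p < n" "q < n" "ev (cid p) \<noteq> ev (cid q)" for p q
    using that
  proof (induction "len (cid p) - pos p + pos q" arbitrary: p q rule: less_induct)
    case less
    have "(if Suc (pos p) < len (cid p) then X (nx p) q else 0) = 0"
    proof (cases "Suc (pos p) < len (cid p)")
      case True
      with nx[OF less.prems(1) True] less.hyps[of "nx p" q] less.prems show ?thesis by simp
    qed simp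
    moreover have "(if pos q > 0 then X p (pv q) else 0) = 0"
    proof (cases "pos q > 0")
      case True
      with pv[OF less.prems(2) True] less.hyps[of p "pv q"] less.prems show ?thesis by simp
    qed simp
    ultimately have "(ev (cid q) - ev (cid p)) * X p q = 0" using c[OF less.prems(1,2)] by simp
    then show ?case using less.prems(3) by simp
  qed
  have E1: "X p' q' = X p q" if "p < n" "q < n" "p' < n" "q' < n" "ev (cid p) = ev (cid q)" "cid p' = cid p" "cid q' = cid q"
    "pos p' = Suc (pos p)" "pos q' = Suc (pos q)" for p q p' q'
  proof -
    have l: "Suc (pos p) < len (cid p)" using pos_less[OF that(3)] that by simp
    have "nx p = p'" using nx[OF that(1) l] pos_inj[of "nx p" p'] that by simp
    moreover have "pv q' = q" using pv[OF that(4)] pos_inj[of "pv q'" q] that by simp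
    ultimately show ?thesis using c[OF that(1,4)] that l by simp
  qed
  have E2: "X p q = 0" if "p < n" "q < n" "ev (cid p) = ev (cid q)" "0 < pos p" "pos q = 0" for p q
  proof -
    note P = pv[OF that(1,4)]
    have l: "Suc (pos (pv p)) < len (cid (pv p))" using pos_less[OF that(1)] P by simp
    have "nx (pv p) = p" using nx[OF _ l] P pos_inj[of "nx (pv p)" p] that(1) by simp
    then show ?thesis using c[of "pv p" q] P l that by simp
  qed
  have E3: "X p q = 0" if "p < n" "q < n" "ev (cid p) = ev (cid q)" "Suc (pos p) = len (cid p)" "Suc (pos q) < len (cid q)" for p q
  proof -
    note N = nx[OF that(2,5)]
    have "pv (nx q) = q" using pv[of "nx q"] N pos_inj[of "pv (nx q)" q] that(2) by simp
    then show ?thesis using c[of p "nx q"] N that by simp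
  qed
  show ?thesis unfolding shift_inv_def
  proof (intro conjI allI impI)
    fix p q assume "p < n" "q < n" "ev (cid p) \<noteq> ev (cid q)"
    then show "X p q = 0" by (rule D)
  next
    fix p q p' q' assume "p < n" "q < n" "p' < n" "q' < n" "ev (cid p) = ev (cid q)" "cid p' = cid p" "cid q' = cid q"
      "pos p' = Suc (pos p)" "pos q' = Suc (pos q)"
    then show "X p' q' = X p q" by (rule E1)
  next
    fix p q assume "p < n" "q < n" "ev (cid p) = ev (cid q)" "0 < pos p" "pos q = 0"
    then show "X p q = 0" by (rule E2)
  next
    fix p q assume "p < n" "q < n" "ev (cid p) = ev (cid q)" "Suc (pos p) = len (cid p)" "Suc (pos q) < len (cid q)"
    then show "X p q = 0" by (rule E3)
  qed
qed

lemma shift_inv_imp_commutes: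
  assumes "shift_inv X"
  shows "commutes X"
  unfolding commutes_eq
proof (intro allI impI)
  fix p q assume p: "p < n" and q: "q < n"
  have D: "X p q = 0" if "p < n" "q < n" "ev (cid p) \<noteq> ev (cid q)" for p q
    using shift_invD1[OF assms] that by simp
  have E1: "X p' q' = X p q" if "p < n" "q < n" "p' < n" "q' < n" "ev (cid p) = ev (cid q)" "cid p' = cid p" "cid q' = cid q"
    "pos p' = Suc (pos p)" "pos q' = Suc (pos q)" for p q p' q'
    using shift_invD2[OF assms that] .
  have E2: "X p q = 0" if "p < n" "q < n" "ev (cid p) = ev (cid q)" "0 < pos p" "pos q = 0" for p q
    using shift_invD3[OF assms that] .
  have E3: "X p q = 0" if "p < n" "q < n" "ev (cid p) = ev (cid q)" "Suc (pos p) = len (cid p)" "Suc (pos q) < len (cid q)" for p q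
    using shift_invD4[OF assms that] .
  let ?A = "if Suc (pos p) < len (cid p) then X (nx p) q else 0" and ?B = "if pos q > 0 then X p (pv q) else 0"
  show "(ev (cid q) - ev (cid p)) * X p q = ?A - ?B"
  proof (cases "ev (cid p) = ev (cid q)")
    case False
    have "?A = 0" using nx[OF p] D[of "nx p" q] q False by auto
    moreover have "?B = 0" using pv[OF q] D[of p "pv q"] p False by auto
    ultimately show ?thesis using D[OF p q False] by simp
  next
    case True
    have "?A = ?B"
    proof (cases "Suc (pos p) < len (cid p)")
      case l: True
      note N = nx[OF p l]
      show ?thesis
      proof (cases "pos q > 0")
        case True
        note P = pv[OF q True]
        have "X (nx p) q = X p (pv q)" by (rule E1) (use N P p q \<open>ev (cid p) = ev (cid q)\<close> in simp_all)
        then show ?thesis using l True by simp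
      next
        case False
        have "X (nx p) q = 0" by (rule E2) (use N q False \<open>ev (cid p) = ev (cid q)\<close> in simp_all)
        then show ?thesis using False by simp
      qed
    next
      case l: False
      then have l': "Suc (pos p) = len (cid p)" using pos_less[OF p] by simp
      show ?thesis
      proof (cases "pos q > 0")
        case True
        note P = pv[OF q True]
        have "X p (pv q) = 0"
          by (rule E3) (use P p q l' pos_less[OF q] \<open>ev (cid p) = ev (cid q)\<close> in simp_all)
        then show ?thesis using l by simp
      qed (use l in simp)
    qed
    then show ?thesis using True by simp
  qed
qed

lemma commutes_iff_shift_inv: "commutes X \<longleftrightarrow> shift_inv X"
  using commutes_imp_shift_inv shift_inv_imp_commutes by blast

text \<open>Following the diagonal to the upper left ends in the first column, strictly below the
  first row, where the entry is 0.\<close>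

lemma shift_inv_below:
  assumes X: "shift_inv X" and "p < n" "q < n" "pos q < pos p"
  shows "X p q = 0"
proof (cases "ev (cid p) = ev (cid q)")
  case True
  then show ?thesis using assms(2-)
  proof (induction "pos q" arbitrary: p q)
    case 0
    then show ?case using shift_invD3[OF X, of p q] by simp
  next
    case (Suc i)
    have P: "pv p < n \<and> cid (pv p) = cid p \<and> Suc (pos (pv p)) = pos p" by (rule pv) (use Suc.prems in auto)
    have Q: "pv q < n \<and> cid (pv q) = cid q \<and> Suc (pos (pv q)) = pos q" by (rule pv) (use Suc in auto)
    have "X (pv p) (pv q) = 0" by (rule Suc.hyps(1)) (use P Q Suc.hyps(2) Suc.prems in auto)
    moreover have "X p q = X (pv p) (pv q)"
      by (rule shift_invD2[OF X]) (use P Q Suc.prems in auto)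
    ultimately show ?case by simp
  qed
qed (use shift_invD1[OF assms(1-3)] in simp)

text \<open>Following the diagonal to the lower right ends in the last row, strictly before the last
  column, where the entry is 0.\<close>

lemma shift_inv_short:
  assumes X: "shift_inv X" and "p < n" "q < n" "len (cid p) + pos q < len (cid q) + pos p"
  shows "X p q = 0"
proof (cases "ev (cid p) = ev (cid q)")
  case True
  then show ?thesis using assms(2-)
  proof (induction "len (cid p) - pos p" arbitrary: p q rule: less_induct)
    case less
    have lq: "Suc (pos q) < len (cid q)" using pos_less[OF less.prems(2)] less.prems(4) by linarith
    show ?case
    proof (cases "Suc (pos p) < len (cid p)")
      case l: True
      note P = nx[OF less.prems(2) l] and Q = nx[OF less.prems(3) lq]
      have "X (nx p) (nx q) = 0" by (rule less.hyps) (use P Q l less.prems in auto)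
      moreover have "X (nx p) (nx q) = X p q"
        by (rule shift_invD2[OF X less.prems(2,3)]) (use P Q less.prems(1) in auto)
      ultimately show ?thesis by simp
    next
      case False
      then have "Suc (pos p) = len (cid p)" using pos_less[OF less.prems(2)] by simp
      then show ?thesis using shift_invD4[OF X less.prems(2,3,1)] lq by simp
    qed
  qed
qed (use shift_invD1[OF assms(1-3)] in simp)

lemma shift_inv_same:
  assumes X: "shift_inv X" and "p < n" "q < n" "p' < n" "q' < n" "ev (cid p) = ev (cid q)"
    "cid p' = cid p" "cid q' = cid q" "pos p = pos q" "pos p' = pos q'"
  shows "X p q = X p' q'"
proof -
  have le: "X p q = X p' q'" if "p < n" "q < n" "p' < n" "q' < n" "ev (cid p) = ev (cid q)"
    "cid p' = cid p" "cid q' = cid q" "pos p = pos q" "pos p' = pos q'" "pos p \<le> pos p'" for p q p' q'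
    using that
  proof (induction "pos p' - pos p" arbitrary: p' q')
    case 0
    have "p' = p" by (rule pos_inj) (use 0 in simp_all)
    moreover have "q' = q" by (rule pos_inj) (use 0 in simp_all)
    ultimately show ?case by simp
  next
    case (Suc i)
    have P: "pv p' < n \<and> cid (pv p') = cid p' \<and> Suc (pos (pv p')) = pos p'"
      by (rule pv) (use Suc.prems(3) Suc.hyps(2) in simp_all)
    have Q: "pv q' < n \<and> cid (pv q') = cid q' \<and> Suc (pos (pv q')) = pos q'"
      by (rule pv) (use Suc.prems(4,9) Suc.hyps(2) in simp_all)
    have e: "ev (cid (pv p')) = ev (cid (pv q'))" using P Q Suc.prems(5-7) by simp
    have "X p q = X (pv p') (pv q')"
    proof (rule Suc.hyps(1)[OF _ Suc.prems(1,2)])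
      show "i = pos (pv p') - pos p" "pos (pv p') = pos (pv q')" "pos p \<le> pos (pv p')"
        using P Q Suc.hyps(2) Suc.prems(9) by linarith+
    qed (use P Q Suc.prems in simp_all)
    moreover have "X p' q' = X (pv p') (pv q')"
      by (rule shift_invD2[OF X _ _ Suc.prems(3,4) e]) (use P Q in simp_all)
    ultimately show ?case by simp
  qed
  show ?thesis
  proof (cases "pos p \<le> pos p'")
    case True
    show ?thesis by (rule le[OF assms(2-10) True])
  next
    case False
    have e: "ev (cid p') = ev (cid q')" using assms(6-8) by simp
    have "X p' q' = X p q"
      by (rule le[OF assms(4,5,2,3) e assms(7,8)[symmetric] assms(10,9)]) (use False in simp)
    then show ?thesis by simp
  qed
qed

text \<open>In \<open>shift_inv\<close> matrices, the entries at \<open>free\<close> positions are arbitrary; they are the starts of the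
  nonzero diagonals of the blocks.\<close>

definition free :: "(nat \<times> nat) set" where
  "free = {(p, q). p < n \<and> q < n \<and> ev (cid p) = ev (cid q) \<and> pos p = 0 \<and> len (cid q) \<le> pos q + len (cid p)}"

text \<open>The positions on the diagonals that may be nonzero; the free positions are those among
  them in the first row of a block.\<close>

definition good :: "nat \<Rightarrow> nat \<Rightarrow> bool" where
  "good p q \<longleftrightarrow> ev (cid p) = ev (cid q) \<and> pos p \<le> pos q \<and> len (cid q) + pos p \<le> pos q + len (cid p)"

text \<open>A good position off the first row is compared with its predecessor on the diagonal;
  elsewhere the entry itself is taken. Vanishing of these functionals at all positions that are not
  free describes the commutant without redundancy.\<close>

definition diag_diff :: "nat \<times> nat \<Rightarrow> fmat \<Rightarrow> complex" where
  "diag_diff x X = (case x of (p, q) \<Rightarrow> X p q - (if good p q \<and> 0 < pos p then X (pv p) (pv q) else 0))"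

lemma diag_diff_lin:
  "diag_diff x (\<lambda>p q. a * u p q + b * v p q) = a * diag_diff x u + b * diag_diff x v"
proof -
  obtain p q where x: "x = (p, q)" by (cases x)
  show ?thesis unfolding diag_diff_def x prod.case
    by (cases "good p q \<and> 0 < pos p") (simp_all only: if_True if_False simp_thms, simp_all add: right_diff_distrib)
qed

lemma diag_diff_zero_iff:
  "(\<forall>x\<in>{..<n} \<times> {..<n} - free. diag_diff x X = 0) \<longleftrightarrow> shift_inv X"
proof
  assume X: "shift_inv X"
  show "\<forall>x\<in>{..<n} \<times> {..<n} - free. diag_diff x X = 0"
  proof
    fix x assume "x \<in> {..<n} \<times> {..<n} - free"
    then obtain p q where x: "x = (p, q)" "p < n" "q < n" "(p, q) \<notin> free" by auto
    show "diag_diff x X = 0"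
    proof (cases "good p q \<and> 0 < pos p")
      case True
      note P = pv[OF x(2)] and Q = pv[OF x(3)]
      have "X p q = X (pv p) (pv q)"
        by (rule shift_invD2[OF X]) (use P Q True x in \<open>auto simp: good_def\<close>)
      then show ?thesis using True by (simp add: diag_diff_def x)
    next
      case False
      have "X p q = 0"
      proof (cases "ev (cid p) = ev (cid q)")
        case ev: True
        have "\<not> good p q" using False x by (auto simp: good_def free_def)
        then have "pos q < pos p \<or> len (cid p) + pos q < len (cid q) + pos p" using ev by (auto simp: good_def)
        then show ?thesis using shift_inv_below[OF X x(2,3)] shift_inv_short[OF X x(2,3)] by blast
      qed (use shift_invD1[OF X x(2,3)] in simp)
      then show ?thesis using False by (auto simp: diag_diff_def x)
    qed
  qed
next
  assume X: "\<forall>x\<in>{..<n} \<times> {..<n} - free. diag_diff x X = 0"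
  have bad: "X p q = 0" if "p < n" "q < n" "\<not> good p q" for p q
  proof -
    have "(p, q) \<in> {..<n} \<times> {..<n} - free" using that by (auto simp: free_def good_def)
    from X[rule_format, OF this] show ?thesis using that by (simp add: diag_diff_def)
  qed
  have step: "X p' q' = X p q" if "p < n" "q < n" "p' < n" "q' < n" "ev (cid p) = ev (cid q)" "cid p' = cid p" "cid q' = cid q"
    "pos p' = Suc (pos p)" "pos q' = Suc (pos q)" for p q p' q'
  proof (cases "good p q")
    case True
    have "pv p' = p" using pv[OF that(3)] pos_inj[of "pv p'" p] that by simp
    moreover have "pv q' = q" using pv[OF that(4)] pos_inj[of "pv q'" q] that by simp
    moreover have "(p', q') \<in> {..<n} \<times> {..<n} - free" using that by (auto simp: free_def)
    moreover have "good p' q'" using True that by (simp add: good_def)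
    ultimately show ?thesis using X[rule_format, of "(p', q')"] that by (simp add: diag_diff_def)
  next
    case False
    then have "\<not> good p' q'" using that by (simp add: good_def)
    then show ?thesis using bad[OF that(1,2) False] bad[OF that(3,4)] by simp
  qed
  show "shift_inv X"
    unfolding shift_inv_def
  proof (intro conjI allI impI)
    fix p q assume "p < n" "q < n" "ev (cid p) \<noteq> ev (cid q)"
    then show "X p q = 0" by (intro bad) (auto simp: good_def)
  next
    fix p q p' q' assume "p < n" "q < n" "p' < n" "q' < n" "ev (cid p) = ev (cid q)" "cid p' = cid p" "cid q' = cid q"
      "pos p' = Suc (pos p)" "pos q' = Suc (pos q)"
    then show "X p' q' = X p q" by (rule step)
  next
    fix p q assume "p < n" "q < n" "ev (cid p) = ev (cid q)" "0 < pos p" "pos q = 0"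
    then show "X p q = 0" by (intro bad) (auto simp: good_def)
  next
    fix p q assume "p < n" "q < n" "ev (cid p) = ev (cid q)" "Suc (pos p) = len (cid p)" "Suc (pos q) < len (cid q)"
    then show "X p q = 0" by (intro bad) (auto simp: good_def)
  qed
qed

text \<open>Sums prescribed differences along a diagonal, starting in the first row. The counter
  stands for \<open>pos p\<close>, the number of steps from there.\<close>

primrec solve :: "(nat \<times> nat \<Rightarrow> complex) \<Rightarrow> nat \<Rightarrow> fmat" where
  "solve t 0 = (\<lambda>p q. t (p, q))"
| "solve t (Suc i) = (\<lambda>p q. t (p, q) + (if good p q then solve t i (pv p) (pv q) else 0))"

lemma diag_diff_surj: "\<exists>X. \<forall>x\<in>{..<n} \<times> {..<n} - free. diag_diff x X = t x"
proof (rule exI[of _ "\<lambda>p q. solve t (pos p) p q"], rule ballI)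
  fix x assume "x \<in> {..<n} \<times> {..<n} - free"
  then obtain p q where x: "x = (p, q)" "p < n" "q < n" by auto
  show "diag_diff x (\<lambda>p q. solve t (pos p) p q) = t x"
  proof (cases "pos p")
    case 0
    then show ?thesis by (simp add: diag_diff_def x)
  next
    case (Suc i)
    then have "pos (pv p) = i" using pv[OF x(2)] by simp
    then show ?thesis using Suc by (simp add: diag_diff_def x)
  qed
qed

end

lemma (in chains) diag_diff_cong:
  assumes "\<And>p q. p < n \<Longrightarrow> q < n \<Longrightarrow> X p q = Y p q" and x: "x \<in> {..<n} \<times> {..<n}"
  shows "diag_diff x X = diag_diff x Y"
proof -
  obtain p q where x': "x = (p, q)" "p < n" "q < n" using x by auto
  show ?thesis
  proof (cases "good p q \<and> 0 < pos p")
    case True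
    then have "0 < pos q" by (simp add: good_def)
    then have "X (pv p) (pv q) = Y (pv p) (pv q)" using pv[of p] pv[of q] True x' by (intro assms(1)) simp_all
    then show ?thesis using assms(1)[OF x'(2,3)] True by (simp add: diag_diff_def x')
  next
    case False
    then show ?thesis unfolding diag_diff_def x' prod.case if_not_P[OF False] using assms(1)[OF x'(2,3)] by simp
  qed
qed

section \<open>The codimension of the centralizer from the sizes of the Jordan blocks\<close>

definition jstrips :: "(nat \<times> complex) list \<Rightarrow> ((nat \<times> complex) \<times> nat) list" where
  "jstrips xs = map (\<lambda>(q, c). ((q, c), q)) xs"

lemma jstrips_nth: "a < length xs \<Longrightarrow> jstrips xs ! a = (xs ! a, fst (xs ! a))"
  by (simp add: jstrips_def split: prod.split)

lemma total_jstrips: "total_size (jstrips xs) = sum_list (map fst xs)"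
  by (induction xs) (auto simp: jstrips_def)

lemma jstrips_chains:
  "chains (total_size (jstrips xs)) (sidx (jstrips xs)) (sloc (jstrips xs)) (\<lambda>a. fst (xs ! a))"
proof
  let ?ss = "jstrips xs"
  have L: "length ?ss = length xs" by (simp add: jstrips_def)
  show "sloc ?ss p < fst (xs ! sidx ?ss p)" if "p < total_size ?ss" for p
    using coord_props[OF that] by (simp add: L jstrips_nth)
  show "p = q" if "p < total_size ?ss" "q < total_size ?ss" "sidx ?ss p = sidx ?ss q" "sloc ?ss p = sloc ?ss q" for p q
    using coord_inj[OF that] .
  show "\<exists>q<total_size ?ss. sidx ?ss q = sidx ?ss p \<and> sloc ?ss q = i" if "p < total_size ?ss" "i < fst (xs ! sidx ?ss p)" for p i
  proof -
    have "sidx ?ss p < length ?ss" by (rule coord_props(1)[OF that(1)])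
    moreover have "i < snd (?ss ! sidx ?ss p)" using that(2) calculation by (simp add: L jstrips_nth)
    ultimately show ?thesis using coord_start[of "sidx ?ss p" ?ss i] by blast
  qed
qed

lemma jordan_matrix_coord:
  assumes "p < total_size (jstrips xs)" "q < total_size (jstrips xs)"
  shows "jordan_matrix xs $$ (p, q) =
    chains.jm (sidx (jstrips xs)) (sloc (jstrips xs)) (\<lambda>a. snd (xs ! a)) p q"
proof -
  let ?ss = "jstrips xs" and ?Ms = "map (\<lambda>(n, a). jordan_block n a) xs"
  have m: "map (\<lambda>M. (M, dim_row M)) ?Ms = map (\<lambda>(a, s). ((case a of (n, c) \<Rightarrow> jordan_block n c), s)) ?ss"
    by (auto simp: jstrips_def)
  note P = coord_map[OF assms(1), of "\<lambda>a. case a of (n, c) \<Rightarrow> jordan_block n c"]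
  note Q = coord_map[OF assms(2), of "\<lambda>a. case a of (n, c) \<Rightarrow> jordan_block n c"]
  have L: "length ?ss = length xs" by (simp add: jstrips_def)
  have sq: "square_mat M" if "M \<in> set ?Ms" for M using that by auto
  have pq: "p < total_size (map (\<lambda>M. (M, dim_row M)) ?Ms)" "q < total_size (map (\<lambda>M. (M, dim_row M)) ?Ms)"
    unfolding m total_map by (rule assms)+
  have e: "jordan_matrix xs $$ (p, q) = (if sidx ?ss p = sidx ?ss q then
      (case slab ?ss p of (n, c) \<Rightarrow> jordan_block n c) $$ (sloc ?ss p, sloc ?ss q) else 0)"
    unfolding jordan_matrix_def using diag_block_mat_coord[of ?Ms p q, OF sq pq]
    unfolding m Let_def P Q .
  note cp = coord_props[OF assms(1)] and cq = coord_props[OF assms(2)]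
  have sp: "slab ?ss p = xs ! sidx ?ss p" using cp by (simp add: L jstrips_nth)
  have lp: "sloc ?ss p < fst (xs ! sidx ?ss p)" "sloc ?ss q < fst (xs ! sidx ?ss q)"
    using cp cq by (simp_all add: L jstrips_nth)
  have "p = q \<longleftrightarrow> sidx ?ss p = sidx ?ss q \<and> sloc ?ss p = sloc ?ss q" using coord_inj[OF assms] by auto
  then show ?thesis unfolding e sp chains.jm_def[OF jstrips_chains] using lp
    by (cases "xs ! sidx ?ss p") auto
qed

text \<open>Frobenius's formula for the dimension of the space of intertwiners between two Jordan
  matrices.\<close>

definition pair_min :: "(nat \<times> complex) list \<Rightarrow> (nat \<times> complex) list \<Rightarrow> nat" where
  "pair_min xs ys = (\<Sum>a<length xs. \<Sum>b<length ys. if snd (xs ! a) = snd (ys ! b) then min (fst (xs ! a)) (fst (ys ! b)) else 0)"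

text \<open>Between chains of lengths \<open>x\<close> and \<open>y\<close> with the same
  eigenvalue, the free positions are those of the first row from column \<open>y - x\<close> on,
  which are \<open>min x y\<close> many.\<close>

lemma card_free_jordan:
  assumes pos: "\<And>x. x \<in> set xs \<Longrightarrow> 1 \<le> fst x"
  shows "card (chains.free (total_size (jstrips xs)) (sidx (jstrips xs)) (sloc (jstrips xs)) (\<lambda>a. fst (xs ! a)) (\<lambda>a. snd (xs ! a)))
    = pair_min xs xs"
proof -
  let ?ss = "jstrips xs"
  interpret chains "total_size ?ss" "sidx ?ss" "sloc ?ss" "\<lambda>a. fst (xs ! a)" "\<lambda>a. snd (xs ! a)" by (rule jstrips_chains)
  have L: "length ?ss = length xs" by (simp add: jstrips_def)
  define c where "c p q = (snd (xs ! sidx ?ss p) = snd (xs ! sidx ?ss q) \<and> sloc ?ss p = 0 \<and>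
    fst (xs ! sidx ?ss q) \<le> sloc ?ss q + fst (xs ! sidx ?ss p))" for p q
  have "free = {x \<in> {..<total_size ?ss} \<times> {..<total_size ?ss}. c (fst x) (snd x)}" by (auto simp: free_def c_def)
  then have "card free = (\<Sum>x\<in>{..<total_size ?ss} \<times> {..<total_size ?ss}. if c (fst x) (snd x) then 1 else 0)"
    by (simp add: sum.If_cases Int_def)
  also have "\<dots> = (\<Sum>p<total_size ?ss. \<Sum>q<total_size ?ss. if c p q then 1 else 0)"
    by (simp add: sum.cartesian_product case_prod_beta)
  also have "\<dots> = (\<Sum>a<length xs. \<Sum>i<fst (xs ! a). \<Sum>b<length xs. \<Sum>j<fst (xs ! b).
      if snd (xs ! a) = snd (xs ! b) \<and> i = 0 \<and> fst (xs ! b) \<le> j + fst (xs ! a) then 1 else 0)"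
    unfolding sum_total L
  proof (intro sum.cong)
    fix a i b j
    assume a: "a \<in> {..<length xs}" and b: "b \<in> {..<length xs}" and i: "i \<in> {..<fst (xs ! a)}" and j: "j \<in> {..<fst (xs ! b)}"
    have "i < snd (?ss ! a)" "j < snd (?ss ! b)" using a b i j by (simp_all add: jstrips_nth)
    then show "(if c (start ?ss a + i) (start ?ss b + j) then 1 else 0) =
      (if snd (xs ! a) = snd (xs ! b) \<and> i = 0 \<and> fst (xs ! b) \<le> j + fst (xs ! a) then 1 else 0)"
      using a b coord_start[of a ?ss i] coord_start[of b ?ss j] by (simp add: c_def L)
  qed (simp_all add: jstrips_nth)
  also have "\<dots> = pair_min xs xs"
    unfolding pair_min_def
  proof (rule sum.cong[OF refl])
    fix a assume a: "a \<in> {..<length xs}"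
    then have pa: "0 < fst (xs ! a)" using pos[of "xs ! a"] by simp
    have "(\<Sum>i<fst (xs ! a). \<Sum>b<length xs. \<Sum>j<fst (xs ! b).
      if snd (xs ! a) = snd (xs ! b) \<and> i = 0 \<and> fst (xs ! b) \<le> j + fst (xs ! a) then 1 else 0) =
      (\<Sum>i<fst (xs ! a). if i = 0 then (\<Sum>b<length xs. \<Sum>j<fst (xs ! b).
      if snd (xs ! a) = snd (xs ! b) \<and> fst (xs ! b) \<le> j + fst (xs ! a) then 1 else 0) else (0::nat))"
      by (rule sum.cong) auto
    also have "\<dots> = (\<Sum>b<length xs. \<Sum>j<fst (xs ! b).
      if snd (xs ! a) = snd (xs ! b) \<and> fst (xs ! b) \<le> j + fst (xs ! a) then 1 else 0)" using pa by simp
    also have "\<dots> = (\<Sum>b<length xs. if snd (xs ! a) = snd (xs ! b) then min (fst (xs ! a)) (fst (xs ! b)) else 0)"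
    proof (rule sum.cong[OF refl])
      fix b
      have "(\<Sum>j<y. if y \<le> j + x then 1 else 0) = min x y" for x y :: nat
      proof -
        have "(\<Sum>j<y. if y \<le> j + x then 1 else 0) = card {j. j < y \<and> y \<le> j + x}"
          by (simp add: sum.If_cases Int_def)
        moreover have "{j. j < y \<and> y \<le> j + x} = {y - x..<y}" by auto
        ultimately show ?thesis by simp
      qed
      then show "(\<Sum>j<fst (xs ! b). if snd (xs ! a) = snd (xs ! b) \<and> fst (xs ! b) \<le> j + fst (xs ! a) then 1 else 0) =
        (if snd (xs ! a) = snd (xs ! b) then min (fst (xs ! a)) (fst (xs ! b)) else 0)"
        by (cases "snd (xs ! a) = snd (xs ! b)") simp_all
    qed
    finally show "(\<Sum>i<fst (xs ! a). \<Sum>b<length xs. \<Sum>j<fst (xs ! b).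
      if snd (xs ! a) = snd (xs ! b) \<and> i = 0 \<and> fst (xs ! b) \<le> j + fst (xs ! a) then 1 else 0) =
      (\<Sum>b<length xs. if snd (xs ! a) = snd (xs ! b) then min (fst (xs ! a)) (fst (xs ! b)) else 0)" .
  qed
  finally show ?thesis .
qed

text \<open>In a decreasing list the minimum of two entries is the one with the larger index, and
  \<open>j\<close> is the larger index of exactly \<open>2 * j - 1\<close> pairs.\<close>

lemma sum_min_sorted:
  assumes "sorted_wrt (\<ge>) (qs :: nat list)"
  shows "(\<Sum>a<length qs. \<Sum>b<length qs. min (qs ! a) (qs ! b)) = (\<Sum>j=1..length qs. (2 * j - 1) * qs ! (j - 1))"
  using assms
proof (induction qs rule: rev_induct)
  case (snoc q qs)
  let ?L = "length qs"
  have le: "q \<le> qs ! a" if "a < ?L" for a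
    using snoc.prems that by (auto simp: sorted_wrt_append)
  have "(\<Sum>a<length (qs @ [q]). \<Sum>b<length (qs @ [q]). min ((qs @ [q]) ! a) ((qs @ [q]) ! b)) =
    (\<Sum>a<?L. (\<Sum>b<?L. min (qs ! a) (qs ! b)) + q) + ((\<Sum>b<?L. q) + q)"
    by (simp add: nth_append le min_absorb1 min_absorb2)
  also have "\<dots> = (\<Sum>a<?L. \<Sum>b<?L. min (qs ! a) (qs ! b)) + (2 * Suc ?L - 1) * q"
    by (simp add: sum.distrib algebra_simps)
  also have "(\<Sum>a<?L. \<Sum>b<?L. min (qs ! a) (qs ! b)) = (\<Sum>j=1..?L. (2 * j - 1) * qs ! (j - 1))"
    using snoc by (simp add: sorted_wrt_append)
  also have "\<dots> = (\<Sum>j=1..?L. (2 * j - 1) * (qs @ [q]) ! (j - 1))"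
    by (rule sum.cong) (auto simp: nth_append)
  finally show ?case by simp
qed simp

lemma pair_min_append_left: "pair_min (xs @ xs') ys = pair_min xs ys + pair_min xs' ys"
  unfolding pair_min_def length_append sum_lessThan_add by (simp add: nth_append cong: if_cong)

lemma pair_min_append_right: "pair_min xs (ys @ ys') = pair_min xs ys + pair_min xs ys'"
  unfolding pair_min_def length_append sum_lessThan_add by (simp add: nth_append sum.distrib cong: if_cong)

lemma pair_min_disjoint: "snd ` set xs \<inter> snd ` set ys = {} \<Longrightarrow> pair_min xs ys = 0"
  unfolding pair_min_def by (intro sum.neutral ballI) (auto dest!: nth_mem)

definition jlist :: "(complex \<times> nat list) list \<Rightarrow> (nat \<times> complex) list" where
  "jlist cqs = concat (map (\<lambda>(c, qs). map (\<lambda>q. (q, c)) qs) cqs)"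

lemma pair_min_jlist:
  assumes "distinct (map fst cqs)" "\<And>c qs. (c, qs) \<in> set cqs \<Longrightarrow> sorted_wrt (\<ge>) qs"
  shows "pair_min (jlist cqs) (jlist cqs) =
    (\<Sum>i<length cqs. \<Sum>j=1..length (snd (cqs ! i)). (2 * j - 1) * snd (cqs ! i) ! (j - 1))"
  using assms
proof (induction cqs)
  case Nil
  show ?case by (simp add: jlist_def pair_min_def)
next
  case (Cons x cqs)
  obtain c qs where x: "x = (c, qs)" by (cases x)
  let ?A = "map (\<lambda>q. (q, c)) qs"
  have j: "jlist (x # cqs) = ?A @ jlist cqs" by (simp add: jlist_def x)
  have dj: "snd ` set ?A \<inter> snd ` set (jlist cqs) = {}"
    using Cons.prems(1) by (force simp: jlist_def x)
  have "pair_min ?A ?A = (\<Sum>a<length qs. \<Sum>b<length qs. min (qs ! a) (qs ! b))"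
    by (simp add: pair_min_def)
  also have "\<dots> = (\<Sum>j=1..length qs. (2 * j - 1) * qs ! (j - 1))"
    by (rule sum_min_sorted) (use Cons.prems(2)[of c qs] in \<open>simp add: x\<close>)
  finally have A: "pair_min ?A ?A = (\<Sum>j=1..length qs. (2 * j - 1) * qs ! (j - 1))" .
  have "pair_min (jlist cqs) (jlist cqs) =
    (\<Sum>i<length cqs. \<Sum>j=1..length (snd (cqs ! i)). (2 * j - 1) * snd (cqs ! i) ! (j - 1))"
    using Cons.prems by (intro Cons.IH) auto
  then show ?case
    unfolding j pair_min_append_left pair_min_append_right length_Cons sum.lessThan_Suc_shift
    using A pair_min_disjoint[OF dj] pair_min_disjoint[of "jlist cqs" ?A] dj by (simp add: x Int_commute)
qed

text \<open>\<open>W\<close> is only known to be similar to the Jordan matrix, so the functionals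
  \<open>diag_diff\<close> are transported by conjugation with the similarity. An explicit family of
  functionals that is jointly onto is produced, rather than a dimension, because this is what
  \<open>codim_step\<close> consumes.\<close>

lemma commutant_functionals:
  assumes W: "W \<in> carrier_mat k k" and data: "jordan_data cqs" and sim: "similar_mat W (jordan_of_data cqs)"
  shows "\<exists>K (G :: nat \<times> nat \<Rightarrow> fmat \<Rightarrow> complex). finite K \<and>
    card K = k\<^sup>2 - (\<Sum>i<length cqs. \<Sum>j=1..length (snd (cqs ! i)). (2 * j - 1) * snd (cqs ! i) ! (j - 1)) \<and>
    (\<forall>x\<in>K. \<forall>a b u v. G x (\<lambda>p q. a * u p q + b * v p q) = a * G x u + b * G x v) \<and>
    (\<forall>X. (\<forall>x\<in>K. G x X = 0) \<longleftrightarrow> (\<forall>p<k. \<forall>q<k. mm k X (\<lambda>p q. W $$ (p, q)) p q = mm k (\<lambda>p q. W $$ (p, q)) X p q)) \<and>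
    (\<forall>t. \<exists>X. \<forall>x\<in>K. G x X = t x)"
proof -
  let ?xs = "jlist cqs"
  let ?ss = "jstrips ?xs"
  let ?J = "jordan_matrix ?xs"
  have J: "jordan_of_data cqs = ?J" by (simp add: jordan_of_data_def jlist_def)
  interpret chains "total_size ?ss" "sidx ?ss" "sloc ?ss" "\<lambda>a. fst (?xs ! a)" "\<lambda>a. snd (?xs ! a)" by (rule jstrips_chains)
  from similar_matD[OF sim[unfolded J]] obtain n U V where
    car: "{W, ?J, U, V} \<subseteq> carrier_mat n n" and UV: "U * V = 1\<^sub>m n" "V * U = 1\<^sub>m n" and WUV: "W = U * ?J * V" by blast
  have nk: "n = k" using car W by auto
  have Jc: "?J \<in> carrier_mat k k" and Uc: "U \<in> carrier_mat k k" and Vc: "V \<in> carrier_mat k k" using car nk by auto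
  have tk: "total_size ?ss = k" using Jc by (auto simp: total_jstrips)
  define Uf Vf where "Uf p q = U $$ (p, q)" and "Vf p q = V $$ (p, q)" for p q
  have sqm: "sq k (mm k X Y) = sq k X * sq k Y" for X Y
    by (rule eq_matI) (auto simp: scalar_prod_def mm_def atLeast0LessThan)
  have sqe: "(\<forall>p<k. \<forall>q<k. X p q = Y p q) \<longleftrightarrow> sq k X = sq k Y" for X Y
  proof
    assume "sq k X = sq k Y"
    then show "\<forall>p<k. \<forall>q<k. X p q = Y p q" using sq_simps(2) by metis
  qed (auto intro!: eq_matI)
  have sqU: "sq k Uf = U" and sqV: "sq k Vf = V" and sqW: "sq k (\<lambda>p q. W $$ (p, q)) = W"
    using Uc Vc W by (auto intro!: eq_matI simp: Uf_def Vf_def sq_def)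
  have sqJ: "sq k jm = ?J"
    using Jc jordan_matrix_coord[of _ ?xs] tk by (intro eq_matI) auto
  define tr where "tr X = mm k Vf (mm k X Uf)" for X
  have sqtr: "sq k (tr X) = V * (sq k X * U)" for X by (simp add: tr_def sqm sqU sqV)
  have as: "A * B * C = A * (B * C)" if "A \<in> carrier_mat k k" "B \<in> carrier_mat k k" "C \<in> carrier_mat k k" for A B C :: "complex mat"
    using assoc_mult_mat[OF that] .
  have c1: "U * (V * A) = A" "V * (U * A) = A" if "A \<in> carrier_mat k k" for A
  proof -
    have "U * (V * A) = U * V * A" by (rule as[OF Uc Vc that, symmetric])
    then show "U * (V * A) = A" using UV(1) that nk by simp
    have "V * (U * A) = V * U * A" by (rule as[OF Vc Uc that, symmetric])
    then show "V * (U * A) = A" using UV(2) that nk by simp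
  qed
  have mc: "A * B \<in> carrier_mat k k" if "A \<in> carrier_mat k k" "B \<in> carrier_mat k k" for A B :: "complex mat"
    by (rule mult_carrier_mat[OF that])
  have comm: "shift_inv (tr X) \<longleftrightarrow> (\<forall>p<k. \<forall>q<k. mm k X (\<lambda>p q. W $$ (p, q)) p q = mm k (\<lambda>p q. W $$ (p, q)) X p q)" for X
  proof -
    let ?X = "sq k X"
    have Xc: "?X \<in> carrier_mat k k" by simp
    have "shift_inv (tr X) \<longleftrightarrow> commutes (tr X)" by (rule commutes_iff_shift_inv[symmetric])
    also have "\<dots> \<longleftrightarrow> (\<forall>p<k. \<forall>q<k. mm k (tr X) jm p q = mm k jm (tr X) p q)"
      unfolding commutes_def unfolding tk by (rule refl)
    also have "\<dots> \<longleftrightarrow> sq k (mm k (tr X) jm) = sq k (mm k jm (tr X))" by (rule sqe)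
    also have "\<dots> \<longleftrightarrow> V * (?X * U) * ?J = ?J * (V * (?X * U))" by (simp only: sqm sqtr sqJ)
    also have "\<dots> \<longleftrightarrow> ?X * W = W * ?X"
    proof
      assume e: "V * (?X * U) * ?J = ?J * (V * (?X * U))"
      have "?X * W = ?X * (U * (?J * V))" by (simp only: WUV as[OF Uc Jc Vc])
      also have "\<dots> = U * (V * (?X * (U * (?J * V))))" by (simp add: c1(1) mc Xc Uc Jc Vc)
      also have "\<dots> = U * ((V * (?X * U) * ?J) * V)" by (simp add: as mc Xc Uc Jc Vc)
      also have "\<dots> = U * ((?J * (V * (?X * U))) * V)" by (simp only: e)
      also have "\<dots> = U * (?J * (V * (?X * (U * V))))" by (simp add: as mc Xc Uc Jc Vc)
      also have "\<dots> = U * (?J * (V * ?X))" unfolding UV(1) nk right_mult_one_mat[OF Xc] by (rule refl)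
      also have "\<dots> = W * ?X" unfolding WUV by (simp add: as mc Xc Uc Jc Vc)
      finally show "?X * W = W * ?X" .
    next
      assume e: "?X * W = W * ?X"
      have VU: "?J * V * U = ?J"
        unfolding as[OF Jc Vc Uc] UV(2) nk by (rule right_mult_one_mat[OF Jc])
      have "V * (?X * U) * ?J = V * (?X * (U * (?J * V * U)))" unfolding VU by (simp add: as mc Xc Uc Jc Vc)
      also have "\<dots> = V * ((?X * W) * U)" unfolding WUV by (simp add: as mc Xc Uc Jc Vc)
      also have "\<dots> = V * ((W * ?X) * U)" by (simp only: e)
      also have "\<dots> = V * (U * (?J * (V * (?X * U))))" unfolding WUV by (simp add: as mc Xc Uc Jc Vc)
      also have "\<dots> = ?J * (V * (?X * U))" by (rule c1(2)) (simp add: mc Xc Uc Jc Vc)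
      finally show "V * (?X * U) * ?J = ?J * (V * (?X * U))" .
    qed
    also have "\<dots> \<longleftrightarrow> (\<forall>p<k. \<forall>q<k. mm k X (\<lambda>p q. W $$ (p, q)) p q = mm k (\<lambda>p q. W $$ (p, q)) X p q)"
      by (simp only: sqe sqm sqW)
    finally show ?thesis .
  qed
  define K :: "(nat \<times> nat) set" where "K = {..<k} \<times> {..<k} - free"
  have fsub: "free \<subseteq> {..<k} \<times> {..<k}" unfolding free_def unfolding tk by auto
  have fin: "finite K" by (simp add: K_def)
  have "card K = k\<^sup>2 - card free"
    unfolding K_def using fsub finite_subset[OF fsub] by (subst card_Diff_subset) (auto simp: power2_eq_square)
  moreover have "card free = (\<Sum>i<length cqs. \<Sum>j=1..length (snd (cqs ! i)). (2 * j - 1) * snd (cqs ! i) ! (j - 1))"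
  proof -
    have "card free = pair_min ?xs ?xs"
      by (rule card_free_jordan) (use data in \<open>auto simp: jlist_def jordan_data_def\<close>)
    also have "\<dots> = (\<Sum>i<length cqs. \<Sum>j=1..length (snd (cqs ! i)). (2 * j - 1) * snd (cqs ! i) ! (j - 1))"
      by (rule pair_min_jlist) (use data in \<open>auto simp: jordan_data_def\<close>)
    finally show ?thesis .
  qed
  ultimately have cardK: "card K = k\<^sup>2 - (\<Sum>i<length cqs. \<Sum>j=1..length (snd (cqs ! i)). (2 * j - 1) * snd (cqs ! i) ! (j - 1))"
    by simp
  let ?G = "\<lambda>x X. diag_diff x (tr X)"
  have "?G x (\<lambda>p q. a * u p q + b * v p q) = a * ?G x u + b * ?G x v" for x a b u v
  proof -
    have "tr (\<lambda>p q. a * u p q + b * v p q) = (\<lambda>p q. a * tr u p q + b * tr v p q)"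
      by (intro ext) (simp add: tr_def mm_def sum_distrib_left sum_distrib_right sum.distrib algebra_simps)
    then show ?thesis by (simp only: diag_diff_lin)
  qed
  moreover have "(\<forall>x\<in>K. ?G x X = 0) \<longleftrightarrow> (\<forall>p<k. \<forall>q<k. mm k X (\<lambda>p q. W $$ (p, q)) p q = mm k (\<lambda>p q. W $$ (p, q)) X p q)" for X
    unfolding comm[symmetric] using diag_diff_zero_iff[of "tr X"] unfolding K_def unfolding tk .
  moreover have "\<exists>X. \<forall>x\<in>K. ?G x X = t x" for t
  proof -
    obtain X0 where X0: "\<forall>x\<in>K. diag_diff x X0 = t x" using diag_diff_surj[of t] unfolding K_def unfolding tk by (elim exE)
    let ?X = "mm k Uf (mm k X0 Vf)"
    have "sq k (tr ?X) = sq k X0"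
    proof -
      have "V * (U * (sq k X0 * V) * U) = V * (U * (sq k X0 * (V * U)))" by (simp add: as mc Uc Vc)
      also have "\<dots> = sq k X0" unfolding UV(2) nk by (simp add: c1(2) Uc)
      finally show ?thesis by (simp add: sqtr sqm sqU sqV)
    qed
    then have eq: "\<forall>p<k. \<forall>q<k. tr ?X p q = X0 p q" using sqe by blast
    have "diag_diff x (tr ?X) = t x" if "x \<in> K" for x
    proof -
      have "diag_diff x (tr ?X) = diag_diff x X0"
        by (rule diag_diff_cong) (use eq that in \<open>auto simp: tk K_def\<close>)
      then show ?thesis using X0 that by simp
    qed
    then show ?thesis by blast
  qed
  ultimately show ?thesis using fin cardK by (intro exI[where x = K] exI[where x = ?G] conjI) blast+
qed

section \<open>Weyr matrices as rearranged Jordan matrices, and their standard partition\<close>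

definition wnext :: "nat list \<Rightarrow> nat \<Rightarrow> nat" where
  "wnext ws i = (if i < length ws then ws ! i else 0)"

text \<open>A part of the conjugate partition: position \<open>x\<close> recurs in every strip of
  size greater than \<open>x\<close>, so this is the length of the Jordan chain running through
  it.\<close>

definition clen :: "nat list \<Rightarrow> nat \<Rightarrow> nat" where
  "clen ws x = length (filter (\<lambda>w. x < w) ws)"

lemma clen_le: "clen ws x \<le> length ws"
  by (simp add: clen_def)

lemma less_clen_iff:
  assumes "sorted_wrt (\<ge>) ws"
  shows "i < clen ws x \<longleftrightarrow> x < wnext ws i"
  using assms
proof (induction ws arbitrary: i)
  case (Cons w ws)
  show ?case
  proof (cases "x < w")
    case True
    then show ?thesis using Cons by (cases i) (simp_all add: clen_def wnext_def)
  next
    case False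
    then have "filter (\<lambda>w. x < w) ws = []" using Cons.prems by (auto simp: filter_empty_conv)
    moreover have "\<forall>v\<in>set (w # ws). v \<le> x" using Cons.prems False by auto
    then have "wnext (w # ws) i \<le> x" unfolding all_set_conv_all_nth by (simp add: wnext_def)
    ultimately show ?thesis using False by (simp add: clen_def)
  qed
qed (simp add: clen_def wnext_def)

lemma wnext_antimono: "sorted_wrt (\<ge>) ws \<Longrightarrow> wnext ws (Suc i) \<le> wnext ws i"
  by (auto simp: wnext_def sorted_wrt_iff_nth_less)

definition jl :: "nat list \<Rightarrow> (nat \<times> nat) list" where
  "jl ws = map (\<lambda>j. (j, ws ! (j - 1))) [1..<Suc (length ws)]"

definition ql :: "complex \<Rightarrow> nat list \<Rightarrow> nat \<Rightarrow> ((complex \<times> nat) \<times> nat) list" where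
  "ql c ws j = map (\<lambda>q. ((c, q), jordan_count ws q)) (rev [j..<Suc (length ws)])"

lemma jl_nth: "i < length ws \<Longrightarrow> jl ws ! i = (Suc i, ws ! i)"
  by (simp add: jl_def del: upt_Suc)

lemma length_jl: "length (jl ws) = length ws"
  by (simp add: jl_def del: upt_Suc)

lemma total_jl: "total_size (jl ws) = sum_list ws"
proof -
  have "map snd (jl ws) = ws" by (rule nth_equalityI) (simp_all add: length_jl jl_nth)
  then show ?thesis by (simp add: total_size_def)
qed

lemma start_jl: "j \<le> length ws \<Longrightarrow> start (jl ws) j = sum_list (take j ws)"
proof (induction j)
  case (Suc j)
  then show ?case by (simp add: start_def jl_nth take_Suc_conv_app_nth)
qed (simp add: start_def)

text \<open>Within a strip, longer chains come first, so position \<open>x\<close> falls into the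
  substrip of its chain length \<open>clen ws x\<close>. The induction runs from the last strip
  upwards to the first, because the substrips of strip \<open>j\<close> are those of strip
  \<open>Suc j\<close> followed by one more.\<close>

lemma ql_coord:
  assumes s: "sorted_wrt (\<ge>) ws" and "1 \<le> j" "j \<le> Suc (length ws)"
  shows "total_size (ql c ws j) = wnext ws (j - 1) \<and> (\<forall>x<wnext ws (j - 1). slab (ql c ws j) x = (c, clen ws x) \<and>
    sloc (ql c ws j) x = x - wnext ws (clen ws x) \<and> sidx (ql c ws j) x = length ws - clen ws x)"
  using assms(2,3)
proof (induction "Suc (length ws) - j" arbitrary: j)
  case 0
  then show ?case by (simp add: ql_def wnext_def)
next
  case (Suc i)
  have jl: "j \<le> length ws" using Suc.hyps(2) by simp
  have "i = Suc (length ws) - Suc j" "1 \<le> Suc j" "Suc j \<le> Suc (length ws)" using Suc.hyps(2) jl by auto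
  from Suc.hyps(1)[OF this] have IH: "total_size (ql c ws (Suc j)) = wnext ws j"
    "\<And>x. x < wnext ws j \<Longrightarrow> slab (ql c ws (Suc j)) x = (c, clen ws x) \<and>
    sloc (ql c ws (Suc j)) x = x - wnext ws (clen ws x) \<and> sidx (ql c ws (Suc j)) x = length ws - clen ws x" by simp_all
  have split: "ql c ws j = ql c ws (Suc j) @ [((c, j), jordan_count ws j)]"
    using jl by (simp add: ql_def upt_conv_Cons del: upt_Suc)
  have cnt: "jordan_count ws j = wnext ws (j - 1) - wnext ws j"
  proof -
    have "j - 1 < length ws" using jl Suc.prems(1) by linarith
    then show ?thesis by (simp add: jordan_count_def wnext_def)
  qed
  have le: "wnext ws j \<le> wnext ws (j - 1)" using wnext_antimono[OF s, of "j - 1"] Suc.prems(1) by simp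
  have len: "length (ql c ws (Suc j)) = length ws - j" by (simp add: ql_def del: upt_Suc)
  have "slab (ql c ws j) x = (c, clen ws x) \<and> sloc (ql c ws j) x = x - wnext ws (clen ws x) \<and>
      sidx (ql c ws j) x = length ws - clen ws x" if x: "x < wnext ws (j - 1)" for x
  proof (cases "x < wnext ws j")
    case True
    then show ?thesis using IH by (simp add: split coord_append)
  next
    case False
    have "\<not> j < clen ws x" "j - 1 < clen ws x" using False x by (simp_all add: less_clen_iff[OF s])
    then have "clen ws x = j" using Suc.prems(1) by simp
    then show ?thesis using False x le by (simp add: split coord_append coord_Cons IH(1) cnt len)
  qed
  then show ?case using IH(1) le by (simp add: split cnt)
qed

locale weyr =
  fixes cws :: "(complex \<times> nat list) list"
  assumes distinct: "distinct (map fst cws)"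
    and sorted: "\<And>a. a \<in> set cws \<Longrightarrow> sorted_wrt (\<ge>) (snd a)"
begin

definition cs :: "((complex \<times> nat list) \<times> nat) list" where
  "cs = map (\<lambda>a. (a, sum_list (snd a))) cws"

abbreviation "k \<equiv> total_size cs"
abbreviation "std \<equiv> standard_partition cws"

text \<open>Coordinates of an index: number \<open>we\<close> of the eigenvalue, strip
  \<open>wj\<close> counted from 0, and position \<open>wx\<close> inside the strip. The pair
  \<open>(we, wx)\<close> names the Jordan chain, and \<open>wj\<close> is the place in it.\<close>

definition we :: "nat \<Rightarrow> nat" where "we p = sidx cs p"
definition wws :: "nat \<Rightarrow> nat list" where "wws p = snd (cws ! we p)"
definition wj :: "nat \<Rightarrow> nat" where "wj p = sidx (jl (wws p)) (sloc cs p)"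
definition wx :: "nat \<Rightarrow> nat" where "wx p = sloc (jl (wws p)) (sloc cs p)"

lemma cs_nth: "i < length cws \<Longrightarrow> cs ! i = (cws ! i, sum_list (snd (cws ! i)))"
  by (simp add: cs_def)

lemma length_cs: "length cs = length cws" by (simp add: cs_def)

lemma we_props:
  assumes "p < k"
  shows "we p < length cws" "sloc cs p < total_size (jl (wws p))" "sorted_wrt (\<ge>) (wws p)"
    "wj p < length (wws p)" "wx p < wws p ! wj p" "sloc cs p = start (jl (wws p)) (wj p) + wx p"
    "slab (jl (wws p)) (sloc cs p) = Suc (wj p)" "cs ! sidx cs p = (cws ! we p, sum_list (wws p))"
proof -
  note c = coord_props[OF assms]
  show w: "we p < length cws" using c by (simp add: we_def length_cs)
  show "sorted_wrt (\<ge>) (wws p)" unfolding wws_def by (rule sorted) (use w in simp)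
  show cn: "cs ! sidx cs p = (cws ! we p, sum_list (wws p))"
    using cs_nth[OF w] by (simp add: we_def wws_def)
  then show t: "sloc cs p < total_size (jl (wws p))" using c(3) by (simp add: total_jl)
  note j = coord_props[OF t]
  show wj: "wj p < length (wws p)" using j by (simp add: wj_def length_jl)
  show "wx p < wws p ! wj p" using j(3) jl_nth[OF wj] by (simp add: wx_def wj_def)
  show "sloc cs p = start (jl (wws p)) (wj p) + wx p" using j(4) by (simp add: wx_def wj_def)
  show "slab (jl (wws p)) (sloc cs p) = Suc (wj p)" using j(2) jl_nth[OF wj] by (simp add: wj_def)
qed

lemma w_inj:
  assumes "p < k" "q < k" "we p = we q" "wj p = wj q" "wx p = wx q"
  shows "p = q"
proof (rule coord_inj[OF assms(1,2)])
  show "sidx cs p = sidx cs q" using assms(3) by (simp add: we_def)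
  have "wws p = wws q" using assms(3) by (simp add: wws_def)
  then show "sloc cs p = sloc cs q" using we_props(6)[OF assms(1)] we_props(6)[OF assms(2)] assms(4,5) by simp
qed

lemma w_surj:
  assumes "e < length cws" "j < length (snd (cws ! e))" "x < snd (cws ! e) ! j"
  shows "\<exists>p<k. we p = e \<and> wj p = j \<and> wx p = x"
proof -
  let ?ws = "snd (cws ! e)"
  let ?y = "start (jl ?ws) j + x"
  have jx: "j < length (jl ?ws)" "x < snd (jl ?ws ! j)" using assms by (simp_all add: length_jl jl_nth)
  note y = coord_start[OF jx]
  have e: "e < length cs" "?y < snd (cs ! e)" using assms(1) y(1) by (simp_all add: length_cs cs_nth total_jl)
  note p = coord_start[OF e]
  have "wws (start cs e + ?y) = ?ws" using p by (simp add: wws_def we_def)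
  then show ?thesis using p y by (intro exI[of _ "start cs e + ?y"]) (simp add: we_def wj_def wx_def)
qed

lemma chains: "chains k (\<lambda>p. (we p, wx p)) wj (\<lambda>(e, x). clen (snd (cws ! e)) x)"
proof
  show "wj p < (case (we p, wx p) of (e, x) \<Rightarrow> clen (snd (cws ! e)) x)" if "p < k" for p
    using we_props(3-5)[OF that] less_clen_iff[OF we_props(3)[OF that], of "wj p" "wx p"]
    by (simp add: wws_def wnext_def)
  show "p = q" if "p < k" "q < k" "(we p, wx p) = (we q, wx q)" "wj p = wj q" for p q
    using w_inj that by simp
  show "\<exists>q<k. (we q, wx q) = (we p, wx p) \<and> wj q = i"
    if p: "p < k" and i: "i < (case (we p, wx p) of (e, x) \<Rightarrow> clen (snd (cws ! e)) x)" for p i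
  proof -
    have i': "i < clen (wws p) (wx p)" using i by (simp add: wws_def)
    then have "wx p < wnext (wws p) i" using less_clen_iff[OF we_props(3)[OF p]] by simp
    moreover have il: "i < length (wws p)" using i' clen_le[of "wws p" "wx p"] by simp
    ultimately have "wx p < wws p ! i" by (simp add: wnext_def)
    then obtain q where "q < k" "we q = we p" "wj q = i" "wx q = wx p"
      using w_surj[of "we p" i "wx p"] we_props(1)[OF p] il by (auto simp: wws_def)
    then show ?thesis by (intro exI[of _ q]) simp
  qed
qed

sublocale chains k "\<lambda>p. (we p, wx p)" wj "\<lambda>(e, x). clen (snd (cws ! e)) x" "\<lambda>(e, x). fst (cws ! e)"
  by (rule chains)

lemma ev_eq_iff: "p < k \<Longrightarrow> q < k \<Longrightarrow> fst (cws ! we p) = fst (cws ! we q) \<longleftrightarrow> we p = we q"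
  using nth_eq_iff_index_eq[OF distinct, of "we p" "we q"] we_props(1) by simp

lemma dim_weyr: "dim_row (weyr_matrix cws) = k" "dim_col (weyr_matrix cws) = k"
proof -
  have "map dim_row (map (\<lambda>(c, ws). weyr_block c ws) cws) = map snd cs"
    "map dim_col (map (\<lambda>(c, ws). weyr_block c ws) cws) = map snd cs"
    by (auto simp: cs_def weyr_block_def)
  then show "dim_row (weyr_matrix cws) = k" "dim_col (weyr_matrix cws) = k"
    by (simp_all only: weyr_matrix_def dim_diag_block_mat total_size_def)
qed

text \<open>The ones link equal positions of consecutive strips, that is, consecutive vectors of one
  chain.\<close>

lemma weyr_block_coord:
  assumes "p < k" "q < k" "we p = we q"
  shows "weyr_block c (wws p) $$ (sloc cs p, sloc cs q) =
    (if sloc cs p = sloc cs q then c else if wx p = wx q \<and> wj q = Suc (wj p) then 1 else 0)"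
proof -
  let ?ws = "wws p"
  have wq: "wws q = ?ws" using assms(3) by (simp add: wws_def)
  note P = we_props[OF assms(1)] and Q = we_props[OF assms(2), unfolded wq]
  have b: "sloc cs p < sum_list ?ws" "sloc cs q < sum_list ?ws" using P(2) Q(2) by (simp_all add: total_jl)
  have "(\<exists>j t. Suc j < length ?ws \<and> t < ?ws ! Suc j \<and> sloc cs p = sum_list (take j ?ws) + t \<and>
      sloc cs q = sum_list (take (Suc j) ?ws) + t) \<longleftrightarrow> wx p = wx q \<and> wj q = Suc (wj p)"
  proof
    assume "\<exists>j t. Suc j < length ?ws \<and> t < ?ws ! Suc j \<and> sloc cs p = sum_list (take j ?ws) + t \<and>
      sloc cs q = sum_list (take (Suc j) ?ws) + t"
    then obtain j t where jt: "Suc j < length ?ws" "t < ?ws ! Suc j" "sloc cs p = start (jl ?ws) j + t"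
      "sloc cs q = start (jl ?ws) (Suc j) + t" by (auto simp: start_jl simp del: take_Suc)
    have "t < ?ws ! j" using wnext_antimono[OF P(3), of j] jt by (simp add: wnext_def)
    then have "sidx (jl ?ws) (sloc cs p) = j" "sloc (jl ?ws) (sloc cs p) = t"
      unfolding jt(3) using jt(1) coord_start[of j "jl ?ws" t] by (simp_all add: length_jl jl_nth)
    moreover have "sidx (jl ?ws) (sloc cs q) = Suc j" "sloc (jl ?ws) (sloc cs q) = t"
      unfolding jt(4) using jt(1,2) coord_start[of "Suc j" "jl ?ws" t] by (simp_all add: length_jl jl_nth)
    ultimately show "wx p = wx q \<and> wj q = Suc (wj p)" by (simp add: wx_def wj_def wq)
  next
    assume e: "wx p = wx q \<and> wj q = Suc (wj p)"
    show "\<exists>j t. Suc j < length ?ws \<and> t < ?ws ! Suc j \<and> sloc cs p = sum_list (take j ?ws) + t \<and>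
      sloc cs q = sum_list (take (Suc j) ?ws) + t"
    proof (intro exI conjI)
      show "Suc (wj p) < length ?ws" "wx p < ?ws ! Suc (wj p)" using Q(4,5) e by simp_all
      show "sloc cs p = sum_list (take (wj p) ?ws) + wx p" using P(4,6) by (simp add: start_jl)
      show "sloc cs q = sum_list (take (Suc (wj p)) ?ws) + wx p" using Q(4,6) e by (simp add: start_jl del: take_Suc)
    qed
  qed
  then show ?thesis using b by (simp add: weyr_block_def)
qed

lemma weyr_matrix_coord:
  assumes "p < k" "q < k"
  shows "weyr_matrix cws $$ (p, q) = jm p q"
proof -
  let ?Ms = "map (\<lambda>(c, ws). weyr_block c ws) cws"
  have m: "map (\<lambda>M. (M, dim_row M)) ?Ms = map (\<lambda>(a, s). ((case a of (c, ws) \<Rightarrow> weyr_block c ws), s)) cs"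
    by (auto simp: cs_def weyr_block_def)
  note P = coord_map[OF assms(1), of "\<lambda>a. case a of (c, ws) \<Rightarrow> weyr_block c ws"]
  note Q = coord_map[OF assms(2), of "\<lambda>a. case a of (c, ws) \<Rightarrow> weyr_block c ws"]
  have sq: "square_mat M" if "M \<in> set ?Ms" for M using that by (auto simp: weyr_block_def)
  have pq: "p < total_size (map (\<lambda>M. (M, dim_row M)) ?Ms)" "q < total_size (map (\<lambda>M. (M, dim_row M)) ?Ms)"
    unfolding m total_map by (rule assms)+
  have e: "weyr_matrix cws $$ (p, q) = (if sidx cs p = sidx cs q then
      (case slab cs p of (c, ws) \<Rightarrow> weyr_block c ws) $$ (sloc cs p, sloc cs q) else 0)"
    unfolding weyr_matrix_def using diag_block_mat_coord[of ?Ms p q, OF sq pq]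
    unfolding m Let_def P Q .
  have sp: "slab cs p = (fst (cws ! we p), wws p)"
    using coord_props(2)[OF assms(1)] we_props(8)[OF assms(1)] by (simp add: wws_def)
  show ?thesis
  proof (cases "we p = we q")
    case True
    have "p = q \<longleftrightarrow> sloc cs p = sloc cs q" using coord_inj[OF assms] True by (auto simp: we_def)
    then show ?thesis unfolding e sp prod.case weyr_block_coord[OF assms True] using True
      by (auto simp: we_def[symmetric] jm_def)
  next
    case False
    then show ?thesis unfolding e jm_def by (auto simp: we_def)
  qed
qed

definition inner :: "(complex \<times> nat list) \<times> nat \<Rightarrow> ((complex \<times> nat) \<times> nat) list" where
  "inner a = concat (map (\<lambda>b. ql (fst (fst a)) (snd (fst a)) (fst b)) (jl (snd (fst a))))"

lemma std_inner: "std = concat (map inner cs)"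
  unfolding standard_partition_def cs_def inner_def jl_def ql_def map_map o_def case_prod_unfold fst_conv snd_conv
  by (rule refl)

lemma ql_total:
  assumes "sorted_wrt (\<ge>) ws" "b \<in> set (jl ws)"
  shows "total_size (ql c ws (fst b)) = snd b"
proof -
  obtain i where i: "i < length ws" "b = (Suc i, ws ! i)"
    using assms(2) by (metis in_set_conv_nth jl_nth length_jl)
  then show ?thesis using ql_coord[OF assms(1), of "Suc i" c] by (simp add: wnext_def)
qed

lemma inner_total:
  assumes "a \<in> set cs"
  shows "total_size (inner a) = snd a"
proof -
  have a: "snd a = sum_list (snd (fst a))" "fst a \<in> set cws" using assms by (auto simp: cs_def)
  have "total_size (inner a) = total_size (jl (snd (fst a)))"
    unfolding inner_def by (rule total_concat_map, rule ql_total[OF sorted[OF a(2)]])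
  then show ?thesis by (simp add: a total_jl)
qed

lemma total_std: "total_size std = k"
  unfolding std_inner by (rule total_concat_map[OF inner_total])

lemma ql_at:
  assumes "p < k"
  shows "slab (ql c (wws p) (Suc (wj p))) (wx p) = (c, clen (wws p) (wx p))"
    "sloc (ql c (wws p) (Suc (wj p))) (wx p) = wx p - wnext (wws p) (clen (wws p) (wx p))"
    "sidx (ql c (wws p) (Suc (wj p))) (wx p) = length (wws p) - clen (wws p) (wx p)"
  using ql_coord[OF we_props(3)[OF assms], of "Suc (wj p)" c] we_props(4,5)[OF assms] by (simp_all add: wnext_def)

lemma inner_at:
  assumes "p < k"
  shows "inner (cs ! sidx cs p) = concat (map (\<lambda>b. ql (fst (cws ! we p)) (wws p) (fst b)) (jl (wws p)))"
    and "jl (wws p) ! sidx (jl (wws p)) (sloc cs p) = (Suc (wj p), wws p ! wj p)"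
  using we_props(8)[OF assms] jl_nth[OF we_props(4)[OF assms]] by (simp_all add: inner_def wws_def wj_def)

lemma std_coord:
  assumes "p < k"
  shows "slab std p = (fst (cws ! we p), clen (wws p) (wx p))"
    "sloc std p = wx p - wnext (wws p) (clen (wws p) (wx p))"
proof -
  let ?f = "\<lambda>b. ql (fst (cws ! we p)) (wws p) (fst b)"
  have s1: "slab (concat (map inner cs)) p = slab (inner (cs ! sidx cs p)) (sloc cs p)"
    "sloc (concat (map inner cs)) p = sloc (inner (cs ! sidx cs p)) (sloc cs p)"
    by (rule split_coord[where f = inner, OF inner_total assms], assumption)+
  have s2: "slab (concat (map ?f (jl (wws p)))) (sloc cs p) = slab (?f (Suc (wj p), wws p ! wj p)) (wx p)"
    "sloc (concat (map ?f (jl (wws p)))) (sloc cs p) = sloc (?f (Suc (wj p), wws p ! wj p)) (wx p)"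
    unfolding wx_def inner_at(2)[OF assms, symmetric]
    by (rule split_coord[where f = ?f, OF ql_total[OF we_props(3)[OF assms]] we_props(2)[OF assms]], assumption)+
  show "slab std p = (fst (cws ! we p), clen (wws p) (wx p))"
    unfolding std_inner s1 inner_at(1)[OF assms] s2 fst_conv ql_at[OF assms] by (rule refl)
  show "sloc std p = wx p - wnext (wws p) (clen (wws p) (wx p))"
    unfolding std_inner s1 inner_at(1)[OF assms] s2 fst_conv ql_at[OF assms] by (rule refl)
qed

lemma std_order:
  assumes "p < k" "q < k"
  shows "sidx std p < sidx std q \<longleftrightarrow> we p < we q \<or> we p = we q \<and> (wj p < wj q \<or>
    wj p = wj q \<and> clen (wws q) (wx q) < clen (wws p) (wx p))"
proof -
  have 1: "sidx std p < sidx std q \<longleftrightarrow> we p < we q \<or> we p = we q \<and>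
    sidx (inner (cs ! sidx cs p)) (sloc cs p) < sidx (inner (cs ! sidx cs p)) (sloc cs q)"
    unfolding std_inner we_def by (rule split_order[OF inner_total assms])
  have "sidx (inner (cs ! sidx cs p)) (sloc cs p) < sidx (inner (cs ! sidx cs p)) (sloc cs q) \<longleftrightarrow>
    wj p < wj q \<or> wj p = wj q \<and> clen (wws q) (wx q) < clen (wws p) (wx p)" if e: "we p = we q"
  proof -
    have wq: "wws q = wws p" using e by (simp add: wws_def)
    have tq: "sloc cs q < total_size (jl (wws p))" using we_props(2)[OF assms(2)] wq by simp
    have jq: "wj q = sidx (jl (wws p)) (sloc cs q)" and xq: "wx q = sloc (jl (wws p)) (sloc cs q)"
      by (simp_all add: wj_def wx_def wq)
    let ?f = "\<lambda>b. ql (fst (cws ! we p)) (wws p) (fst b)"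
    have o: "sidx (concat (map ?f (jl (wws p)))) (sloc cs p) < sidx (concat (map ?f (jl (wws p)))) (sloc cs q) \<longleftrightarrow>
      wj p < wj q \<or> wj p = wj q \<and> sidx (?f (Suc (wj p), wws p ! wj p)) (wx p) < sidx (?f (Suc (wj p), wws p ! wj p)) (wx q)"
      unfolding wx_def[of p] xq jq inner_at(2)[OF assms(1), symmetric] unfolding wj_def[of p]
      by (rule split_order[where f = ?f, OF ql_total[OF we_props(3)[OF assms(1)]] we_props(2)[OF assms(1)] tq], assumption)
    have s: "sidx (ql c (wws p) (Suc (wj p))) (wx q) = length (wws p) - clen (wws p) (wx q)" if "wj p = wj q" for c
      using ql_at(3)[OF assms(2), of c] wq that by simp
    show ?thesis
      unfolding inner_at(1)[OF assms(1)] o fst_conv ql_at(3)[OF assms(1)] wq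
      using s[of "fst (cws ! we p)"] clen_le[of "wws p" "wx p"] clen_le[of "wws p" "wx q"] by auto
  qed
  with 1 show ?thesis by auto
qed

lemma std_eq:
  assumes "p < k" "q < k"
  shows "sidx std p = sidx std q \<longleftrightarrow> we p = we q \<and> wj p = wj q \<and> clen (wws p) (wx p) = clen (wws q) (wx q)"
proof -
  have eq: "(x::nat) = y \<longleftrightarrow> \<not> x < y \<and> \<not> y < x" for x y by auto
  show ?thesis
    unfolding eq[of "sidx std p" "sidx std q"] std_order[OF assms] std_order[OF assms(2,1)]
    by (cases "we p = we q"; cases "wj p = wj q") auto
qed

lemma wx_ge: "p < k \<Longrightarrow> wnext (wws p) (clen (wws p) (wx p)) \<le> wx p"
  using less_clen_iff[OF we_props(3), of p "clen (wws p) (wx p)" "wx p"] by simp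

text \<open>The three ways of lying below the block diagonal match three vanishing rules: different
  eigenvalues, a later place of the row in its chain than of the column, and, inside one strip, a
  row chain shorter than the column chain.\<close>

lemma commutes_block_triangular:
  assumes X: "commutes X" and p: "p < k" and q: "q < k" and lt: "sidx std q < sidx std p"
  shows "X p q = 0"
proof -
  have X': "shift_inv X" using X by (simp only: commutes_iff_shift_inv)
  consider "we p \<noteq> we q" | "we p = we q" "wj q < wj p" | "we p = we q" "wj p = wj q" "clen (wws p) (wx p) < clen (wws q) (wx q)"
    using lt unfolding std_order[OF q p] by linarith
  then show ?thesis
  proof cases
    case 1
    then show ?thesis using shift_invD1[OF X' p q] ev_eq_iff[OF p q] by simp
  next
    case 2
    then show ?thesis using shift_inv_below[OF X' p q] by simp
  next
    case 3
    then show ?thesis using shift_inv_short[OF X' p q] by (simp add: wws_def)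
  qed
qed

text \<open>Equal labels mean equal eigenvalue and chain length. Corresponding positions of the two
  blocks then belong to the same pair of chains and differ by a shift along them, under which the
  entries are invariant.\<close>

lemma commutes_diagonal:
  assumes X: "commutes X" and lt: "p < k" "q < k" "p' < k" "q' < k" and "sidx std p = sidx std q" "sidx std p' = sidx std q'"
    and "slab std p = slab std p'" "sloc std p = sloc std p'" "sloc std q = sloc std q'"
  shows "X p q = X p' q'"
proof -
  have X': "shift_inv X" using X by (simp only: commutes_iff_shift_inv)
  have pq: "we p = we q" "wj p = wj q" "clen (wws p) (wx p) = clen (wws q) (wx q)"
    using assms(6) std_eq[OF lt(1,2)] by auto
  have pq': "we p' = we q'" "wj p' = wj q'" "clen (wws p') (wx p') = clen (wws q') (wx q')"
    using assms(7) std_eq[OF lt(3,4)] by auto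
  have pp: "fst (cws ! we p) = fst (cws ! we p')" "clen (wws p) (wx p) = clen (wws p') (wx p')"
    using assms(8) std_coord(1)[OF lt(1)] std_coord(1)[OF lt(3)] by auto
  have e: "we p = we p'" using pp(1) ev_eq_iff[OF lt(1,3)] by simp
  have w: "wws p' = wws p" "wws q = wws p" "wws q' = wws p" using e pq(1) pq'(1) by (simp_all add: wws_def)
  have "wx p = wx p'"
    using assms(9) wx_ge[OF lt(1)] wx_ge[OF lt(3)] pp(2) w std_coord(2)[OF lt(1)] std_coord(2)[OF lt(3)] by simp
  moreover have "wx q = wx q'"
    using assms(10) wx_ge[OF lt(2)] wx_ge[OF lt(4)] pp(2) pq(3) pq'(3) w std_coord(2)[OF lt(2)] std_coord(2)[OF lt(4)] by simp
  ultimately show ?thesis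
    using pq pq' e by (intro shift_inv_same[OF X' lt]) simp_all
qed

text \<open>Such a matrix mixes only chains of the same eigenvalue and length, with coefficients
  that do not depend on the place in the chain.\<close>

lemma block_diagonal_commutes:
  assumes X: "\<And>p q. p < k \<Longrightarrow> q < k \<Longrightarrow> X p q = (if sidx std p = sidx std q then fam (slab std p) (sloc std p) (sloc std q) else 0)"
  shows "commutes X"
  unfolding commutes_iff_shift_inv shift_inv_def prod.case
proof (intro conjI allI impI)
  fix p q assume "p < k" "q < k" "fst (cws ! we p) \<noteq> fst (cws ! we q)"
  then show "X p q = 0" using X std_eq by auto
next
  fix p q p' q'
  assume lt: "p < k" "q < k" "p' < k" "q' < k" and "fst (cws ! we p) = fst (cws ! we q)"
    and e: "(we p', wx p') = (we p, wx p)" "(we q', wx q') = (we q, wx q)" and j: "wj p' = Suc (wj p)" "wj q' = Suc (wj q)"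
  have w: "wws p' = wws p" "wws q' = wws q" using e by (simp_all add: wws_def)
  have "sidx std p = sidx std q \<longleftrightarrow> sidx std p' = sidx std q'"
    using e j w by (simp add: std_eq lt)
  moreover have "slab std p' = slab std p" "sloc std p' = sloc std p" "sloc std q' = sloc std q"
    using e w by (simp_all add: std_coord lt)
  ultimately show "X p' q' = X p q" using X lt by simp
next
  fix p q assume "p < k" "q < k" "0 < wj p" "wj q = 0"
  then show "X p q = 0" using X std_eq by auto
next
  fix p q assume lt: "p < k" "q < k" and l: "Suc (wj p) = clen (snd (cws ! we p)) (wx p)" "Suc (wj q) < clen (snd (cws ! we q)) (wx q)"
  have "\<not> sidx std p = sidx std q" unfolding std_eq[OF lt] using l by (simp add: wws_def)
  then show "X p q = 0" using X[OF lt] by simp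
qed

lemma std_sizes:
  assumes "(tag, s) \<in> set std" "(tag, s') \<in> set std"
  shows "s = s'"
proof -
  have *: "\<exists>a\<in>set cws. fst tag = fst a \<and> s = jordan_count (snd a) (snd tag)" if "(tag, s) \<in> set std" for tag s
  proof -
    from that obtain c ws q where "(c, ws) \<in> set cws" "tag = (c, q)" "s = jordan_count ws q"
      by (auto simp: standard_partition_def simp del: upt_Suc)
    then show ?thesis by (intro bexI[of _ "(c, ws)"]) auto
  qed
  obtain a where a: "a \<in> set cws" "fst tag = fst a" "s = jordan_count (snd a) (snd tag)" using *[OF assms(1)] by blast
  obtain b where b: "b \<in> set cws" "fst tag = fst b" "s' = jordan_count (snd b) (snd tag)" using *[OF assms(2)] by blast
  have "a = b" using distinct a(1,2) b(1,2) by (metis eq_key_imp_eq_value prod.collapse)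
  then show ?thesis using a(3) b(3) by simp
qed

end

text \<open>Collects the facts on the centralizer of a Weyr matrix in terms of the standard
  partition alone, which keeps the chain coordinates out of the analysis of the algorithm.\<close>

lemma weyr_commutant:
  assumes data: "weyr_data ordC cws" and W: "weyr_matrix cws \<in> carrier_mat k k"
  defines "Wf \<equiv> (\<lambda>p q. weyr_matrix cws $$ (p, q))" and "ss \<equiv> standard_partition cws"
  shows "total_size ss = k"
    and "\<And>tag s s'. (tag, s) \<in> set ss \<Longrightarrow> (tag, s') \<in> set ss \<Longrightarrow> s = s'"
    and "\<And>X p q. \<forall>p<k. \<forall>q<k. mm k X Wf p q = mm k Wf X p q \<Longrightarrow> p < k \<Longrightarrow> q < k \<Longrightarrow> sidx ss q < sidx ss p \<Longrightarrow> X p q = 0"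
    and "\<And>X. \<forall>p<k. \<forall>q<k. mm k X Wf p q = mm k Wf X p q \<Longrightarrow> \<exists>fam. \<forall>p<k. \<forall>q<k. sidx ss p = sidx ss q \<longrightarrow>
      X p q = fam (slab ss p) (sloc ss p) (sloc ss q)"
    and "\<And>X fam. (\<And>p q. p < k \<Longrightarrow> q < k \<Longrightarrow> X p q = (if sidx ss p = sidx ss q then fam (slab ss p) (sloc ss p) (sloc ss q) else 0))
      \<Longrightarrow> \<forall>p<k. \<forall>q<k. mm k X Wf p q = mm k Wf X p q"
proof -
  interpret weyr cws
  proof
    show "sorted_wrt (\<ge>) (snd a)" if "a \<in> set cws" for a
      using data that unfolding weyr_data_def by (cases a) auto
    have "sorted_wrt (\<lambda>c d. (c, d) \<in> ordC \<and> c \<noteq> d) (map fst cws)" using data by (simp add: weyr_data_def)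
    then have lt: "\<And>i j. i < j \<Longrightarrow> j < length (map fst cws) \<Longrightarrow> map fst cws ! i \<noteq> map fst cws ! j"
      unfolding sorted_wrt_iff_nth_less by blast
    show "distinct (map fst cws)"
      unfolding distinct_conv_nth
    proof (intro allI impI)
      fix i j assume "i < length (map fst cws)" "j < length (map fst cws)" "i \<noteq> j"
      then show "map fst cws ! i \<noteq> map fst cws ! j" using lt[of i j] lt[of j i] by (cases "i < j") auto
    qed
  qed
  have tk: "total_size cs = k" using W dim_weyr by auto
  have c: "commutes X \<longleftrightarrow> (\<forall>p<k. \<forall>q<k. mm k X Wf p q = mm k Wf X p q)" for X
  proof -
    have e: "Wf p q = jm p q" if "p < k" "q < k" for p q
      unfolding Wf_def by (rule weyr_matrix_coord) (simp_all only: tk that)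
    have "mm k X jm p q = mm k X Wf p q" "mm k jm X p q = mm k Wf X p q" if "p < k" "q < k" for p q
      by (rule mm_cong; simp add: e that)+
    then show ?thesis unfolding commutes_def unfolding tk by simp
  qed
  show "total_size ss = k" unfolding ss_def total_std tk by (rule refl)
  show "s = s'" if "(tag, s) \<in> set ss" "(tag, s') \<in> set ss" for tag s s'
    using std_sizes that unfolding ss_def .
  show "X p q = 0" if "\<forall>p<k. \<forall>q<k. mm k X Wf p q = mm k Wf X p q" "p < k" "q < k" "sidx ss q < sidx ss p" for X p q
  proof -
    have "commutes X" using that(1) by (simp only: c)
    from commutes_block_triangular[OF this, of p q, unfolded tk, folded ss_def, OF that(2-4)] show ?thesis .
  qed
  show "\<exists>fam. \<forall>p<k. \<forall>q<k. sidx ss p = sidx ss q \<longrightarrow> X p q = fam (slab ss p) (sloc ss p) (sloc ss q)"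
    if X: "\<forall>p<k. \<forall>q<k. mm k X Wf p q = mm k Wf X p q" for X
  proof -
    let ?P = "\<lambda>tag s t x. fst x < k \<and> snd x < k \<and> sidx ss (fst x) = sidx ss (snd x) \<and> slab ss (fst x) = tag \<and>
      sloc ss (fst x) = s \<and> sloc ss (snd x) = t"
    \<comment> \<open>A diagonal block of given label may occur at several substrips. One occurrence
      defines the family, and equality of the blocks makes its values independent of the
      choice.\<close>
    define pick where "pick tag s t = (SOME x. ?P tag s t x)" for tag s t
    have "X p q = X (fst (pick (slab ss p) (sloc ss p) (sloc ss q))) (snd (pick (slab ss p) (sloc ss p) (sloc ss q)))"
      if pq: "p < k" "q < k" "sidx ss p = sidx ss q" for p q
    proof -
      let ?x = "pick (slab ss p) (sloc ss p) (sloc ss q)"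
      have x: "?P (slab ss p) (sloc ss p) (sloc ss q) ?x"
        unfolding pick_def by (rule someI[of "?P (slab ss p) (sloc ss p) (sloc ss q)" "(p, q)"]) (use pq in simp)
      have "commutes X" using X by (simp only: c)
      from commutes_diagonal[OF this, of p q "fst ?x" "snd ?x", unfolded tk, folded ss_def] x pq
      show ?thesis by simp
    qed
    then show ?thesis
      by (intro exI[where x = "\<lambda>tag s t. X (fst (pick tag s t)) (snd (pick tag s t))"]) blast
  qed
  show "\<forall>p<k. \<forall>q<k. mm k X Wf p q = mm k Wf X p q"
    if "\<And>p q. p < k \<Longrightarrow> q < k \<Longrightarrow> X p q = (if sidx ss p = sidx ss q then fam (slab ss p) (sloc ss p) (sloc ss q) else 0)" for X fam
  proof -
    have "commutes X"
      by (rule block_diagonal_commutes[of X fam], unfold tk, fold ss_def) (rule that)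
    then show ?thesis by (simp only: c)
  qed
qed

section \<open>The invariant of Belitskii's algorithm\<close>

definition Lam :: "nat \<Rightarrow> nat \<Rightarrow> nat \<Rightarrow> system \<Rightarrow> position set \<Rightarrow> tri set" where
  "Lam m n l S R = {v. \<forall>x\<in>R. defect m n l S S v x = 0}"

definition upper :: "nat \<Rightarrow> nat \<Rightarrow> nat \<Rightarrow> strips \<Rightarrow> tri \<Rightarrow> bool" where
  "upper m n l P v \<longleftrightarrow> (\<forall>sp. \<forall>p<dim_of m n l sp. \<forall>q<dim_of m n l sp. sidx (P sp) q < sidx (P sp) p \<longrightarrow> v sp p q = 0)"

definition block_form :: "nat \<Rightarrow> nat \<Rightarrow> nat \<Rightarrow> strips \<Rightarrow> tri \<Rightarrow> bool" where
  "block_form m n l P v \<longleftrightarrow> upper m n l P v \<and>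
    (\<exists>fam. \<forall>sp. \<forall>p<dim_of m n l sp. \<forall>q<dim_of m n l sp. sidx (P sp) p = sidx (P sp) q \<longrightarrow>
       v sp p q = fam (slab (P sp) p) (sloc (P sp) p) (sloc (P sp) q))"

definition diagv :: "strips \<Rightarrow> (nat \<Rightarrow> fmat) \<Rightarrow> tri" where
  "diagv P fam = (\<lambda>sp p q. if sidx (P sp) p = sidx (P sp) q
     then fam (slab (P sp) p) (sloc (P sp) p) (sloc (P sp) q) else 0)"

definition valid :: "nat \<Rightarrow> nat \<Rightarrow> nat \<Rightarrow> strips \<Rightarrow> bool" where
  "valid m n l P \<longleftrightarrow> (\<forall>sp. total_size (P sp) = dim_of m n l sp) \<and>
    (\<forall>sp sp' d s s'. (d, s) \<in> set (P sp) \<longrightarrow> (d, s') \<in> set (P sp') \<longrightarrow> s = s')"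

text \<open>The order of processing makes the reduced positions closed under moving down and to the
  left. For block triangular factors, an entry of \<open>v N\<close> uses only entries of
  \<open>N\<close> in the same strip or below, and an entry of \<open>N v\<close> only those in the
  same strip or to the left, so conditions on \<open>R\<close> stay within \<open>R\<close>.\<close>

definition staircase :: "nat \<Rightarrow> nat \<Rightarrow> nat \<Rightarrow> strips \<Rightarrow> position set \<Rightarrow> bool" where
  "staircase m n l P R \<longleftrightarrow> R \<subseteq> sys_idx m n l \<and> (\<forall>N p q p' q'. (N, p, q) \<in> R \<longrightarrow> (N, p', q') \<in> sys_idx m n l \<longrightarrow>
    sidx (P (row_space N)) p \<le> sidx (P (row_space N)) p' \<longrightarrow> sidx (P (col_space N)) q' \<le> sidx (P (col_space N)) q \<longrightarrow>
    (N, p', q') \<in> R)"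

text \<open>The structure of \<open>\<Lambda>\<close>: it consists of block upper triangular triples with equal diagonal blocks at
  equivalent strips, and contains all block diagonal ones. Since \<open>\<Lambda>\<close> is then a bimodule over the block
  diagonal triples, this suffices for the dichotomy for \<open>D\<close>, and the linear relations between the
  off-diagonal blocks are not needed.\<close>

definition bel_inv :: "nat \<Rightarrow> nat \<Rightarrow> nat \<Rightarrow> system \<Rightarrow> strips \<Rightarrow> position set \<Rightarrow> nat \<Rightarrow> bool" where
  "bel_inv m n l S P R d \<longleftrightarrow> S \<in> systems m n l \<and> valid m n l P \<and> staircase m n l P R \<and>
    (\<forall>v\<in>Lam m n l S R. block_form m n l P v) \<and> (\<forall>fam. diagv P fam \<in> Lam m n l S R) \<and> codim (Lam m n l S R) d"

lemma upperD: "upper m n l P v \<Longrightarrow> p < dim_of m n l sp \<Longrightarrow> q < dim_of m n l sp \<Longrightarrow> sidx (P sp) q < sidx (P sp) p \<Longrightarrow> v sp p q = 0"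
  by (simp add: upper_def)

lemma staircaseD:
  assumes "staircase m n l P R" "(N, p, q) \<in> R"
  shows "p < dim_of m n l (row_space N)" "q < dim_of m n l (col_space N)"
    and "p' < dim_of m n l (row_space N) \<Longrightarrow> q' < dim_of m n l (col_space N) \<Longrightarrow>
      sidx (P (row_space N)) p \<le> sidx (P (row_space N)) p' \<Longrightarrow> sidx (P (col_space N)) q' \<le> sidx (P (col_space N)) q \<Longrightarrow>
      (N, p', q') \<in> R"
proof -
  have "(N, p, q) \<in> sys_idx m n l" using assms unfolding staircase_def by blast
  then show "p < dim_of m n l (row_space N)" "q < dim_of m n l (col_space N)" by (simp_all add: sys_idx_def)
  assume "p' < dim_of m n l (row_space N)" "q' < dim_of m n l (col_space N)"
  then have "(N, p', q') \<in> sys_idx m n l" by (simp add: sys_idx_def)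
  moreover assume "sidx (P (row_space N)) p \<le> sidx (P (row_space N)) p'" "sidx (P (col_space N)) q' \<le> sidx (P (col_space N)) q"
  ultimately show "(N, p', q') \<in> R" using assms unfolding staircase_def by blast
qed

text \<open>The inverse of a block triangular matrix is block triangular. The strips from that of
  \<open>p\<close> on form a corner on which \<open>cof\<close> is a right inverse up to a scalar;
  for square matrices it is then also a left inverse, which determines the entries of
  \<open>cof\<close> in the rows of the corner.\<close>

lemma cof_upper:
  assumes u: "upper m n l P v" and d: "disc m n l v \<noteq> 0"
  shows "upper m n l P (cof m n l v)"
  unfolding upper_def
proof (intro allI impI)
  fix sp p q
  let ?k = "dim_of m n l sp" and ?i = "sidx (P sp)" and ?C = "cof m n l v sp" and ?\<delta> = "disc m n l v"
  assume p: "p < ?k" and q: "q < ?k" and lt: "?i q < ?i p"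
  define D where "D a = (?i p \<le> ?i a)" for a
  have vD: "v sp a c = 0" if "D a" "\<not> D c" "a < ?k" "c < ?k" for a c
    by (rule upperD[OF u that(3,4)]) (use that(1,2) in \<open>simp add: D_def\<close>)
  have vC: "(\<Sum>c<?k. v sp a c * ?C c b) = ?\<delta> * idm a b" if "a < ?k" "b < ?k" for a b
    using mm_cof(2)[OF that] by (simp add: mm_def)
  have vCD: "(\<Sum>c<?k. if D c then v sp a c * ?C c b else 0) = ?\<delta> * idm a b" if "a < ?k" "b < ?k" "D a" for a b
    unfolding vC[OF that(1,2), symmetric] by (rule sum.cong) (use vD that in auto)
  \<comment> \<open>\<open>u'\<close> and \<open>c'\<close> are \<open>v\<close> and its candidate
    inverse on the corner \<open>D\<close>, completed by the identity to full size so that matrices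
    of a fixed dimension can be used.\<close>
  define u' where "u' a b = (if D a \<and> D b then v sp a b else idm a b)" for a b
  define c' where "c' a b = (if D a \<and> D b then ?C a b / ?\<delta> else idm a b)" for a b
  \<comment> \<open>Column \<open>q\<close> of \<open>cof\<close>, restricted to the corner. The
    invertible \<open>u'\<close> kills it because \<open>q\<close> lies outside the corner, so it is
    zero.\<close>
  define W where "W a b = (if D a then ?C a q else (0::complex))" for a b :: nat
  have uc: "mm ?k u' c' a b = idm a b" if a: "a < ?k" and b: "b < ?k" for a b
  proof (cases "D a")
    case True
    show ?thesis
    proof (cases "D b")
      case Db: True
      have "mm ?k u' c' a b = (\<Sum>c<?k. (if D c then v sp a c * ?C c b else 0) / ?\<delta>)"
        unfolding mm_def by (rule sum.cong) (use True Db in \<open>auto simp: u'_def c'_def idm_def\<close>)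
      also have "\<dots> = idm a b" unfolding sum_divide_distrib[symmetric] vCD[OF a b True] using d by simp
      finally show ?thesis .
    next
      case Db: False
      have "mm ?k u' c' a b = 0"
        unfolding mm_def by (rule sum.neutral) (use True Db in \<open>auto simp: u'_def c'_def idm_def\<close>)
      then show ?thesis using True Db by (auto simp: idm_def)
    qed
  next
    case False
    have "mm ?k u' c' a b = mm ?k idm c' a b" by (rule mm_cong) (use False in \<open>auto simp: u'_def\<close>)
    then show ?thesis using False mm_idm_left[OF a] by (simp add: c'_def)
  qed
  have "sq ?k u' * sq ?k c' = 1\<^sub>m ?k"
    by (rule eq_matI) (use uc in \<open>auto simp: scalar_prod_def mm_def atLeast0LessThan idm_def\<close>)
  then have "sq ?k c' * sq ?k u' = 1\<^sub>m ?k" by (rule mat_mult_left_right_inverse[OF sq_simps(1) sq_simps(1)])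
  then have cu: "mm ?k c' u' p b = idm p b" if "b < ?k" for b
  proof -
    have "(sq ?k c' * sq ?k u') $$ (p, b) = 1\<^sub>m ?k $$ (p, b)" by (simp only: \<open>sq ?k c' * sq ?k u' = 1\<^sub>m ?k\<close>)
    moreover have "(sq ?k c' * sq ?k u') $$ (p, b) = mm ?k c' u' p b"
      using that p by (simp add: scalar_prod_def mm_def atLeast0LessThan)
    ultimately show ?thesis using that p by (simp add: idm_def)
  qed
  have uW: "mm ?k u' W a b = 0" if a: "a < ?k" for a b
  proof (cases "D a")
    case True
    have "mm ?k u' W a b = (\<Sum>c<?k. if D c then v sp a c * ?C c q else 0)"
      unfolding mm_def by (rule sum.cong) (use True in \<open>auto simp: u'_def W_def\<close>)
    also have "\<dots> = ?\<delta> * idm a q" by (rule vCD[OF a q True])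
    also have "\<dots> = 0" using True lt by (auto simp: idm_def D_def)
    finally show ?thesis .
  next
    case False
    have "mm ?k u' W a b = mm ?k idm W a b" by (rule mm_cong) (use False in \<open>auto simp: u'_def\<close>)
    then show ?thesis using False mm_idm_left[OF a] by (simp add: W_def)
  qed
  have "W p q = mm ?k idm W p q" by (simp add: mm_idm_left p)
  also have "\<dots> = mm ?k (mm ?k c' u') W p q" by (rule mm_cong) (simp_all add: cu)
  also have "\<dots> = mm ?k c' (mm ?k u' W) p q" by (simp only: mm_assoc)
  also have "\<dots> = 0" unfolding mm_def[of _ c'] by (simp add: uW)
  finally show "?C p q = 0" by (simp add: W_def D_def)
qed

lemma comp_upper:
  assumes "upper m n l P u" "upper m n l P v"
  shows "upper m n l P (tcomp m n l u v)"
  unfolding upper_def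
proof (intro allI impI)
  fix sp p q assume p: "p < dim_of m n l sp" and q: "q < dim_of m n l sp" and lt: "sidx (P sp) q < sidx (P sp) p"
  have "u sp p a * v sp a q = 0" if "a < dim_of m n l sp" for a
  proof (cases "sidx (P sp) a < sidx (P sp) p")
    case True
    then show ?thesis using upperD[OF assms(1) p that] by simp
  next
    case False
    then have "sidx (P sp) q < sidx (P sp) a" using lt by simp
    then show ?thesis using upperD[OF assms(2) that q] by simp
  qed
  then have "mm (dim_of m n l sp) (u sp) (v sp) p q = 0" unfolding mm_def by (intro sum.neutral) blast
  then show "tcomp m n l u v sp p q = 0" by (simp add: tcomp_def)
qed

text \<open>By the staircase shape, block triangular factors on both sides bring into a position of
  \<open>R\<close> only entries from positions of \<open>R\<close>.\<close>

lemma upper_mult_zero: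
  assumes st: "staircase m n l P R" and pq: "(N, p, q) \<in> R"
    and X: "upper m n l P x" and Y: "upper m n l P y"
    and E: "\<And>a b. (N, a, b) \<in> R \<Longrightarrow> E a b = 0"
  shows "mm (dim_of m n l (row_space N)) (x (row_space N)) (mm (dim_of m n l (col_space N)) E (y (col_space N))) p q = 0"
proof -
  note s = staircaseD[OF st pq]
  have "x (row_space N) p a * (\<Sum>b<dim_of m n l (col_space N). E a b * y (col_space N) b q) = 0"
    if a: "a < dim_of m n l (row_space N)" for a
  proof (cases "sidx (P (row_space N)) a < sidx (P (row_space N)) p")
    case True
    then show ?thesis using upperD[OF X s(1) a] by simp
  next
    case False
    have "E a b * y (col_space N) b q = 0" if b: "b < dim_of m n l (col_space N)" for b
    proof (cases "sidx (P (col_space N)) q < sidx (P (col_space N)) b")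
      case True
      then show ?thesis using upperD[OF Y b s(2)] by simp
    next
      case False
      then show ?thesis using E[OF s(3)[OF a b]] \<open>\<not> sidx (P (row_space N)) a < _\<close> by simp
    qed
    then have "(\<Sum>b<dim_of m n l (col_space N). E a b * y (col_space N) b q) = 0" by (intro sum.neutral) blast
    then show ?thesis by simp
  qed
  then show ?thesis unfolding mm_def by (intro sum.neutral) blast
qed

lemma mm_minus_left: "mm k (\<lambda>a b. X a b - Y a b) Z p q = mm k X Z p q - mm k Y Z p q"
  by (simp add: mm_def left_diff_distrib sum_subtractf)

lemma mm_minus_right: "mm k Z (\<lambda>a b. X a b - Y a b) p q = mm k Z X p q - mm k Z Y p q"
  by (simp add: mm_def right_diff_distrib sum_subtractf)

lemma mm_scale: "mm k X (\<lambda>a b. c * idm a b) p q = c * mm k X idm p q"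
  "mm k (\<lambda>a b. c * idm a b) X p q = c * mm k idm X p q"
  by (simp_all add: mm_def sum_distrib_left mult_ac)

lemma defect_agree:
  assumes st: "staircase m n l P R" and v: "upper m n l P v"
    and e: "\<And>N p q. (N, p, q) \<in> R \<Longrightarrow> ent S' N p q = ent S N p q" and pq: "(N, p, q) \<in> R"
  shows "defect m n l S' S' v (N, p, q) = defect m n l S S v (N, p, q)"
proof -
  note s = staircaseD[OF st pq]
  have "v (row_space N) p a * ent S' N a q = v (row_space N) p a * ent S N a q" if a: "a < dim_of m n l (row_space N)" for a
  proof (cases "sidx (P (row_space N)) a < sidx (P (row_space N)) p")
    case True
    then show ?thesis using upperD[OF v s(1) a] by simp
  next
    case False
    then show ?thesis using e[OF s(3)[OF a s(2)]] by simp
  qed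
  moreover have "ent S' N p b * v (col_space N) b q = ent S N p b * v (col_space N) b q" if b: "b < dim_of m n l (col_space N)" for b
  proof (cases "sidx (P (col_space N)) q < sidx (P (col_space N)) b")
    case True
    then show ?thesis using upperD[OF v b s(2)] by simp
  next
    case False
    then show ?thesis using e[OF s(3)[OF s(1) b]] by simp
  qed
  ultimately have "mm (dim_of m n l (row_space N)) (v (row_space N)) (ent S' N) p q = mm (dim_of m n l (row_space N)) (v (row_space N)) (ent S N) p q"
    "mm (dim_of m n l (col_space N)) (ent S' N) (v (col_space N)) p q = mm (dim_of m n l (col_space N)) (ent S N) (v (col_space N)) p q"
    unfolding mm_def by (intro sum.cong; simp)+
  then show ?thesis by (simp add: defect_def)
qed

text \<open>Whatever transformation from the group is chosen, reduced entries stay, and with them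
  the algebra. The delicate point is that elements of the new algebra are not yet known to be block
  triangular; conjugation by \<open>u\<close> takes them into the old algebra, where this is known,
  and conjugating back preserves it.\<close>

lemma transform_step:
  assumes inv: "bel_inv m n l S P R d" and u: "u \<in> Lam m n l S R" and du: "disc m n l u \<noteq> 0"
  defines "S' \<equiv> act (triple m n l u) S"
  shows "bel_inv m n l S' P R d" "Lam m n l S' R = Lam m n l S R" "(N, p, q) \<in> R \<Longrightarrow> ent S' N p q = ent S N p q"
proof -
  have S: "S \<in> systems m n l" and st: "staircase m n l P R" and bf: "\<And>v. v \<in> Lam m n l S R \<Longrightarrow> upper m n l P v"
    using inv by (simp_all add: bel_inv_def block_form_def)
  let ?C = "cof m n l u" and ?\<delta> = "disc m n l u"
  have uu: "upper m n l P u" by (rule bf[OF u])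
  have uC: "upper m n l P ?C" by (rule cof_upper[OF uu du])
  have iu: "intw m n l S S' u" unfolding S'_def by (rule intw_act[OF S du])
  have ic: "intw m n l S' S ?C" by (rule intw_cof[OF iu du])
  have S': "S' \<in> systems m n l" unfolding S'_def by (rule act_systems[OF S du])
  have ent: "ent S' N p q = ent S N p q" if pq: "(N, p, q) \<in> R" for N p q
  proof -
    let ?c = "dim_of m n l (col_space N)" and ?u = "u (col_space N)" and ?cc = "?C (col_space N)"
    let ?\<Delta> = "\<lambda>a b. ent S' N a b - ent S N a b"
    note s = staircaseD[OF st pq]
    \<comment> \<open>\<open>u S = S' u\<close> holds everywhere and \<open>u S = S u\<close> on
      \<open>R\<close>, so \<open>(S' - S) u\<close> vanishes on \<open>R\<close>. The block
      triangular scaled inverse of \<open>u\<close> then removes the factor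
      \<open>u\<close>.\<close>
    have 0: "mm ?c ?\<Delta> ?u a b = 0" if ab: "(N, a, b) \<in> R" for a b
    proof -
      note s' = staircaseD[OF st ab]
      have "defect m n l S S u (N, a, b) = 0" using u ab unfolding Lam_def by blast
      then show ?thesis using intwD[OF iu s'(1,2)] by (simp add: mm_minus_left defect_def)
    qed
    have "mm ?c (mm ?c ?\<Delta> ?u) ?cc p q = 0"
      unfolding mm_def[of _ "mm ?c ?\<Delta> ?u"]
    proof (rule sum.neutral, rule ballI)
      fix b assume "b \<in> {..<?c}"
      then have b: "b < ?c" by simp
      show "mm ?c ?\<Delta> ?u p b * ?cc b q = 0"
      proof (cases "sidx (P (col_space N)) q < sidx (P (col_space N)) b")
        case True
        then show ?thesis using upperD[OF uC b s(2)] by simp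
      next
        case False
        then show ?thesis using 0[OF s(3)[OF s(1) b]] by simp
      qed
    qed
    moreover have "mm ?c (mm ?c ?\<Delta> ?u) ?cc p q = mm ?c ?\<Delta> (\<lambda>a b. ?\<delta> * idm a b) p q"
      unfolding mm_assoc by (rule mm_cong) (simp_all add: mm_cof s(2))
    ultimately have "?\<delta> * ?\<Delta> p q = 0" by (simp add: mm_scale mm_idm_right s(2))
    then show ?thesis using du by simp
  qed
  have agree: "v \<in> Lam m n l S' R \<longleftrightarrow> v \<in> Lam m n l S R" if "upper m n l P v" for v
  proof -
    have "defect m n l S' S' v x = defect m n l S S v x" if "x \<in> R" for x
      using defect_agree[OF st \<open>upper m n l P v\<close> ent] that by (cases x) simp
    then show ?thesis unfolding Lam_def by simp
  qed
  have up': "upper m n l P v" if v: "v \<in> Lam m n l S' R" for v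
  proof -
    \<comment> \<open>At \<open>S\<close> the triple \<open>cof u * v * u\<close> has the defect
      \<open>cof u * (v S' - S' v) * u\<close>, which vanishes on \<open>R\<close> together with its
      middle factor.\<close>
    let ?x = "tcomp m n l ?C (tcomp m n l v u)"
    have "?x \<in> Lam m n l S R"
      unfolding Lam_def mem_Collect_eq
    proof
      fix x assume "x \<in> R"
      obtain N p q where x: "x = (N, p, q)" by (cases x)
      with \<open>x \<in> R\<close> have pq: "(N, p, q) \<in> R" by simp
      let ?r = "dim_of m n l (row_space N)" and ?c = "dim_of m n l (col_space N)"
      let ?vr = "v (row_space N)" and ?vc = "v (col_space N)" and ?ur = "u (row_space N)" and ?uc = "u (col_space N)"
      let ?cr = "?C (row_space N)" and ?cc = "?C (col_space N)" and ?X = "ent S N" and ?X' = "ent S' N"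
      note s = staircaseD[OF st pq]
      have cx: "mm ?r (?x (row_space N)) Z p q = mm ?r ?cr (mm ?r ?vr (mm ?r ?ur Z)) p q" for Z
      proof -
        have "mm ?r (?x (row_space N)) Z p q = mm ?r (mm ?r ?cr (mm ?r ?vr ?ur)) Z p q"
        proof (rule mm_cong)
          fix a assume a: "a < ?r"
          have "?x (row_space N) p a = mm ?r ?cr (tcomp m n l v u (row_space N)) p a"
            using s(1) a by (simp add: tcomp_def)
          also have "\<dots> = mm ?r ?cr (mm ?r ?vr ?ur) p a" by (rule mm_cong) (simp_all add: tcomp_def a)
          finally show "?x (row_space N) p a = mm ?r ?cr (mm ?r ?vr ?ur) p a" .
        qed simp
        then show ?thesis by (simp only: mm_assoc)
      qed
      have xc: "mm ?c Z (?x (col_space N)) p q = mm ?c Z (mm ?c ?cc (mm ?c ?vc ?uc)) p q" for Z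
      proof (rule mm_cong)
        fix a assume a: "a < ?c"
        have "?x (col_space N) a q = mm ?c ?cc (tcomp m n l v u (col_space N)) a q"
          using s(2) a by (simp add: tcomp_def)
        also have "\<dots> = mm ?c ?cc (mm ?c ?vc ?uc) a q" by (rule mm_cong) (simp_all add: tcomp_def s(2))
        finally show "?x (col_space N) a q = mm ?c ?cc (mm ?c ?vc ?uc) a q" .
      qed simp
      let ?D = "\<lambda>a b. mm ?r ?vr ?X' a b - mm ?c ?X' ?vc a b"
      have 1: "mm ?r (?x (row_space N)) ?X p q = mm ?r ?cr (mm ?c (mm ?r ?vr ?X') ?uc) p q"
      proof -
        have "mm ?r (?x (row_space N)) ?X p q = mm ?r ?cr (mm ?r ?vr (mm ?r ?ur ?X)) p q" by (rule cx)
        also have "\<dots> = mm ?r ?cr (mm ?r ?vr (mm ?c ?X' ?uc)) p q"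
          by (intro mm_cong refl intwD[OF iu]) (simp_all add: s(2))
        finally show ?thesis by (simp only: mm_assoc)
      qed
      have 2: "mm ?c ?X (?x (col_space N)) p q = mm ?r ?cr (mm ?c (mm ?c ?X' ?vc) ?uc) p q"
      proof -
        have "mm ?c ?X (?x (col_space N)) p q = mm ?c (mm ?c ?X ?cc) (mm ?c ?vc ?uc) p q"
          unfolding xc by (simp only: mm_assoc)
        also have "\<dots> = mm ?c (mm ?r ?cr ?X') (mm ?c ?vc ?uc) p q"
          by (intro mm_cong refl intwD[OF ic, symmetric]) (simp_all add: s(1))
        finally show ?thesis by (simp only: mm_assoc)
      qed
      have "defect m n l S S ?x (N, p, q) = mm ?r ?cr (mm ?c (mm ?r ?vr ?X') ?uc) p q - mm ?r ?cr (mm ?c (mm ?c ?X' ?vc) ?uc) p q"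
        unfolding defect_def prod.case 1 2 by (rule refl)
      also have "\<dots> = mm ?r ?cr (mm ?c ?D ?uc) p q"
        unfolding mm_minus_right[symmetric] by (rule mm_cong) (simp_all only: mm_minus_left)
      also have "\<dots> = 0"
      proof (rule upper_mult_zero[OF st pq uC uu])
        fix a b assume "(N, a, b) \<in> R"
        then have "defect m n l S' S' v (N, a, b) = 0" using v unfolding Lam_def by blast
        then show "?D a b = 0" by (simp add: defect_def)
      qed
      finally show "defect m n l S S ?x x = 0" unfolding x .
    qed
    then have ux: "upper m n l P (tcomp m n l u (tcomp m n l ?x ?C))"
      by (intro comp_upper uu uC bf)
    show ?thesis unfolding upper_def
    proof (intro allI impI)
      fix sp p q assume p: "p < dim_of m n l sp" and q: "q < dim_of m n l sp" and lt: "sidx (P sp) q < sidx (P sp) p"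
      let ?k = "dim_of m n l sp"
      have "tcomp m n l u (tcomp m n l ?x ?C) sp p q = mm ?k (u sp) (mm ?k (mm ?k (?C sp) (mm ?k (v sp) (u sp))) (?C sp)) p q"
      proof -
        have "tcomp m n l u (tcomp m n l ?x ?C) sp p q = mm ?k (u sp) (tcomp m n l ?x ?C sp) p q" using p q by (simp add: tcomp_def)
        also have "\<dots> = mm ?k (u sp) (mm ?k (mm ?k (?C sp) (mm ?k (v sp) (u sp))) (?C sp)) p q"
        proof (rule mm_cong[OF refl])
          fix a assume a: "a < ?k"
          have "tcomp m n l ?x ?C sp a q = mm ?k (?x sp) (?C sp) a q" using a q by (simp add: tcomp_def)
          also have "\<dots> = mm ?k (mm ?k (?C sp) (mm ?k (v sp) (u sp))) (?C sp) a q"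
          proof (rule mm_cong[OF _ refl])
            fix b assume b: "b < ?k"
            have "?x sp a b = mm ?k (?C sp) (tcomp m n l v u sp) a b" using a b by (simp add: tcomp_def)
            also have "\<dots> = mm ?k (?C sp) (mm ?k (v sp) (u sp)) a b" by (rule mm_cong) (simp_all add: tcomp_def b)
            finally show "?x sp a b = mm ?k (?C sp) (mm ?k (v sp) (u sp)) a b" .
          qed
          finally show "tcomp m n l ?x ?C sp a q = mm ?k (mm ?k (?C sp) (mm ?k (v sp) (u sp))) (?C sp) a q" .
        qed
        finally show ?thesis .
      qed
      also have "\<dots> = mm ?k (mm ?k (u sp) (?C sp)) (mm ?k (v sp) (mm ?k (u sp) (?C sp))) p q" by (simp only: mm_assoc)
      also have "\<dots> = mm ?k (\<lambda>a b. ?\<delta> * idm a b) (mm ?k (v sp) (\<lambda>a b. ?\<delta> * idm a b)) p q"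
      proof (rule mm_cong)
        show "mm ?k (u sp) (?C sp) p a = ?\<delta> * idm p a" if "a < ?k" for a by (rule mm_cof(2)[OF p that])
        show "mm ?k (v sp) (mm ?k (u sp) (?C sp)) a q = mm ?k (v sp) (\<lambda>a b. ?\<delta> * idm a b) a q" if "a < ?k" for a
          by (rule mm_cong) (simp_all add: mm_cof(2) q)
      qed
      also have "\<dots> = ?\<delta> * (?\<delta> * v sp p q)" by (simp add: mm_scale mm_idm_left mm_idm_right p q)
      finally have "?\<delta> * (?\<delta> * v sp p q) = 0" using upperD[OF ux p q lt] by simp
      then show "v sp p q = 0" using du by simp
    qed
  qed
  have L: "Lam m n l S' R = Lam m n l S R"
  proof (rule equalityI; rule subsetI)
    show "v \<in> Lam m n l S R" if "v \<in> Lam m n l S' R" for v using agree[OF up'[OF that]] that by simp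
    show "v \<in> Lam m n l S' R" if "v \<in> Lam m n l S R" for v using agree[OF bf[OF that]] that by simp
  qed
  then show "Lam m n l S' R = Lam m n l S R" .
  show "bel_inv m n l S' P R d" using inv S' unfolding bel_inv_def L by simp
  show "ent S' N p q = ent S N p q" if "(N, p, q) \<in> R" using ent[OF that] .
qed

lemma defect_lin: "lin (\<lambda>v. defect m n l S S' v x)"
  unfolding lin_def
proof (intro allI)
  fix a b u v
  obtain N p q where x: "x = (N, p, q)" by (cases x)
  show "defect m n l S S' (\<lambda>s p q. a * u s p q + b * v s p q) x = a * defect m n l S S' u x + b * defect m n l S S' v x"
    unfolding x defect_def prod.case mm_lin_left mm_lin_right by (simp add: algebra_simps)
qed

lemma defect_cong:
  assumes x: "x \<in> sys_idx m n l"
    and e: "\<And>sp p q. p < dim_of m n l sp \<Longrightarrow> q < dim_of m n l sp \<Longrightarrow> u sp p q = v sp p q"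
  shows "defect m n l S S' u x = defect m n l S S' v x"
proof -
  obtain N p q where x': "x = (N, p, q)" by (cases x)
  have pq: "p < dim_of m n l (row_space N)" "q < dim_of m n l (col_space N)" using x by (simp_all add: x' sys_idx_def)
  have "mm (dim_of m n l (row_space N)) (u (row_space N)) (ent S N) p q = mm (dim_of m n l (row_space N)) (v (row_space N)) (ent S N) p q"
    by (rule mm_cong) (simp_all add: e pq)
  moreover have "mm (dim_of m n l (col_space N)) (ent S' N) (u (col_space N)) p q = mm (dim_of m n l (col_space N)) (ent S' N) (v (col_space N)) p q"
    by (rule mm_cong) (simp_all add: e pq)
  ultimately show ?thesis by (simp add: x' defect_def)
qed

lemma Lam_cong:
  assumes R: "R \<subseteq> sys_idx m n l"
    and e: "\<And>sp p q. p < dim_of m n l sp \<Longrightarrow> q < dim_of m n l sp \<Longrightarrow> u sp p q = v sp p q"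
  shows "u \<in> Lam m n l S R \<longleftrightarrow> v \<in> Lam m n l S R"
proof -
  have "defect m n l S S u x = defect m n l S S v x" if "x \<in> R" for x
    by (rule defect_cong) (use that R e in auto)
  then show ?thesis by (simp add: Lam_def)
qed

definition tri_of :: "mat_triple \<Rightarrow> tri" where
  "tri_of T = (\<lambda>sp p q. factor sp T $$ (p, q))"

lemma preserving_algebra_iff:
  assumes T: "T \<in> square_triples m n l" and S: "S \<in> systems m n l" and R: "R \<subseteq> sys_idx m n l"
  shows "T \<in> preserving_algebra m n l S R \<longleftrightarrow> tri_of T \<in> Lam m n l S R"
proof -
  have "(factor (row_space N) T * component_mat N S) $$ (p, q) = (component_mat N S * factor (col_space N) T) $$ (p, q) \<longleftrightarrow>
    defect m n l S S (tri_of T) (N, p, q) = 0" if "(N, p, q) \<in> R" for N p q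
  proof -
    have pq: "p < dim_of m n l (row_space N)" "q < dim_of m n l (col_space N)" using that R by (auto simp: sys_idx_def)
    have fc: "factor sp T \<in> carrier_mat (dim_of m n l sp) (dim_of m n l sp)" for sp
      using T by (cases T; cases sp) (auto simp: square_triples_def)
    show ?thesis
      using pq fc[of "row_space N"] fc[of "col_space N"] component_mat_carrier[OF S, of N]
      by (simp add: defect_def mm_def tri_of_def ent_def scalar_prod_def atLeast0LessThan)
  qed
  then show ?thesis using T by (auto simp: preserving_algebra_def Lam_def)
qed

lemma triple_square: "triple m n l v \<in> square_triples m n l"
  by (simp add: triple_def square_triples_def)

lemma tri_of_triple: "p < dim_of m n l sp \<Longrightarrow> q < dim_of m n l sp \<Longrightarrow> tri_of (triple m n l v) sp p q = v sp p q"
  by (simp add: tri_of_def factor_triple)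

lemma sum_strips_cond:
  "(\<Sum>p\<in>{p. p < total_size ss \<and> Q (sidx ss p)}. h p) = (\<Sum>a\<in>{a. a < length ss \<and> Q a}. \<Sum>t<snd (ss ! a). h (start ss a + t))"
proof -
  have "(\<Sum>p\<in>{p. p < total_size ss \<and> Q (sidx ss p)}. h p) = (\<Sum>p<total_size ss. if Q (sidx ss p) then h p else 0)"
    by (simp add: sum.inter_filter flip: lessThan_iff)
  also have "\<dots> = (\<Sum>a<length ss. \<Sum>t<snd (ss ! a). if Q a then h (start ss a + t) else 0)"
    unfolding sum_total by (intro sum.cong) (simp_all add: coord_start)
  also have "\<dots> = (\<Sum>a<length ss. if Q a then \<Sum>t<snd (ss ! a). h (start ss a + t) else 0)"
    by (intro sum.cong) simp_all
  also have "\<dots> = (\<Sum>a\<in>{a. a < length ss \<and> Q a}. \<Sum>t<snd (ss ! a). h (start ss a + t))"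
    by (simp add: sum.inter_filter flip: lessThan_iff)
  finally show ?thesis .
qed

text \<open>An entry of \<open>D\<close>, expressed by positions: the strips below the row strip of
  \<open>p\<close> and those to the left of the column strip of \<open>q\<close> contribute.\<close>

definition resid :: "nat \<Rightarrow> nat \<Rightarrow> nat \<Rightarrow> strips \<Rightarrow> system \<Rightarrow> tri \<Rightarrow> component \<Rightarrow> nat \<Rightarrow> nat \<Rightarrow> complex" where
  "resid m n l P S v N p q =
    (\<Sum>a\<in>{a. a < dim_of m n l (row_space N) \<and> sidx (P (row_space N)) p < sidx (P (row_space N)) a}.
       v (row_space N) p a * ent S N a q) -
    (\<Sum>b\<in>{b. b < dim_of m n l (col_space N) \<and> sidx (P (col_space N)) b < sidx (P (col_space N)) q}.
       ent S N p b * v (col_space N) b q)"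

lemma residual_entry:
  assumes val: "valid m n l P" and i: "i < length (P (row_space N))" and j: "j < length (P (col_space N))"
    and s: "s < snd (P (row_space N) ! i)" and t: "t < snd (P (col_space N) ! j)"
  shows "residual P S T N i j $$ (s, t) =
    resid m n l P S (tri_of T) N (start (P (row_space N)) i + s) (start (P (col_space N)) j + t)"
proof -
  let ?rs = "P (row_space N)" and ?cs = "P (col_space N)"
  let ?p = "start ?rs i + s" and ?q = "start ?cs j + t"
  have tot: "total_size (P sp) = dim_of m n l sp" for sp using val by (simp add: valid_def)
  have ip: "sidx ?rs ?p = i" and jq: "sidx ?cs ?q = j" using coord_start[OF i s] coord_start[OF j t] by auto
  have A: "(\<Sum>a\<in>{a. a < dim_of m n l (row_space N) \<and> i < sidx ?rs a}. tri_of T (row_space N) ?p a * ent S N a ?q) =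
    (\<Sum>a\<in>{i<..<length ?rs}. (block ?rs ?rs (factor (row_space N) T) i a * block ?rs ?cs (component_mat N S) a j) $$ (s, t))"
  proof -
    have set: "{a. a < length ?rs \<and> i < a} = {i<..<length ?rs}" by auto
    show ?thesis
      unfolding tot[symmetric] sum_strips_cond[where ss = ?rs and Q = "\<lambda>x. i < x"] set
      by (rule sum.cong) (use s t in \<open>simp_all add: block_def scalar_prod_def atLeast0LessThan offset_start tri_of_def ent_def\<close>)
  qed
  have B: "(\<Sum>b\<in>{b. b < dim_of m n l (col_space N) \<and> sidx ?cs b < j}. ent S N ?p b * tri_of T (col_space N) b ?q) =
    (\<Sum>a<j. (block ?rs ?cs (component_mat N S) i a * block ?cs ?cs (factor (col_space N) T) a j) $$ (s, t))"
  proof -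
    have set: "{a. a < length ?cs \<and> a < j} = {..<j}" using j by auto
    show ?thesis
      unfolding tot[symmetric] sum_strips_cond[where ss = ?cs and Q = "\<lambda>x. x < j"] set
      by (rule sum.cong) (use s t in \<open>simp_all add: block_def scalar_prod_def atLeast0LessThan offset_start tri_of_def ent_def\<close>)
  qed
  show ?thesis
    unfolding residual_def Let_def resid_def ip jq A B using s t by simp
qed

lemma resid_cong:
  assumes "p < dim_of m n l (row_space N)" "q < dim_of m n l (col_space N)"
    and e: "\<And>sp p q. p < dim_of m n l sp \<Longrightarrow> q < dim_of m n l sp \<Longrightarrow> u sp p q = v sp p q"
  shows "resid m n l P S u N p q = resid m n l P S v N p q"
  unfolding resid_def using assms by (intro arg_cong2[where f = minus] sum.cong) auto

lemma residual_vanishes_iff: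
  assumes val: "valid m n l P" and S: "S \<in> systems m n l" and R: "R \<subseteq> sys_idx m n l"
    and i: "i < length (P (row_space N))" and j: "j < length (P (col_space N))"
  shows "residual_vanishes m n l S P R N i j \<longleftrightarrow> (\<forall>v\<in>Lam m n l S R. \<forall>s<snd (P (row_space N) ! i). \<forall>t<snd (P (col_space N) ! j).
     resid m n l P S v N (start (P (row_space N)) i + s) (start (P (col_space N)) j + t) = 0)"
proof -
  let ?rs = "P (row_space N)" and ?cs = "P (col_space N)"
  have tot: "total_size (P sp) = dim_of m n l sp" for sp using val by (simp add: valid_def)
  have zero: "residual P S T N i j = 0\<^sub>m (snd (?rs ! i)) (snd (?cs ! j)) \<longleftrightarrow> (\<forall>s<snd (?rs ! i). \<forall>t<snd (?cs ! j).
     resid m n l P S (tri_of T) N (start ?rs i + s) (start ?cs j + t) = 0)" for T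
  proof
    assume "residual P S T N i j = 0\<^sub>m (snd (?rs ! i)) (snd (?cs ! j))"
    then show "\<forall>s<snd (?rs ! i). \<forall>t<snd (?cs ! j). resid m n l P S (tri_of T) N (start ?rs i + s) (start ?cs j + t) = 0"
      using residual_entry[OF val i j, of _ _ S T] by simp
  next
    assume a: "\<forall>s<snd (?rs ! i). \<forall>t<snd (?cs ! j). resid m n l P S (tri_of T) N (start ?rs i + s) (start ?cs j + t) = 0"
    have d: "dim_row (residual P S T N i j) = snd (?rs ! i)" "dim_col (residual P S T N i j) = snd (?cs ! j)"
      by (simp_all add: residual_def Let_def)
    show "residual P S T N i j = 0\<^sub>m (snd (?rs ! i)) (snd (?cs ! j))"
      by (rule eq_matI) (use a d residual_entry[OF val i j, of _ _ S T] in simp_all)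
  qed
  show ?thesis
  proof
    assume rv: "residual_vanishes m n l S P R N i j"
    show "\<forall>v\<in>Lam m n l S R. \<forall>s<snd (?rs ! i). \<forall>t<snd (?cs ! j). resid m n l P S v N (start ?rs i + s) (start ?cs j + t) = 0"
    proof (intro ballI allI impI)
      fix v s t assume v: "v \<in> Lam m n l S R" and s: "s < snd (?rs ! i)" and t: "t < snd (?cs ! j)"
      have "tri_of (triple m n l v) \<in> Lam m n l S R"
        using v Lam_cong[OF R, of "tri_of (triple m n l v)" v S] tri_of_triple by blast
      then have "triple m n l v \<in> preserving_algebra m n l S R"
        using preserving_algebra_iff[OF triple_square S R] by blast
      then have "resid m n l P S (tri_of (triple m n l v)) N (start ?rs i + s) (start ?cs j + t) = 0"
        using rv zero s t unfolding residual_vanishes_def by blast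
      moreover have "resid m n l P S (tri_of (triple m n l v)) N (start ?rs i + s) (start ?cs j + t) =
          resid m n l P S v N (start ?rs i + s) (start ?cs j + t)"
        by (rule resid_cong) (use coord_start(1)[OF i s] coord_start(1)[OF j t] in \<open>simp_all add: tot tri_of_triple\<close>)
      ultimately show "resid m n l P S v N (start ?rs i + s) (start ?cs j + t) = 0" by simp
    qed
  next
    assume a: "\<forall>v\<in>Lam m n l S R. \<forall>s<snd (?rs ! i). \<forall>t<snd (?cs ! j). resid m n l P S v N (start ?rs i + s) (start ?cs j + t) = 0"
    show "residual_vanishes m n l S P R N i j"
      unfolding residual_vanishes_def zero
    proof
      fix T assume T: "T \<in> preserving_algebra m n l S R"
      then have "T \<in> square_triples m n l" by (simp add: preserving_algebra_def)
      then have "tri_of T \<in> Lam m n l S R" using preserving_algebra_iff[OF _ S R] T by blast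
      then show "\<forall>s<snd (?rs ! i). \<forall>t<snd (?cs ! j). resid m n l P S (tri_of T) N (start ?rs i + s) (start ?cs j + t) = 0"
        using a by blast
    qed
  qed
qed

definition blk :: "nat \<Rightarrow> nat \<Rightarrow> nat \<Rightarrow> strips \<Rightarrow> component \<Rightarrow> nat \<Rightarrow> nat \<Rightarrow> position set" where
  "blk m n l P N i j = {(N, p, q) | p q. (N, p, q) \<in> sys_idx m n l \<and> sidx (P (row_space N)) p = i \<and> sidx (P (col_space N)) q = j}"

lemma strip_interval:
  assumes "i < length ss"
  shows "p \<in> {start ss i..<start ss (Suc i)} \<longleftrightarrow> p < total_size ss \<and> sidx ss p = i"
proof
  have s: "start ss (Suc i) = start ss i + snd (ss ! i)" by (simp add: start_def)
  assume "p \<in> {start ss i..<start ss (Suc i)}"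
  then have "p = start ss i + (p - start ss i)" "p - start ss i < snd (ss ! i)" using s by auto
  then show "p < total_size ss \<and> sidx ss p = i" using coord_start[OF assms, of "p - start ss i"] by simp
next
  have s: "start ss (Suc i) = start ss i + snd (ss ! i)" by (simp add: start_def)
  assume "p < total_size ss \<and> sidx ss p = i"
  then show "p \<in> {start ss i..<start ss (Suc i)}" using coord_props[of p ss] s by auto
qed

lemma block_positions_eq:
  assumes val: "valid m n l P" and "i < length (P (row_space N))" "j < length (P (col_space N))"
  shows "block_positions P N i j = blk m n l P N i j"
proof -
  have tot: "total_size (P sp) = dim_of m n l sp" for sp using val by (simp add: valid_def)
  show ?thesis
    unfolding block_positions_def blk_def offset_start strip_interval[OF assms(2)] strip_interval[OF assms(3)] tot sys_idx_def
    by auto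
qed

text \<open>Since the block is first in the order, everything in lower row strips, and everything to
  its left in its own row strip, is reduced. This makes \<open>D\<close> depend on reduced entries
  only and keeps the staircase shape when the block is added.\<close>

lemma first_unreduced_props:
  assumes fu: "first_unreduced P R N i j" and val: "valid m n l P" and st: "staircase m n l P R"
  shows "i < length (P (row_space N))" "j < length (P (col_space N))"
    and "\<And>p q. (N, p, q) \<in> sys_idx m n l \<Longrightarrow> i < sidx (P (row_space N)) p \<or> i = sidx (P (row_space N)) p \<and> sidx (P (col_space N)) q < j \<Longrightarrow>
      (N, p, q) \<in> R"
    and "staircase m n l P (R \<union> blk m n l P N i j)"
proof -
  let ?rs = "P (row_space N)" and ?cs = "P (col_space N)"
  have tot: "total_size (P sp) = dim_of m n l sp" for sp using val by (simp add: valid_def)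
  show i: "i < length ?rs" and j: "j < length ?cs" using fu by (auto simp: first_unreduced_def unreduced_def is_block_def)
  show red: "(N, p, q) \<in> R" if pq: "(N, p, q) \<in> sys_idx m n l"
    and less: "i < sidx ?rs p \<or> i = sidx ?rs p \<and> sidx ?cs q < j" for p q
  proof -
    have p: "p < total_size ?rs" and q: "q < total_size ?cs" using pq by (simp_all add: sys_idx_def tot)
    let ?i = "sidx ?rs p" and ?j = "sidx ?cs q"
    note lp = coord_props(1)[OF p] and lq = coord_props(1)[OF q]
    have "precedes (N, ?i, ?j) (N, i, j)" using less by auto
    then have "\<not> unreduced P R N ?i ?j" using fu unfolding first_unreduced_def by blast
    then have "block_positions P N ?i ?j \<subseteq> R" using lp lq by (simp add: unreduced_def is_block_def)
    moreover have "(N, p, q) \<in> block_positions P N ?i ?j"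
      unfolding block_positions_eq[OF val lp lq] blk_def using pq by simp
    ultimately show ?thesis by blast
  qed
  show "staircase m n l P (R \<union> blk m n l P N i j)"
    unfolding staircase_def
  proof (intro conjI allI impI)
    show "R \<union> blk m n l P N i j \<subseteq> sys_idx m n l" using st by (auto simp: staircase_def blk_def)
    fix N' p q p' q'
    assume a: "(N', p, q) \<in> R \<union> blk m n l P N i j" and pq': "(N', p', q') \<in> sys_idx m n l"
      and le: "sidx (P (row_space N')) p \<le> sidx (P (row_space N')) p'" "sidx (P (col_space N')) q' \<le> sidx (P (col_space N')) q"
    show "(N', p', q') \<in> R \<union> blk m n l P N i j"
    proof (cases "(N', p, q) \<in> R")
      case True
      then show ?thesis using st pq' le unfolding staircase_def by blast
    next
      case False
      then have b: "N' = N" "sidx ?rs p = i" "sidx ?cs q = j" using a by (auto simp: blk_def)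
      show ?thesis
      proof (cases "sidx ?rs p' = i \<and> sidx ?cs q' = j")
        case True
        then show ?thesis using pq' b by (simp add: blk_def)
      next
        case False
        then have "i < sidx ?rs p' \<or> i = sidx ?rs p' \<and> sidx ?cs q' < j" using le b by auto
        then show ?thesis using red[of p' q'] pq' b by simp
      qed
    qed
  qed
qed

text \<open>As \<open>v\<close> is block triangular, strips above the row strip and to the right of
  the column strip drop out. Those below and to the left make up \<open>D\<close>, and the two
  strips themselves contribute the diagonal blocks of \<open>v\<close>.\<close>

lemma defect_block:
  assumes val: "valid m n l P" and v: "upper m n l P v"
    and i: "i < length (P (row_space N))" and j: "j < length (P (col_space N))"
    and s: "s < snd (P (row_space N) ! i)" and t: "t < snd (P (col_space N) ! j)"
  defines "p \<equiv> start (P (row_space N)) i + s" and "q \<equiv> start (P (col_space N)) j + t"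
  shows "defect m n l S S v (N, p, q) = resid m n l P S v N p q +
    (\<Sum>x<snd (P (row_space N) ! i). v (row_space N) p (start (P (row_space N)) i + x) * ent S N (start (P (row_space N)) i + x) q) -
    (\<Sum>y<snd (P (col_space N) ! j). ent S N p (start (P (col_space N)) j + y) * v (col_space N) (start (P (col_space N)) j + y) q)"
proof -
  let ?rs = "P (row_space N)" and ?cs = "P (col_space N)"
  let ?r = "dim_of m n l (row_space N)" and ?c = "dim_of m n l (col_space N)"
  have tot: "total_size (P sp) = dim_of m n l sp" for sp using val by (simp add: valid_def)
  have p: "p < ?r" "sidx ?rs p = i" and q: "q < ?c" "sidx ?cs q = j"
    using coord_start[OF i s] coord_start[OF j t] by (simp_all add: tot p_def q_def)
  have A: "mm ?r (v (row_space N)) (ent S N) p q = (\<Sum>a\<in>{a. a < ?r \<and> i < sidx ?rs a}. v (row_space N) p a * ent S N a q) +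
    (\<Sum>a\<in>{a. a < ?r \<and> sidx ?rs a = i}. v (row_space N) p a * ent S N a q)"
  proof -
    have "(\<Sum>a\<in>{..<?r}. v (row_space N) p a * ent S N a q) = (\<Sum>a\<in>{a. a < ?r \<and> i < sidx ?rs a} \<union> {a. a < ?r \<and> sidx ?rs a = i}. v (row_space N) p a * ent S N a q)"
    proof (rule sum.mono_neutral_right)
      show "\<forall>a\<in>{..<?r} - ({a. a < ?r \<and> i < sidx ?rs a} \<union> {a. a < ?r \<and> sidx ?rs a = i}). v (row_space N) p a * ent S N a q = 0"
      proof
        fix a assume "a \<in> {..<?r} - ({a. a < ?r \<and> i < sidx ?rs a} \<union> {a. a < ?r \<and> sidx ?rs a = i})"
        then have "a < ?r" "sidx ?rs a < sidx ?rs p" using p by auto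
        then show "v (row_space N) p a * ent S N a q = 0" using upperD[OF v p(1)] by simp
      qed
    qed auto
    also have "\<dots> = (\<Sum>a\<in>{a. a < ?r \<and> i < sidx ?rs a}. v (row_space N) p a * ent S N a q) +
      (\<Sum>a\<in>{a. a < ?r \<and> sidx ?rs a = i}. v (row_space N) p a * ent S N a q)"
      by (rule sum.union_disjoint) auto
    finally show ?thesis by (simp add: mm_def)
  qed
  have B: "mm ?c (ent S N) (v (col_space N)) p q = (\<Sum>a\<in>{a. a < ?c \<and> sidx ?cs a < j}. ent S N p a * v (col_space N) a q) +
    (\<Sum>a\<in>{a. a < ?c \<and> sidx ?cs a = j}. ent S N p a * v (col_space N) a q)"
  proof -
    have "(\<Sum>a\<in>{..<?c}. ent S N p a * v (col_space N) a q) = (\<Sum>a\<in>{a. a < ?c \<and> sidx ?cs a < j} \<union> {a. a < ?c \<and> sidx ?cs a = j}. ent S N p a * v (col_space N) a q)"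
    proof (rule sum.mono_neutral_right)
      show "\<forall>a\<in>{..<?c} - ({a. a < ?c \<and> sidx ?cs a < j} \<union> {a. a < ?c \<and> sidx ?cs a = j}). ent S N p a * v (col_space N) a q = 0"
      proof
        fix a assume "a \<in> {..<?c} - ({a. a < ?c \<and> sidx ?cs a < j} \<union> {a. a < ?c \<and> sidx ?cs a = j})"
        then have "a < ?c" "sidx ?cs q < sidx ?cs a" using q by auto
        then show "ent S N p a * v (col_space N) a q = 0" using upperD[OF v _ q(1)] by simp
      qed
    qed auto
    also have "\<dots> = (\<Sum>a\<in>{a. a < ?c \<and> sidx ?cs a < j}. ent S N p a * v (col_space N) a q) +
      (\<Sum>a\<in>{a. a < ?c \<and> sidx ?cs a = j}. ent S N p a * v (col_space N) a q)"
      by (rule sum.union_disjoint) auto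
    finally show ?thesis by (simp add: mm_def)
  qed
  note sr = sum_strip[OF i, unfolded tot] and sc = sum_strip[OF j, unfolded tot]
  show ?thesis
    unfolding defect_def prod.case A B resid_def p(2) q(2) sr sc by simp
qed

lemma defect_block_fam:
  assumes val: "valid m n l P" and v: "upper m n l P v"
    and fam: "\<And>sp p q. p < dim_of m n l sp \<Longrightarrow> q < dim_of m n l sp \<Longrightarrow> sidx (P sp) p = sidx (P sp) q \<Longrightarrow>
       v sp p q = fam (slab (P sp) p) (sloc (P sp) p) (sloc (P sp) q)"
    and i: "i < length (P (row_space N))" "P (row_space N) ! i = (a, mk)" and j: "j < length (P (col_space N))" "P (col_space N) ! j = (b, nk)"
    and M: "\<And>s t. s < mk \<Longrightarrow> t < nk \<Longrightarrow> ent S N (start (P (row_space N)) i + s) (start (P (col_space N)) j + t) = M s t"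
    and s: "s < mk" and t: "t < nk"
  shows "defect m n l S S v (N, start (P (row_space N)) i + s, start (P (col_space N)) j + t) =
    resid m n l P S v N (start (P (row_space N)) i + s) (start (P (col_space N)) j + t) +
    mm mk (fam a) M s t - mm nk M (fam b) s t"
proof -
  have tot: "total_size (P sp) = dim_of m n l sp" for sp using val by (simp add: valid_def)
  have s': "x < snd (P (row_space N) ! i)" if "x < mk" for x using i that by simp
  have t': "y < snd (P (col_space N) ! j)" if "y < nk" for y using j that by simp
  have "v (row_space N) (start (P (row_space N)) i + s) (start (P (row_space N)) i + x) = fam a s x" if "x < mk" for x
    using fam[of "start (P (row_space N)) i + s" "row_space N" "start (P (row_space N)) i + x"]
      coord_start[OF i(1) s'[OF s]] coord_start[OF i(1) s'[OF that]] i by (simp add: tot)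
  moreover have "v (col_space N) (start (P (col_space N)) j + y) (start (P (col_space N)) j + t) = fam b y t" if "y < nk" for y
    using fam[of "start (P (col_space N)) j + y" "col_space N" "start (P (col_space N)) j + t"]
      coord_start[OF j(1) t'[OF that]] coord_start[OF j(1) t'[OF t]] j by (simp add: tot)
  ultimately show ?thesis
    unfolding defect_block[OF val v i(1) j(1) s'[OF s] t'[OF t]]
    using i(2) j(2) s t by (simp add: mm_def M)
qed

section \<open>Splitting the strips\<close>

text \<open>The condition on sizes ranges over two spaces because equivalent strips may belong to
  different spaces; it keeps the size of a strip a function of its label.\<close>

locale strip_split =
  fixes m n l :: nat and P :: strips and f :: "strip \<Rightarrow> strip list"
  assumes val: "valid m n l P"
    and total_f: "\<And>sp a. a \<in> set (P sp) \<Longrightarrow> total_size (f a) = snd a"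
    and sizes_f: "\<And>sp sp' a b e s s'. a \<in> set (P sp) \<Longrightarrow> b \<in> set (P sp') \<Longrightarrow> (e, s) \<in> set (f a) \<Longrightarrow> (e, s') \<in> set (f b) \<Longrightarrow> s = s'"
begin

definition sz :: "nat \<Rightarrow> nat" where "sz d = (THE s. \<exists>sp. (d, s) \<in> set (P sp))"

lemma total_P: "total_size (P sp) = dim_of m n l sp"
  using val by (simp add: valid_def)

lemma sz_eq:
  assumes "(d, s) \<in> set (P sp)"
  shows "sz d = s"
  unfolding sz_def
proof (rule the_equality)
  fix s' assume "\<exists>sp. (d, s') \<in> set (P sp)"
  then obtain sp' where "(d, s') \<in> set (P sp')" by (elim exE)
  then show "s' = s" using val assms unfolding valid_def by blast
qed (rule exI[of _ sp], rule assms)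

lemma strip_in: "p < dim_of m n l sp \<Longrightarrow> P sp ! sidx (P sp) p \<in> set (P sp)"
  using coord_props(1)[of p "P sp"] by (simp add: total_P)

lemma strip_at:
  assumes "p < dim_of m n l sp"
  shows "P sp ! sidx (P sp) p = (slab (P sp) p, sz (slab (P sp) p))" "(slab (P sp) p, sz (slab (P sp) p)) \<in> set (P sp)"
    "sloc (P sp) p < sz (slab (P sp) p)"
proof -
  let ?a = "P sp ! sidx (P sp) p"
  have p: "p < total_size (P sp)" using assms by (simp add: total_P)
  have a: "?a \<in> set (P sp)" by (rule strip_in[OF assms])
  have f: "fst ?a = slab (P sp) p" by (simp add: coord_props(2)[OF p])
  have "(slab (P sp) p, snd ?a) \<in> set (P sp)" using a by (simp add: f[symmetric])
  then have s: "sz (slab (P sp) p) = snd ?a" by (rule sz_eq)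
  show e: "?a = (slab (P sp) p, sz (slab (P sp) p))" by (rule prod_eqI) (simp_all add: f s)
  show "(slab (P sp) p, sz (slab (P sp) p)) \<in> set (P sp)" using a by (simp only: e)
  show "sloc (P sp) p < sz (slab (P sp) p)" using coord_props(3)[OF p] by (simp add: s)
qed

definition sub :: "nat \<Rightarrow> strip list" where "sub d = f (d, sz d)"

lemma total_concat: "total_size (concat (map f (P sp))) = dim_of m n l sp"
proof -
  have "total_size (concat (map f (P sp))) = total_size (P sp)" by (rule total_concat_map) (rule total_f)
  then show ?thesis by (simp add: total_P)
qed

lemma new_coord:
  assumes "p < dim_of m n l sp"
  shows "slab (split_strips f P sp) p = slab (sub (slab (P sp) p)) (sloc (P sp) p)"
    "sloc (split_strips f P sp) p = sloc (sub (slab (P sp) p)) (sloc (P sp) p)"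
proof -
  have p: "p < total_size (P sp)" "p < total_size (concat (map f (P sp)))" using assms by (simp_all only: total_P total_concat)
  note c = split_coord[where f = f and ss = "P sp", OF total_f p(1)]
  show "slab (split_strips f P sp) p = slab (sub (slab (P sp) p)) (sloc (P sp) p)"
    unfolding split_strips_def filter_coord(1)[OF p(2)] sub_def strip_at(1)[OF assms, symmetric] by (rule c(1))
  show "sloc (split_strips f P sp) p = sloc (sub (slab (P sp) p)) (sloc (P sp) p)"
    unfolding split_strips_def filter_coord(2)[OF p(2)] sub_def strip_at(1)[OF assms, symmetric] by (rule c(2))
qed

lemma new_less:
  assumes "p < dim_of m n l sp" "q < dim_of m n l sp"
  shows "sidx (split_strips f P sp) p < sidx (split_strips f P sp) q \<longleftrightarrow> sidx (P sp) p < sidx (P sp) q \<or>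
    sidx (P sp) p = sidx (P sp) q \<and> sidx (sub (slab (P sp) p)) (sloc (P sp) p) < sidx (sub (slab (P sp) p)) (sloc (P sp) q)"
proof -
  have p: "p < total_size (P sp)" "p < total_size (concat (map f (P sp)))" using assms by (simp_all only: total_P total_concat)
  have q: "q < total_size (P sp)" "q < total_size (concat (map f (P sp)))" using assms by (simp_all only: total_P total_concat)
  show ?thesis
    unfolding split_strips_def filter_order[OF p(2) q(2)] sub_def strip_at(1)[OF assms(1), symmetric]
    by (rule split_order[where f = f and ss = "P sp", OF total_f p(1) q(1)])
qed

lemma new_eq:
  assumes "p < dim_of m n l sp" "q < dim_of m n l sp"
  shows "sidx (split_strips f P sp) p = sidx (split_strips f P sp) q \<longleftrightarrow> sidx (P sp) p = sidx (P sp) q \<and>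
    sidx (sub (slab (P sp) p)) (sloc (P sp) p) = sidx (sub (slab (P sp) p)) (sloc (P sp) q)"
proof -
  have sl: "slab (P sp) p = slab (P sp) q" if "sidx (P sp) p = sidx (P sp) q"
    using that strip_at(1)[OF assms(1)] strip_at(1)[OF assms(2)] by simp
  have eq: "(x::nat) = y \<longleftrightarrow> \<not> x < y \<and> \<not> y < x" for x y by auto
  show ?thesis
    unfolding eq[of "sidx (split_strips f P sp) p"] new_less[OF assms] new_less[OF assms(2,1)]
    using sl by (cases "sidx (P sp) p = sidx (P sp) q") auto
qed

lemma old_le:
  assumes "p < dim_of m n l sp" "q < dim_of m n l sp" "sidx (split_strips f P sp) p \<le> sidx (split_strips f P sp) q"
  shows "sidx (P sp) p \<le> sidx (P sp) q"
  using new_less[OF assms(2,1)] assms(3) by linarith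

lemma valid_split: "valid m n l (split_strips f P)"
  unfolding valid_def
proof (intro conjI allI impI)
  show "total_size (split_strips f P sp) = dim_of m n l sp" for sp
    by (simp only: split_strips_def filter_total total_concat)
  fix sp sp' d s s' assume a: "(d, s) \<in> set (split_strips f P sp)" "(d, s') \<in> set (split_strips f P sp')"
  from a(1) obtain x where x: "x \<in> set (P sp)" "(d, s) \<in> set (f x)" by (auto simp: split_strips_def)
  from a(2) obtain y where y: "y \<in> set (P sp')" "(d, s') \<in> set (f y)" by (auto simp: split_strips_def)
  show "s = s'" by (rule sizes_f[OF x(1) y(1) x(2) y(2)])
qed

lemma staircase_split:
  assumes "staircase m n l P R"
  shows "staircase m n l (split_strips f P) R"
  unfolding staircase_def
proof (intro conjI allI impI)
  show "R \<subseteq> sys_idx m n l" using assms by (simp add: staircase_def)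
  fix N p q p' q' assume pq: "(N, p, q) \<in> R" and pq': "(N, p', q') \<in> sys_idx m n l"
    and le: "sidx (split_strips f P (row_space N)) p \<le> sidx (split_strips f P (row_space N)) p'"
      "sidx (split_strips f P (col_space N)) q' \<le> sidx (split_strips f P (col_space N)) q"
  note s = staircaseD[OF assms pq]
  have p'q': "p' < dim_of m n l (row_space N)" "q' < dim_of m n l (col_space N)" using pq' by (simp_all add: sys_idx_def)
  show "(N, p', q') \<in> R" by (rule s(3)[OF p'q' old_le[OF s(1) p'q'(1) le(1)] old_le[OF p'q'(2) s(2) le(2)]])
qed

text \<open>Entries between different old strips are already triangular, so the block form for the
  finer partition is a condition on the old diagonal blocks alone.\<close>

lemma block_form_split:
  assumes v: "upper m n l P v"
    and fam: "\<And>sp p q. p < dim_of m n l sp \<Longrightarrow> q < dim_of m n l sp \<Longrightarrow> sidx (P sp) p = sidx (P sp) q \<Longrightarrow>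
       v sp p q = fam (slab (P sp) p) (sloc (P sp) p) (sloc (P sp) q)"
    and zero: "\<And>sp d s x y. (d, s) \<in> set (P sp) \<Longrightarrow> x < s \<Longrightarrow> y < s \<Longrightarrow> sidx (f (d, s)) y < sidx (f (d, s)) x \<Longrightarrow> fam d x y = 0"
    and eq: "\<And>sp d s x y. (d, s) \<in> set (P sp) \<Longrightarrow> x < s \<Longrightarrow> y < s \<Longrightarrow> sidx (f (d, s)) x = sidx (f (d, s)) y \<Longrightarrow>
       fam d x y = fam' (slab (f (d, s)) x) (sloc (f (d, s)) x) (sloc (f (d, s)) y)"
  shows "block_form m n l (split_strips f P) v"
  unfolding block_form_def upper_def
proof (intro conjI exI[of _ fam'] allI impI)
  fix sp p q assume p: "p < dim_of m n l sp" and q: "q < dim_of m n l sp"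
  note sp = strip_at[OF p] and sq = strip_at[OF q]
  have sl: "slab (P sp) q = slab (P sp) p" if "sidx (P sp) p = sidx (P sp) q" using that sp(1) sq(1) by simp
  show "v sp p q = 0" if lt: "sidx (split_strips f P sp) q < sidx (split_strips f P sp) p"
  proof (cases "sidx (P sp) q < sidx (P sp) p")
    case True
    then show ?thesis by (rule upperD[OF v p q])
  next
    case False
    then have e: "sidx (P sp) p = sidx (P sp) q"
      and l: "sidx (sub (slab (P sp) q)) (sloc (P sp) q) < sidx (sub (slab (P sp) q)) (sloc (P sp) p)"
      using lt unfolding new_less[OF q p] by auto
    have "fam (slab (P sp) p) (sloc (P sp) p) (sloc (P sp) q) = 0"
      by (rule zero[OF sp(2,3)]) (use sq(3) l in \<open>simp_all add: sl[OF e] sub_def\<close>)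
    then show ?thesis by (simp only: fam[OF p q e])
  qed
  show "v sp p q = fam' (slab (split_strips f P sp) p) (sloc (split_strips f P sp) p) (sloc (split_strips f P sp) q)"
    if "sidx (split_strips f P sp) p = sidx (split_strips f P sp) q"
  proof -
    have e: "sidx (P sp) p = sidx (P sp) q"
      and l: "sidx (sub (slab (P sp) p)) (sloc (P sp) p) = sidx (sub (slab (P sp) p)) (sloc (P sp) q)"
      using that unfolding new_eq[OF p q] by auto
    have "fam (slab (P sp) p) (sloc (P sp) p) (sloc (P sp) q) =
        fam' (slab (sub (slab (P sp) p)) (sloc (P sp) p)) (sloc (sub (slab (P sp) p)) (sloc (P sp) p)) (sloc (sub (slab (P sp) p)) (sloc (P sp) q))"
      unfolding sub_def by (rule eq[OF sp(2,3)]) (use sq(3) l in \<open>simp_all add: sl[OF e] sub_def\<close>)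
    then show ?thesis by (simp only: fam[OF p q e] new_coord[OF p] new_coord[OF q] sl[OF e])
  qed
qed

text \<open>A block diagonal triple for the finer partition is also block diagonal for the coarser
  one. Exhibiting its coarse diagonal blocks reduces membership in the new algebra to an equation
  between these blocks.\<close>

lemma diagv_split:
  assumes p: "p < dim_of m n l sp" and q: "q < dim_of m n l sp"
  shows "diagv (split_strips f P) fam' sp p q = diagv P (\<lambda>d s t. if sidx (f (d, sz d)) s = sidx (f (d, sz d)) t
    then fam' (slab (f (d, sz d)) s) (sloc (f (d, sz d)) s) (sloc (f (d, sz d)) t) else 0) sp p q"
proof -
  have sl: "slab (P sp) q = slab (P sp) p" if "sidx (P sp) p = sidx (P sp) q" using that strip_at(1)[OF p] strip_at(1)[OF q] by simp
  show ?thesis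
    unfolding diagv_def new_eq[OF p q] new_coord[OF p] new_coord[OF q] sub_def by (simp add: sl)
qed

end

lemma bel_inv_block:
  assumes inv: "bel_inv m n l S P R d" and "staircase m n l P' (R \<union> Q)" and "valid m n l P'"
    and "\<And>v. v \<in> Lam m n l S (R \<union> Q) \<Longrightarrow> block_form m n l P' v"
    and "\<And>fam. diagv P' fam \<in> Lam m n l S (R \<union> Q)" and "codim (Lam m n l S (R \<union> Q)) d'"
  shows "bel_inv m n l S P' (R \<union> Q) d'"
  using assms by (simp add: bel_inv_def)

lemma mem_Lam_blk:
  assumes val: "valid m n l P" and i: "i < length (P (row_space N))" and j: "j < length (P (col_space N))"
  shows "v \<in> Lam m n l S (R \<union> blk m n l P N i j) \<longleftrightarrow> v \<in> Lam m n l S R \<and>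
    (\<forall>s<snd (P (row_space N) ! i). \<forall>t<snd (P (col_space N) ! j).
      defect m n l S S v (N, start (P (row_space N)) i + s, start (P (col_space N)) j + t) = 0)"
proof -
  have tot: "total_size (P sp) = dim_of m n l sp" for sp using val by (simp add: valid_def)
  have "(\<forall>x\<in>blk m n l P N i j. defect m n l S S v x = 0) \<longleftrightarrow> (\<forall>s<snd (P (row_space N) ! i). \<forall>t<snd (P (col_space N) ! j).
      defect m n l S S v (N, start (P (row_space N)) i + s, start (P (col_space N)) j + t) = 0)" (is "?L \<longleftrightarrow> ?R")
  proof
    assume L: ?L
    show ?R
    proof (intro allI impI)
      fix s t assume s: "s < snd (P (row_space N) ! i)" and t: "t < snd (P (col_space N) ! j)"
      have "(N, start (P (row_space N)) i + s, start (P (col_space N)) j + t) \<in> blk m n l P N i j"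
        using coord_start[OF i s] coord_start[OF j t] by (simp add: blk_def sys_idx_def tot)
      then show "defect m n l S S v (N, start (P (row_space N)) i + s, start (P (col_space N)) j + t) = 0" using L by blast
    qed
  next
    assume R: ?R
    show ?L
    proof
      fix x assume "x \<in> blk m n l P N i j"
      then obtain p q where x: "x = (N, p, q)" and pq: "p < total_size (P (row_space N))" "q < total_size (P (col_space N))"
        "sidx (P (row_space N)) p = i" "sidx (P (col_space N)) q = j" by (auto simp: blk_def sys_idx_def tot)
      show "defect m n l S S v x = 0"
        unfolding x using R coord_props(3,4)[OF pq(1)] coord_props(3,4)[OF pq(2)] pq(3,4) by metis
    qed
  qed
  then show ?thesis by (auto simp: Lam_def)
qed

section \<open>The three kinds of reduction steps\<close>

lemma diagv_upper: "upper m n l P (diagv P fam)"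
  by (simp add: upper_def diagv_def)

lemma resid_diagv: "resid m n l P S (diagv P fam) N p q = 0"
  by (simp add: resid_def diagv_def)

text \<open>The product rule \<open>u v N - N u v = u (v N - N v) + (u N - N u) v\<close>.\<close>

lemma defect_comp:
  assumes "p < dim_of m n l (row_space N)" "q < dim_of m n l (col_space N)"
  shows "defect m n l S S (tcomp m n l u v) (N, p, q) =
    mm (dim_of m n l (row_space N)) (u (row_space N)) (\<lambda>a b. defect m n l S S v (N, a, b)) p q +
    mm (dim_of m n l (col_space N)) (\<lambda>a b. defect m n l S S u (N, a, b)) (v (col_space N)) p q"
proof -
  let ?r = "dim_of m n l (row_space N)" and ?c = "dim_of m n l (col_space N)"
  let ?ur = "u (row_space N)" and ?uc = "u (col_space N)" and ?vr = "v (row_space N)" and ?vc = "v (col_space N)"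
  let ?X = "ent S N"
  have 1: "mm ?r (tcomp m n l u v (row_space N)) ?X p q = mm ?r (mm ?r ?ur ?vr) ?X p q"
    by (rule mm_cong) (simp_all add: tcomp_def assms)
  have 2: "mm ?c ?X (tcomp m n l u v (col_space N)) p q = mm ?c ?X (mm ?c ?uc ?vc) p q"
    by (rule mm_cong) (simp_all add: tcomp_def assms)
  have 3: "mm ?r ?ur (\<lambda>a b. defect m n l S S v (N, a, b)) p q = mm ?r ?ur (mm ?r ?vr ?X) p q - mm ?r ?ur (mm ?c ?X ?vc) p q"
    by (simp add: defect_def mm_minus_right)
  have 4: "mm ?c (\<lambda>a b. defect m n l S S u (N, a, b)) ?vc p q = mm ?c (mm ?r ?ur ?X) ?vc p q - mm ?c (mm ?c ?X ?uc) ?vc p q"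
    by (simp add: defect_def mm_minus_left)
  have 5: "mm ?r ?ur (mm ?c ?X ?vc) p q = mm ?c (mm ?r ?ur ?X) ?vc p q"
    by (simp only: mm_assoc)
  show ?thesis unfolding 3 4 5 unfolding defect_def prod.case 1 2 by (simp add: mm_assoc)
qed

lemma defect_comp_left:
  assumes st: "staircase m n l P R" and u: "u \<in> Lam m n l S R" and v: "upper m n l P v" and pq: "(N, p, q) \<in> R"
  shows "defect m n l S S (tcomp m n l u v) (N, p, q) =
    mm (dim_of m n l (row_space N)) (u (row_space N)) (\<lambda>a b. defect m n l S S v (N, a, b)) p q"
proof -
  note s = staircaseD[OF st pq]
  have "defect m n l S S u (N, p, b) * v (col_space N) b q = 0" if b: "b < dim_of m n l (col_space N)" for b
  proof (cases "sidx (P (col_space N)) q < sidx (P (col_space N)) b")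
    case True
    then show ?thesis using upperD[OF v b s(2)] by simp
  next
    case False
    then have "(N, p, b) \<in> R" by (intro s(3)[OF s(1) b]) auto
    then show ?thesis using u by (simp add: Lam_def)
  qed
  then have "mm (dim_of m n l (col_space N)) (\<lambda>a b. defect m n l S S u (N, a, b)) (v (col_space N)) p q = 0"
    unfolding mm_def by (intro sum.neutral) blast
  then show ?thesis by (simp add: defect_comp[OF s(1,2)])
qed

lemma defect_comp_right:
  assumes st: "staircase m n l P R" and v: "v \<in> Lam m n l S R" and u: "upper m n l P u" and pq: "(N, p, q) \<in> R"
  shows "defect m n l S S (tcomp m n l u v) (N, p, q) =
    mm (dim_of m n l (col_space N)) (\<lambda>a b. defect m n l S S u (N, a, b)) (v (col_space N)) p q"
proof -
  note s = staircaseD[OF st pq]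
  have "u (row_space N) p a * defect m n l S S v (N, a, q) = 0" if a: "a < dim_of m n l (row_space N)" for a
  proof (cases "sidx (P (row_space N)) a < sidx (P (row_space N)) p")
    case True
    then show ?thesis using upperD[OF u s(1) a] by simp
  next
    case False
    then have "(N, a, q) \<in> R" by (intro s(3)[OF a s(2)]) auto
    then show ?thesis using v by (simp add: Lam_def)
  qed
  then have "mm (dim_of m n l (row_space N)) (u (row_space N)) (\<lambda>a b. defect m n l S S v (N, a, b)) p q = 0"
    unfolding mm_def by (intro sum.neutral) blast
  then show ?thesis by (simp add: defect_comp[OF s(1,2)])
qed

lemma Lam_comp:
  assumes st: "staircase m n l P R" and u: "u \<in> Lam m n l S R" "upper m n l P u" and v: "v \<in> Lam m n l S R" "upper m n l P v"
  shows "tcomp m n l u v \<in> Lam m n l S R"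
  unfolding Lam_def mem_Collect_eq
proof
  fix x assume x: "x \<in> R"
  obtain N p q where xe: "x = (N, p, q)" by (cases x)
  have pq: "(N, p, q) \<in> R" using x xe by simp
  note s = staircaseD[OF st pq]
  have "defect m n l S S u (N, p, b) * v (col_space N) b q = 0" if b: "b < dim_of m n l (col_space N)" for b
  proof (cases "sidx (P (col_space N)) q < sidx (P (col_space N)) b")
    case True
    then show ?thesis using upperD[OF v(2) b s(2)] by simp
  next
    case False
    then have "(N, p, b) \<in> R" by (intro s(3)[OF s(1) b]) auto
    then show ?thesis using u(1) by (simp add: Lam_def)
  qed
  then have "mm (dim_of m n l (col_space N)) (\<lambda>a b. defect m n l S S u (N, a, b)) (v (col_space N)) p q = 0"
    unfolding mm_def by (intro sum.neutral) blast
  then show "defect m n l S S (tcomp m n l u v) x = 0"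
    unfolding xe defect_comp_right[OF st v(1) u(2) pq] .
qed

text \<open>The situation in the middle of a step: the system is already transformed, so the block
  at \<open>(i, j)\<close> equals its normal form \<open>M\<close>, but the conditions from this
  block are not yet imposed. The set \<open>Q\<close> adds them to \<open>R\<close>.\<close>

locale bel_block =
  fixes m n l :: nat and S :: system and P :: strips and R :: "position set" and d :: nat
    and N :: component and i j a mk b nk :: nat and M :: fmat
  assumes inv: "bel_inv m n l S P R d"
    and i: "i < length (P (row_space N))" "P (row_space N) ! i = (a, mk)"
    and j: "j < length (P (col_space N))" "P (col_space N) ! j = (b, nk)"
    and M: "\<And>s t. s < mk \<Longrightarrow> t < nk \<Longrightarrow> ent S N (start (P (row_space N)) i + s) (start (P (col_space N)) j + t) = M s t"
    and st': "staircase m n l P (R \<union> blk m n l P N i j)"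
begin

definition row :: "nat \<Rightarrow> nat" where "row s = start (P (row_space N)) i + s"
definition col :: "nat \<Rightarrow> nat" where "col t = start (P (col_space N)) j + t"
definition Q :: "position set" where "Q = R \<union> blk m n l P N i j"
definition df :: "tri \<Rightarrow> nat \<times> nat \<Rightarrow> complex" where "df v x = defect m n l S S v (N, row (fst x), col (snd x))"

lemma val: "valid m n l P" and st: "staircase m n l P R" and S: "S \<in> systems m n l"
  and cod: "codim (Lam m n l S R) d" and diag: "diagv P fam \<in> Lam m n l S R"
  using inv by (simp_all add: bel_inv_def)

lemma stQ: "staircase m n l P Q"
  using st' by (simp add: Q_def)

lemma Q_idx: "Q \<subseteq> sys_idx m n l"
  using stQ by (simp add: staircase_def)

lemma Lam_upper: "v \<in> Lam m n l S R \<Longrightarrow> upper m n l P v"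
  using inv by (simp add: bel_inv_def block_form_def)

definition fits :: "tri \<Rightarrow> (nat \<Rightarrow> fmat) \<Rightarrow> bool" where
  "fits v fam \<longleftrightarrow> (\<forall>sp. \<forall>p<dim_of m n l sp. \<forall>q<dim_of m n l sp. sidx (P sp) p = sidx (P sp) q \<longrightarrow>
     v sp p q = fam (slab (P sp) p) (sloc (P sp) p) (sloc (P sp) q))"

lemma fitsD: "fits v fam \<Longrightarrow> p < dim_of m n l sp \<Longrightarrow> q < dim_of m n l sp \<Longrightarrow> sidx (P sp) p = sidx (P sp) q \<Longrightarrow>
     v sp p q = fam (slab (P sp) p) (sloc (P sp) p) (sloc (P sp) q)"
  by (simp add: fits_def)

lemma fits_diagv: "fits (diagv P fam) fam"
  by (simp add: fits_def diagv_def)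

lemma Lam_fam:
  assumes "v \<in> Lam m n l S R"
  obtains fam where "fits v fam"
proof -
  have "block_form m n l P v" using inv assms by (simp add: bel_inv_def)
  then have "\<exists>fam. fits v fam" by (simp add: block_form_def fits_def)
  then show thesis using that by (elim exE)
qed

lemma tot: "total_size (P sp) = dim_of m n l sp"
  using val by (simp add: valid_def)

lemma row_props:
  assumes "s < mk"
  shows "row s < dim_of m n l (row_space N)" "sidx (P (row_space N)) (row s) = i" "slab (P (row_space N)) (row s) = a"
    "sloc (P (row_space N)) (row s) = s"
proof -
  have "s < snd (P (row_space N) ! i)" using assms i by simp
  from coord_start[OF i(1) this] show "row s < dim_of m n l (row_space N)" "sidx (P (row_space N)) (row s) = i"
    "slab (P (row_space N)) (row s) = a" "sloc (P (row_space N)) (row s) = s" by (simp_all add: row_def i(2) tot)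
qed

lemma col_props:
  assumes "t < nk"
  shows "col t < dim_of m n l (col_space N)" "sidx (P (col_space N)) (col t) = j" "slab (P (col_space N)) (col t) = b"
    "sloc (P (col_space N)) (col t) = t"
proof -
  have "t < snd (P (col_space N) ! j)" using assms j by simp
  from coord_start[OF j(1) this] show "col t < dim_of m n l (col_space N)" "sidx (P (col_space N)) (col t) = j"
    "slab (P (col_space N)) (col t) = b" "sloc (P (col_space N)) (col t) = t" by (simp_all add: col_def j(2) tot)
qed

lemma row_col_Q: "s < mk \<Longrightarrow> t < nk \<Longrightarrow> (N, row s, col t) \<in> Q"
  using row_props[of s] col_props[of t] by (simp add: Q_def blk_def sys_idx_def)

lemma strip_sizes:
  "(a, s) \<in> set (P sp) \<Longrightarrow> s = mk" "(b, s) \<in> set (P sp) \<Longrightarrow> s = nk"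
proof -
  have "(a, mk) \<in> set (P (row_space N))" "(b, nk) \<in> set (P (col_space N))" using i j nth_mem by metis+
  then show "(a, s) \<in> set (P sp) \<Longrightarrow> s = mk" "(b, s) \<in> set (P sp) \<Longrightarrow> s = nk" using val unfolding valid_def by blast+
qed

lemma df_lin: "lin (\<lambda>v. df v x)"
  unfolding df_def by (rule defect_lin)

lemma mem_Lam_Q: "v \<in> Lam m n l S Q \<longleftrightarrow> v \<in> Lam m n l S R \<and> (\<forall>s<mk. \<forall>t<nk. df v (s, t) = 0)"
  using mem_Lam_blk[OF val i(1) j(1)] by (simp add: Q_def df_def row_def col_def i(2) j(2))

lemma df_fam:
  assumes v: "upper m n l P v" and fam: "fits v fam" and "s < mk" "t < nk"
  shows "df v (s, t) = resid m n l P S v N (row s) (col t) + mm mk (fam a) M s t - mm nk M (fam b) s t"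
  unfolding df_def fst_conv snd_conv row_def col_def
  by (rule defect_block_fam[where fam = fam, OF val v fitsD[OF fam] i j M]) (assumption | rule assms)+

lemma df_diagv:
  assumes "s < mk" "t < nk"
  shows "df (diagv P fam) (s, t) = mm mk (fam a) M s t - mm nk M (fam b) s t"
  unfolding df_fam[OF diagv_upper fits_diagv assms] by (simp add: resid_diagv)

text \<open>The entries \<open>df\<close> of the block need not be independent on the algebra. They
  may be replaced by any independent functionals with the same common kernel in it.\<close>

lemma codim_Q:
  assumes K: "finite K" and G: "\<And>x. x \<in> K \<Longrightarrow> lin (G x)"
    and surj: "\<And>c :: 'k \<Rightarrow> complex. \<exists>v\<in>Lam m n l S R. \<forall>x\<in>K. G x v = c x"
    and ker: "\<And>v. v \<in> Lam m n l S R \<Longrightarrow> (\<forall>x\<in>K. G x v = 0) \<longleftrightarrow> (\<forall>s<mk. \<forall>t<nk. df v (s, t) = 0)"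
  shows "codim (Lam m n l S Q) (d + card K)"
proof (rule codim_step[where V = "Lam m n l S R" and G = G, OF cod K])
  show "lin (G x)" if "x \<in> K" for x by (rule G[OF that])
  show "\<exists>v\<in>Lam m n l S R. \<forall>x\<in>K. G x v = c x" for c by (rule surj)
  show "Lam m n l S Q = {v \<in> Lam m n l S R. \<forall>x\<in>K. G x v = 0}"
    using mem_Lam_Q ker by blast
qed

text \<open>All diagonal blocks are given by the same matrix unit. On the rows of strip
  \<open>i\<close>, multiplication from the left moves row \<open>s0\<close> to row
  \<open>s1\<close> and erases the rest.\<close>

lemma elem_left:
  assumes "s < mk" "s0 < mk" "s1 < mk"
  shows "mm (dim_of m n l (row_space N)) (diagv P (\<lambda>d x y. if x = s1 \<and> y = s0 then 1 else 0) (row_space N)) E (row s) q =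
    (if s = s1 then E (row s0) q else 0)"
proof -
  let ?r = "dim_of m n l (row_space N)" and ?L = "\<lambda>d x y. if x = s1 \<and> y = s0 then 1 else (0::complex)"
  note s = row_props[OF assms(1)] and s0 = row_props[OF assms(2)]
  have "diagv P ?L (row_space N) (row s) x * E x q = (if x = row s0 then (if s = s1 then E (row s0) q else 0) else 0)"
    if x: "x < ?r" for x
  proof (cases "x = row s0")
    case True
    then show ?thesis using s s0 by (simp add: diagv_def)
  next
    case False
    have "\<not> (sidx (P (row_space N)) x = i \<and> sloc (P (row_space N)) x = s0)"
      using coord_inj[of x "P (row_space N)" "row s0"] False x s0 by (auto simp: tot)
    then show ?thesis using False s by (auto simp: diagv_def)
  qed
  then have "mm ?r (diagv P ?L (row_space N)) E (row s) q = (\<Sum>x<?r. if x = row s0 then (if s = s1 then E (row s0) q else 0) else 0)"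
    unfolding mm_def by (intro sum.cong) auto
  also have "\<dots> = (if s = s1 then E (row s0) q else 0)" using s0(1) by (simp add: sum.delta)
  finally show ?thesis .
qed

lemma elem_right:
  assumes "t < nk" "t0 < nk" "t1 < nk"
  shows "mm (dim_of m n l (col_space N)) E (diagv P (\<lambda>d x y. if x = t0 \<and> y = t1 then 1 else 0) (col_space N)) p (col t) =
    (if t = t1 then E p (col t0) else 0)"
proof -
  let ?r = "dim_of m n l (col_space N)" and ?L = "\<lambda>d x y. if x = t0 \<and> y = t1 then 1 else (0::complex)"
  note s = col_props[OF assms(1)] and s0 = col_props[OF assms(2)]
  have "E p x * diagv P ?L (col_space N) x (col t) = (if x = col t0 then (if t = t1 then E p (col t0) else 0) else 0)"
    if x: "x < ?r" for x
  proof (cases "x = col t0")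
    case True
    then show ?thesis using s s0 by (simp add: diagv_def)
  next
    case False
    have "\<not> (sidx (P (col_space N)) x = j \<and> sloc (P (col_space N)) x = t0)"
      using coord_inj[of x "P (col_space N)" "col t0"] False x s0 by (auto simp: tot)
    then show ?thesis using False s by (auto simp: diagv_def)
  qed
  then have "mm ?r E (diagv P ?L (col_space N)) p (col t) = (\<Sum>x<?r. if x = col t0 then (if t = t1 then E p (col t0) else 0) else 0)"
    unfolding mm_def by (intro sum.cong) auto
  also have "\<dots> = (if t = t1 then E p (col t0) else 0)" using s0(1) by (simp add: sum.delta)
  finally show ?thesis .
qed

text \<open>Here \<open>D\<close> takes all values because the values of \<open>D\<close> form a bimodule over the diagonal blocks, and a
  nonzero bimodule of rectangular matrices contains everything.\<close>

lemma zero_step: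
  assumes M0: "\<And>s t. s < mk \<Longrightarrow> t < nk \<Longrightarrow> M s t = 0"
    and v0: "v0 \<in> Lam m n l S R" and s0: "s0 < mk" and t0: "t0 < nk" and nz: "resid m n l P S v0 N (row s0) (col t0) \<noteq> 0"
  shows "bel_inv m n l S P Q (d + mk * nk)"
proof -
  have mm0: "mm mk X M s t = 0" "mm nk M X s t = 0" if "s < mk" "t < nk" for X s t
    using that by (simp_all add: mm_def M0)
  \<comment> \<open>As \<open>M\<close> is zero, block diagonal triples preserve the new block too,
    so in the product rule they contribute no defect of their own.\<close>
  have dQ: "diagv P fam \<in> Lam m n l S Q" for fam
    unfolding mem_Lam_Q using diag by (simp add: df_diagv mm0)
  have dv0: "df v0 (s0, t0) \<noteq> 0"
  proof -
    obtain fam where fam: "fits v0 fam" by (rule Lam_fam[OF v0])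
    show ?thesis using nz by (simp add: df_fam[OF Lam_upper[OF v0] fam s0 t0] mm0 s0 t0)
  qed
  \<comment> \<open>Matrix units from both sides move the nonzero value at \<open>(s0, t0)\<close>
    to the position \<open>x\<close> and erase all other entries of the block, which gives a dual
    basis up to a scalar.\<close>
  define w where "w x = tcomp m n l (diagv P (\<lambda>d x' y. if x' = fst x \<and> y = s0 then 1 else 0))
    (tcomp m n l v0 (diagv P (\<lambda>d x' y. if x' = t0 \<and> y = snd x then 1 else 0)))" for x :: "nat \<times> nat"
  have w: "w x \<in> Lam m n l S R" for x
    unfolding w_def by (intro Lam_comp[OF st] comp_upper diag diagv_upper v0 Lam_upper)
  have dw: "df (w x) y = (if y = x then df v0 (s0, t0) else 0)" if x: "x \<in> {..<mk} \<times> {..<nk}" and y: "y \<in> {..<mk} \<times> {..<nk}" for x y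
  proof -
    obtain s1 t1 where xe: "x = (s1, t1)" by (cases x)
    obtain s t where ye: "y = (s, t)" by (cases y)
    have lt: "s1 < mk" "t1 < nk" "s < mk" "t < nk" using x y by (simp_all add: xe ye)
    let ?Rr = "diagv P (\<lambda>d x' y. if x' = t0 \<and> y = t1 then 1 else 0)"
    have "df (w x) y = (if s = s1 then defect m n l S S (tcomp m n l v0 ?Rr) (N, row s0, col t) else 0)"
      unfolding df_def w_def xe ye fst_conv snd_conv
        defect_comp_left[OF stQ dQ comp_upper[OF Lam_upper[OF v0] diagv_upper] row_col_Q[OF lt(3,4)]] elem_left[OF lt(3) s0 lt(1)]
      by (rule refl)
    also have "defect m n l S S (tcomp m n l v0 ?Rr) (N, row s0, col t) = (if t = t1 then df v0 (s0, t0) else 0)"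
      unfolding defect_comp_right[OF stQ dQ Lam_upper[OF v0] row_col_Q[OF s0 lt(4)]] elem_right[OF lt(4) t0 lt(2)] df_def
      by simp
    finally show ?thesis by (simp add: xe ye)
  qed
  let ?K = "{..<mk} \<times> {..<nk}"
  have c: "codim (Lam m n l S Q) (d + card ?K)"
  proof (rule codim_Q[where G = "\<lambda>x v. df v x"])
    fix c :: "nat \<times> nat \<Rightarrow> complex"
    let ?v = "\<lambda>sp p q. \<Sum>x\<in>?K. c x / df v0 (s0, t0) * w x sp p q"
    have "?v \<in> Lam m n l S R"
      unfolding Lam_def mem_Collect_eq
    proof
      fix x assume x: "x \<in> R"
      have "defect m n l S S ?v x = (\<Sum>y\<in>?K. c y / df v0 (s0, t0) * defect m n l S S (w y) x)"
        by (rule lin_sum[OF defect_lin]) simp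
      also have "\<dots> = 0"
      proof (rule sum.neutral, rule ballI)
        fix y show "c y / df v0 (s0, t0) * defect m n l S S (w y) x = 0" using w[of y] x by (simp add: Lam_def)
      qed
      finally show "defect m n l S S ?v x = 0" .
    qed
    moreover have "df ?v x = c x" if x: "x \<in> ?K" for x
    proof -
      have "df ?v x = (\<Sum>y\<in>?K. c y / df v0 (s0, t0) * df (w y) x)" by (rule lin_sum[OF df_lin]) simp
      also have "\<dots> = (\<Sum>y\<in>?K. if y = x then c x else 0)"
        by (rule sum.cong) (use dw x dv0 in \<open>auto simp del: mem_Sigma_iff\<close>)
      also have "\<dots> = c x" using x by (simp add: sum.delta')
      finally show ?thesis .
    qed
    ultimately show "\<exists>v\<in>Lam m n l S R. \<forall>x\<in>?K. df v x = c x" by (intro bexI[of _ ?v]) auto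
  qed (auto simp: df_lin)
  show ?thesis
    unfolding Q_def
  proof (rule bel_inv_block[OF inv st' val])
    show "block_form m n l P v" if "v \<in> Lam m n l S (R \<union> blk m n l P N i j)" for v
      using that inv mem_Lam_Q[of v] by (simp add: Q_def bel_inv_def)
    show "diagv P fam \<in> Lam m n l S (R \<union> blk m n l P N i j)" for fam
      using dQ[of fam] by (simp only: Q_def)
    show "codim (Lam m n l S (R \<union> blk m n l P N i j)) (d + mk * nk)" using c by (simp add: Q_def)
  qed
qed

text \<open>For the diagonal blocks \<open>P\<close> and \<open>Q\<close> at the two strips, the
  condition reads \<open>P M = M Q\<close>. In the lower left corner it is void; since
  \<open>P\<close> and \<open>Q\<close> are unrelated, the other \<open>r * (mk + nk - r)\<close>
  entries are independent conditions. The solutions are block triangular for the new substrips and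
  share one block, which the fresh label records.\<close>

lemma rank_step:
  assumes res: "\<And>v s t. v \<in> Lam m n l S R \<Longrightarrow> s < mk \<Longrightarrow> t < nk \<Longrightarrow> resid m n l P S v N (row s) (col t) = 0"
    and ab: "a \<noteq> b" and r: "r \<le> mk" "r \<le> nk" and Mr: "\<And>s t. s < mk \<Longrightarrow> t < nk \<Longrightarrow> M s t = (if s < r \<and> t = nk - r + s then 1 else 0)"
    and e: "e \<notin> labels P"
    and f: "f = (\<lambda>(d, s). if d = a then [(e, r), (a, mk - r)] else if d = b then [(b, nk - r), (e, r)] else [(d, s)])"
  shows "bel_inv m n l S (split_strips f P) Q (d + r * (mk + nk - r))"
proof -
  have elab: "c \<noteq> e" if "(c, s) \<in> set (P sp)" for c s sp
    using e that unfolding labels_def by force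
  interpret strip_split m n l P f
  proof
    show "valid m n l P" by (rule val)
    show "total_size (f x) = snd x" if "x \<in> set (P sp)" for x sp
      using strip_sizes[of "snd x" sp] that r by (cases x) (auto simp: f)
    fix sp sp' x y c s s' assume x: "x \<in> set (P sp)" and y: "y \<in> set (P sp')" and xs: "(c, s) \<in> set (f x)" and ys: "(c, s') \<in> set (f y)"
    have ze: "z = r" if "w \<in> set (P sp)" "(e, z) \<in> set (f w)" for w z sp
      using that elab[of "fst w" "snd w" sp] by (cases w) (auto simp: f split: if_splits)
    have za: "z = mk - r" if "(a, z) \<in> set (f w)" "a \<noteq> e" for w z
      using that ab by (cases w) (auto simp: f split: if_splits)
    have zb: "z = nk - r" if "(b, z) \<in> set (f w)" "b \<noteq> e" for w z
      using that ab by (cases w) (auto simp: f split: if_splits)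
    have zc: "w = (c, z)" if "(c, z) \<in> set (f w)" "c \<noteq> e" "c \<noteq> a" "c \<noteq> b" for w z
      using that by (cases w) (auto simp: f split: if_splits)
    consider "c = e" | "c = a" "c \<noteq> e" | "c = b" "c \<noteq> e" | "c \<noteq> e" "c \<noteq> a" "c \<noteq> b" by argo
    then show "s = s'"
    proof cases
      case 1
      then show ?thesis using ze[OF x, of s] ze[OF y, of s'] xs ys by simp
    next
      case 2
      then show ?thesis using za[of s x] za[of s' y] xs ys by simp
    next
      case 3
      then show ?thesis using zb[of s x] zb[of s' y] xs ys by simp
    next
      case 4
      have "(c, s) \<in> set (P sp)" "(c, s') \<in> set (P sp')" using x y by (simp_all only: zc[OF xs 4] zc[OF ys 4])
      then show ?thesis using val unfolding valid_def by blast
    qed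
  qed
  have strips_ab: "(a, mk) \<in> set (P (row_space N))" "(b, nk) \<in> set (P (col_space N))"
    using nth_mem[OF i(1)] nth_mem[OF j(1)] by (simp_all add: i(2) j(2))
  have ae: "a \<noteq> e" and be: "b \<noteq> e" by (rule elab[OF strips_ab(1)], rule elab[OF strips_ab(2)])
  obtain q where q: "nk = q + r" using le_Suc_ex[OF r(2)] by (metis add.commute)
  have nkr: "nk - r = q" using q by simp
  have left: "mm mk X M s t = (if nk - r \<le> t then X s (t - (nk - r)) else 0)" if t: "t < nk" for X s t
  proof -
    have "mm mk X M s t = (\<Sum>x<mk. if x = t - (nk - r) then (if nk - r \<le> t then X s (t - (nk - r)) else 0) else 0)"
      unfolding mm_def by (rule sum.cong) (use t r in \<open>auto simp: Mr\<close>)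
    also have "\<dots> = (if nk - r \<le> t then X s (t - (nk - r)) else 0)" using t r by (auto simp: sum.delta)
    finally show ?thesis .
  qed
  have right: "mm nk M X s t = (if s < r then X (nk - r + s) t else 0)" if s: "s < mk" for X s t
  proof -
    have "mm nk M X s t = (\<Sum>x<nk. if x = nk - r + s then (if s < r then X (nk - r + s) t else 0) else 0)"
      unfolding mm_def by (rule sum.cong) (use s r in \<open>auto simp: Mr\<close>)
    also have "\<dots> = (if s < r then X (nk - r + s) t else 0)" using s r by (auto simp: sum.delta)
    finally show ?thesis .
  qed
  have dfv: "df v (s, t) = (if nk - r \<le> t then fam a s (t - (nk - r)) else 0) - (if s < r then fam b (nk - r + s) t else 0)"
    if "v \<in> Lam m n l S R" "fits v fam" "s < mk" "t < nk" for v fam s t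
    unfolding df_fam[OF Lam_upper[OF that(1)] that(2-4)] res[OF that(1,3,4)] left[OF that(4)] right[OF that(3)] by simp
  \<comment> \<open>The top \<open>r\<close> rows, and below them the last \<open>r\<close> columns.
    At the other positions both \<open>P M\<close> and \<open>M Q\<close> are zero.\<close>
  let ?K = "{..<r} \<times> {..<nk} \<union> {r..<mk} \<times> {nk - r..<nk}"
  have cK: "card ?K = r * (mk + nk - r)"
  proof -
    have "card ?K = card ({..<r} \<times> {..<nk}) + card ({r..<mk} \<times> {nk - r..<nk})" by (rule card_Un_disjoint) auto
    also have "\<dots> = r * nk + (mk - r) * r" using r by (simp add: card_cartesian_product)
    also have "\<dots> = r * (mk + nk - r)" using le_Suc_ex[OF r(1)] by (elim exE) (simp add: algebra_simps)
    finally show ?thesis .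
  qed
  have c: "codim (Lam m n l S Q) (d + card ?K)"
  proof (rule codim_Q[where G = "\<lambda>x v. df v x"])
    fix c :: "nat \<times> nat \<Rightarrow> complex"
    \<comment> \<open>Values in the last \<open>r\<close> columns are produced by \<open>P\<close>
      alone, those in the top rows further left by \<open>Q\<close> alone; \<open>Q\<close> is zero
      where it would disturb the former.\<close>
    define fam where "fam z x y = (if z = a then if y < r then c (x, nk - r + y) else 0
      else if nk - r \<le> x \<and> y < nk - r then - c (x - (nk - r), y) else 0)" for z x y :: nat
    have "df (diagv P fam) x = c x" if "x \<in> ?K" for x
      using that r ab by (cases x) (auto simp: dfv[OF diag fits_diagv] fam_def)
    then show "\<exists>v\<in>Lam m n l S R. \<forall>x\<in>?K. df v x = c x" by (intro bexI[of _ "diagv P fam"] diag) blast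
  next
    fix v assume v: "v \<in> Lam m n l S R"
    obtain fam where fam: "fits v fam" by (rule Lam_fam[OF v])
    have out: "df v (s, t) = 0" if "s < mk" "t < nk" "(s, t) \<notin> ?K" for s t
      using that(3) by (auto simp: dfv[OF v fam that(1,2)] that(1,2))
    show "(\<forall>x\<in>?K. df v x = 0) \<longleftrightarrow> (\<forall>s<mk. \<forall>t<nk. df v (s, t) = 0)"
    proof
      assume K: "\<forall>x\<in>?K. df v x = 0"
      show "\<forall>s<mk. \<forall>t<nk. df v (s, t) = 0"
      proof (intro allI impI)
        fix s t assume "s < mk" "t < nk"
        then show "df v (s, t) = 0" using bspec[OF K, of "(s, t)"] out[of s t] by blast
      qed
    qed (use r in auto)
  qed (auto simp: df_lin)
  show ?thesis
    unfolding Q_def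
  proof (rule bel_inv_block[OF inv staircase_split[OF st'] valid_split])
    fix v assume "v \<in> Lam m n l S (R \<union> blk m n l P N i j)"
    then have v: "v \<in> Lam m n l S R" and df0: "\<And>s t. s < mk \<Longrightarrow> t < nk \<Longrightarrow> df v (s, t) = 0"
      using mem_Lam_Q[of v] by (simp_all add: Q_def)
    obtain fam where fam: "fits v fam" by (rule Lam_fam[OF v])
    have eq: "(if q \<le> t then fam a s (t - q) else 0) = (if s < r then fam b (q + s) t else 0)" if "s < mk" "t < nk" for s t
      using df0[OF that] unfolding dfv[OF v fam that] nkr by simp
    \<comment> \<open>In two by two block notation for \<open>P\<close> and \<open>Q\<close>, the
      equation \<open>P M = M Q\<close> amounts to \<open>P21 = 0\<close>, \<open>Q21 = 0\<close>
      and \<open>P11 = Q22\<close>, proved here in this order.\<close>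
    have eq1: "fam a x y = 0" if "r \<le> x" "x < mk" "y < r" for x y
      using eq[of x "q + y"] that q by simp
    have eq2: "fam b x y = 0" if "q \<le> x" "x < nk" "y < q" for x y
    proof -
      have "x - q < r" "x - q < mk" "y < nk" "q + (x - q) = x" using that q r by linarith+
      then show ?thesis using eq[of "x - q" y] that by simp
    qed
    have eq3: "fam a (x - q) (y - q) = fam b x y" if "q \<le> x" "x < nk" "q \<le> y" "y < nk" for x y
      using eq[of "x - q" y] that q r by auto
    \<comment> \<open>The fresh label carries the common block \<open>P11 = Q22\<close>. Label
      \<open>a\<close> now stands for \<open>P22\<close>, hence the shift by \<open>r\<close>; label
      \<open>b\<close> stands for \<open>Q11\<close>, which begins at position 0.\<close>
    define fam' where "fam' c = (if c = e then fam a else if c = a then (\<lambda>x y. fam a (r + x) (r + y)) else fam c)" for c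
    show "block_form m n l (split_strips f P) v"
    proof (rule block_form_split[OF Lam_upper[OF v] fitsD[OF fam], where fam' = fam'])
      fix sp c s x y assume cs: "(c, s) \<in> set (P sp)" and x: "x < s" and y: "y < s"
      note ce = elab[OF cs]
      have cases: "c = a \<and> s = mk \<or> c = b \<and> s = nk \<or> c \<noteq> a \<and> c \<noteq> b" using cs strip_sizes by blast
      show "fam c x y = 0" if lt: "sidx (f (c, s)) y < sidx (f (c, s)) x"
        using cases
      proof (elim disjE)
        assume 1: "c = a \<and> s = mk"
        then have "y < r" "r \<le> x" using lt x y r by (auto simp: f coord_Cons split: if_splits)
        then show ?thesis using eq1[of x y] 1 x by simp
      next
        assume 2: "c = b \<and> s = nk"
        then have "y < q" "q \<le> x" using lt x y ab q by (auto simp: f nkr coord_Cons split: if_splits)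
        then show ?thesis using eq2[of x y] 2 x by simp
      next
        assume 3: "c \<noteq> a \<and> c \<noteq> b"
        then show ?thesis using lt x y by (simp add: f coord_Cons)
      qed
      show "fam c x y = fam' (slab (f (c, s)) x) (sloc (f (c, s)) x) (sloc (f (c, s)) y)"
        if e: "sidx (f (c, s)) x = sidx (f (c, s)) y"
        using cases
      proof (elim disjE)
        assume 1: "c = a \<and> s = mk"
        then have "x < r \<longleftrightarrow> y < r" using e x y r by (auto simp: f coord_Cons split: if_splits)
        then show ?thesis using 1 x y r ae by (auto simp: f coord_Cons fam'_def)
      next
        assume 2: "c = b \<and> s = nk"
        then have xy: "x < q \<longleftrightarrow> y < q" using e x y ab q by (auto simp: f nkr coord_Cons split: if_splits)
        have lt: "x < nk" "y < nk" using 2 x y by simp_all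
        show ?thesis
        proof (cases "x < q")
          case True
          then show ?thesis using xy 2 lt ab be by (simp add: f nkr coord_Cons fam'_def)
        next
          case False
          then have "fam a (x - q) (y - q) = fam b x y" using eq3[of x y] xy lt by simp
          then show ?thesis using False xy 2 lt ab q by (simp add: f nkr coord_Cons fam'_def less_diff_conv2)
        qed
      next
        assume 3: "c \<noteq> a \<and> c \<noteq> b"
        then show ?thesis using x y ce by (simp add: f coord_Cons fam'_def)
      qed
    qed
  next
    fix fam' :: "nat \<Rightarrow> fmat"
    let ?g = "\<lambda>c s t. if sidx (f (c, sz c)) s = sidx (f (c, sz c)) t
      then fam' (slab (f (c, sz c)) s) (sloc (f (c, sz c)) s) (sloc (f (c, sz c)) t) else 0"
    have sa: "sz a = mk" and sb: "sz b = nk"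
      by (rule sz_eq[OF strips_ab(1)], rule sz_eq[OF strips_ab(2)])
    have ga: "?g a s t = (if s < r \<and> t < r then fam' e s t else if s < r \<or> t < r then 0 else fam' a (s - r) (t - r))"
      if "s < mk" "t < mk" for s t
      using that by (simp add: sa f coord_Cons)
    have gb: "?g b s t = (if s < q \<and> t < q then fam' b s t else if s < q \<or> t < q then 0 else fam' e (s - q) (t - q))"
      if "s < nk" "t < nk" for s t
    proof -
      have "s < q \<or> s - q < r" "t < q \<or> t - q < r" using that q by linarith+
      then show ?thesis using ab by (auto simp: sb f nkr coord_Cons)
    qed
    have "df (diagv P ?g) (s, t) = 0" if st: "s < mk" "t < nk" for s t
    proof -
      have "q \<le> t \<Longrightarrow> ?g a s (t - q) = (if s < r then fam' e s (t - q) else 0)"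
      proof -
        assume "q \<le> t"
        then have "t - q < r" "t - q < mk" using st q r by linarith+
        then show "?g a s (t - q) = (if s < r then fam' e s (t - q) else 0)" using ga[OF st(1), of "t - q"] by simp
      qed
      moreover have "s < r \<Longrightarrow> ?g b (q + s) t = (if q \<le> t then fam' e s (t - q) else 0)"
        using gb[of "q + s" t] st q by simp
      ultimately show ?thesis
        unfolding dfv[OF diag fits_diagv that] nkr by (cases "q \<le> t"; cases "s < r") (simp_all only: if_True if_False diff_self simp_thms)
    qed
    then have "diagv P ?g \<in> Lam m n l S Q" using mem_Lam_Q diag by blast
    moreover have "diagv (split_strips f P) fam' \<in> Lam m n l S Q \<longleftrightarrow> diagv P ?g \<in> Lam m n l S Q"
      by (rule Lam_cong[OF Q_idx]) (rule diagv_split)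
    ultimately show "diagv (split_strips f P) fam' \<in> Lam m n l S (R \<union> blk m n l P N i j)" by (simp add: Q_def)
  next
    show "codim (Lam m n l S (R \<union> blk m n l P N i j)) (d + r * (mk + nk - r))" using c unfolding cK by (simp only: Q_def)
  qed
qed

text \<open>The two strips are equivalent, so \<open>P\<close> and \<open>Q\<close> are the same
  matrix, and the condition is that it commutes with \<open>W\<close>. The number of conditions is
  read off from the Jordan form, the new strips from the Weyr form.\<close>

lemma weyr_step:
  assumes res: "\<And>v s t. v \<in> Lam m n l S R \<Longrightarrow> s < mk \<Longrightarrow> t < nk \<Longrightarrow> resid m n l P S v N (row s) (col t) = 0"
    and ab: "b = a" "nk = mk" and data: "weyr_data ordC cws" and W: "weyr_matrix cws \<in> carrier_mat mk mk"
    and MW: "\<And>s t. M s t = weyr_matrix cws $$ (s, t)"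
    and jd: "jordan_data cqs" and sim: "similar_mat (weyr_matrix cws) (jordan_of_data cqs)"
    and g: "inj_on g (fst ` set (standard_partition cws))" "g ` fst ` set (standard_partition cws) \<inter> labels P = {}"
    and f: "f = (\<lambda>(d, s). if d = a then map (\<lambda>(tag, t). (g tag, t)) (standard_partition cws) else [(d, s)])"
  shows "bel_inv m n l S (split_strips f P) Q
    (d + (mk\<^sup>2 - (\<Sum>i<length cqs. \<Sum>j=1..length (snd (cqs ! i)). (2 * j - 1) * snd (cqs ! i) ! (j - 1))))"
proof -
  let ?std = "standard_partition cws" and ?Wf = "\<lambda>p q. weyr_matrix cws $$ (p, q)"
  let ?tags = "fst ` set ?std"
  define commutes where "commutes X \<longleftrightarrow> (\<forall>p<mk. \<forall>q<mk. mm mk X ?Wf p q = mm mk ?Wf X p q)" for X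
  note wc = weyr_commutant[OF data W, folded commutes_def]
  have lab: "c \<in> labels P" if "(c, s) \<in> set (P sp)" for c s sp
    using that unfolding labels_def by force
  have gt: "g tag \<noteq> c" if "(tag, s) \<in> set ?std" "(c, s') \<in> set (P sp)" for tag s c s' sp
  proof
    assume "g tag = c"
    moreover have "g tag \<in> g ` ?tags" using that(1) by force
    ultimately show False using g(2) lab[OF that(2)] by blast
  qed
  have new: thesis if "(c, s) \<in> set (f x)" "fst x = a" "\<And>tag. (tag, s) \<in> set ?std \<Longrightarrow> g tag = c \<Longrightarrow> thesis" for x c s thesis
    using that(1,2) by (cases x) (auto simp: f intro: that(3))
  have old: "x = (c, s)" if "(c, s) \<in> set (f x)" "fst x \<noteq> a" for x c s
    using that by (cases x) (simp add: f)
  interpret strip_split m n l P f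
  proof
    show "valid m n l P" by (rule val)
    show "total_size (f x) = snd x" if "x \<in> set (P sp)" for x sp
      using strip_sizes(1)[of "snd x" sp] that wc(1) by (cases x) (auto simp: f total_map)
    fix sp sp' x y c s s' assume x: "x \<in> set (P sp)" and y: "y \<in> set (P sp')" and xs: "(c, s) \<in> set (f x)" and ys: "(c, s') \<in> set (f y)"
    show "s = s'"
    proof (cases "fst x = a"; cases "fst y = a")
      assume "fst x = a" "fst y = a"
      obtain tag where t: "(tag, s) \<in> set ?std" "g tag = c" by (rule new[OF xs \<open>fst x = a\<close>])
      obtain tag' where t': "(tag', s') \<in> set ?std" "g tag' = c" by (rule new[OF ys \<open>fst y = a\<close>])
      have "tag = tag'"
      proof (rule inj_onD[OF g(1)])
        show "g tag = g tag'" by (simp only: t(2) t'(2))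
        show "tag \<in> ?tags" using t(1) by (rule rev_image_eqI) simp
        show "tag' \<in> ?tags" using t'(1) by (rule rev_image_eqI) simp
      qed
      then have "(tag, s') \<in> set ?std" using t'(1) by simp
      then show ?thesis by (rule wc(2)[OF t(1)])
    next
      assume "fst x = a" "fst y \<noteq> a"
      obtain tag where t: "(tag, s) \<in> set ?std" "g tag = c" by (rule new[OF xs \<open>fst x = a\<close>])
      have "(c, s') \<in> set (P sp')" using old[OF ys \<open>fst y \<noteq> a\<close>] y by simp
      from gt[OF t(1) this] t(2) show ?thesis by simp
    next
      assume "fst x \<noteq> a" "fst y = a"
      obtain tag where t: "(tag, s') \<in> set ?std" "g tag = c" by (rule new[OF ys \<open>fst y = a\<close>])
      have "(c, s) \<in> set (P sp)" using old[OF xs \<open>fst x \<noteq> a\<close>] x by simp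
      from gt[OF t(1) this] t(2) show ?thesis by simp
    next
      assume "fst x \<noteq> a" "fst y \<noteq> a"
      then have "(c, s) \<in> set (P sp)" "(c, s') \<in> set (P sp')" using old[OF xs] old[OF ys] x y by simp_all
      then show ?thesis using val unfolding valid_def by blast
    qed
  qed
  have MW': "M = ?Wf" by (intro ext) (rule MW)
  have dfv: "df v (s, t) = mm mk (fam a) ?Wf s t - mm mk ?Wf (fam a) s t"
    if "v \<in> Lam m n l S R" "fits v fam" "s < mk" "t < mk" for v fam s t
    unfolding df_fam[OF Lam_upper[OF that(1)] that(2,3) that(4)[folded ab(2)]] res[OF that(1,3) that(4)[folded ab(2)]]
    by (simp add: MW' ab)
  have ker: "(\<forall>s<mk. \<forall>t<nk. df v (s, t) = 0) \<longleftrightarrow> commutes (fam a)" if v: "v \<in> Lam m n l S R" and fam: "fits v fam" for v fam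
    using dfv[OF v fam] by (simp add: commutes_def ab)
  from commutant_functionals[OF W jd sim] obtain K and Gm :: "nat \<times> nat \<Rightarrow> fmat \<Rightarrow> complex" where K: "finite K"
    and cK: "card K = mk\<^sup>2 - (\<Sum>i<length cqs. \<Sum>j=1..length (snd (cqs ! i)). (2 * j - 1) * snd (cqs ! i) ! (j - 1))"
    and Gl: "\<forall>x\<in>K. \<forall>a b u v. Gm x (\<lambda>p q. a * u p q + b * v p q) = a * Gm x u + b * Gm x v"
    and Gk: "\<forall>X. (\<forall>x\<in>K. Gm x X = 0) \<longleftrightarrow> (\<forall>p<mk. \<forall>q<mk. mm mk X ?Wf p q = mm mk ?Wf X p q)"
    and Gs: "\<forall>t. \<exists>X. \<forall>x\<in>K. Gm x X = t x" by (elim exE conjE) (rule that)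
  have com_zero: "commutes X" if "\<And>p q. p < mk \<Longrightarrow> q < mk \<Longrightarrow> X p q = 0" for X
    using that by (simp add: commutes_def mm_def)
  \<comment> \<open>Matrices that vanish below \<open>mk\<close> commute with \<open>W\<close> in
    the sense required, so the functionals kill them and depend only on the entries of the
    block.\<close>
  have Gm_cong: "Gm x X = Gm x Y" if x: "x \<in> K" and XY: "\<And>p q. p < mk \<Longrightarrow> q < mk \<Longrightarrow> X p q = Y p q" for x X Y
  proof -
    have "commutes (\<lambda>p q. 1 * X p q + (-1) * Y p q)" by (rule com_zero) (simp add: XY)
    then have "\<forall>x\<in>K. Gm x (\<lambda>p q. 1 * X p q + (-1) * Y p q) = 0" using Gk[rule_format, of "\<lambda>p q. 1 * X p q + (-1) * Y p q"] by (simp add: commutes_def)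
    then have "Gm x (\<lambda>p q. 1 * X p q + (-1) * Y p q) = 0" using x by (rule bspec)
    then show ?thesis using Gl[rule_format, OF x, of 1 X "-1" Y] by simp
  qed
  \<comment> \<open>The diagonal block is read off from the triple at strip \<open>i\<close>: a
    family with \<open>fits v fam\<close> is only known to exist, whereas the functionals on triples
    have to be linear in \<open>v\<close>.\<close>
  define blkv where "blkv v = (\<lambda>s t. v (row_space N) (row s) (row t))" for v :: tri
  have blkv: "blkv v s t = fam a s t" if fam: "fits v fam" and "s < mk" "t < mk" for v fam s t
    using fitsD[OF fam, of "row s" "row_space N" "row t"] row_props[OF that(2)] row_props[OF that(3)] by (simp add: blkv_def)
  have c: "codim (Lam m n l S Q) (d + card K)"
  proof (rule codim_Q[where G = "\<lambda>x v. Gm x (blkv v)", OF K])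
    show "lin (\<lambda>v. Gm x (blkv v))" if x: "x \<in> K" for x
      unfolding lin_def blkv_def using Gl[rule_format, OF x] by simp
  next
    fix c
    obtain X where X: "\<forall>x\<in>K. Gm x X = c x" using Gs[rule_format, of c] by (elim exE)
    have "Gm x (blkv (diagv P (\<lambda>_. X))) = c x" if x: "x \<in> K" for x
    proof -
      have "Gm x (blkv (diagv P (\<lambda>_. X))) = Gm x X" by (rule Gm_cong[OF x]) (rule blkv[OF fits_diagv])
      also have "\<dots> = c x" by (rule bspec[OF X x])
      finally show ?thesis .
    qed
    then show "\<exists>v\<in>Lam m n l S R. \<forall>x\<in>K. Gm x (blkv v) = c x" by (intro bexI[of _ "diagv P (\<lambda>_. X)"] diag) blast
  next
    fix v assume v: "v \<in> Lam m n l S R"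
    obtain fam where fam: "fits v fam" by (rule Lam_fam[OF v])
    have "(\<forall>x\<in>K. Gm x (blkv v) = 0) \<longleftrightarrow> (\<forall>x\<in>K. Gm x (fam a) = 0)"
      using Gm_cong[of _ "blkv v" "fam a"] blkv[OF fam] by simp
    also have "\<dots> \<longleftrightarrow> commutes (fam a)" using Gk[rule_format, of "fam a"] by (simp add: commutes_def)
    finally show "(\<forall>x\<in>K. Gm x (blkv v) = 0) \<longleftrightarrow> (\<forall>s<mk. \<forall>t<nk. df v (s, t) = 0)" by (simp only: ker[OF v fam])
  qed
  have fa: "f (a, s) = map (\<lambda>(tag, t). (g tag, t)) ?std" for s by (simp add: f)
  have co: "sidx (f (a, s)) x = sidx ?std x" "slab (f (a, s)) x = g (slab ?std x)" "sloc (f (a, s)) x = sloc ?std x" if "x < mk" for s x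
    unfolding fa using that wc(1) by (simp_all add: coord_map)
  have tag: "slab ?std x \<in> ?tags" if "x < mk" for x
    using coord_props(1,2)[of x ?std] that wc(1) nth_mem by force
  show ?thesis
    unfolding Q_def
  proof (rule bel_inv_block[OF inv staircase_split[OF st'] valid_split])
    fix v assume "v \<in> Lam m n l S (R \<union> blk m n l P N i j)"
    then have v: "v \<in> Lam m n l S R" and df0: "\<forall>s<mk. \<forall>t<nk. df v (s, t) = 0"
      using mem_Lam_Q[of v] by (simp_all add: Q_def)
    obtain fam where fam: "fits v fam" by (rule Lam_fam[OF v])
    have com: "commutes (fam a)" using df0 by (simp only: ker[OF v fam])
    obtain fam'' where fam'': "\<forall>p<mk. \<forall>q<mk. sidx ?std p = sidx ?std q \<longrightarrow> fam a p q = fam'' (slab ?std p) (sloc ?std p) (sloc ?std q)"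
      using wc(4)[OF com] by (elim exE)
    \<comment> \<open>A new label is translated back into its tag; labels outside the image of
      \<open>g\<close> are old ones and keep their diagonal blocks.\<close>
    define fam' where "fam' c = (if c \<in> g ` ?tags then fam'' (inv_into ?tags g c) else fam c)" for c
    show "block_form m n l (split_strips f P) v"
    proof (rule block_form_split[OF Lam_upper[OF v] fitsD[OF fam], where fam' = fam'])
      fix sp c s x y assume cs: "(c, s) \<in> set (P sp)" and x: "x < s" and y: "y < s"
      have c: "c \<notin> g ` ?tags" using lab[OF cs] g(2) by blast
      have s: "s = mk" if "c = a" using cs strip_sizes(1) that by blast
      show "fam c x y = 0" if lt: "sidx (f (c, s)) y < sidx (f (c, s)) x"
      proof (cases "c = a")
        case True
        have xy: "x < mk" "y < mk" using x y s[OF True] by simp_all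
        show ?thesis using wc(3)[OF com xy] lt unfolding True co[OF xy(1)] co[OF xy(2)] by blast
      next
        case False
        then show ?thesis using lt x y by (simp add: f coord_Cons)
      qed
      show "fam c x y = fam' (slab (f (c, s)) x) (sloc (f (c, s)) x) (sloc (f (c, s)) y)"
        if e: "sidx (f (c, s)) x = sidx (f (c, s)) y"
      proof (cases "c = a")
        case True
        have xy: "x < mk" "y < mk" using x y s[OF True] by simp_all
        have "fam' (g (slab ?std x)) = fam'' (slab ?std x)"
          using tag[OF xy(1)] by (simp add: fam'_def inv_into_f_f[OF g(1)])
        then show ?thesis using fam''[rule_format, OF xy] e unfolding True co[OF xy(1)] co[OF xy(2)] by simp
      next
        case False
        then show ?thesis using x y c by (simp add: f coord_Cons fam'_def)
      qed
    qed
  next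
    fix fam' :: "nat \<Rightarrow> fmat"
    let ?g = "\<lambda>c s t. if sidx (f (c, sz c)) s = sidx (f (c, sz c)) t
      then fam' (slab (f (c, sz c)) s) (sloc (f (c, sz c)) s) (sloc (f (c, sz c)) t) else 0"
    have "commutes (?g a)"
      by (rule wc(5)[where fam = "\<lambda>tag. fam' (g tag)"]) (simp add: co)
    then have "\<forall>s<mk. \<forall>t<nk. df (diagv P ?g) (s, t) = 0" by (simp only: ker[OF diag fits_diagv])
    then have "diagv P ?g \<in> Lam m n l S Q" using mem_Lam_Q diag by blast
    moreover have "diagv (split_strips f P) fam' \<in> Lam m n l S Q \<longleftrightarrow> diagv P ?g \<in> Lam m n l S Q"
      by (rule Lam_cong[OF Q_idx]) (rule diagv_split)
    ultimately show "diagv (split_strips f P) fam' \<in> Lam m n l S (R \<union> blk m n l P N i j)" by (simp add: Q_def)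
  next
    show "codim (Lam m n l S (R \<union> blk m n l P N i j))
      (d + (mk\<^sup>2 - (\<Sum>i<length cqs. \<Sum>j=1..length (snd (cqs ! i)). (2 * j - 1) * snd (cqs ! i) ! (j - 1))))"
      using c unfolding cK by (simp only: Q_def)
  qed
qed

end

section \<open>Running the algorithm\<close>

lemma comp_block_entry:
  assumes "s < snd (P (row_space N) ! i)" "t < snd (P (col_space N) ! j)"
  shows "comp_block P S N i j $$ (s, t) = ent S N (start (P (row_space N)) i + s) (start (P (col_space N)) j + t)"
  using assms by (simp add: comp_block_def block_def ent_def offset_start)

lemma rank_normal_form_entry:
  assumes "s < mk" "t < nk" "r \<le> mk" "r \<le> nk"
  shows "rank_normal_form mk nk r $$ (s, t) = (if s < r \<and> t = nk - r + s then 1 else 0)"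
  using assms by (auto simp: rank_normal_form_def)

lemma preserving_group_step:
  assumes inv: "bel_inv m n l S P R d" and T: "T \<in> preserving_group m n l S R"
  shows "bel_inv m n l (act T S) P R d" "Lam m n l (act T S) R = Lam m n l S R"
    "(N, p, q) \<in> R \<Longrightarrow> ent (act T S) N p q = ent S N p q" "equiv_class m n l (act T S) = equiv_class m n l S"
proof -
  have S: "S \<in> systems m n l" and R: "R \<subseteq> sys_idx m n l" using inv by (simp_all add: bel_inv_def staircase_def)
  have GL: "T \<in> GL_triples m n l" and pa: "T \<in> preserving_algebra m n l S R" using T by (simp_all add: preserving_group_def)
  have sq: "T \<in> square_triples m n l" using pa by (simp add: preserving_algebra_def)
  have trip: "triple m n l (tri_of T) = T" using triple_surj[OF sq] by (simp add: tri_of_def)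
  have u: "tri_of T \<in> Lam m n l S R" using pa preserving_algebra_iff[OF sq S R] by blast
  have du: "disc m n l (tri_of T) \<noteq> 0" using GL triple_GL_iff[of m n l "tri_of T"] by (simp add: trip)
  note s = transform_step[OF inv u du, unfolded trip]
  show "bel_inv m n l (act T S) P R d" by (rule s(1))
  show "Lam m n l (act T S) R = Lam m n l S R" by (rule s(2))
  show "(N, p, q) \<in> R \<Longrightarrow> ent (act T S) N p q = ent S N p q" by (rule s(3))
  show "equiv_class m n l (act T S) = equiv_class m n l S" using equiv_class_act[OF S du] by (simp only: trip)
qed

text \<open>The case distinction on \<open>D\<close> is made before the transformation, while the
  codimension is counted after it. \<open>D\<close> involves only reduced entries, which the
  transformation keeps.\<close>

lemma resid_agree:
  assumes val: "valid m n l P" and i: "i < length (P (row_space N))" and j: "j < length (P (col_space N))"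
    and red: "\<And>p q. (N, p, q) \<in> sys_idx m n l \<Longrightarrow>
      i < sidx (P (row_space N)) p \<or> i = sidx (P (row_space N)) p \<and> sidx (P (col_space N)) q < j \<Longrightarrow> (N, p, q) \<in> R"
    and e: "\<And>p q. (N, p, q) \<in> R \<Longrightarrow> ent S' N p q = ent S N p q"
    and s: "s < snd (P (row_space N) ! i)" and t: "t < snd (P (col_space N) ! j)"
  shows "resid m n l P S' v N (start (P (row_space N)) i + s) (start (P (col_space N)) j + t) =
    resid m n l P S v N (start (P (row_space N)) i + s) (start (P (col_space N)) j + t)"
proof -
  have tot: "total_size (P sp) = dim_of m n l sp" for sp using val by (simp add: valid_def)
  let ?p = "start (P (row_space N)) i + s" and ?q = "start (P (col_space N)) j + t"
  have p: "?p < dim_of m n l (row_space N)" "sidx (P (row_space N)) ?p = i" using coord_start[OF i s] by (simp_all add: tot)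
  have q: "?q < dim_of m n l (col_space N)" "sidx (P (col_space N)) ?q = j" using coord_start[OF j t] by (simp_all add: tot)
  have "ent S' N x ?q = ent S N x ?q" if "x < dim_of m n l (row_space N)" "i < sidx (P (row_space N)) x" for x
    by (rule e[OF red]) (use that q in \<open>simp_all add: sys_idx_def\<close>)
  moreover have "ent S' N ?p x = ent S N ?p x" if "x < dim_of m n l (col_space N)" "sidx (P (col_space N)) x < j" for x
    by (rule e[OF red]) (use that p in \<open>simp_all add: sys_idx_def\<close>)
  ultimately show ?thesis
    unfolding resid_def p(2) q(2) by (intro arg_cong2[where f = minus] sum.cong) auto
qed

lemma belitskii_step_inv:
  assumes step: "belitskii_step ordC m n l (S, P, R) B (S', P', R')" and inv: "bel_inv m n l S P R d"
  shows "bel_inv m n l S' P' R' (d + sigma B)" "equiv_class m n l S' = equiv_class m n l S"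
proof -
  have val: "valid m n l P" and S: "S \<in> systems m n l" and st: "staircase m n l P R"
    using inv by (simp_all add: bel_inv_def)
  have R: "R \<subseteq> sys_idx m n l" using st by (simp add: staircase_def)
  have "bel_inv m n l S' P' R' (d + sigma B) \<and> equiv_class m n l S' = equiv_class m n l S"
    using step
  proof cases
    case (zero_reduction N i j a mk b nk T)
    note fu = first_unreduced_props[OF \<open>first_unreduced P R N i j\<close> val st]
    note tr = preserving_group_step[OF inv \<open>T \<in> preserving_group m n l S R\<close>]
    note ri = \<open>P (row_space N) ! i = (a, mk)\<close> and cj = \<open>P (col_space N) ! j = (b, nk)\<close>
    have ra: "resid m n l P (act T S) v N (start (P (row_space N)) i + s) (start (P (col_space N)) j + t) =
        resid m n l P S v N (start (P (row_space N)) i + s) (start (P (col_space N)) j + t)"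
      if "s < snd (P (row_space N) ! i)" "t < snd (P (col_space N) ! j)" for v s t
      by (rule resid_agree[OF val fu(1,2)]) (erule fu(3), assumption | erule tr(3) | rule that)+
    interpret bb: bel_block m n l "act T S" P R d N i j a mk b nk "\<lambda>_ _. 0"
    proof
      fix s t assume st: "s < mk" "t < nk"
      have "comp_block P (act T S) N i j $$ (s, t) = 0" using \<open>comp_block P (act T S) N i j = 0\<^sub>m mk nk\<close> st by simp
      then show "ent (act T S) N (start (P (row_space N)) i + s) (start (P (col_space N)) j + t) = 0"
        using comp_block_entry[of s P N i t j "act T S"] st ri cj by simp
    qed (fact tr(1) fu(1,2,4) ri cj)+
    obtain v s t where v: "v \<in> Lam m n l S R" and st: "s < snd (P (row_space N) ! i)" "t < snd (P (col_space N) ! j)"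
      and nz: "resid m n l P S v N (start (P (row_space N)) i + s) (start (P (col_space N)) j + t) \<noteq> 0"
      using \<open>\<not> residual_vanishes m n l S P R N i j\<close> unfolding residual_vanishes_iff[OF val S R fu(1,2)] by blast
    have "bel_inv m n l (act T S) P bb.Q (d + mk * nk)"
    proof (rule bb.zero_step)
      show "v \<in> Lam m n l (act T S) R" using v by (simp only: tr(2))
      show "s < mk" "t < nk" using st ri cj by simp_all
      show "resid m n l P (act T S) v N (bb.row s) (bb.col t) \<noteq> 0"
        using nz ra[OF st] by (simp add: bb.row_def bb.col_def)
    qed simp
    then show ?thesis
      using tr(4) block_positions_eq[OF val fu(1,2)] by (simp add: bb.Q_def zero_reduction(1-4))
  next
    case (rank_reduction N i j a mk b nk r T e f)
    note fu = first_unreduced_props[OF \<open>first_unreduced P R N i j\<close> val st]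
    note tr = preserving_group_step[OF inv \<open>T \<in> preserving_group m n l S R\<close>]
    have ra: "resid m n l P (act T S) v N (start (P (row_space N)) i + s) (start (P (col_space N)) j + t) =
        resid m n l P S v N (start (P (row_space N)) i + s) (start (P (col_space N)) j + t)"
      if "s < snd (P (row_space N) ! i)" "t < snd (P (col_space N) ! j)" for v s t
      by (rule resid_agree[OF val fu(1,2)]) (erule fu(3), assumption | erule tr(3) | rule that)+
    note ri = \<open>P (row_space N) ! i = (a, mk)\<close> and cj = \<open>P (col_space N) ! j = (b, nk)\<close>
    note nf = \<open>comp_block P (act T S) N i j = rank_normal_form mk nk r\<close>
    \<comment> \<open>The normal form has \<open>r + (mk - r)\<close> rows and
      \<open>(nk - r) + r\<close> columns. With truncated subtraction these numbers equal
      \<open>mk\<close> and \<open>nk\<close> only if \<open>r\<close> is at most both.\<close>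
    have "dim_row (rank_normal_form mk nk r) = mk" "dim_col (rank_normal_form mk nk r) = nk"
      unfolding nf[symmetric] by (simp_all add: comp_block_def block_def ri cj)
    then have r: "r \<le> mk" "r \<le> nk" by (simp_all add: rank_normal_form_def)
    interpret bb: bel_block m n l "act T S" P R d N i j a mk b nk "\<lambda>s t. if s < r \<and> t = nk - r + s then 1 else 0"
    proof
      fix s t assume st: "s < mk" "t < nk"
      show "ent (act T S) N (start (P (row_space N)) i + s) (start (P (col_space N)) j + t) = (if s < r \<and> t = nk - r + s then 1 else 0)"
        using comp_block_entry[of s P N i t j "act T S"] st unfolding nf rank_normal_form_entry[OF st r] by (simp add: ri cj)
    qed (fact tr(1) fu(1,2,4) ri cj)+
    have "bel_inv m n l (act T S) (split_strips f P) bb.Q (d + r * (mk + nk - r))"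
    proof (rule bb.rank_step)
      show "resid m n l P (act T S) v N (bb.row s) (bb.col t) = 0" if "v \<in> Lam m n l (act T S) R" "s < mk" "t < nk" for v s t
      proof -
        have st: "s < snd (P (row_space N) ! i)" "t < snd (P (col_space N) ! j)" using that by (simp_all add: ri cj)
        have "v \<in> Lam m n l S R" using that(1) by (simp only: tr(2))
        then show ?thesis
          using \<open>residual_vanishes m n l S P R N i j\<close> st unfolding residual_vanishes_iff[OF val S R fu(1,2)] bb.row_def bb.col_def ra[OF st]
          by blast
      qed
    qed (rule refl \<open>a \<noteq> b\<close> r \<open>e \<notin> labels P\<close> rank_reduction)+
    then show ?thesis
      using tr(4) block_positions_eq[OF val fu(1,2)] by (simp add: bb.Q_def rank_reduction(1-4))
  next
    case (weyr_reduction N i j a mk cws W T cqs g f)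
    note fu = first_unreduced_props[OF \<open>first_unreduced P R N i j\<close> val st]
    note tr = preserving_group_step[OF inv \<open>T \<in> preserving_group m n l S R\<close>]
    have ra: "resid m n l P (act T S) v N (start (P (row_space N)) i + s) (start (P (col_space N)) j + t) =
        resid m n l P S v N (start (P (row_space N)) i + s) (start (P (col_space N)) j + t)"
      if "s < snd (P (row_space N) ! i)" "t < snd (P (col_space N) ! j)" for v s t
      by (rule resid_agree[OF val fu(1,2)]) (erule fu(3), assumption | erule tr(3) | rule that)+
    note ri = \<open>P (row_space N) ! i = (a, mk)\<close> and cj = \<open>P (col_space N) ! j = (a, mk)\<close>
    note nf = \<open>comp_block P (act T S) N i j = W\<close>
    have W: "W \<in> carrier_mat mk mk"
      unfolding nf[symmetric] by (simp add: comp_block_def block_def ri cj)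
    have We: "W = weyr_matrix cws" by fact
    interpret bb: bel_block m n l "act T S" P R d N i j a mk a mk "\<lambda>s t. weyr_matrix cws $$ (s, t)"
    proof
      fix s t assume st: "s < mk" "t < mk"
      show "ent (act T S) N (start (P (row_space N)) i + s) (start (P (col_space N)) j + t) = weyr_matrix cws $$ (s, t)"
        using comp_block_entry[of s P N i t j "act T S"] st unfolding nf We by (simp add: ri cj)
    qed (fact tr(1) fu(1,2,4) ri cj)+
    have "bel_inv m n l (act T S) (split_strips f P) bb.Q
      (d + (mk\<^sup>2 - (\<Sum>i<length cqs. \<Sum>j=1..length (snd (cqs ! i)). (2 * j - 1) * snd (cqs ! i) ! (j - 1))))"
    proof (rule bb.weyr_step)
      show "resid m n l P (act T S) v N (bb.row s) (bb.col t) = 0" if "v \<in> Lam m n l (act T S) R" "s < mk" "t < mk" for v s t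
      proof -
        have st: "s < snd (P (row_space N) ! i)" "t < snd (P (col_space N) ! j)" using that by (simp_all add: ri cj)
        have "v \<in> Lam m n l S R" using that(1) by (simp only: tr(2))
        then show ?thesis
          using \<open>residual_vanishes m n l S P R N i j\<close> st unfolding residual_vanishes_iff[OF val S R fu(1,2)] bb.row_def bb.col_def ra[OF st]
          by blast
      qed
    qed (rule refl weyr_reduction W[unfolded We] \<open>similar_mat W (jordan_of_data cqs)\<close>[unfolded We])+
    then show ?thesis
      using tr(4) block_positions_eq[OF val fu(1,2)] W by (simp add: bb.Q_def weyr_reduction(1-4))
  qed
  then show "bel_inv m n l S' P' R' (d + sigma B)" "equiv_class m n l S' = equiv_class m n l S" by blast+
qed

text \<open>The number \<open>d\<close> accounts for the steps already made, which lets the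
  induction follow the run. At its end every position is reduced, so the algebra is the stabilizer
  algebra of the final system, whose orbit is that of the initial one.\<close>

lemma belitskii_run_dim:
  assumes "belitskii_run ordC m n l (S, P, R) Bs" and "bel_inv m n l S P R d"
  shows "krull_dim (subtopology (zariski_topology m n l) (equiv_class m n l S)) = enat (d + (\<Sum>k<length Bs. sigma (Bs ! k)))"
  using assms
proof (induction "(S, P, R)" Bs arbitrary: S P R d rule: belitskii_run.induct)
  case (finished P R S)
  have val: "valid m n l P" and S: "S \<in> systems m n l" and R: "R \<subseteq> sys_idx m n l" and c: "codim (Lam m n l S R) d"
    using finished.prems by (simp_all add: bel_inv_def staircase_def)
  have tot: "total_size (P sp) = dim_of m n l sp" for sp using val by (simp add: valid_def)
  have "x \<in> R" if x: "x \<in> sys_idx m n l" for x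
  proof -
    obtain N p q where xe: "x = (N, p, q)" by (cases x)
    have p: "p < total_size (P (row_space N))" and q: "q < total_size (P (col_space N))" using x by (simp_all add: xe sys_idx_def tot)
    note lp = coord_props(1)[OF p] and lq = coord_props(1)[OF q]
    have "block_positions P N (sidx (P (row_space N)) p) (sidx (P (col_space N)) q) \<subseteq> R"
      using finished.hyps lp lq unfolding unreduced_def is_block_def by blast
    then show ?thesis
      using x unfolding block_positions_eq[OF val lp lq] by (auto simp: xe blk_def)
  qed
  then have "R = sys_idx m n l" using R by blast
  then have "Lam m n l S R = {v. intw m n l S S v}" by (simp add: Lam_def intw_defect)
  then show ?case using krull_dim_orbit_codim[OF S, of d] c by simp
next
  case (step B st' Bs)
  obtain S' P' R' where st': "st' = (S', P', R')" by (cases st')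
  note s = belitskii_step_inv[OF step.hyps(1)[unfolded st'] step.prems]
  have "krull_dim (subtopology (zariski_topology m n l) (equiv_class m n l S')) = enat (d + sigma B + (\<Sum>k<length Bs. sigma (Bs ! k)))"
    by (rule step.hyps(3)[OF st' s(1)])
  then show ?case unfolding s(2) length_Cons sum.lessThan_Suc_shift by (simp add: add.assoc)
qed

text \<open>With no position reduced, the algebra contains all triples. Each space is at most one
  strip and the labels 0, 1, 2 differ, so the components of a triple are its own diagonal
  blocks.\<close>

lemma bel_inv_initial:
  assumes S: "S \<in> systems m n l"
  shows "bel_inv m n l S (initial_strips m n l) {} 0"
proof -
  let ?P = "initial_strips m n l"
  have val: "valid m n l ?P"
    unfolding valid_def
  proof (intro conjI allI impI)
    show "total_size (?P sp) = dim_of m n l sp" for sp by (cases sp) simp_all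
    fix sp sp' d s s' assume "(d, s) \<in> set (?P sp)" "(d, s') \<in> set (?P sp')"
    then show "s = s'" by (cases sp; cases sp') (auto split: if_splits)
  qed
  have z: "sidx (?P sp) p = 0" "sloc (?P sp) p = p" "slab (?P sp) p = (case sp of Input \<Rightarrow> 0 | State \<Rightarrow> 1 | Output \<Rightarrow> 2)"
    if "p < dim_of m n l sp" for sp p
    using that by (cases sp; simp add: coord_Cons)+
  have "block_form m n l ?P v" for v
    unfolding block_form_def upper_def
    by (intro conjI exI[of _ "\<lambda>d. if d = 0 then v Input else if d = 1 then v State else v Output"])
      (auto simp: z split: space.split)
  then show ?thesis
    using S val codim_UNIV by (simp add: bel_inv_def staircase_def Lam_def)
qed

theorem theorem2:
  fixes m n l :: nat and A B C :: "complex mat"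
    and ordC :: "(complex \<times> complex) set" and Ms :: "reduced_block list"
  assumes "linear_order ordC"
    and "A \<in> carrier_mat n n" and "B \<in> carrier_mat n m" and "C \<in> carrier_mat l n"
    and "belitskii ordC m n l (A, B, C) Ms"
  shows "krull_dim (subtopology (zariski_topology m n l) (equiv_class m n l (A, B, C))) =
           enat (\<Sum>k<length Ms. sigma (Ms ! k))"
proof -
  have "(A, B, C) \<in> systems m n l" using assms(2-4) by (simp add: systems_def)
  from belitskii_run_dim[OF assms(5)[unfolded belitskii_def] bel_inv_initial[OF this]] show ?thesis by simp
qed

end
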